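(* Let $\underline R$ be a $C_n$-Tambara functor, let $g=e^{2\pi i/n}$ be the chosen generator of $C_n$, let $H\le C_n$ and $r\in\underline R(C_n/H)$. The reduced $g$-twisted Dennis trace of the norm-induced map $f^{C_n}_{N^{C_n}_H(r)}\colon\underline R\to{}^g\underline R$ is the Teichmüller class $\tau_H(r)$: $$(\widetilde{\operatorname{tr}}^g_{\mathrm{Dennis}})_{C_n/C_n}\Bigl[\bigl(\underline R,f^{C_n}_{N^{C_n}_H(r)}\bigr)\Bigr]=\tau_H(r).$$
   Context: **Mackey, Green and Tambara functors.** A $C_n$-Mackey functor is an additive functor from the Burnside category of finite $C_n$-sets to $\mathbf{Ab}$; $\mathbf{Mack}_{C_n}$ is closed symmetric monoidal under the box product $\square$ with internal Hom $\underline{\mathrm{Hom}}$; Green functors are monoids. A $C_n$-Tambara functor is a commutative $C_n$-Green functor with multiplicative norm maps satisfying the Tambara compatibility and distributivity relations; $N^{C_n}_H\colon\underline R(C_n/H)\to\underline R(C_n/C_n)$ is the internal norm. A left $\underline R$-module is finitely generated projective if it is a direct summand of $\underline R\square\underline A_X$, $\underline A_X$ the functor represented by a finite $C_n$-set $X$. **Twists.** The orbit automorphisms $xL\mapsto gxL$ of $C_n/L$ induce a Green functor automorphism $\alpha_g$ of $\underline R$. For a left $\underline R$-module $\underline P$, ${}^g\underline P$ is the same Mackey functor with left action precomposed with $\alpha_g$. **Twisted $\mathrm{HH}_0$.** $\underline{\mathrm{HH}}^g_0(\underline R)$ is the coequalizer in $\mathbf{Mack}_{C_n}$ of $\mu\circ(\alpha_g\square\mathrm{id})$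 and $\mu\circ\mathfrak s\colon\underline R\square\underline R\rightrightarrows\underline R$ ($\mu$ multiplication, $\mathfrak s$ symmetry), with quotient map $q^{(g)}$; for $x\in\underline R(C_n/C_n)$, $[x]=q^{(g)}_{C_n/C_n}(x)$. **Reduced twisted Dennis trace at $C_n/C_n$.** $\mathrm{End}^g(\underline R)$ is the exact category of pairs $(\underline P,f)$ with $\underline P$ a finitely generated projective left $\underline R$-module and $f\colon\underline P\to{}^g\underline P$ a module map (morphisms $u$: module maps with ${}^gu\circ f=h\circ u$). $\widetilde K_0(\mathrm{End}^g(\underline R))$ is the cokernel of the map from $K_0$ of finitely generated projective modules induced by $\underline P\mapsto(\underline P,0)$. For such $\underline P$, with ${}^*\underline P=\underline{\mathrm{Hom}}_{\underline R}(\underline P,\underline R)$, let $\delta\colon{}^*\underline P\square_{\underline R}{}^g\underline P\cong\underline{\mathrm{Hom}}_{\underline R}(\underline P,{}^g\underline P)$ be the tensor–Hom isomorphism and $\pi^{(g)}\colon{}^*\underline P\square_{\underline R}{}^g\underline P\to\underline{\mathrm{HH}}_0^g(\underline R)$ the map induced by symmetry, evaluation and $q^{(g)}$; $\operatorname{tr}^g_{\mathrm{HS}}=\pi^{(g)}\circ\delta^{-1}$. Then $(\widetilde{\operatorname{tr}}^g_{\mathrm{Dennis}})_{C_n/C_n}\colon\widetilde K_0(\mathrm{End}^g(\underline R))\to\underline{\mathrm{HH}}^g_0(\underline R)(C_n/C_n)$ sends $[(\underline P,f)]$ to $(\operatorname{tr}^g_{\mathrm{HS}})_{C_n/C_n}(f)$.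 **The map $f^{C_n}_x$.** For $x\in\underline R(C_n/C_n)$, $f_x^{C_n}\colon\underline R\to{}^g\underline R$ is the left $\underline R$-module map corresponding to $x$ under $\underline{\mathrm{Hom}}_{\underline R}(\underline R,{}^g\underline R)(C_n/C_n)\cong{}^g\underline R(C_n/C_n)=\underline R(C_n/C_n)$, i.e. with $(f_x^{C_n})_{C_n/C_n}(1)=x$; explicitly $(f_x^{C_n})_{C_n/L}(a)=\alpha_g(a)\,\mathrm{res}^{C_n}_L(x)$. **Teichmüller maps.** $\tau_H\colon\underline R(C_n/H)\to\underline{\mathbb W}_{C_n}(\underline R)(C_n/C_n)$ is the ($m=1$) Teichmüller map of Blumberg–Gerhardt–Hill–Lawson, where $\underline{\mathbb W}_{C_n}(\underline R)=\underline{\mathrm{HH}}^{C_n}_{C_n}(\underline R)_0$ is canonically identified with $\underline{\mathrm{HH}}^g_0(\underline R)$. Under this identification it is given by $\tau_H(r)=[N^{C_n}_H(r)]$. *)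

theory Defs
  imports Complex_Main "HOL-Algebra.Free_Abelian_Groups" "HOL-Algebra.Group_Action"
begin

section \<open>Abelian groups by generators and relations\<close>

text \<open>Abelian groups are \<^const>\<open>comm_group\<close>s in the sense of HOL-Algebra; in particular their
  addition is written multiplicatively.\<close>

definition ab_pres :: "'s set \<Rightarrow> ('s \<Rightarrow>\<^sub>0 int) set \<Rightarrow> ('s \<Rightarrow>\<^sub>0 int) set monoid" where
  "ab_pres S Rl = free_Abelian_group S Mod generate (free_Abelian_group S) Rl"

definition ab_cls :: "'s set \<Rightarrow> ('s \<Rightarrow>\<^sub>0 int) set \<Rightarrow> 's \<Rightarrow> ('s \<Rightarrow>\<^sub>0 int) set" where
  "ab_cls S Rl s = generate (free_Abelian_group S) Rl #>\<^bsub>free_Abelian_group S\<^esub> frag_of s"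

definition ab_ext :: "('c, 'z) monoid_scheme \<Rightarrow> ('s \<Rightarrow> 'c) \<Rightarrow> ('s \<Rightarrow>\<^sub>0 int) \<Rightarrow> 'c" where
  "ab_ext G h x = finprod G (\<lambda>s. h s [^]\<^bsub>G\<^esub> Poly_Mapping.lookup x s) (Poly_Mapping.keys x)"

text \<open>The map induced on a quotient by a map that is constant on each coset.\<close>

definition descend :: "('a \<Rightarrow> 'b) \<Rightarrow> 'a set \<Rightarrow> 'b" where
  "descend h c = the_elem (h ` c)"

text \<open>The homomorphism from a presented group to \<open>G\<close> with prescribed values on the generators.\<close>

definition ab_lift :: "('c, 'z) monoid_scheme \<Rightarrow> ('s \<Rightarrow> 'c) \<Rightarrow> ('s \<Rightarrow>\<^sub>0 int) set \<Rightarrow> 'c" where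
  "ab_lift G h = descend (ab_ext G h)"


section \<open>Finite $C_n$-sets\<close>

definition Cn :: "nat \<Rightarrow> complex monoid" where
  "Cn n = \<lparr>carrier = {z. z ^ n = 1}, mult = (*), one = 1\<rparr>"

definition Cn_gen :: "nat \<Rightarrow> complex" where
  "Cn_gen n = exp (2 * of_real pi * \<i> / of_nat n)"

text \<open>A universe of points that contains the orbits $C_n/L$ and is closed under finite products
  and coproducts; every finite $C_n$-set is isomorphic to one with points in it.
  A $C_n$-set is a set of points together with an action of \<^term>\<open>Cn n\<close>.\<close>

datatype pt = PCoset (pcoset: "complex set") | PPair (pfst: pt) (psnd: pt) | PInl pt | PInr pt

type_synonym gset = "pt set \<times> (complex \<Rightarrow> pt \<Rightarrow> pt)"

definition mk_gset :: "pt set \<Rightarrow> (complex \<Rightarrow> pt \<Rightarrow> pt) \<Rightarrow> gset" where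
  "mk_gset E act = (E, \<lambda>a. restrict (act a) E)"

definition gpull :: "gset \<Rightarrow> (pt \<Rightarrow> pt) \<Rightarrow> gset \<Rightarrow> (pt \<Rightarrow> pt) \<Rightarrow> gset" where
  "gpull X f Y h = mk_gset {PPair x y | x y. x \<in> fst X \<and> y \<in> fst Y \<and> f x = h y}
     (\<lambda>a w. PPair (snd X a (pfst w)) (snd Y a (psnd w)))"

definition gprod :: "gset \<Rightarrow> gset \<Rightarrow> gset" (infixr \<open>\<times>\<^sub>G\<close> 75) where
  "X \<times>\<^sub>G Y = mk_gset {PPair x y | x y. x \<in> fst X \<and> y \<in> fst Y}
     (\<lambda>a w. PPair (snd X a (pfst w)) (snd Y a (psnd w)))"

definition pcase :: "(pt \<Rightarrow> 'b) \<Rightarrow> (pt \<Rightarrow> 'b) \<Rightarrow> pt \<Rightarrow> 'b" where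
  "pcase f h w = (case w of PInl x \<Rightarrow> f x | PInr y \<Rightarrow> h y | _ \<Rightarrow> undefined)"

definition gsum :: "gset \<Rightarrow> gset \<Rightarrow> gset" (infixr \<open>+\<^sub>G\<close> 65) where
  "X +\<^sub>G Y = mk_gset (PInl ` fst X \<union> PInr ` fst Y)
     (\<lambda>a. pcase (\<lambda>x. PInl (snd X a x)) (\<lambda>y. PInr (snd Y a y)))"

definition gid :: "gset \<Rightarrow> pt \<Rightarrow> pt" where
  "gid X = (\<lambda>x\<in>fst X. x)"


section \<open>The data of Mackey, Green and Tambara functors and of modules\<close>

text \<open>A span from \<open>X\<close> to \<open>Y\<close> is a triple \<open>(U, p, q)\<close> of legs \<open>p : U \<rightarrow> X\<close> and \<open>q : U \<rightarrow> Y\<close>.\<close>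

type_synonym span = "gset \<times> (pt \<Rightarrow> pt) \<times> (pt \<Rightarrow> pt)"
type_synonym bmor = "(span \<Rightarrow>\<^sub>0 int) set"
type_synonym ('m, 'k) box = "((gset \<times> gset \<times> bmor \<times> 'm \<times> 'k) \<Rightarrow>\<^sub>0 int) set"

record 'm mackey =
  val :: "gset \<Rightarrow> 'm monoid"
  mor :: "gset \<Rightarrow> gset \<Rightarrow> bmor \<Rightarrow> 'm \<Rightarrow> 'm"

record 'r green = "'r mackey" +
  mul :: "gset \<Rightarrow> ('r, 'r) box \<Rightarrow> 'r"
  unt :: "gset \<Rightarrow> bmor \<Rightarrow> 'r"

record 'r tambara = "'r green" +
  nrm :: "gset \<Rightarrow> gset \<Rightarrow> (pt \<Rightarrow> pt) \<Rightarrow> 'r \<Rightarrow> 'r"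

record ('r, 'p) rmod = "'p mackey" +
  lact :: "gset \<Rightarrow> ('r, 'p) box \<Rightarrow> 'p"

definition regular :: "('r, 'z) green_scheme \<Rightarrow> ('r, 'r) rmod" where
  "regular R = \<lparr>val = val R, mor = mor R, lact = mul R\<rparr>"


context
  fixes n :: nat
begin

section \<open>The Burnside category\<close>

definition gsets :: "gset set" where
  "gsets = {X. finite (fst X) \<and> group_action (Cn n) (fst X) (snd X)}"

definition gmaps :: "gset \<Rightarrow> gset \<Rightarrow> (pt \<Rightarrow> pt) set" where
  "gmaps X Y = {f \<in> fst X \<rightarrow>\<^sub>E fst Y.
     \<forall>a\<in>carrier (Cn n). \<forall>x\<in>fst X. f (snd X a x) = snd Y a (f x)}"

definition gorbit :: "complex set \<Rightarrow> gset" where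
  "gorbit L = mk_gset {PCoset (x <#\<^bsub>Cn n\<^esub> L) | x. x \<in> carrier (Cn n)}
     (\<lambda>a w. PCoset (a <#\<^bsub>Cn n\<^esub> pcoset w))"

definition pnt :: pt where
  "pnt = PCoset (carrier (Cn n))"

text \<open>The one-point $C_n$-set $C_n/C_n$ with point \<^const>\<open>pnt\<close>, the unit for the product.\<close>

definition gone :: gset where
  "gone = gorbit (carrier (Cn n))"

definition gterm :: "gset \<Rightarrow> pt \<Rightarrow> pt" where
  "gterm X = (\<lambda>x\<in>fst X. pnt)"

definition spans :: "gset \<Rightarrow> gset \<Rightarrow> span set" where
  "spans X Y = {(U, p, q). U \<in> gsets \<and> p \<in> gmaps U X \<and> q \<in> gmaps U Y}"

definition span_iso :: "span \<Rightarrow> span \<Rightarrow> bool" where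
  "span_iso = (\<lambda>(U, p, q) (V, p', q'). \<exists>h\<in>gmaps U V. bij_betw h (fst U) (fst V) \<and>
     (\<forall>u\<in>fst U. p' (h u) = p u \<and> q' (h u) = q u))"

definition span_sum :: "span \<Rightarrow> span \<Rightarrow> span" where
  "span_sum = (\<lambda>(U, p, q) (V, p', q').
     (U +\<^sub>G V, restrict (pcase p p') (fst (U +\<^sub>G V)), restrict (pcase q q') (fst (U +\<^sub>G V))))"

definition span_comp :: "span \<Rightarrow> span \<Rightarrow> span" where
  "span_comp = (\<lambda>(U, p, q) (V, p', q').
     (gpull U q V p', \<lambda>w\<in>fst (gpull U q V p'). p (pfst w), \<lambda>w\<in>fst (gpull U q V p'). q' (psnd w)))"

definition span_prod :: "span \<Rightarrow> span \<Rightarrow> span" where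
  "span_prod = (\<lambda>(U, p, q) (V, p', q').
     (U \<times>\<^sub>G V, \<lambda>w\<in>fst (U \<times>\<^sub>G V). PPair (p (pfst w)) (p' (psnd w)),
      \<lambda>w\<in>fst (U \<times>\<^sub>G V). PPair (q (pfst w)) (q' (psnd w))))"

text \<open>The morphism group is the group completion of the monoid of isomorphism classes of spans
  under disjoint union.\<close>

definition brels :: "gset \<Rightarrow> gset \<Rightarrow> (span \<Rightarrow>\<^sub>0 int) set" where
  "brels X Y =
     {frag_of s - frag_of t | s t. s \<in> spans X Y \<and> t \<in> spans X Y \<and> span_iso s t} \<union>
     {frag_of (span_sum s t) - frag_of s - frag_of t | s t. s \<in> spans X Y \<and> t \<in> spans X Y}"

definition bhom :: "gset \<Rightarrow> gset \<Rightarrow> bmor monoid" where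
  "bhom X Y = ab_pres (spans X Y) (brels X Y)"

definition bcls :: "gset \<Rightarrow> gset \<Rightarrow> span \<Rightarrow> bmor" where
  "bcls X Y s = ab_cls (spans X Y) (brels X Y) s"

text \<open>\<open>bcomp X Y Z a b\<close> is the composite of \<open>a : X \<rightarrow> Y\<close> followed by \<open>b : Y \<rightarrow> Z\<close>, and
  \<open>bprod X X' Y Y' a b\<close> is \<open>a \<times> b : X \<times> Y \<rightarrow> X' \<times> Y'\<close> for \<open>a : X \<rightarrow> X'\<close> and \<open>b : Y \<rightarrow> Y'\<close>; both are the
  biadditive extensions of the operations on spans.\<close>

definition bcomp :: "gset \<Rightarrow> gset \<Rightarrow> gset \<Rightarrow> bmor \<Rightarrow> bmor \<Rightarrow> bmor" where
  "bcomp X Y Z a b =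
     ab_lift (bhom X Z) (\<lambda>s. ab_lift (bhom X Z) (\<lambda>t. bcls X Z (span_comp s t)) b) a"

definition bprod :: "gset \<Rightarrow> gset \<Rightarrow> gset \<Rightarrow> gset \<Rightarrow> bmor \<Rightarrow> bmor \<Rightarrow> bmor" where
  "bprod X X' Y Y' a b =
     ab_lift (bhom (X \<times>\<^sub>G Y) (X' \<times>\<^sub>G Y'))
       (\<lambda>s. ab_lift (bhom (X \<times>\<^sub>G Y) (X' \<times>\<^sub>G Y'))
         (\<lambda>t. bcls (X \<times>\<^sub>G Y) (X' \<times>\<^sub>G Y') (span_prod s t)) b) a"

text \<open>The morphisms \<open>X \<rightarrow> Y\<close> (transfer) and \<open>Y \<rightarrow> X\<close> (restriction) given by \<open>f : X \<rightarrow> Y\<close>.\<close>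

definition bcov :: "gset \<Rightarrow> gset \<Rightarrow> (pt \<Rightarrow> pt) \<Rightarrow> bmor" where
  "bcov X Y f = bcls X Y (X, gid X, restrict f (fst X))"

definition bcon :: "gset \<Rightarrow> gset \<Rightarrow> (pt \<Rightarrow> pt) \<Rightarrow> bmor" where
  "bcon X Y f = bcls Y X (X, restrict f (fst X), gid X)"

definition bid :: "gset \<Rightarrow> bmor" where
  "bid X = bcov X X (gid X)"


section \<open>Mackey functors\<close>

definition mackey_functor :: "('m, 'x) mackey_scheme \<Rightarrow> bool" where
  "mackey_functor M \<longleftrightarrow>
     (\<forall>X\<in>gsets. comm_group (val M X)) \<and>
     (\<forall>X\<in>gsets. \<forall>Y\<in>gsets. \<forall>b\<in>carrier (bhom X Y). mor M X Y b \<in> hom (val M X) (val M Y)) \<and>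
     (\<forall>X\<in>gsets. \<forall>x\<in>carrier (val M X). mor M X X (bid X) x = x) \<and>
     (\<forall>X\<in>gsets. \<forall>Y\<in>gsets. \<forall>Z\<in>gsets. \<forall>a\<in>carrier (bhom X Y). \<forall>b\<in>carrier (bhom Y Z).
        \<forall>x\<in>carrier (val M X). mor M X Z (bcomp X Y Z a b) x = mor M Y Z b (mor M X Y a x)) \<and>
     (\<forall>X\<in>gsets. \<forall>Y\<in>gsets. \<forall>a\<in>carrier (bhom X Y). \<forall>b\<in>carrier (bhom X Y). \<forall>x\<in>carrier (val M X).
        mor M X Y (a \<otimes>\<^bsub>bhom X Y\<^esub> b) x = mor M X Y a x \<otimes>\<^bsub>val M Y\<^esub> mor M X Y b x)"

definition tra :: "('m, 'x) mackey_scheme \<Rightarrow> gset \<Rightarrow> gset \<Rightarrow> (pt \<Rightarrow> pt) \<Rightarrow> 'm \<Rightarrow> 'm" where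
  "tra M X Y f = mor M X Y (bcov X Y f)"

definition res :: "('m, 'x) mackey_scheme \<Rightarrow> gset \<Rightarrow> gset \<Rightarrow> (pt \<Rightarrow> pt) \<Rightarrow> 'm \<Rightarrow> 'm" where
  "res M X Y f = mor M Y X (bcon X Y f)"

definition rep :: "gset \<Rightarrow> bmor mackey" where
  "rep X = \<lparr>val = \<lambda>Y. bhom X Y, mor = \<lambda>Y Z b a. bcomp X Y Z a b\<rparr>"

text \<open>Families of maps are normalised outside of their domain, so that equality is equality of
  morphisms.\<close>

definition mk_nat :: "('m, 'x) mackey_scheme \<Rightarrow> (gset \<Rightarrow> 'm \<Rightarrow> 'k) \<Rightarrow> gset \<Rightarrow> 'm \<Rightarrow> 'k" where
  "mk_nat M f = (\<lambda>X\<in>gsets. \<lambda>x\<in>carrier (val M X). f X x)"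

definition mackey_hom ::
  "('m, 'x) mackey_scheme \<Rightarrow> ('k, 'y) mackey_scheme \<Rightarrow> (gset \<Rightarrow> 'm \<Rightarrow> 'k) set" where
  "mackey_hom M N = {f. mk_nat M f = f \<and>
     (\<forall>X\<in>gsets. f X \<in> hom (val M X) (val N X)) \<and>
     (\<forall>X\<in>gsets. \<forall>Y\<in>gsets. \<forall>b\<in>carrier (bhom X Y). \<forall>x\<in>carrier (val M X).
        f Y (mor M X Y b x) = mor N X Y b (f X x))}"

definition nat_id :: "gset \<Rightarrow> 'm \<Rightarrow> 'm" where
  "nat_id X x = x"

text \<open>The coequalizer of \<open>d, e : M \<rightarrow> N\<close>, formed objectwise, and its quotient map.\<close>

definition coeq_rel :: "('m, 'x) mackey_scheme \<Rightarrow> ('k, 'y) mackey_scheme \<Rightarrow>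
  (gset \<Rightarrow> 'm \<Rightarrow> 'k) \<Rightarrow> (gset \<Rightarrow> 'm \<Rightarrow> 'k) \<Rightarrow> gset \<Rightarrow> 'k set" where
  "coeq_rel M N d e X = {d X z \<otimes>\<^bsub>val N X\<^esub> inv\<^bsub>val N X\<^esub> e X z | z. z \<in> carrier (val M X)}"

definition coeq_map :: "('m, 'x) mackey_scheme \<Rightarrow> ('k, 'y) mackey_scheme \<Rightarrow>
  (gset \<Rightarrow> 'm \<Rightarrow> 'k) \<Rightarrow> (gset \<Rightarrow> 'm \<Rightarrow> 'k) \<Rightarrow> gset \<Rightarrow> 'k \<Rightarrow> 'k set" where
  "coeq_map M N d e X x = coeq_rel M N d e X #>\<^bsub>val N X\<^esub> x"

definition coeq :: "('m, 'x) mackey_scheme \<Rightarrow> ('k, 'y) mackey_scheme \<Rightarrow>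
  (gset \<Rightarrow> 'm \<Rightarrow> 'k) \<Rightarrow> (gset \<Rightarrow> 'm \<Rightarrow> 'k) \<Rightarrow> 'k set mackey" where
  "coeq M N d e =
     \<lparr>val = \<lambda>X. val N X Mod coeq_rel M N d e X,
      mor = \<lambda>X Y b. descend (\<lambda>x. coeq_map M N d e Y (mor N X Y b x))\<rparr>"


section \<open>The box product\<close>

text \<open>Day convolution
  $(M \mathbin{\square} N)(X) = \int^{Y,Z} A(Y \times Z, X) \otimes M(Y) \otimes N(Z)$:
  the generator \<open>(Y, Z, \<phi>, m, k)\<close> stands for $\phi \otimes m \otimes k$.\<close>

definition box_gens :: "('m, 'x) mackey_scheme \<Rightarrow> ('k, 'y) mackey_scheme \<Rightarrow> gset \<Rightarrow>
  (gset \<times> gset \<times> bmor \<times> 'm \<times> 'k) set" where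
  "box_gens M N X = {(Y, Z, \<phi>, m, k). Y \<in> gsets \<and> Z \<in> gsets \<and> \<phi> \<in> carrier (bhom (Y \<times>\<^sub>G Z) X) \<and>
     m \<in> carrier (val M Y) \<and> k \<in> carrier (val N Z)}"

definition box_rels :: "('m, 'x) mackey_scheme \<Rightarrow> ('k, 'y) mackey_scheme \<Rightarrow> gset \<Rightarrow>
  ((gset \<times> gset \<times> bmor \<times> 'm \<times> 'k) \<Rightarrow>\<^sub>0 int) set" where
  "box_rels M N X =
     {frag_of (Y, Z, \<phi> \<otimes>\<^bsub>bhom (Y \<times>\<^sub>G Z) X\<^esub> \<phi>', m, k) - frag_of (Y, Z, \<phi>, m, k)
         - frag_of (Y, Z, \<phi>', m, k) | Y Z \<phi> \<phi>' m k.
       (Y, Z, \<phi>, m, k) \<in> box_gens M N X \<and> (Y, Z, \<phi>', m, k) \<in> box_gens M N X} \<union>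
     {frag_of (Y, Z, \<phi>, m \<otimes>\<^bsub>val M Y\<^esub> m', k) - frag_of (Y, Z, \<phi>, m, k)
         - frag_of (Y, Z, \<phi>, m', k) | Y Z \<phi> m m' k.
       (Y, Z, \<phi>, m, k) \<in> box_gens M N X \<and> (Y, Z, \<phi>, m', k) \<in> box_gens M N X} \<union>
     {frag_of (Y, Z, \<phi>, m, k \<otimes>\<^bsub>val N Z\<^esub> k') - frag_of (Y, Z, \<phi>, m, k)
         - frag_of (Y, Z, \<phi>, m, k') | Y Z \<phi> m k k'.
       (Y, Z, \<phi>, m, k) \<in> box_gens M N X \<and> (Y, Z, \<phi>, m, k') \<in> box_gens M N X} \<union>
     {frag_of (Y', Z', \<phi>, mor M Y Y' a m, mor N Z Z' b k)
         - frag_of (Y, Z, bcomp (Y \<times>\<^sub>G Z) (Y' \<times>\<^sub>G Z') X (bprod Y Y' Z Z' a b) \<phi>, m, k)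
         | Y Y' Z Z' \<phi> a b m k.
       Y \<in> gsets \<and> Y' \<in> gsets \<and> Z \<in> gsets \<and> Z' \<in> gsets \<and> \<phi> \<in> carrier (bhom (Y' \<times>\<^sub>G Z') X) \<and>
       a \<in> carrier (bhom Y Y') \<and> b \<in> carrier (bhom Z Z') \<and>
       m \<in> carrier (val M Y) \<and> k \<in> carrier (val N Z)}"

definition box_gen :: "('m, 'x) mackey_scheme \<Rightarrow> ('k, 'y) mackey_scheme \<Rightarrow> gset \<Rightarrow>
  (gset \<times> gset \<times> bmor \<times> 'm \<times> 'k) \<Rightarrow> ('m, 'k) box" where
  "box_gen M N X t = ab_cls (box_gens M N X) (box_rels M N X) t"

definition box :: "('m, 'x) mackey_scheme \<Rightarrow> ('k, 'y) mackey_scheme \<Rightarrow> ('m, 'k) box mackey" where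
  "box M N =
     \<lparr>val = \<lambda>X. ab_pres (box_gens M N X) (box_rels M N X),
      mor = \<lambda>X X' b. ab_lift (ab_pres (box_gens M N X') (box_rels M N X'))
        (\<lambda>(Y, Z, \<phi>, m, k). box_gen M N X' (Y, Z, bcomp (Y \<times>\<^sub>G Z) X X' \<phi> b, m, k))\<rparr>"

text \<open>\<open>box_map M' N' f h\<close> is \<open>f \<box> h : M \<box> N \<rightarrow> M' \<box> N'\<close>.\<close>

definition box_map :: "('m2, 'x) mackey_scheme \<Rightarrow> ('k2, 'y) mackey_scheme \<Rightarrow>
  (gset \<Rightarrow> 'm \<Rightarrow> 'm2) \<Rightarrow> (gset \<Rightarrow> 'k \<Rightarrow> 'k2) \<Rightarrow> gset \<Rightarrow> ('m, 'k) box \<Rightarrow> ('m2, 'k2) box" where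
  "box_map M' N' f h X = ab_lift (val (box M' N') X)
     (\<lambda>(Y, Z, \<phi>, m, k). box_gen M' N' X (Y, Z, \<phi>, f Y m, h Z k))"

definition box_sym :: "('m, 'x) mackey_scheme \<Rightarrow> ('k, 'y) mackey_scheme \<Rightarrow>
  gset \<Rightarrow> ('m, 'k) box \<Rightarrow> ('k, 'm) box" where
  "box_sym M N X = ab_lift (val (box N M) X)
     (\<lambda>(Y, Z, \<phi>, m, k). box_gen N M X
       (Z, Y, bcomp (Z \<times>\<^sub>G Y) (Y \<times>\<^sub>G Z) X
                (bcov (Z \<times>\<^sub>G Y) (Y \<times>\<^sub>G Z) (\<lambda>w. PPair (psnd w) (pfst w))) \<phi>, k, m))"

definition box_assoc ::
  "('l, 'w) mackey_scheme \<Rightarrow> ('m, 'x) mackey_scheme \<Rightarrow> ('k, 'y) mackey_scheme \<Rightarrow>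
   gset \<Rightarrow> (('l, 'm) box, 'k) box \<Rightarrow> ('l, ('m, 'k) box) box" where
  "box_assoc L M N X = ab_lift (val (box L (box M N)) X)
     (\<lambda>(U, Z, \<phi>, t, k). ab_lift (val (box L (box M N)) X)
       (\<lambda>(Y, V, \<psi>, l, m). box_gen L (box M N) X
         (Y, V \<times>\<^sub>G Z,
          bcomp (Y \<times>\<^sub>G (V \<times>\<^sub>G Z)) ((Y \<times>\<^sub>G V) \<times>\<^sub>G Z) X
            (bcov (Y \<times>\<^sub>G (V \<times>\<^sub>G Z)) ((Y \<times>\<^sub>G V) \<times>\<^sub>G Z)
               (\<lambda>w. PPair (PPair (pfst w) (pfst (psnd w))) (psnd (psnd w))))
            (bcomp ((Y \<times>\<^sub>G V) \<times>\<^sub>G Z) (U \<times>\<^sub>G Z) X (bprod (Y \<times>\<^sub>G V) U Z Z \<psi> (bid Z)) \<phi>),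
          l, box_gen M N (V \<times>\<^sub>G Z) (V, Z, bid (V \<times>\<^sub>G Z), m, k))) t)"

definition box_assoc_inv ::
  "('l, 'w) mackey_scheme \<Rightarrow> ('m, 'x) mackey_scheme \<Rightarrow> ('k, 'y) mackey_scheme \<Rightarrow>
   gset \<Rightarrow> ('l, ('m, 'k) box) box \<Rightarrow> (('l, 'm) box, 'k) box" where
  "box_assoc_inv L M N X = ab_lift (val (box (box L M) N) X)
     (\<lambda>(Y, U, \<phi>, l, t). ab_lift (val (box (box L M) N) X)
       (\<lambda>(V, Z, \<psi>, m, k). box_gen (box L M) N X
         (Y \<times>\<^sub>G V, Z,
          bcomp ((Y \<times>\<^sub>G V) \<times>\<^sub>G Z) (Y \<times>\<^sub>G (V \<times>\<^sub>G Z)) X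
            (bcov ((Y \<times>\<^sub>G V) \<times>\<^sub>G Z) (Y \<times>\<^sub>G (V \<times>\<^sub>G Z))
               (\<lambda>w. PPair (pfst (pfst w)) (PPair (psnd (pfst w)) (psnd w))))
            (bcomp (Y \<times>\<^sub>G (V \<times>\<^sub>G Z)) (Y \<times>\<^sub>G U) X (bprod Y Y (V \<times>\<^sub>G Z) U (bid Y) \<psi>) \<phi>),
          box_gen L M (Y \<times>\<^sub>G V) (Y, V, bid (Y \<times>\<^sub>G V), l, m), k)) t)"

text \<open>The unit for the box product is \<^term>\<open>rep gone\<close>; these are the unit isomorphisms.\<close>

definition box_lunit :: "('m, 'x) mackey_scheme \<Rightarrow> gset \<Rightarrow> (bmor, 'm) box \<Rightarrow> 'm" where
  "box_lunit M X = ab_lift (val M X)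
     (\<lambda>(Y, Z, \<phi>, a, m). mor M (Y \<times>\<^sub>G Z) X \<phi>
        (mor M (gone \<times>\<^sub>G Z) (Y \<times>\<^sub>G Z) (bprod gone Y Z Z a (bid Z))
          (tra M Z (gone \<times>\<^sub>G Z) (\<lambda>z. PPair pnt z) m)))"

definition box_runit :: "('m, 'x) mackey_scheme \<Rightarrow> gset \<Rightarrow> ('m, bmor) box \<Rightarrow> 'm" where
  "box_runit M X = ab_lift (val M X)
     (\<lambda>(Y, Z, \<phi>, m, a). mor M (Y \<times>\<^sub>G Z) X \<phi>
        (mor M (Y \<times>\<^sub>G gone) (Y \<times>\<^sub>G Z) (bprod Y Y gone Z (bid Y) a)
          (tra M Y (Y \<times>\<^sub>G gone) (\<lambda>y. PPair y pnt) m)))"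


section \<open>Green functors and their modules\<close>

definition green_functor :: "('r, 'z) green_scheme \<Rightarrow> bool" where
  "green_functor R \<longleftrightarrow> mackey_functor R \<and>
     mul R \<in> mackey_hom (box R R) R \<and> unt R \<in> mackey_hom (rep gone) R \<and>
     (\<forall>X\<in>gsets. \<forall>z\<in>carrier (val (box (box R R) R) X).
        mul R X (box_map R R (mul R) nat_id X z) =
        mul R X (box_map R R nat_id (mul R) X (box_assoc R R R X z))) \<and>
     (\<forall>X\<in>gsets. \<forall>z\<in>carrier (val (box (rep gone) R) X).
        mul R X (box_map R R (unt R) nat_id X z) = box_lunit R X z) \<and>
     (\<forall>X\<in>gsets. \<forall>z\<in>carrier (val (box R (rep gone)) X).
        mul R X (box_map R R nat_id (unt R) X z) = box_runit R X z)"

definition comm_green_functor :: "('r, 'z) green_scheme \<Rightarrow> bool" where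
  "comm_green_functor R \<longleftrightarrow> green_functor R \<and>
     (\<forall>X\<in>gsets. \<forall>z\<in>carrier (val (box R R) X). mul R X (box_sym R R X z) = mul R X z)"

definition rmodule :: "('r, 'z) green_scheme \<Rightarrow> ('r, 'p, 'y) rmod_scheme \<Rightarrow> bool" where
  "rmodule R P \<longleftrightarrow> mackey_functor P \<and> lact P \<in> mackey_hom (box R P) P \<and>
     (\<forall>X\<in>gsets. \<forall>z\<in>carrier (val (box (box R R) P) X).
        lact P X (box_map R P (mul R) nat_id X z) =
        lact P X (box_map R P nat_id (lact P) X (box_assoc R R P X z))) \<and>
     (\<forall>X\<in>gsets. \<forall>z\<in>carrier (val (box (rep gone) P) X).
        lact P X (box_map R P (unt R) nat_id X z) = box_lunit P X z)"

definition rmod_hom :: "('r, 'z) green_scheme \<Rightarrow> ('r, 'p, 'x) rmod_scheme \<Rightarrow>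
  ('r, 'q, 'y) rmod_scheme \<Rightarrow> (gset \<Rightarrow> 'p \<Rightarrow> 'q) set" where
  "rmod_hom R P Q = {f \<in> mackey_hom P Q. \<forall>X\<in>gsets. \<forall>z\<in>carrier (val (box R P) X).
     f X (lact P X z) = lact Q X (box_map R Q nat_id f X z)}"

text \<open>The external products $R(U) \times R(V) \to R(U \times V)$ and
  $R(U) \times P(V) \to P(U \times V)$, and the ring structure of $R(X)$.\<close>

definition xmul :: "('r, 'z) green_scheme \<Rightarrow> gset \<Rightarrow> gset \<Rightarrow> 'r \<Rightarrow> 'r \<Rightarrow> 'r" where
  "xmul R U V a b = mul R (U \<times>\<^sub>G V) (box_gen R R (U \<times>\<^sub>G V) (U, V, bid (U \<times>\<^sub>G V), a, b))"

definition xact :: "('r, 'z) green_scheme \<Rightarrow> ('r, 'p, 'y) rmod_scheme \<Rightarrow>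
  gset \<Rightarrow> gset \<Rightarrow> 'r \<Rightarrow> 'p \<Rightarrow> 'p" where
  "xact R P U V a p = lact P (U \<times>\<^sub>G V) (box_gen R P (U \<times>\<^sub>G V) (U, V, bid (U \<times>\<^sub>G V), a, p))"

definition imul :: "('r, 'z) green_scheme \<Rightarrow> gset \<Rightarrow> 'r \<Rightarrow> 'r \<Rightarrow> 'r" where
  "imul R X a b = res R X (X \<times>\<^sub>G X) (\<lambda>x. PPair x x) (xmul R X X a b)"

definition ione :: "('r, 'z) green_scheme \<Rightarrow> gset \<Rightarrow> 'r" where
  "ione R X = res R X gone (gterm X) (unt R gone (bid gone))"


section \<open>Tambara functors\<close>

text \<open>\<open>exponential X Y A f p Z q e\<close>: the diagram
  $A \xleftarrow{e} X \times_Y Z \to Z \xrightarrow{q} Y$ is the exponential diagram of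
  $A \xrightarrow{p} X \xrightarrow{f} Y$, that is, \<open>e\<close> identifies the fibre of $Z = \Pi_f A$ over
  \<open>y\<close> with the set of sections of \<open>p\<close> over $f^{-1}(y)$.\<close>

definition exponential :: "gset \<Rightarrow> gset \<Rightarrow> gset \<Rightarrow> (pt \<Rightarrow> pt) \<Rightarrow> (pt \<Rightarrow> pt) \<Rightarrow>
  gset \<Rightarrow> (pt \<Rightarrow> pt) \<Rightarrow> (pt \<Rightarrow> pt) \<Rightarrow> bool" where
  "exponential X Y A f p Z q e \<longleftrightarrow>
     Z \<in> gsets \<and> q \<in> gmaps Z Y \<and> e \<in> gmaps (gpull X f Z q) A \<and>
     (\<forall>w\<in>fst (gpull X f Z q). p (e w) = pfst w) \<and>
     (\<forall>y\<in>fst Y. bij_betw (\<lambda>z. \<lambda>x\<in>{x \<in> fst X. f x = y}. e (PPair x z)) {z \<in> fst Z. q z = y}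
        (\<Pi>\<^sub>E x\<in>{x \<in> fst X. f x = y}. {a \<in> fst A. p a = x}))"

definition tambara_functor :: "('r, 'z) tambara_scheme \<Rightarrow> bool" where
  "tambara_functor R \<longleftrightarrow> comm_green_functor R \<and>
     (\<forall>X\<in>gsets. \<forall>Y\<in>gsets. \<forall>f\<in>gmaps X Y.
        nrm R X Y f \<in> carrier (val R X) \<rightarrow> carrier (val R Y) \<and>
        nrm R X Y f (ione R X) = ione R Y \<and>
        (\<forall>a\<in>carrier (val R X). \<forall>b\<in>carrier (val R X).
           nrm R X Y f (imul R X a b) = imul R Y (nrm R X Y f a) (nrm R X Y f b))) \<and>
     (\<forall>X\<in>gsets. \<forall>a\<in>carrier (val R X). nrm R X X (gid X) a = a) \<and>
     (\<forall>X\<in>gsets. \<forall>Y\<in>gsets. \<forall>Z\<in>gsets. \<forall>f\<in>gmaps X Y. \<forall>h\<in>gmaps Y Z. \<forall>a\<in>carrier (val R X).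
        nrm R X Z (compose (fst X) h f) a = nrm R Y Z h (nrm R X Y f a)) \<and>
     (\<forall>X\<in>gsets. \<forall>a\<in>carrier (val R (X +\<^sub>G X)).
        nrm R (X +\<^sub>G X) X (restrict (pcase (\<lambda>x. x) (\<lambda>x. x)) (fst (X +\<^sub>G X))) a =
        imul R X (res R X (X +\<^sub>G X) PInl a) (res R X (X +\<^sub>G X) PInr a)) \<and>
     (\<forall>X\<in>gsets. \<forall>Y\<in>gsets. \<forall>Y'\<in>gsets. \<forall>f\<in>gmaps X Y. \<forall>h\<in>gmaps Y' Y. \<forall>a\<in>carrier (val R X).
        res R Y' Y h (nrm R X Y f a) =
        nrm R (gpull X f Y' h) Y' (restrict psnd (fst (gpull X f Y' h)))
          (res R (gpull X f Y' h) X pfst a)) \<and>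
     (\<forall>X\<in>gsets. \<forall>Y\<in>gsets. \<forall>A\<in>gsets. \<forall>f\<in>gmaps X Y. \<forall>p\<in>gmaps A X. \<forall>Z q e.
        exponential X Y A f p Z q e \<longrightarrow> (\<forall>a\<in>carrier (val R A).
          nrm R X Y f (tra R A X p a) =
          tra R Z Y q (nrm R (gpull X f Z q) Z (restrict psnd (fst (gpull X f Z q)))
            (res R (gpull X f Z q) A e a))))"

definition inorm :: "('r, 'z) tambara_scheme \<Rightarrow> complex set \<Rightarrow> 'r \<Rightarrow> 'r" where
  "inorm R H r = nrm R (gorbit H) gone (gterm (gorbit H)) r"


section \<open>Twists and twisted $\mathrm{HH}_0$\<close>

text \<open>Restriction along $xL \mapsto gxL$; as $C_n$ is abelian, acting by \<open>g\<close> is equivariant on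
  every finite $C_n$-set, which extends the automorphism from orbits to all objects.\<close>

definition alpha :: "('r, 'z) green_scheme \<Rightarrow> complex \<Rightarrow> gset \<Rightarrow> 'r \<Rightarrow> 'r" where
  "alpha R g X = res R X X (snd X g)"

definition twist :: "('r, 'z) green_scheme \<Rightarrow> complex \<Rightarrow> ('r, 'p) rmod \<Rightarrow> ('r, 'p) rmod" where
  "twist R g P = P\<lparr>lact := \<lambda>X z. lact P X (box_map R P (alpha R g) nat_id X z)\<rparr>"

definition hh_left :: "('r, 'z) green_scheme \<Rightarrow> complex \<Rightarrow> gset \<Rightarrow> ('r, 'r) box \<Rightarrow> 'r" where
  "hh_left R g X z = mul R X (box_map R R (alpha R g) nat_id X z)"

definition hh_right :: "('r, 'z) green_scheme \<Rightarrow> gset \<Rightarrow> ('r, 'r) box \<Rightarrow> 'r" where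
  "hh_right R X z = mul R X (box_sym R R X z)"

definition HH0 :: "('r, 'z) green_scheme \<Rightarrow> complex \<Rightarrow> 'r set mackey" where
  "HH0 R g = coeq (box R R) R (hh_left R g) (hh_right R)"

definition HH0_map :: "('r, 'z) green_scheme \<Rightarrow> complex \<Rightarrow> gset \<Rightarrow> 'r \<Rightarrow> 'r set" where
  "HH0_map R g = coeq_map (box R R) R (hh_left R g) (hh_right R)"


section \<open>Internal Hom, duals and relative box products\<close>

text \<open>The module $Q_X = Q(X \times -)$; the internal Hom is
  $\underline{\mathrm{Hom}}_R(P, Q)(X) = \mathrm{Hom}_R(P, Q_X)$.\<close>

definition shift :: "('r, 'z) green_scheme \<Rightarrow> ('r, 'q) rmod \<Rightarrow> gset \<Rightarrow> ('r, 'q) rmod" where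
  "shift R Q X =
     \<lparr>val = \<lambda>Y. val Q (X \<times>\<^sub>G Y),
      mor = \<lambda>Y Y' b. mor Q (X \<times>\<^sub>G Y) (X \<times>\<^sub>G Y') (bprod X X Y Y' (bid X) b),
      lact = \<lambda>Y. ab_lift (val Q (X \<times>\<^sub>G Y))
        (\<lambda>(U, V, \<phi>, a, q).
          mor Q (X \<times>\<^sub>G (U \<times>\<^sub>G V)) (X \<times>\<^sub>G Y) (bprod X X (U \<times>\<^sub>G V) Y (bid X) \<phi>)
            (tra Q (U \<times>\<^sub>G (X \<times>\<^sub>G V)) (X \<times>\<^sub>G (U \<times>\<^sub>G V))
               (\<lambda>w. PPair (pfst (psnd w)) (PPair (pfst w) (psnd (psnd w))))
               (xact R Q U (X \<times>\<^sub>G V) a q)))\<rparr>"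

definition inthom :: "('r, 'z) green_scheme \<Rightarrow> ('r, 'p) rmod \<Rightarrow> ('r, 'q) rmod \<Rightarrow>
  (gset \<Rightarrow> 'p \<Rightarrow> 'q) mackey" where
  "inthom R P Q =
     \<lparr>val = \<lambda>X. \<lparr>carrier = rmod_hom R P (shift R Q X),
        mult = \<lambda>\<theta> \<theta>'. mk_nat P (\<lambda>Y p. \<theta> Y p \<otimes>\<^bsub>val Q (X \<times>\<^sub>G Y)\<^esub> \<theta>' Y p),
        one = mk_nat P (\<lambda>Y p. \<one>\<^bsub>val Q (X \<times>\<^sub>G Y)\<^esub>)\<rparr>,
      mor = \<lambda>X X' b \<theta>. mk_nat P
        (\<lambda>Y p. mor Q (X \<times>\<^sub>G Y) (X' \<times>\<^sub>G Y) (bprod X X' Y Y b (bid Y)) (\<theta> Y p))\<rparr>"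

text \<open>A module map \<open>f : P \<rightarrow> Q\<close> as an element of $\underline{\mathrm{Hom}}_R(P, Q)(C_n/C_n)$.\<close>

definition hom_elt :: "('r, 'p) rmod \<Rightarrow> ('r, 'q) rmod \<Rightarrow> (gset \<Rightarrow> 'p \<Rightarrow> 'q) \<Rightarrow>
  gset \<Rightarrow> 'p \<Rightarrow> 'q" where
  "hom_elt P Q f = mk_nat P (\<lambda>Y p. tra Q Y (gone \<times>\<^sub>G Y) (\<lambda>y. PPair pnt y) (f Y p))"

definition dual :: "('r, 'z) green_scheme \<Rightarrow> ('r, 'p) rmod \<Rightarrow> (gset \<Rightarrow> 'p \<Rightarrow> 'r) mackey" where
  "dual R P = inthom R P (regular R)"

text \<open>The right action of \<open>R\<close> on the dual, $(\theta r)(p) = \theta(p) r$.\<close>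

definition dual_ract :: "('r, 'z) green_scheme \<Rightarrow> ('r, 'p) rmod \<Rightarrow>
  gset \<Rightarrow> (gset \<Rightarrow> 'p \<Rightarrow> 'r, 'r) box \<Rightarrow> gset \<Rightarrow> 'p \<Rightarrow> 'r" where
  "dual_ract R P X = ab_lift (val (dual R P) X)
     (\<lambda>(U, V, \<phi>, \<theta>, r). mk_nat P
       (\<lambda>Y p. mor R ((U \<times>\<^sub>G V) \<times>\<^sub>G Y) (X \<times>\<^sub>G Y) (bprod (U \<times>\<^sub>G V) X Y Y \<phi> (bid Y))
          (tra R ((U \<times>\<^sub>G Y) \<times>\<^sub>G V) ((U \<times>\<^sub>G V) \<times>\<^sub>G Y)
             (\<lambda>w. PPair (PPair (pfst (pfst w)) (psnd w)) (psnd (pfst w)))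
             (xmul R (U \<times>\<^sub>G Y) V (\<theta> Y p) r))))"

text \<open>\<open>M \<box>\<^sub>R Q\<close> for a right module \<open>M\<close> with action \<open>ra\<close>.\<close>

definition rbox :: "('r, 'z) green_scheme \<Rightarrow> ('m, 'x) mackey_scheme \<Rightarrow>
  (gset \<Rightarrow> ('m, 'r) box \<Rightarrow> 'm) \<Rightarrow> ('r, 'q) rmod \<Rightarrow> ('m, 'q) box set mackey" where
  "rbox R M ra Q = coeq (box (box M R) Q) (box M Q)
     (box_map M Q ra nat_id) (\<lambda>X z. box_map M Q nat_id (lact Q) X (box_assoc M R Q X z))"


section \<open>The Hattori--Stallings trace\<close>

definition dual_rbox :: "('r, 'z) green_scheme \<Rightarrow> complex \<Rightarrow> ('r, 'p) rmod \<Rightarrow>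
  (gset \<Rightarrow> 'p \<Rightarrow> 'r, 'p) box set mackey" where
  "dual_rbox R g P = rbox R (dual R P) (dual_ract R P) (twist R g P)"

text \<open>$\delta(\theta \otimes q)(p) = \theta(p) \cdot q$, with the twisted action on \<open>q\<close>.\<close>

definition hs_delta :: "('r, 'z) green_scheme \<Rightarrow> complex \<Rightarrow> ('r, 'p) rmod \<Rightarrow>
  gset \<Rightarrow> (gset \<Rightarrow> 'p \<Rightarrow> 'r, 'p) box set \<Rightarrow> gset \<Rightarrow> 'p \<Rightarrow> 'p" where
  "hs_delta R g P X = descend (ab_lift (val (inthom R P (twist R g P)) X)
     (\<lambda>(U, V, \<phi>, \<theta>, q). mk_nat P
       (\<lambda>Y p. mor P ((U \<times>\<^sub>G V) \<times>\<^sub>G Y) (X \<times>\<^sub>G Y) (bprod (U \<times>\<^sub>G V) X Y Y \<phi> (bid Y))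
          (tra P ((U \<times>\<^sub>G Y) \<times>\<^sub>G V) ((U \<times>\<^sub>G V) \<times>\<^sub>G Y)
             (\<lambda>w. PPair (PPair (pfst (pfst w)) (psnd w)) (psnd (pfst w)))
             (xact R (twist R g P) (U \<times>\<^sub>G Y) V (\<theta> Y p) q)))))"

definition evaluation :: "('r, 'z) green_scheme \<Rightarrow> gset \<Rightarrow>
  ('p, gset \<Rightarrow> 'p \<Rightarrow> 'r) box \<Rightarrow> 'r" where
  "evaluation R X = ab_lift (val R X)
     (\<lambda>(V, U, \<phi>, p, \<theta>). mor R (V \<times>\<^sub>G U) X \<phi>
        (tra R (U \<times>\<^sub>G V) (V \<times>\<^sub>G U) (\<lambda>w. PPair (psnd w) (pfst w)) (\<theta> V p)))"

definition hs_pi :: "('r, 'z) green_scheme \<Rightarrow> complex \<Rightarrow> ('r, 'p) rmod \<Rightarrow>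
  gset \<Rightarrow> (gset \<Rightarrow> 'p \<Rightarrow> 'r, 'p) box set \<Rightarrow> 'r set" where
  "hs_pi R g P X = descend
     (\<lambda>z. HH0_map R g X (evaluation R X (box_sym (dual R P) (twist R g P) X z)))"

text \<open>Meaningful for finitely generated projective \<open>P\<close>, where \<^const>\<open>hs_delta\<close> is an isomorphism.\<close>

definition hs_trace :: "('r, 'z) green_scheme \<Rightarrow> complex \<Rightarrow> ('r, 'p) rmod \<Rightarrow>
  gset \<Rightarrow> (gset \<Rightarrow> 'p \<Rightarrow> 'p) \<Rightarrow> 'r set" where
  "hs_trace R g P X f =
     hs_pi R g P X (inv_into (carrier (val (dual_rbox R g P) X)) (hs_delta R g P X) f)"


section \<open>$K$-theory of twisted endomorphisms\<close>

definition free_rmod :: "('r, 'z) green_scheme \<Rightarrow> gset \<Rightarrow> ('r, ('r, bmor) box) rmod" where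
  "free_rmod R X =
     \<lparr>val = val (box R (rep X)), mor = mor (box R (rep X)),
      lact = \<lambda>Y z. box_map R (rep X) (mul R) nat_id Y (box_assoc_inv R R (rep X) Y z)\<rparr>"

text \<open>A direct summand is the same as a retract, since idempotents split.\<close>

definition fg_projective :: "('r, 'z) green_scheme \<Rightarrow> ('r, 'p) rmod \<Rightarrow> bool" where
  "fg_projective R P \<longleftrightarrow> rmodule R P \<and>
     (\<exists>X\<in>gsets. \<exists>i\<in>rmod_hom R P (free_rmod R X). \<exists>s\<in>rmod_hom R (free_rmod R X) P.
        \<forall>Y\<in>gsets. \<forall>p\<in>carrier (val P Y). s Y (i Y p) = p)"

definition short_exact :: "('r, 'p) rmod \<Rightarrow> (gset \<Rightarrow> 'p \<Rightarrow> 'p) \<Rightarrow> ('r, 'p) rmod \<Rightarrow>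
  (gset \<Rightarrow> 'p \<Rightarrow> 'p) \<Rightarrow> ('r, 'p) rmod \<Rightarrow> bool" where
  "short_exact P' u P v P'' \<longleftrightarrow> (\<forall>X\<in>gsets.
     inj_on (u X) (carrier (val P' X)) \<and>
     u X ` carrier (val P' X) = kernel (val P X) (val P'' X) (v X) \<and>
     v X ` carrier (val P X) = carrier (val P'' X))"

text \<open>\<open>K\<^sub>0\<close> of an exact category with set of objects \<open>Ob\<close>; a triple \<open>(a, b, c)\<close> in \<open>Tr\<close> means
  that there is an exact sequence from \<open>a\<close> through \<open>b\<close> to \<open>c\<close>.\<close>

definition K0_rels :: "('o \<times> 'o \<times> 'o) set \<Rightarrow> ('o \<Rightarrow>\<^sub>0 int) set" where
  "K0_rels Tr = {frag_of b - frag_of a - frag_of c | a b c. (a, b, c) \<in> Tr}"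

text \<open>Modules have their elements in the type of elements of \<open>R\<close>. This is no restriction up
  to isomorphism: $R \mathbin{\square} A_X \cong R(X \times -)$, and a summand is isomorphic to a
  submodule.\<close>

definition proj_objs :: "('r, 'z) green_scheme \<Rightarrow> ('r, 'r) rmod set" where
  "proj_objs R = {P. fg_projective R P}"

definition proj_exact ::
  "('r, 'z) green_scheme \<Rightarrow> (('r, 'r) rmod \<times> ('r, 'r) rmod \<times> ('r, 'r) rmod) set" where
  "proj_exact R = {(P', P, P''). P' \<in> proj_objs R \<and> P \<in> proj_objs R \<and> P'' \<in> proj_objs R \<and>
     (\<exists>u\<in>rmod_hom R P' P. \<exists>v\<in>rmod_hom R P P''. short_exact P' u P v P'')}"

definition K0_proj :: "('r, 'z) green_scheme \<Rightarrow> (('r, 'r) rmod \<Rightarrow>\<^sub>0 int) set monoid" where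
  "K0_proj R = ab_pres (proj_objs R) (K0_rels (proj_exact R))"

end

type_synonym 'r endo = "('r, 'r) rmod \<times> (gset \<Rightarrow> 'r \<Rightarrow> 'r)"

context
  fixes n :: nat
begin

definition end_objs :: "('r, 'z) green_scheme \<Rightarrow> complex \<Rightarrow> 'r endo set" where
  "end_objs R g = {(P, f). P \<in> proj_objs n R \<and> f \<in> rmod_hom n R P (twist n R g P)}"

definition end_hom :: "('r, 'z) green_scheme \<Rightarrow> 'r endo \<Rightarrow> 'r endo \<Rightarrow> (gset \<Rightarrow> 'r \<Rightarrow> 'r) set" where
  "end_hom R = (\<lambda>(P, f) (Q, h). {u \<in> rmod_hom n R P Q.
     \<forall>X\<in>gsets n. \<forall>p\<in>carrier (val P X). u X (f X p) = h X (u X p)})"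

definition end_exact ::
  "('r, 'z) green_scheme \<Rightarrow> complex \<Rightarrow> ('r endo \<times> 'r endo \<times> 'r endo) set" where
  "end_exact R g = {(E', E, E''). E' \<in> end_objs R g \<and> E \<in> end_objs R g \<and> E'' \<in> end_objs R g \<and>
     (\<exists>u\<in>end_hom R E' E. \<exists>v\<in>end_hom R E E''. short_exact n (fst E') u (fst E) v (fst E''))}"

definition K0_end :: "('r, 'z) green_scheme \<Rightarrow> complex \<Rightarrow> ('r endo \<Rightarrow>\<^sub>0 int) set monoid" where
  "K0_end R g = ab_pres (end_objs R g) (K0_rels (end_exact R g))"

definition K0_end_cls :: "('r, 'z) green_scheme \<Rightarrow> complex \<Rightarrow> 'r endo \<Rightarrow> ('r endo \<Rightarrow>\<^sub>0 int) set" where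
  "K0_end_cls R g E = ab_cls (end_objs R g) (K0_rels (end_exact R g)) E"

definition K0_zero :: "('r, 'z) green_scheme \<Rightarrow> complex \<Rightarrow>
  (('r, 'r) rmod \<Rightarrow>\<^sub>0 int) set \<Rightarrow> ('r endo \<Rightarrow>\<^sub>0 int) set" where
  "K0_zero R g = ab_lift (K0_end R g)
     (\<lambda>P. K0_end_cls R g (P, mk_nat n P (\<lambda>X p. \<one>\<^bsub>val P X\<^esub>)))"

definition K0_end_red ::
  "('r, 'z) green_scheme \<Rightarrow> complex \<Rightarrow> ('r endo \<Rightarrow>\<^sub>0 int) set set monoid" where
  "K0_end_red R g = K0_end R g Mod (K0_zero R g ` carrier (K0_proj n R))"

definition K0_end_red_cls ::
  "('r, 'z) green_scheme \<Rightarrow> complex \<Rightarrow> 'r endo \<Rightarrow> ('r endo \<Rightarrow>\<^sub>0 int) set set" where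
  "K0_end_red_cls R g E =
     (K0_zero R g ` carrier (K0_proj n R)) #>\<^bsub>K0_end R g\<^esub> K0_end_cls R g E"

text \<open>The homomorphism on \<^const>\<open>K0_end_red\<close> induced by the Hattori--Stallings trace, at the
  level $C_n/C_n$.\<close>

definition dennis_trace_red ::
  "('r, 'z) green_scheme \<Rightarrow> complex \<Rightarrow> ('r endo \<Rightarrow>\<^sub>0 int) set set \<Rightarrow> 'r set" where
  "dennis_trace_red R g = descend (ab_lift (val (HH0 n R g) (gone n))
     (\<lambda>(P, f). hs_trace n R g P (gone n) (hom_elt n P (twist n R g P) f)))"


section \<open>The maps $f_x$ and the Teichmueller maps\<close>

definition fmap :: "('r, 'z) green_scheme \<Rightarrow> complex \<Rightarrow> 'r \<Rightarrow> gset \<Rightarrow> 'r \<Rightarrow> 'r" where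
  "fmap R g x = mk_nat n R
     (\<lambda>X a. imul n R X (alpha n R g X a) (res n R X (gone n) (gterm n X) x))"

text \<open>The Teichmueller map, under the identification of $\underline{\mathbb W}_{C_n}(R)$ with
  $\underline{\mathrm{HH}}_0^g(R)$, where \<open>g\<close> is the chosen generator.\<close>

definition teichmueller :: "('r, 'z) tambara_scheme \<Rightarrow> complex set \<Rightarrow> 'r \<Rightarrow> 'r set" where
  "teichmueller R H r = HH0_map n R (Cn_gen n) (gone n) (inorm n R H r)"

end

end

theory Submission
  imports Defs
begin

text \<open>The norm enters only through the element \<open>N(r)\<close> of \<open>R(C\<^sub>n/C\<^sub>n)\<close> that it produces. For every \<open>x\<close> in
  \<open>R(C\<^sub>n/C\<^sub>n)\<close> the reduced Dennis trace of \<open>(R, f\<^sub>x)\<close> is \<open>[x]\<close> (\<open>dennis_trace_fmap\<close>), and the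
  theorem is the case \<open>x = N(r)\<close>. On a formal level this is one line: \<open>f\<^sub>x(a) = \<alpha>(a) x\<close> is the
  twisted action of \<open>a\<close> on \<open>x\<close>, so \<open>f\<^sub>x\<close> is \<open>\<delta>(1 \<otimes> x)\<close> where \<open>1\<close> stands for the identity in the
  dual of \<open>R\<close>, and \<open>\<pi>(1 \<otimes> x) = [x]\<close>.

  What has to be proved is that the trace takes this value. All maps out of quotients are given by
  representatives, and the inverse of \<open>\<delta>\<close> is a choice of preimage, so the value at one class is
  known only once independence of all choices is, first for the trace of one endomorphism and
  then for \<open>K\<close>-theory.

  Let \<open>P\<close> be finitely generated projective. As \<open>R \<box> A\<^sub>X\<close> is \<open>R(X \<times> -)\<close>, a retraction of it onto \<open>P\<close>
  amounts to a dual basis: a finite set \<open>X\<close>, an element \<open>p\<^sub>0\<close> of \<open>P(X)\<close> and a functional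
  \<open>\<theta>\<^sub>0 : P \<rightarrow> R(X \<times> -)\<close> such that \<open>q = \<Sum> \<theta>\<^sub>0(q)(x) p\<^sub>0(x)\<close>, the sum over the points of \<open>X\<close> being a
  transfer along \<open>X \<rightarrow> C\<^sub>n/C\<^sub>n\<close> (\<open>fg_projective_dual_basis\<close>). For an endomorphism \<open>F\<close> let \<open>t(F)\<close> be
  the class of \<open>\<Sum> \<theta>\<^sub>0(F(p\<^sub>0(x)))(x)\<close> in \<open>HH\<^sub>0\<close>. For \<open>F = \<delta>(\<theta> \<otimes> q)\<close> the linearity of \<open>\<theta>\<^sub>0\<close> turns this
  into the class of \<open>\<Sum> \<alpha>(\<theta>(p\<^sub>0(x))) \<theta>\<^sub>0(q)(x)\<close>; the defining relation of \<open>HH\<^sub>0\<close> together with the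
  commutativity of \<open>R\<close> removes \<open>\<alpha>\<close>, and the dual basis then collapses the sum to \<open>\<theta>(q)\<close>. Hence
  \<open>\<pi>(z) = t(\<delta>(z))\<close> for all \<open>z\<close> (\<open>pi0_basis_trace\<close>), so \<open>\<pi>(z)\<close> depends on \<open>\<delta>(z)\<close> alone and the
  trace of \<open>\<delta>(z)\<close> is \<open>\<pi>(z)\<close> whichever preimage is chosen (\<open>hs_trace_eq_pi0\<close>).

  The trace is additive on short exact sequences (\<open>trace_additive\<close>): such a sequence splits since
  the outer terms have dual bases, and together these expand the endomorphism in the middle. The
  zero endomorphism has trace zero. So the trace descends to the reduced group and is computed
  there on representatives (\<open>dennis_trace_red_cls\<close>).

  The computations take place with external products \<open>R(U) \<times> P(V) \<rightarrow> P(U \<times> V)\<close> instead of the box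
  product. A box product represents the pairings that are natural in both variables (\<open>pairing\<close>,
  \<open>blift\<close>), every morphism of the Burnside category is additively generated by restrictions
  followed by transfers (\<open>nathomI\<close>), and these are exchanged by base change along an arbitrary
  pullback square (\<open>base_change\<close>). Each sum over points above is then a restriction to a diagonal
  followed by a transfer, and identities between such sums are instances of base change.\<close>

section \<open>Presented abelian groups\<close>

lemma (in comm_group) ab_ext_hom:
  assumes "h \<in> S \<rightarrow> carrier G"
  shows "ab_ext G h \<in> hom (free_Abelian_group S) G"
proof -
  have ext: "ab_ext G h x = finprod G (\<lambda>s. h s [^] Poly_Mapping.lookup x s) A"
    if "finite A" "Poly_Mapping.keys x \<subseteq> A" "A \<subseteq> S" for x A
  proof -
    have "finprod G (\<lambda>s. h s [^] Poly_Mapping.lookup x s) (Poly_Mapping.keys x)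
        = finprod G (\<lambda>s. h s [^] Poly_Mapping.lookup x s) A"
      using that assms
      by (intro finprod_mono_neutral_cong_left) (auto simp: in_keys_iff Pi_iff subset_iff intro!: int_pow_closed)
    then show ?thesis by (simp add: ab_ext_def)
  qed
  show ?thesis
  proof (rule homI)
    fix x assume "x \<in> carrier (free_Abelian_group S)"
    then show "ab_ext G h x \<in> carrier G"
      using assms by (auto simp: ab_ext_def intro!: finprod_closed int_pow_closed)
  next
    fix x y
    assume x: "x \<in> carrier (free_Abelian_group S)" and y: "y \<in> carrier (free_Abelian_group S)"
    let ?A = "Poly_Mapping.keys x \<union> Poly_Mapping.keys y"
    have A: "finite ?A" "?A \<subseteq> S" "Poly_Mapping.keys (x + y) \<subseteq> ?A"
      using x y keys_add[of x y] by auto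
    have "ab_ext G h (x + y) = finprod G (\<lambda>s. h s [^] (Poly_Mapping.lookup x s + Poly_Mapping.lookup y s)) ?A"
      using ext[OF A(1) A(3) A(2)] by (simp add: lookup_add)
    also have "\<dots> = finprod G (\<lambda>s. h s [^] Poly_Mapping.lookup x s \<otimes> h s [^] Poly_Mapping.lookup y s) ?A"
      using A assms by (intro finprod_cong) (auto simp: int_pow_mult simp_implies_def Pi_iff subset_iff)
    also have "\<dots> = ab_ext G h x \<otimes> ab_ext G h y"
      using A assms ext[of ?A x] ext[of ?A y]
      by (subst finprod_multf) (auto simp: Pi_iff subset_iff)
    finally show "ab_ext G h (x \<otimes>\<^bsub>free_Abelian_group S\<^esub> y) = ab_ext G h x \<otimes> ab_ext G h y"
      by simp
  qed
qed

lemma (in comm_group) ab_ext_frag_of: "h s \<in> carrier G \<Longrightarrow> ab_ext G h (frag_of s) = h s"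
  by (simp add: ab_ext_def) 

lemma (in comm_group) ab_ext_diff:
  assumes "h \<in> S \<rightarrow> carrier G" "Poly_Mapping.keys x \<subseteq> S" "Poly_Mapping.keys y \<subseteq> S"
  shows "ab_ext G h (x - y) = ab_ext G h x \<otimes> inv ab_ext G h y"
proof -
  interpret H: group_hom "free_Abelian_group S" G "ab_ext G h"
    using ab_ext_hom[OF assms(1)] is_group by (intro group_hom.intro) (auto simp: group_hom_axioms_def)
  have "ab_ext G h (x \<otimes>\<^bsub>free_Abelian_group S\<^esub> inv\<^bsub>free_Abelian_group S\<^esub> y) = ab_ext G h x \<otimes> inv ab_ext G h y"
    using assms H.hom_mult[of x "inv\<^bsub>free_Abelian_group S\<^esub> y"] H.hom_inv[of y] by simp
  then show ?thesis using assms by simp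
qed

lemma (in comm_group) ab_ext_cong:
  assumes "\<And>s. s \<in> S \<Longrightarrow> h s = h' s" "h' \<in> S \<rightarrow> carrier G" "Poly_Mapping.keys x \<subseteq> S"
  shows "ab_ext G h x = ab_ext G h' x"
  unfolding ab_ext_def using assms
  by (intro finprod_cong) (auto simp: simp_implies_def Pi_iff subset_iff)

text \<open>\<^const>\<open>descend\<close> is determined as soon as the map is constant on the coset; every later use of a map out
  of a quotient goes through this.\<close>

lemma descend_eqI:
  assumes "c \<noteq> {}" "\<And>x. x \<in> c \<Longrightarrow> h x = y"
  shows "descend h c = y"
proof -
  have "h ` c = {y}" using assms by auto
  then show ?thesis by (simp add: descend_def)
qed

lemma generate_normal_free:
  assumes "Rl \<subseteq> carrier (free_Abelian_group S)"
  shows "normal (generate (free_Abelian_group S) Rl) (free_Abelian_group S)"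
proof -
  interpret F: comm_group "free_Abelian_group S" by (rule abelian_free_Abelian_group)
  show ?thesis
    using assms F.generate_is_subgroup F.subgroup_imp_normal by blast
qed

lemma ab_pres_comm_group:
  assumes "Rl \<subseteq> carrier (free_Abelian_group S)"
  shows "comm_group (ab_pres S Rl)"
proof -
  interpret F: comm_group "free_Abelian_group S" by (rule abelian_free_Abelian_group)
  show ?thesis
    unfolding ab_pres_def using assms F.generate_is_subgroup F.abelian_FactGroup by blast
qed

lemma ab_pres_quot_hom:
  assumes "Rl \<subseteq> carrier (free_Abelian_group S)"
  shows "(\<lambda>x. generate (free_Abelian_group S) Rl #>\<^bsub>free_Abelian_group S\<^esub> x)
    \<in> hom (free_Abelian_group S) (ab_pres S Rl)"
  unfolding ab_pres_def
  using normal.r_coset_hom_Mod[OF generate_normal_free[OF assms]] by simp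

lemma ab_cls_closed:
  assumes "s \<in> S"
  shows "ab_cls S Rl s \<in> carrier (ab_pres S Rl)"
  using assms unfolding ab_cls_def ab_pres_def carrier_FactGroup by auto

lemma ab_pres_carrierE:
  assumes "c \<in> carrier (ab_pres S Rl)"
  obtains x where "Poly_Mapping.keys x \<subseteq> S"
    "c = generate (free_Abelian_group S) Rl #>\<^bsub>free_Abelian_group S\<^esub> x"
  using assms unfolding ab_pres_def carrier_FactGroup by auto

text \<open>Every element of the free group is a difference of sums of generators, which is the induction
  used here; the presented group inherits this as a quotient.\<close>

lemma ab_pres_hom_eq:
  assumes Rl: "Rl \<subseteq> carrier (free_Abelian_group S)" and G: "group G"
    and f: "f \<in> hom (ab_pres S Rl) G" and g: "g \<in> hom (ab_pres S Rl) G"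
    and eq: "\<And>s. s \<in> S \<Longrightarrow> f (ab_cls S Rl s) = g (ab_cls S Rl s)"
    and c: "c \<in> carrier (ab_pres S Rl)"
  shows "f c = g c"
proof -
  let ?F = "free_Abelian_group S" and ?q = "\<lambda>x. generate (free_Abelian_group S) Rl #>\<^bsub>free_Abelian_group S\<^esub> x"
  have P: "group (ab_pres S Rl)" using ab_pres_comm_group[OF Rl] by (simp add: comm_group_def)
  interpret q: group_hom ?F "ab_pres S Rl" ?q
    using ab_pres_quot_hom[OF Rl] P by (intro group_hom.intro) (auto simp: group_hom_axioms_def)
  interpret f: group_hom "ab_pres S Rl" G f using f P G
    by (intro group_hom.intro) (auto simp: group_hom_axioms_def)
  interpret g: group_hom "ab_pres S Rl" G g using g P G
    by (intro group_hom.intro) (auto simp: group_hom_axioms_def)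
  obtain x where x: "Poly_Mapping.keys x \<subseteq> S" and cx: "c = ?q x"
    using c by (rule ab_pres_carrierE)
  have "Poly_Mapping.keys x \<subseteq> S \<and> f (?q x) = g (?q x)"
    using x
  proof (induction x rule: frag_induction)
    case zero
    show ?case using q.hom_one by simp
  next
    case (one a)
    then show ?case using eq[of a] by (simp add: ab_cls_def)
  next
    case (diff x y)
    then have xy: "Poly_Mapping.keys x \<subseteq> S" "Poly_Mapping.keys y \<subseteq> S" by auto
    then have "x - y = x \<otimes>\<^bsub>?F\<^esub> inv\<^bsub>?F\<^esub> y" by simp
    then have e: "?q (x - y) = ?q x \<otimes>\<^bsub>ab_pres S Rl\<^esub> inv\<^bsub>ab_pres S Rl\<^esub> ?q y"
      using xy q.hom_mult[of x "inv\<^bsub>?F\<^esub> y"] q.hom_inv[of y] by simp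
    have c: "?q x \<in> carrier (ab_pres S Rl)" "?q y \<in> carrier (ab_pres S Rl)"
      using xy q.hom_closed[of x] q.hom_closed[of y] by auto
    have "Poly_Mapping.keys (x - y) \<subseteq> S" using xy keys_diff[of x y] by blast
    then show ?case using diff c unfolding e by simp
  qed
  then show ?thesis by (simp add: cx)
qed

text \<open>A map on generators that kills the relations extends to the presented group. Only under this
  condition does the value of \<^const>\<open>ab_lift\<close> on a coset make sense.\<close>

lemma ab_lift_coset:
  assumes Rl: "Rl \<subseteq> carrier (free_Abelian_group S)" and G: "comm_group G"
    and h: "h \<in> S \<rightarrow> carrier G" and kill: "\<And>x. x \<in> Rl \<Longrightarrow> ab_ext G h x = \<one>\<^bsub>G\<^esub>"
    and x: "Poly_Mapping.keys x \<subseteq> S"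
  shows "ab_lift G h (generate (free_Abelian_group S) Rl #>\<^bsub>free_Abelian_group S\<^esub> x) = ab_ext G h x"
proof -
  let ?F = "free_Abelian_group S"
  interpret G: comm_group G by fact
  interpret F: comm_group ?F by (rule abelian_free_Abelian_group)
  interpret e: group_hom ?F G "ab_ext G h"
    using G.ab_ext_hom[OF h] by (intro group_hom.intro) (auto simp: group_hom_axioms_def)
  have ker: "ab_ext G h y = \<one>\<^bsub>G\<^esub>" if "y \<in> generate ?F Rl" for y
  proof -
    have "Rl \<subseteq> kernel ?F G (ab_ext G h)" using Rl kill unfolding kernel_def by blast
    then have "generate ?F Rl \<subseteq> kernel ?F G (ab_ext G h)"
      using F.generate_subgroup_incl e.subgroup_kernel by blast
    then show ?thesis using that by (auto simp: kernel_def)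
  qed
  have sub: "generate ?F Rl \<subseteq> carrier ?F" using F.generate_incl[OF Rl] .
  show ?thesis
    unfolding ab_lift_def
  proof (rule descend_eqI)
    show "generate ?F Rl #>\<^bsub>?F\<^esub> x \<noteq> {}"
      using generate.one[of ?F Rl] by (auto simp: r_coset_def)
    fix y assume "y \<in> generate ?F Rl #>\<^bsub>?F\<^esub> x"
    then obtain z where z: "z \<in> generate ?F Rl" "y = z \<otimes>\<^bsub>?F\<^esub> x" by (auto simp: r_coset_def)
    have "ab_ext G h (z \<otimes>\<^bsub>?F\<^esub> x) = ab_ext G h z \<otimes>\<^bsub>G\<^esub> ab_ext G h x"
      using z sub x by (intro e.hom_mult) (auto simp: subset_iff)
    then show "ab_ext G h y = ab_ext G h x" using z ker[OF z(1)] x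
      by (metis G.l_one carrier_free_Abelian_group_iff e.hom_closed)
  qed
qed

lemma ab_lift_hom:
  assumes Rl: "Rl \<subseteq> carrier (free_Abelian_group S)" and G: "comm_group G"
    and h: "h \<in> S \<rightarrow> carrier G" and kill: "\<And>x. x \<in> Rl \<Longrightarrow> ab_ext G h x = \<one>\<^bsub>G\<^esub>"
  shows "ab_lift G h \<in> hom (ab_pres S Rl) G"
proof (rule homI)
  let ?F = "free_Abelian_group S" and ?q = "\<lambda>x. generate (free_Abelian_group S) Rl #>\<^bsub>free_Abelian_group S\<^esub> x"
  interpret G: comm_group G by fact
  interpret e: group_hom ?F G "ab_ext G h"
    using G.ab_ext_hom[OF h] by (intro group_hom.intro) (auto simp: group_hom_axioms_def)
  note lift = ab_lift_coset[OF Rl G h kill]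
  fix c assume c: "c \<in> carrier (ab_pres S Rl)"
  obtain x where x: "Poly_Mapping.keys x \<subseteq> S" "c = ?q x" using c by (rule ab_pres_carrierE)
  show "ab_lift G h c \<in> carrier G" using x lift[OF _ x(1)] e.hom_closed[of x] by auto
  fix d assume d: "d \<in> carrier (ab_pres S Rl)"
  obtain y where y: "Poly_Mapping.keys y \<subseteq> S" "d = ?q y" using d by (rule ab_pres_carrierE)
  have xy: "Poly_Mapping.keys (x + y) \<subseteq> S" using x y keys_add[of x y] by auto
  have "c \<otimes>\<^bsub>ab_pres S Rl\<^esub> d = ?q (x + y)"
    using hom_mult[OF ab_pres_quot_hom[OF Rl], of x y] x y by simp
  then show "ab_lift G h (c \<otimes>\<^bsub>ab_pres S Rl\<^esub> d) = ab_lift G h c \<otimes>\<^bsub>G\<^esub> ab_lift G h d"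
    using x y xy lift e.hom_mult[of x y] by simp
qed

lemma ab_lift_cls:
  assumes Rl: "Rl \<subseteq> carrier (free_Abelian_group S)" and G: "comm_group G"
    and h: "h \<in> S \<rightarrow> carrier G" and kill: "\<And>x. x \<in> Rl \<Longrightarrow> ab_ext G h x = \<one>\<^bsub>G\<^esub>"
    and s: "s \<in> S"
  shows "ab_lift G h (ab_cls S Rl s) = h s"
proof -
  interpret G: comm_group G by fact
  show ?thesis
    using ab_lift_coset[OF Rl G h kill, of "frag_of s"] s h G.ab_ext_frag_of[of h s]
    by (auto simp: ab_cls_def)
qed

lemma ab_lift_cong:
  assumes G: "comm_group G"
    and eq: "\<And>s. s \<in> S \<Longrightarrow> h s = h' s" and h': "h' \<in> S \<rightarrow> carrier G" 
    and c: "c \<in> carrier (ab_pres S Rl)" and Rl: "Rl \<subseteq> carrier (free_Abelian_group S)"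
  shows "ab_lift G h c = ab_lift G h' c"
proof -
  interpret G: comm_group G by fact
  interpret F: comm_group "free_Abelian_group S" by (rule abelian_free_Abelian_group)
  obtain x where x: "Poly_Mapping.keys x \<subseteq> S"
    "c = generate (free_Abelian_group S) Rl #>\<^bsub>free_Abelian_group S\<^esub> x"
    using c by (rule ab_pres_carrierE)
  have "c \<subseteq> carrier (free_Abelian_group S)"
    unfolding x(2) by (rule F.r_coset_subset_G) (use F.generate_incl[OF Rl] x(1) in simp_all)
  then have "ab_ext G h ` c = ab_ext G h' ` c"
    using G.ab_ext_cong[OF eq h'] by (auto intro!: image_cong)
  then show ?thesis by (simp add: ab_lift_def descend_def)
qed

text \<open>The two shapes of relations that occur: an equation between two generators, and the
  expression of a generator as a sum of two others.\<close>

lemma (in comm_group) ab_ext_rel2: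
  assumes "h \<in> S \<rightarrow> carrier G" "s \<in> S" "t \<in> S" "h s = h t"
  shows "ab_ext G h (frag_of s - frag_of t) = \<one>"
  using assms ab_ext_diff[of h S "frag_of s" "frag_of t"] ab_ext_frag_of[of h s] ab_ext_frag_of[of h t]
  by (auto simp: Pi_iff)

lemma (in comm_group) ab_ext_rel3:
  assumes "h \<in> S \<rightarrow> carrier G" "s \<in> S" "t \<in> S" "u \<in> S" "h s = h t \<otimes> h u"
  shows "ab_ext G h (frag_of s - frag_of t - frag_of u) = \<one>"
proof -
  have k: "Poly_Mapping.keys (frag_of s - frag_of t) \<subseteq> S"
    using keys_diff[of "frag_of s" "frag_of t"] assms by auto
  have c: "h s \<in> carrier G" "h t \<in> carrier G" "h u \<in> carrier G" using assms by auto
  have "ab_ext G h (frag_of s - frag_of t - frag_of u) = (h s \<otimes> inv h t) \<otimes> inv h u"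
    using assms k c by (simp add: ab_ext_diff[of h S] ab_ext_frag_of)
  also have "\<dots> = \<one>" using c assms by (simp add: m_assoc m_comm[of "h t"] r_inv)
  finally show ?thesis .
qed

lemma ab_cls_rel:
  assumes Rl: "Rl \<subseteq> carrier (free_Abelian_group S)" and x: "x \<in> Rl"
  shows "generate (free_Abelian_group S) Rl #>\<^bsub>free_Abelian_group S\<^esub> x = \<one>\<^bsub>ab_pres S Rl\<^esub>"
proof -
  interpret F: comm_group "free_Abelian_group S" by (rule abelian_free_Abelian_group)
  show ?thesis unfolding ab_pres_def one_FactGroup
    using F.coset_join2[of x "generate (free_Abelian_group S) Rl"] x Rl F.generate_is_subgroup[OF Rl]
      generate.incl[OF x] by blast
qed

lemma ab_cls_rel2:
  assumes Rl: "Rl \<subseteq> carrier (free_Abelian_group S)" and x: "frag_of s - frag_of t \<in> Rl"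
    and st: "s \<in> S" "t \<in> S"
  shows "ab_cls S Rl s = ab_cls S Rl t"
proof -
  let ?q = "\<lambda>x. generate (free_Abelian_group S) Rl #>\<^bsub>free_Abelian_group S\<^esub> x"
  interpret P: comm_group "ab_pres S Rl" using Rl by (rule ab_pres_comm_group)
  have "?q ((frag_of s - frag_of t) \<otimes>\<^bsub>free_Abelian_group S\<^esub> frag_of t) = ?q (frag_of s - frag_of t) \<otimes>\<^bsub>ab_pres S Rl\<^esub> ?q (frag_of t)"
    using Rl x st by (intro hom_mult[OF ab_pres_quot_hom[OF Rl]]) (blast, simp)
  then show ?thesis using ab_cls_rel[OF Rl x] ab_cls_closed[OF st(2), of Rl] by (simp add: ab_cls_def)
qed

lemma ab_cls_rel3:
  assumes Rl: "Rl \<subseteq> carrier (free_Abelian_group S)" and x: "frag_of s - frag_of t - frag_of u \<in> Rl"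
    and st: "s \<in> S" "t \<in> S" "u \<in> S"
  shows "ab_cls S Rl s = ab_cls S Rl t \<otimes>\<^bsub>ab_pres S Rl\<^esub> ab_cls S Rl u"
proof -
  let ?q = "\<lambda>x. generate (free_Abelian_group S) Rl #>\<^bsub>free_Abelian_group S\<^esub> x"
  interpret P: comm_group "ab_pres S Rl" using Rl by (rule ab_pres_comm_group)
  have k: "Poly_Mapping.keys (frag_of t + frag_of u) \<subseteq> S" using keys_add[of "frag_of t" "frag_of u"] st by auto
  have "?q ((frag_of s - frag_of t - frag_of u) \<otimes>\<^bsub>free_Abelian_group S\<^esub> (frag_of t \<otimes>\<^bsub>free_Abelian_group S\<^esub> frag_of u))
     = ?q (frag_of s - frag_of t - frag_of u) \<otimes>\<^bsub>ab_pres S Rl\<^esub> ?q (frag_of t \<otimes>\<^bsub>free_Abelian_group S\<^esub> frag_of u)"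
    using Rl x st k by (intro hom_mult[OF ab_pres_quot_hom[OF Rl]]) (blast, simp)
  also have "?q (frag_of t \<otimes>\<^bsub>free_Abelian_group S\<^esub> frag_of u) = ?q (frag_of t) \<otimes>\<^bsub>ab_pres S Rl\<^esub> ?q (frag_of u)"
    using st by (intro hom_mult[OF ab_pres_quot_hom[OF Rl]]) auto
  finally show ?thesis using ab_cls_rel[OF Rl x] ab_cls_closed[OF st(2), of Rl] ab_cls_closed[OF st(3), of Rl]
    by (simp add: ab_cls_def)
qed

text \<open>For the second variable in \<open>ab_bilift\<close>: the extension in the first variable is a finite product
  of powers of homomorphisms in the second.\<close>

lemma hom_finprod:
  assumes P: "group P" and G: "comm_group G" and A: "finite A"
    and f: "\<And>s. s \<in> A \<Longrightarrow> f s \<in> hom P G"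
  shows "(\<lambda>b. finprod G (\<lambda>s. f s b [^]\<^bsub>G\<^esub> (k s :: int)) A) \<in> hom P G"
proof -
  interpret G: comm_group G by fact
  interpret P: group P by fact
  show ?thesis
  proof (rule homI)
    fix b assume b: "b \<in> carrier P"
    then show "finprod G (\<lambda>s. f s b [^]\<^bsub>G\<^esub> k s) A \<in> carrier G"
      using f by (intro G.finprod_closed) (auto simp: hom_def)
    fix c assume c: "c \<in> carrier P"
    have "finprod G (\<lambda>s. f s (b \<otimes>\<^bsub>P\<^esub> c) [^]\<^bsub>G\<^esub> k s) A
        = finprod G (\<lambda>s. f s b [^]\<^bsub>G\<^esub> k s \<otimes>\<^bsub>G\<^esub> f s c [^]\<^bsub>G\<^esub> k s) A"
    proof (rule G.finprod_cong')
      show "(\<lambda>s. f s b [^]\<^bsub>G\<^esub> k s \<otimes>\<^bsub>G\<^esub> f s c [^]\<^bsub>G\<^esub> k s) \<in> A \<rightarrow> carrier G"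
        using f b c by (auto simp: hom_def)
    next
      fix s assume s: "s \<in> A"
      have e: "f s (b \<otimes>\<^bsub>P\<^esub> c) = f s b \<otimes>\<^bsub>G\<^esub> f s c" "f s b \<in> carrier G" "f s c \<in> carrier G"
        using f[OF s] b c by (auto simp: hom_def)
      then show "f s (b \<otimes>\<^bsub>P\<^esub> c) [^]\<^bsub>G\<^esub> k s = f s b [^]\<^bsub>G\<^esub> k s \<otimes>\<^bsub>G\<^esub> f s c [^]\<^bsub>G\<^esub> k s"
        by (simp add: G.int_pow_distrib)
    qed simp
    also have "\<dots> = finprod G (\<lambda>s. f s b [^]\<^bsub>G\<^esub> k s) A \<otimes>\<^bsub>G\<^esub> finprod G (\<lambda>s. f s c [^]\<^bsub>G\<^esub> k s) A"
      using f b c by (intro G.finprod_multf) (auto simp: hom_def)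
    finally show "finprod G (\<lambda>s. f s (b \<otimes>\<^bsub>P\<^esub> c) [^]\<^bsub>G\<^esub> k s) A
      = finprod G (\<lambda>s. f s b [^]\<^bsub>G\<^esub> k s) A \<otimes>\<^bsub>G\<^esub> finprod G (\<lambda>s. f s c [^]\<^bsub>G\<^esub> k s) A" .
  qed
qed

text \<open>A function of two generators that kills the relations in each variable extends to a biadditive
  map. The iterated \<^const>\<open>ab_lift\<close> treats the variables differently: the outer lift needs that the
  inner one kills the relations of \<open>S1\<close> for every element \<open>b\<close>, which follows from the case of
  generators since both sides are additive in \<open>b\<close>.\<close>

lemma ab_bilift:
  fixes k :: "'s \<Rightarrow> 't \<Rightarrow> 'c"
  assumes R1: "R1 \<subseteq> carrier (free_Abelian_group S1)" and R2: "R2 \<subseteq> carrier (free_Abelian_group S2)"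
    and G: "comm_group G"
    and k: "\<And>s t. s \<in> S1 \<Longrightarrow> t \<in> S2 \<Longrightarrow> k s t \<in> carrier G"
    and kill1: "\<And>x t. x \<in> R1 \<Longrightarrow> t \<in> S2 \<Longrightarrow> ab_ext G (\<lambda>s. k s t) x = \<one>\<^bsub>G\<^esub>"
    and kill2: "\<And>s x. s \<in> S1 \<Longrightarrow> x \<in> R2 \<Longrightarrow> ab_ext G (k s) x = \<one>\<^bsub>G\<^esub>"
  defines "B \<equiv> \<lambda>a b. ab_lift G (\<lambda>s. ab_lift G (k s) b) a"
  shows "b \<in> carrier (ab_pres S2 R2) \<Longrightarrow> (\<lambda>a. B a b) \<in> hom (ab_pres S1 R1) G" (is "_ \<Longrightarrow> ?A b")
    and "a \<in> carrier (ab_pres S1 R1) \<Longrightarrow> B a \<in> hom (ab_pres S2 R2) G" (is "_ \<Longrightarrow> ?B a")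
    and "s \<in> S1 \<Longrightarrow> t \<in> S2 \<Longrightarrow> B (ab_cls S1 R1 s) (ab_cls S2 R2 t) = k s t" (is "_ \<Longrightarrow> _ \<Longrightarrow> ?C s t")
proof -
  interpret G: comm_group G by fact
  interpret P1: comm_group "ab_pres S1 R1" using R1 by (rule ab_pres_comm_group)
  interpret P2: comm_group "ab_pres S2 R2" using R2 by (rule ab_pres_comm_group)
  have inner: "ab_lift G (k s) \<in> hom (ab_pres S2 R2) G" if "s \<in> S1" for s
    using that by (intro ab_lift_hom[OF R2 G _ kill2]) (auto simp: k)
  have inner_cls: "ab_lift G (k s) (ab_cls S2 R2 t) = k s t" if "s \<in> S1" "t \<in> S2" for s t
    using that by (intro ab_lift_cls[OF R2 G _ kill2]) (auto simp: k)
  have ext: "(\<lambda>b. ab_ext G (\<lambda>s. ab_lift G (k s) b) x) \<in> hom (ab_pres S2 R2) G"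
    if "Poly_Mapping.keys x \<subseteq> S1" for x
    unfolding ab_ext_def using inner that by (intro hom_finprod[OF P2.is_group G]) auto
  have triv: "(\<lambda>_. \<one>\<^bsub>G\<^esub>) \<in> hom (ab_pres S2 R2) G" by (auto intro!: homI)
  have kill: "ab_ext G (\<lambda>s. ab_lift G (k s) b) x = \<one>\<^bsub>G\<^esub>"
    if x: "x \<in> R1" and b: "b \<in> carrier (ab_pres S2 R2)" for x b
  proof (rule ab_pres_hom_eq[OF R2 G.is_group ext triv _ b])
    show xS: "Poly_Mapping.keys x \<subseteq> S1" using subsetD[OF R1 x] by simp
    fix t assume t: "t \<in> S2"
    have "ab_ext G (\<lambda>s. ab_lift G (k s) (ab_cls S2 R2 t)) x = ab_ext G (\<lambda>s. k s t) x"
      using inner_cls t k xS by (intro G.ab_ext_cong[of S1]) auto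
    then show "ab_ext G (\<lambda>s. ab_lift G (k s) (ab_cls S2 R2 t)) x = \<one>\<^bsub>G\<^esub>" using kill1[OF x t] by simp
  qed
  have cl: "(\<lambda>s. ab_lift G (k s) b) \<in> S1 \<rightarrow> carrier G" if "b \<in> carrier (ab_pres S2 R2)" for b
    using inner that by (auto simp: hom_def)
  show A: "?A b" if "b \<in> carrier (ab_pres S2 R2)" for b
    unfolding B_def using cl[OF that] kill that by (intro ab_lift_hom[OF R1 G]) auto
  show B': "?B a" if a: "a \<in> carrier (ab_pres S1 R1)" for a
  proof -
    obtain x where x: "Poly_Mapping.keys x \<subseteq> S1"
      "a = generate (free_Abelian_group S1) R1 #>\<^bsub>free_Abelian_group S1\<^esub> x"
      using a by (rule ab_pres_carrierE)
    have "B a b = ab_ext G (\<lambda>s. ab_lift G (k s) b) x" if "b \<in> carrier (ab_pres S2 R2)" for b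
      unfolding B_def x(2) using cl kill that x(1) by (intro ab_lift_coset[OF R1 G]) auto
    then show ?thesis using ext[OF x(1)] by (auto simp: hom_def Pi_iff)
  qed
  show "?C s t" if "s \<in> S1" "t \<in> S2" for s t
    unfolding B_def using that kill cl ab_cls_closed[OF that(2)]
    by (subst ab_lift_cls[OF R1 G]) (auto simp: inner_cls)
qed

section \<open>Finite sets with an action of the cyclic group\<close>

text \<open>An equivariant map without the normalisation that \<^const>\<open>gmaps\<close> imposes outside of the source.
  Formulas in \<^const>\<open>pfst\<close>, \<^const>\<open>psnd\<close> and \<^const>\<open>PPair\<close> can then be used as maps as they stand.\<close>

definition eqv :: "nat \<Rightarrow> gset \<Rightarrow> gset \<Rightarrow> (pt \<Rightarrow> pt) \<Rightarrow> bool" where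
  "eqv n X Y f \<longleftrightarrow> (\<forall>x\<in>fst X. f x \<in> fst Y) \<and>
     (\<forall>a\<in>carrier (Cn n). \<forall>x\<in>fst X. f (snd X a x) = snd Y a (f x))"

text \<open>The class of a span whose legs are only \<^const>\<open>eqv\<close>; the normalisation is done here.\<close>

definition sp :: "nat \<Rightarrow> gset \<Rightarrow> gset \<Rightarrow> gset \<Rightarrow> (pt \<Rightarrow> pt) \<Rightarrow> (pt \<Rightarrow> pt) \<Rightarrow> bmor" where
  "sp n X Y U p q = bcls n X Y (U, restrict p (fst U), restrict q (fst U))"

text \<open>\<open>assocR\<close> starts from a product bracketed to the right and \<open>assocL\<close> from one bracketed to the
  left. \<open>swap_left\<close> exchanges the first two factors of \<open>X \<times> (Y \<times> Z)\<close>, \<open>swap_right\<close> the last two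
  factors of \<open>(X \<times> Y) \<times> Z\<close>.\<close>

abbreviation on_fst :: "(pt \<Rightarrow> pt) \<Rightarrow> pt \<Rightarrow> pt" where "on_fst f \<equiv> \<lambda>w. PPair (f (pfst w)) (psnd w)"
abbreviation on_snd :: "(pt \<Rightarrow> pt) \<Rightarrow> pt \<Rightarrow> pt" where "on_snd f \<equiv> \<lambda>w. PPair (pfst w) (f (psnd w))"
abbreviation flip :: "pt \<Rightarrow> pt" where "flip \<equiv> \<lambda>w. PPair (psnd w) (pfst w)"
abbreviation assocR :: "pt \<Rightarrow> pt" where "assocR \<equiv> \<lambda>w. PPair (PPair (pfst w) (pfst (psnd w))) (psnd (psnd w))"
abbreviation assocL :: "pt \<Rightarrow> pt" where "assocL \<equiv> \<lambda>w. PPair (pfst (pfst w)) (PPair (psnd (pfst w)) (psnd w))"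
abbreviation swap_left :: "pt \<Rightarrow> pt" where "swap_left \<equiv> \<lambda>w. PPair (pfst (psnd w)) (PPair (pfst w) (psnd (psnd w)))"
abbreviation swap_right :: "pt \<Rightarrow> pt" where "swap_right \<equiv> \<lambda>w. PPair (PPair (pfst (pfst w)) (psnd w)) (psnd (pfst w))"

lemma fst_mk_gset [simp]: "fst (mk_gset E act) = E"
  and snd_mk_gset [simp]: "x \<in> E \<Longrightarrow> snd (mk_gset E act) a x = act a x"
  and snd_mk_gset_ext: "snd (mk_gset E act) a \<in> extensional E"
  by (simp_all add: mk_gset_def)

lemma ball_gprod [simp]: "(\<forall>w\<in>fst (X \<times>\<^sub>G Y). P w) \<longleftrightarrow> (\<forall>x\<in>fst X. \<forall>y\<in>fst Y. P (PPair x y))"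
  and bex_gprod [simp]: "(\<exists>w\<in>fst (X \<times>\<^sub>G Y). P w) \<longleftrightarrow> (\<exists>x\<in>fst X. \<exists>y\<in>fst Y. P (PPair x y))"
  and mem_gprod [simp]: "PPair x y \<in> fst (X \<times>\<^sub>G Y) \<longleftrightarrow> x \<in> fst X \<and> y \<in> fst Y"
  and act_gprod [simp]: "x \<in> fst X \<Longrightarrow> y \<in> fst Y \<Longrightarrow>
     snd (X \<times>\<^sub>G Y) a (PPair x y) = PPair (snd X a x) (snd Y a y)"
  by (auto simp: gprod_def)

lemma ball_gpull [simp]: "(\<forall>w\<in>fst (gpull X f Y h). P w) \<longleftrightarrow>
     (\<forall>x\<in>fst X. \<forall>y\<in>fst Y. f x = h y \<longrightarrow> P (PPair x y))"
  and bex_gpull [simp]: "(\<exists>w\<in>fst (gpull X f Y h). P w) \<longleftrightarrow>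
     (\<exists>x\<in>fst X. \<exists>y\<in>fst Y. f x = h y \<and> P (PPair x y))"
  and mem_gpull [simp]: "PPair x y \<in> fst (gpull X f Y h) \<longleftrightarrow> x \<in> fst X \<and> y \<in> fst Y \<and> f x = h y"
  and act_gpull [simp]: "x \<in> fst X \<Longrightarrow> y \<in> fst Y \<Longrightarrow> f x = h y \<Longrightarrow>
     snd (gpull X f Y h) a (PPair x y) = PPair (snd X a x) (snd Y a y)"
  by (auto simp: gpull_def)

lemma ball_gsum [simp]: "(\<forall>w\<in>fst (X +\<^sub>G Y). P w) \<longleftrightarrow> (\<forall>x\<in>fst X. P (PInl x)) \<and> (\<forall>y\<in>fst Y. P (PInr y))"
  and bex_gsum [simp]: "(\<exists>w\<in>fst (X +\<^sub>G Y). P w) \<longleftrightarrow> (\<exists>x\<in>fst X. P (PInl x)) \<or> (\<exists>y\<in>fst Y. P (PInr y))"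
  and mem_gsum [simp]: "PInl x \<in> fst (X +\<^sub>G Y) \<longleftrightarrow> x \<in> fst X" "PInr y \<in> fst (X +\<^sub>G Y) \<longleftrightarrow> y \<in> fst Y"
  and act_gsum [simp]: "x \<in> fst X \<Longrightarrow> snd (X +\<^sub>G Y) a (PInl x) = PInl (snd X a x)"
    "y \<in> fst Y \<Longrightarrow> snd (X +\<^sub>G Y) a (PInr y) = PInr (snd Y a y)"
  by (auto simp: gsum_def pcase_def)

lemma pcase_simps [simp]: "pcase f h (PInl x) = f x" "pcase f h (PInr y) = h y"
  by (simp_all add: pcase_def)

locale burnside =
  fixes n :: nat
  assumes n1: "n \<ge> 1"
begin

lemma Cn_one [simp]: "1 \<in> carrier (Cn n)" "\<one>\<^bsub>Cn n\<^esub> = 1"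
  and Cn_mult [simp]: "a \<otimes>\<^bsub>Cn n\<^esub> b = a * b"
  and Cn_closed [simp]: "a \<in> carrier (Cn n) \<Longrightarrow> b \<in> carrier (Cn n) \<Longrightarrow> a * b \<in> carrier (Cn n)"
    "a \<in> carrier (Cn n) \<Longrightarrow> inverse a \<in> carrier (Cn n)"
  by (simp_all add: Cn_def power_mult_distrib power_inverse)

lemma Cn_nonzero: "a \<in> carrier (Cn n) \<Longrightarrow> a \<noteq> 0"
  using n1 by (auto simp: Cn_def zero_power)

lemma Cn_inverse: "a \<in> carrier (Cn n) \<Longrightarrow> inverse a * a = 1" "a \<in> carrier (Cn n) \<Longrightarrow> a * inverse a = 1"
  using Cn_nonzero by simp_all

lemma Cn_group: "group (Cn n)"
proof (rule groupI)
  fix a assume a: "a \<in> carrier (Cn n)"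
  show "\<exists>b\<in>carrier (Cn n). b \<otimes>\<^bsub>Cn n\<^esub> a = \<one>\<^bsub>Cn n\<^esub>"
    by (rule bexI[of _ "inverse a"]) (use a Cn_inverse in simp_all)
qed (simp_all add: mult.assoc)

lemma Cn_finite: "finite (carrier (Cn n))"
  using finite_roots_unity[of n] n1 by (simp add: Cn_def)

text \<open>In place of a homomorphism into the bijections, an action by plain equations: with these the
  simplifier can decide equivariance of formulas in points.\<close>

lemma gsets_iff:
  "X \<in> gsets n \<longleftrightarrow> finite (fst X) \<and>
     (\<forall>a\<in>carrier (Cn n). snd X a \<in> extensional (fst X) \<and> (\<forall>x\<in>fst X. snd X a x \<in> fst X)) \<and>
     (\<forall>x\<in>fst X. snd X 1 x = x) \<and>
     (\<forall>a\<in>carrier (Cn n). \<forall>b\<in>carrier (Cn n). \<forall>x\<in>fst X. snd X (a * b) x = snd X a (snd X b x))"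
  (is "_ \<longleftrightarrow> ?R X")
proof
  assume "X \<in> gsets n"
  then have fin: "finite (fst X)" and "group_action (Cn n) (fst X) (snd X)" by (auto simp: gsets_def)
  then interpret A: group_action "Cn n" "fst X" "snd X" by simp
  have "snd X a \<in> extensional (fst X)" if "a \<in> carrier (Cn n)" for a
    using A.bij_prop0[OF that] by (simp add: Bij_def)
  moreover have "snd X a x \<in> fst X" if "a \<in> carrier (Cn n)" "x \<in> fst X" for a x
    using A.element_image[OF that] by simp
  moreover have "snd X 1 x = x" if "x \<in> fst X" for x
    using A.id_eq_one that by (metis Cn_one(2) restrict_apply')
  moreover have "snd X (a * b) x = snd X a (snd X b x)"
    if "a \<in> carrier (Cn n)" "b \<in> carrier (Cn n)" "x \<in> fst X" for a b x
    using A.composition_rule[OF that(3) that(1,2)] by simp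
  ultimately show "?R X" using fin by blast
next
  assume R: "?R X"
  have bij: "snd X a \<in> Bij (fst X)" if a: "a \<in> carrier (Cn n)" for a
  proof -
    have a': "inverse a \<in> carrier (Cn n)" using a by simp
    have "snd X (inverse a) (snd X a x) = x" "snd X a (snd X (inverse a) x) = x" if x: "x \<in> fst X" for x
    proof -
      have "snd X (inverse a * a) x = snd X (inverse a) (snd X a x)"
        "snd X (a * inverse a) x = snd X a (snd X (inverse a) x)" "snd X 1 x = x"
        using R a a' x by blast+
      then show "snd X (inverse a) (snd X a x) = x" "snd X a (snd X (inverse a) x) = x"
        unfolding Cn_inverse[OF a] by simp_all
    qed
    moreover have "snd X a \<in> fst X \<rightarrow> fst X" "snd X (inverse a) \<in> fst X \<rightarrow> fst X" using R a a' by blast+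
    ultimately have b: "bij_betw (snd X a) (fst X) (fst X)"
      by (intro bij_betwI[where g = "snd X (inverse a)"])
    show ?thesis using R a b by (simp add: Bij_def)
  qed
  have "snd X \<in> hom (Cn n) (BijGroup (fst X))"
  proof (rule homI)
    fix a assume "a \<in> carrier (Cn n)"
    then show "snd X a \<in> carrier (BijGroup (fst X))" using bij by (simp add: BijGroup_def)
  next
    fix a b assume ab: "a \<in> carrier (Cn n)" "b \<in> carrier (Cn n)"
    then have "snd X (a * b) = compose (fst X) (snd X a) (snd X b)"
      using R Cn_closed(1)[OF ab] by (intro extensionalityI[of _ "fst X"]) (auto simp: compose_def)
    then show "snd X (a \<otimes>\<^bsub>Cn n\<^esub> b) = snd X a \<otimes>\<^bsub>BijGroup (fst X)\<^esub> snd X b"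
      using bij ab by (simp add: BijGroup_def)
  qed
  then have "group_action (Cn n) (fst X) (snd X)"
    using Cn_group group_BijGroup
    by (intro group_action.intro group_hom.intro) (auto simp: group_hom_axioms_def)
  then show "X \<in> gsets n" using R by (simp add: gsets_def)
qed

lemma gsets_closed [simp]: "X \<in> gsets n \<Longrightarrow> a \<in> carrier (Cn n) \<Longrightarrow> x \<in> fst X \<Longrightarrow> snd X a x \<in> fst X"
  and gsets_act_one [simp]: "X \<in> gsets n \<Longrightarrow> x \<in> fst X \<Longrightarrow> snd X 1 x = x"
  and gsets_act_mult: "X \<in> gsets n \<Longrightarrow> a \<in> carrier (Cn n) \<Longrightarrow> b \<in> carrier (Cn n) \<Longrightarrow> x \<in> fst X \<Longrightarrow>
     snd X a (snd X b x) = snd X (a * b) x"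
  and gsets_finite: "X \<in> gsets n \<Longrightarrow> finite (fst X)"
  by (simp_all add: gsets_iff)

lemma eqvD: "eqv n X Y f \<Longrightarrow> x \<in> fst X \<Longrightarrow> f x \<in> fst Y"
    "eqv n X Y f \<Longrightarrow> x \<in> fst X \<Longrightarrow> a \<in> carrier (Cn n) \<Longrightarrow> f (snd X a x) = snd Y a (f x)"
  by (simp_all add: eqv_def)

lemma gmaps_eqv: "X \<in> gsets n \<Longrightarrow> f \<in> gmaps n X Y \<longleftrightarrow> f \<in> extensional (fst X) \<and> eqv n X Y f"
  by (auto simp: gmaps_def eqv_def PiE_def)

lemma gmaps_restrict: "X \<in> gsets n \<Longrightarrow> eqv n X Y f \<Longrightarrow> restrict f (fst X) \<in> gmaps n X Y"
  by (auto simp: gmaps_def eqv_def)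

lemma eqv_id [simp]: "eqv n X X (\<lambda>x. x)" "X \<in> gsets n \<Longrightarrow> eqv n X X (gid X)"
  by (auto simp: eqv_def gid_def)

lemma eqv_comp: "eqv n X Y f \<Longrightarrow> eqv n Y Z g \<Longrightarrow> eqv n X Z (\<lambda>x. g (f x))"
  by (auto simp: eqv_def)

lemma gprod_gset [simp]:
  assumes "X \<in> gsets n" "Y \<in> gsets n" shows "X \<times>\<^sub>G Y \<in> gsets n"
proof -
  have "fst (X \<times>\<^sub>G Y) = (\<lambda>(x, y). PPair x y) ` (fst X \<times> fst Y)" by (auto simp: gprod_def)
  then have "finite (fst (X \<times>\<^sub>G Y))" using assms by (simp add: gsets_finite)
  moreover have "snd (X \<times>\<^sub>G Y) a \<in> extensional (fst (X \<times>\<^sub>G Y))" for a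
    by (simp add: gprod_def snd_mk_gset_ext)
  ultimately show ?thesis using assms unfolding gsets_iff[of "X \<times>\<^sub>G Y"] by (simp add: gsets_act_mult)
qed

lemma gpull_gset [simp]:
  assumes "X \<in> gsets n" "Y \<in> gsets n" "eqv n X Z f" "eqv n Y Z h" shows "gpull X f Y h \<in> gsets n"
proof -
  have "fst (gpull X f Y h) \<subseteq> (\<lambda>(x, y). PPair x y) ` (fst X \<times> fst Y)" by (auto simp: gpull_def)
  then have "finite (fst (gpull X f Y h))" using assms
    by (meson finite_SigmaI finite_imageI finite_subset gsets_finite)
  moreover have "snd (gpull X f Y h) a \<in> extensional (fst (gpull X f Y h))" for a
    by (simp add: gpull_def snd_mk_gset_ext)
  moreover have "f (snd X a x) = h (snd Y a y)"
    if "a \<in> carrier (Cn n)" "x \<in> fst X" "y \<in> fst Y" "f x = h y" for a x y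
    using assms(3,4) that by (simp add: eqvD(2))
  ultimately show ?thesis using assms unfolding gsets_iff[of "gpull X f Y h"]
    by (simp add: gsets_act_mult)
qed

lemma gsum_gset [simp]:
  assumes "X \<in> gsets n" "Y \<in> gsets n" shows "X +\<^sub>G Y \<in> gsets n"
proof -
  have "finite (fst (X +\<^sub>G Y))" using assms by (simp add: gsum_def gsets_finite)
  moreover have "snd (X +\<^sub>G Y) a \<in> extensional (fst (X +\<^sub>G Y))" for a
    by (simp add: gsum_def snd_mk_gset_ext)
  ultimately show ?thesis using assms unfolding gsets_iff[of "X +\<^sub>G Y"] by (simp add: gsets_act_mult)
qed

lemma gorbit_gset:
  assumes "subgroup L (Cn n)" shows "gorbit n L \<in> gsets n"
proof -
  interpret C: group "Cn n" by (rule Cn_group)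
  have L: "L \<subseteq> carrier (Cn n)" using assms by (rule subgroup.subset)
  have act: "a <#\<^bsub>Cn n\<^esub> (x <#\<^bsub>Cn n\<^esub> L) = (a * x) <#\<^bsub>Cn n\<^esub> L"
    if "a \<in> carrier (Cn n)" "x \<in> carrier (Cn n)" for a x
    using C.lcos_m_assoc[OF L that] by simp
  have E: "fst (gorbit n L) = (\<lambda>x. PCoset (x <#\<^bsub>Cn n\<^esub> L)) ` carrier (Cn n)" by (auto simp: gorbit_def)
  have "finite (fst (gorbit n L))" by (simp add: E Cn_finite)
  moreover have "snd (gorbit n L) a \<in> extensional (fst (gorbit n L))" for a
    by (simp add: gorbit_def snd_mk_gset_ext)
  moreover have s: "snd (gorbit n L) a (PCoset (x <#\<^bsub>Cn n\<^esub> L)) = PCoset ((a * x) <#\<^bsub>Cn n\<^esub> L)"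
    if "a \<in> carrier (Cn n)" "x \<in> carrier (Cn n)" for a x
  proof -
    have "PCoset (x <#\<^bsub>Cn n\<^esub> L) \<in> {PCoset (x <#\<^bsub>Cn n\<^esub> L) | x. x \<in> carrier (Cn n)}" using that by blast
    then show ?thesis using act[OF that] by (simp add: gorbit_def)
  qed
  ultimately show ?thesis unfolding gsets_iff[of "gorbit n L"] E by (auto simp: mult.assoc)
qed

lemma gone_gset [simp]: "gone n \<in> gsets n"
  using gorbit_gset[of "carrier (Cn n)"] Cn_group by (simp add: gone_def group.subgroup_self)

lemma fst_gone [simp]: "fst (gone n) = {pnt n}"
proof -
  interpret C: group "Cn n" by (rule Cn_group)
  have "x <#\<^bsub>Cn n\<^esub> carrier (Cn n) = carrier (Cn n)" if "x \<in> carrier (Cn n)" for x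
    using that C.coset_join3 C.subgroup_self by blast
  then show ?thesis using Cn_one by (auto simp: gone_def gorbit_def pnt_def)
qed

lemma act_gone [simp]: "a \<in> carrier (Cn n) \<Longrightarrow> snd (gone n) a (pnt n) = pnt n"
  using gsets_closed[OF gone_gset, of a "pnt n"] by simp


section \<open>Morphisms of the Burnside category\<close>

lemma restrict_eq_iff: "restrict f A = restrict g A \<longleftrightarrow> (\<forall>x\<in>A. f x = g x)"
  by (metis restrict_apply' restrict_ext)

lemma gpull_restrict [simp]:
  "gpull U (restrict q (fst U)) V h = gpull U q V h" "gpull U q V (restrict h (fst V)) = gpull U q V h"
  unfolding gpull_def by (rule arg_cong2[where f = mk_gset]; auto)+

lemma spansI: "U \<in> gsets n \<Longrightarrow> eqv n U X p \<Longrightarrow> eqv n U Y q \<Longrightarrow>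
    (U, restrict p (fst U), restrict q (fst U)) \<in> spans n X Y"
  by (simp add: spans_def gmaps_restrict)

lemma spansE:
  assumes "s \<in> spans n X Y"
  obtains U p q where "s = (U, restrict p (fst U), restrict q (fst U))"
    "U \<in> gsets n" "eqv n U X p" "eqv n U Y q"
proof -
  obtain U p q where s: "s = (U, p, q)" "U \<in> gsets n" "p \<in> gmaps n U X" "q \<in> gmaps n U Y"
    using assms by (auto simp: spans_def)
  then have "s = (U, restrict p (fst U), restrict q (fst U))" by (simp add: gmaps_eqv extensional_restrict)
  then show ?thesis using that s gmaps_eqv by blast
qed

lemma eqv_pcase: "eqv n U X p \<Longrightarrow> eqv n V X p' \<Longrightarrow> eqv n (U +\<^sub>G V) X (pcase p p')"
  by (simp add: eqv_def)

lemma span_sum_sp: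
  "span_sum (U, restrict p (fst U), restrict q (fst U)) (V, restrict p' (fst V), restrict q' (fst V)) =
   (U +\<^sub>G V, restrict (pcase p p') (fst (U +\<^sub>G V)), restrict (pcase q q') (fst (U +\<^sub>G V)))"
  by (simp add: span_sum_def restrict_eq_iff)

lemma span_sum_spans:
  assumes "s \<in> spans n X Y" "t \<in> spans n X Y" shows "span_sum s t \<in> spans n X Y"
  using assms by (elim spansE) (simp add: span_sum_sp spansI eqv_pcase)

lemma brels_carrier: "brels n X Y \<subseteq> carrier (free_Abelian_group (spans n X Y))"
proof -
  have k: "Poly_Mapping.keys (frag_of s - frag_of t) \<subseteq> S" if "s \<in> S" "t \<in> S" for s t :: span and S
    using that keys_diff[of "frag_of s" "frag_of t"] by auto
  have "Poly_Mapping.keys (frag_of s - frag_of t - frag_of u) \<subseteq> S" if "s \<in> S" "t \<in> S" "u \<in> S" for s t u :: span and S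
    using k[OF that(1,2)] that keys_diff[of "frag_of s - frag_of t" "frag_of u"] by auto
  note k3 = this
  show ?thesis
  proof
    fix x assume "x \<in> brels n X Y"
    then show "x \<in> carrier (free_Abelian_group (spans n X Y))"
      unfolding brels_def using k k3 span_sum_spans
      by (elim UnE CollectE exE conjE) (simp_all only: carrier_free_Abelian_group_iff)
  qed
qed

lemma bhom_comm_group: "comm_group (bhom n X Y)"
  unfolding bhom_def by (rule ab_pres_comm_group[OF brels_carrier])

lemma bhom_group: "group (bhom n X Y)"
  using bhom_comm_group by (simp add: comm_group_def)

lemma bcls_closed: "s \<in> spans n X Y \<Longrightarrow> bcls n X Y s \<in> carrier (bhom n X Y)"
  unfolding bcls_def bhom_def by (rule ab_cls_closed)

lemma sp_closed [simp]: "U \<in> gsets n \<Longrightarrow> eqv n U X p \<Longrightarrow> eqv n U Y q \<Longrightarrow> sp n X Y U p q \<in> carrier (bhom n X Y)"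
  unfolding sp_def by (intro bcls_closed spansI)

lemma bcls_iso: "s \<in> spans n X Y \<Longrightarrow> t \<in> spans n X Y \<Longrightarrow> span_iso n s t \<Longrightarrow> bcls n X Y s = bcls n X Y t"
  unfolding bcls_def by (rule ab_cls_rel2[OF brels_carrier]) (unfold brels_def, blast+)

lemma bcls_sum: "s \<in> spans n X Y \<Longrightarrow> t \<in> spans n X Y \<Longrightarrow>
   bcls n X Y (span_sum s t) = bcls n X Y s \<otimes>\<^bsub>bhom n X Y\<^esub> bcls n X Y t"
  unfolding bcls_def bhom_def by (rule ab_cls_rel3[OF brels_carrier]) (unfold brels_def, blast, simp_all add: span_sum_spans)

lemma span_isoI:
  assumes "U \<in> gsets n" "eqv n U V h" "inj_on h (fst U)" "\<forall>v\<in>fst V. \<exists>u\<in>fst U. h u = v"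
    "\<forall>u\<in>fst U. p' (h u) = p u \<and> q' (h u) = q u"
  shows "span_iso n (U, restrict p (fst U), restrict q (fst U)) (V, restrict p' (fst V), restrict q' (fst V))"
proof -
  have "h ` fst U = fst V"
  proof
    show "h ` fst U \<subseteq> fst V" using eqvD(1)[OF assms(2)] by auto
    show "fst V \<subseteq> h ` fst U" using assms(4) by (metis image_eqI subsetI)
  qed
  then have "bij_betw h (fst U) (fst V)" using assms(3) by (simp add: bij_betw_def)
  then have "bij_betw (restrict h (fst U)) (fst U) (fst V)" by (simp cong: bij_betw_cong)
  then show ?thesis unfolding span_iso_def using assms
    by (auto intro!: bexI[OF _ gmaps_restrict[of U V h]] simp: eqvD)
qed

text \<open>An isomorphism of spans is given here by an equivariant bijection without normalisation, so that
  it can be written as a formula.\<close>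

lemma sp_eqI:
  assumes "U \<in> gsets n" "V \<in> gsets n" "eqv n V X p'" "eqv n V Y q'"
    and "eqv n U V h" "inj_on h (fst U)" "\<forall>v\<in>fst V. \<exists>u\<in>fst U. h u = v"
    "\<forall>u\<in>fst U. p' (h u) = p u \<and> q' (h u) = q u"
  shows "sp n X Y U p q = sp n X Y V p' q'"
proof -
  have "eqv n U X p" "eqv n U Y q"
    using eqv_comp[OF assms(5,3)] eqv_comp[OF assms(5,4)] assms(1,8)
    by (auto simp: eqv_def)
  then show ?thesis unfolding sp_def using assms
    by (intro bcls_iso spansI span_isoI[where h = h]) auto
qed

lemma sp_cong:
  assumes "\<And>u. u \<in> fst U \<Longrightarrow> p u = p' u" "\<And>u. u \<in> fst U \<Longrightarrow> q u = q' u"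
  shows "sp n X Y U p q = sp n X Y U p' q'"
  using assms by (simp add: sp_def cong: restrict_cong)

lemma sp_sum:
  assumes "U \<in> gsets n" "V \<in> gsets n" "eqv n U X p" "eqv n U Y q" "eqv n V X p'" "eqv n V Y q'"
  shows "sp n X Y (U +\<^sub>G V) (pcase p p') (pcase q q') = sp n X Y U p q \<otimes>\<^bsub>bhom n X Y\<^esub> sp n X Y V p' q'"
  unfolding sp_def span_sum_sp[symmetric] using assms by (intro bcls_sum spansI)

lemma span_isoE:
  assumes "span_iso n (U, restrict p (fst U), restrict q (fst U)) (V, restrict p' (fst V), restrict q' (fst V))"
    "U \<in> gsets n"
  obtains h where "eqv n U V h" "inj_on h (fst U)" "\<forall>v\<in>fst V. \<exists>u\<in>fst U. h u = v"
    "\<forall>u\<in>fst U. p' (h u) = p u \<and> q' (h u) = q u"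
proof -
  obtain h where h: "h \<in> gmaps n U V" "bij_betw h (fst U) (fst V)"
    "\<forall>u\<in>fst U. restrict p' (fst V) (h u) = restrict p (fst U) u \<and> restrict q' (fst V) (h u) = restrict q (fst U) u"
    using assms by (auto simp: span_iso_def)
  have e: "eqv n U V h" using h(1) assms(2) by (simp add: gmaps_eqv)
  moreover have "\<forall>v\<in>fst V. \<exists>u\<in>fst U. h u = v" using h(2) unfolding bij_betw_def by (metis imageE)
  moreover have "\<forall>u\<in>fst U. p' (h u) = p u \<and> q' (h u) = q u" using h(3) eqvD(1)[OF e] by simp
  ultimately show ?thesis using that h(2) by (auto simp: bij_betw_def)
qed

text \<open>The two kinds of relations of the group completion, as conditions on a function of spans.\<close>

lemma brels_kill:
  assumes G: "comm_group G" and cl: "h \<in> spans n X Y \<rightarrow> carrier G"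
    and iso: "\<And>s t. s \<in> spans n X Y \<Longrightarrow> t \<in> spans n X Y \<Longrightarrow> span_iso n s t \<Longrightarrow> h s = h t"
    and sum: "\<And>s t. s \<in> spans n X Y \<Longrightarrow> t \<in> spans n X Y \<Longrightarrow> h (span_sum s t) = h s \<otimes>\<^bsub>G\<^esub> h t"
    and x: "x \<in> brels n X Y"
  shows "ab_ext G h x = \<one>\<^bsub>G\<^esub>"
proof -
  interpret G: comm_group G by fact
  show ?thesis using x unfolding brels_def
  proof (elim UnE CollectE exE conjE)
    fix s t assume "x = frag_of s - frag_of t" "s \<in> spans n X Y" "t \<in> spans n X Y" "span_iso n s t"
    then show ?thesis using G.ab_ext_rel2[OF cl] iso by blast
  next
    fix s t assume "x = frag_of (span_sum s t) - frag_of s - frag_of t" "s \<in> spans n X Y" "t \<in> spans n X Y"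
    then show ?thesis using G.ab_ext_rel3[OF cl] sum span_sum_spans by metis
  qed
qed

text \<open>Additive maps are compared on spans. All laws of composition reduce to this, one variable at a
  time.\<close>

lemma bhom_hom_eq:
  assumes G: "group G" and f: "f \<in> hom (bhom n X Y) G" and g: "g \<in> hom (bhom n X Y) G"
    and eq: "\<And>U p q. U \<in> gsets n \<Longrightarrow> eqv n U X p \<Longrightarrow> eqv n U Y q \<Longrightarrow> f (sp n X Y U p q) = g (sp n X Y U p q)"
    and c: "c \<in> carrier (bhom n X Y)"
  shows "f c = g c"
proof (rule ab_pres_hom_eq[OF brels_carrier G])
  show "f \<in> hom (ab_pres (spans n X Y) (brels n X Y)) G" "g \<in> hom (ab_pres (spans n X Y) (brels n X Y)) G"
    "c \<in> carrier (ab_pres (spans n X Y) (brels n X Y))"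
    using f g c by (simp_all add: bhom_def)
  fix s assume "s \<in> spans n X Y"
  then obtain U p q where "s = (U, restrict p (fst U), restrict q (fst U))" "U \<in> gsets n" "eqv n U X p" "eqv n U Y q"
    by (rule spansE)
  then show "f (ab_cls (spans n X Y) (brels n X Y) s) = g (ab_cls (spans n X Y) (brels n X Y) s)"
    using eq[of U p q] by (simp add: sp_def bcls_def)
qed

lemma bcls_span_comp:
  assumes "U \<in> gsets n" "V \<in> gsets n" "eqv n U X p" "eqv n U Y q" "eqv n V Y p'" "eqv n V Z q'"
  shows "span_comp (U, restrict p (fst U), restrict q (fst U)) (V, restrict p' (fst V), restrict q' (fst V)) =
      (gpull U q V p', restrict (\<lambda>w. p (pfst w)) (fst (gpull U q V p')), restrict (\<lambda>w. q' (psnd w)) (fst (gpull U q V p')))"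
    and "eqv n (gpull U q V p') X (\<lambda>w. p (pfst w))" "eqv n (gpull U q V p') Z (\<lambda>w. q' (psnd w))"
  using assms by (simp_all add: span_comp_def restrict_eq_iff eqv_def)

lemma bcls_span_prod:
  assumes "U \<in> gsets n" "V \<in> gsets n" "eqv n U X p" "eqv n U X' q" "eqv n V Y p'" "eqv n V Y' q'"
  shows "span_prod (U, restrict p (fst U), restrict q (fst U)) (V, restrict p' (fst V), restrict q' (fst V)) =
      (U \<times>\<^sub>G V, restrict (\<lambda>w. PPair (p (pfst w)) (p' (psnd w))) (fst (U \<times>\<^sub>G V)),
        restrict (\<lambda>w. PPair (q (pfst w)) (q' (psnd w))) (fst (U \<times>\<^sub>G V)))"
    and "eqv n (U \<times>\<^sub>G V) (X \<times>\<^sub>G Y) (\<lambda>w. PPair (p (pfst w)) (p' (psnd w)))"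
      "eqv n (U \<times>\<^sub>G V) (X' \<times>\<^sub>G Y') (\<lambda>w. PPair (q (pfst w)) (q' (psnd w)))"
  using assms by (simp_all add: span_prod_def restrict_eq_iff eqv_def)

lemma span_comp_spans:
  assumes "s \<in> spans n X Y" "t \<in> spans n Y Z" shows "span_comp s t \<in> spans n X Z"
proof -
  obtain U p q V p' q' where "s = (U, restrict p (fst U), restrict q (fst U))" "U \<in> gsets n" "eqv n U X p" "eqv n U Y q"
      "t = (V, restrict p' (fst V), restrict q' (fst V))" "V \<in> gsets n" "eqv n V Y p'" "eqv n V Z q'"
    using assms by (metis spansE)
  then show ?thesis by (simp add: bcls_span_comp(1)[of U V X p Y q p' Z q'] spansI bcls_span_comp(2,3))
qed

lemma span_prod_spans:
  assumes "s \<in> spans n X X'" "t \<in> spans n Y Y'" shows "span_prod s t \<in> spans n (X \<times>\<^sub>G Y) (X' \<times>\<^sub>G Y')"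
proof -
  obtain U p q V p' q' where "s = (U, restrict p (fst U), restrict q (fst U))" "U \<in> gsets n" "eqv n U X p" "eqv n U X' q"
      "t = (V, restrict p' (fst V), restrict q' (fst V))" "V \<in> gsets n" "eqv n V Y p'" "eqv n V Y' q'"
    using assms by (metis spansE)
  then show ?thesis by (simp add: bcls_span_prod(1)[of U V X p X' q Y p' Y' q'] spansI bcls_span_prod(2,3))
qed

text \<open>Composition of spans respects isomorphisms in the first variable, as the pullback is functorial,
  and disjoint unions, as pullback distributes over them. Products of spans behave likewise in
  each variable.\<close>

lemma bcomp_kills_left:
  assumes "t \<in> spans n Y Z" "x \<in> brels n X Y"
  shows "ab_ext (bhom n X Z) (\<lambda>s. bcls n X Z (span_comp s t)) x = \<one>\<^bsub>bhom n X Z\<^esub>"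
proof (rule brels_kill[OF bhom_comm_group _ _ _ assms(2)])
  obtain V p' q' where t: "t = (V, restrict p' (fst V), restrict q' (fst V))" "V \<in> gsets n" "eqv n V Y p'" "eqv n V Z q'"
    using assms(1) by (rule spansE)
  show "(\<lambda>s. bcls n X Z (span_comp s t)) \<in> spans n X Y \<rightarrow> carrier (bhom n X Z)"
    using assms(1) by (intro funcsetI bcls_closed span_comp_spans)
  fix s1 s2 assume s1: "s1 \<in> spans n X Y" and s2: "s2 \<in> spans n X Y"
  obtain U1 p1 q1 where u1: "s1 = (U1, restrict p1 (fst U1), restrict q1 (fst U1))" "U1 \<in> gsets n" "eqv n U1 X p1" "eqv n U1 Y q1"
    using s1 by (rule spansE)
  obtain U2 p2 q2 where u2: "s2 = (U2, restrict p2 (fst U2), restrict q2 (fst U2))" "U2 \<in> gsets n" "eqv n U2 X p2" "eqv n U2 Y q2"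
    using s2 by (rule spansE)
  have c1: "bcls n X Z (span_comp s1 t) = sp n X Z (gpull U1 q1 V p') (\<lambda>w. p1 (pfst w)) (\<lambda>w. q' (psnd w))"
    and c2: "bcls n X Z (span_comp s2 t) = sp n X Z (gpull U2 q2 V p') (\<lambda>w. p2 (pfst w)) (\<lambda>w. q' (psnd w))"
    using u1 u2 t by (simp_all add: bcls_span_comp(1) sp_def)
  have g: "gpull U1 q1 V p' \<in> gsets n" "gpull U2 q2 V p' \<in> gsets n"
    "gpull (U1 +\<^sub>G U2) (pcase q1 q2) V p' \<in> gsets n"
    using u1 u2 t eqv_pcase[of U1 Y q1 U2 q2] by (auto intro!: gpull_gset)
  note e = bcls_span_comp(2,3)[OF u1(2) t(2) u1(3,4) t(3,4)] bcls_span_comp(2,3)[OF u2(2) t(2) u2(3,4) t(3,4)]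
  { assume "span_iso n s1 s2"
    then obtain h where h: "eqv n U1 U2 h" "inj_on h (fst U1)" "\<forall>v\<in>fst U2. \<exists>u\<in>fst U1. h u = v"
      "\<forall>u\<in>fst U1. p2 (h u) = p1 u \<and> q2 (h u) = q1 u" using u1 u2 by (auto elim: span_isoE)
    show "bcls n X Z (span_comp s1 t) = bcls n X Z (span_comp s2 t)"
      unfolding c1 c2
    proof (rule sp_eqI[OF g(1,2) e(3,4), where h = "on_fst h"])
      show "eqv n (gpull U1 q1 V p') (gpull U2 q2 V p') (on_fst h)"
        using h t(3) u1(4) by (simp add: eqv_def)
      show "inj_on (on_fst h) (fst (gpull U1 q1 V p'))"
        using h(2) unfolding inj_on_def by simp
      show "\<forall>v\<in>fst (gpull U2 q2 V p'). \<exists>u\<in>fst (gpull U1 q1 V p'). PPair (h (pfst u)) (psnd u) = v"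
        using h by simp metis
      show "\<forall>u\<in>fst (gpull U1 q1 V p'). p2 (pfst (PPair (h (pfst u)) (psnd u))) = p1 (pfst u) \<and>
          q' (psnd (PPair (h (pfst u)) (psnd u))) = q' (psnd u)"
        using h(4) by simp
    qed }
  have "bcls n X Z (span_comp (span_sum s1 s2) t) = sp n X Z (gpull (U1 +\<^sub>G U2) (pcase q1 q2) V p') (\<lambda>w. (pcase p1 p2) (pfst w)) (\<lambda>w. q' (psnd w))"
    using u1 u2 t by (simp add: bcls_span_comp(1)[of "U1 +\<^sub>G U2" V X _ Y _ p' Z q'] sp_def span_sum_sp eqv_pcase)
  also have "\<dots> = sp n X Z (gpull U1 q1 V p' +\<^sub>G gpull U2 q2 V p') (pcase (\<lambda>w. p1 (pfst w)) (\<lambda>w. p2 (pfst w))) (pcase (\<lambda>w. q' (psnd w)) (\<lambda>w. q' (psnd w)))"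
  proof (rule sp_eqI[where h = "\<lambda>w. pcase (\<lambda>u. PInl (PPair u (psnd w))) (\<lambda>u. PInr (PPair u (psnd w))) (pfst w)"])
    show "eqv n (gpull (U1 +\<^sub>G U2) (pcase q1 q2) V p') (gpull U1 q1 V p' +\<^sub>G gpull U2 q2 V p')
      (\<lambda>w. pcase (\<lambda>u. PInl (PPair u (psnd w))) (\<lambda>u. PInr (PPair u (psnd w))) (pfst w))"
      using u1(2,4) u2(2,4) t(2,3) by (simp add: eqv_def)
  qed (use g e in \<open>simp_all add: eqv_pcase inj_on_def\<close>)
  finally show "bcls n X Z (span_comp (span_sum s1 s2) t) = bcls n X Z (span_comp s1 t) \<otimes>\<^bsub>bhom n X Z\<^esub> bcls n X Z (span_comp s2 t)"
    unfolding c1 c2 using g e by (simp add: sp_sum)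
qed


lemma bcomp_kills_right:
  assumes "s \<in> spans n X Y" "x \<in> brels n Y Z"
  shows "ab_ext (bhom n X Z) (\<lambda>t. bcls n X Z (span_comp s t)) x = \<one>\<^bsub>bhom n X Z\<^esub>"
proof (rule brels_kill[OF bhom_comm_group _ _ _ assms(2)])
  obtain V p' q' where t: "s = (V, restrict p' (fst V), restrict q' (fst V))" "V \<in> gsets n" "eqv n V X p'" "eqv n V Y q'"
    using assms(1) by (rule spansE)
  show "(\<lambda>t. bcls n X Z (span_comp s t)) \<in> spans n Y Z \<rightarrow> carrier (bhom n X Z)"
    using assms(1) by (intro funcsetI bcls_closed span_comp_spans)
  fix s1 s2 assume s1: "s1 \<in> spans n Y Z" and s2: "s2 \<in> spans n Y Z"
  obtain U1 p1 q1 where u1: "s1 = (U1, restrict p1 (fst U1), restrict q1 (fst U1))" "U1 \<in> gsets n" "eqv n U1 Y p1" "eqv n U1 Z q1"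
    using s1 by (rule spansE)
  obtain U2 p2 q2 where u2: "s2 = (U2, restrict p2 (fst U2), restrict q2 (fst U2))" "U2 \<in> gsets n" "eqv n U2 Y p2" "eqv n U2 Z q2"
    using s2 by (rule spansE)
  have c1: "bcls n X Z (span_comp s s1) = sp n X Z (gpull V q' U1 p1) (\<lambda>w. p' (pfst w)) (\<lambda>w. q1 (psnd w))"
    and c2: "bcls n X Z (span_comp s s2) = sp n X Z (gpull V q' U2 p2) (\<lambda>w. p' (pfst w)) (\<lambda>w. q2 (psnd w))"
    using u1 u2 t by (simp_all add: bcls_span_comp(1) sp_def)
  have g: "gpull V q' U1 p1 \<in> gsets n" "gpull V q' U2 p2 \<in> gsets n"
    "gpull V q' (U1 +\<^sub>G U2) (pcase p1 p2) \<in> gsets n"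
    using u1 u2 t eqv_pcase[of U1 Y p1 U2 p2] by (auto intro!: gpull_gset)
  note e = bcls_span_comp(2,3)[OF t(2) u1(2) t(3,4) u1(3,4)] bcls_span_comp(2,3)[OF t(2) u2(2) t(3,4) u2(3,4)]
  { assume "span_iso n s1 s2"
    then obtain h where h: "eqv n U1 U2 h" "inj_on h (fst U1)" "\<forall>v\<in>fst U2. \<exists>u\<in>fst U1. h u = v"
      "\<forall>u\<in>fst U1. p2 (h u) = p1 u \<and> q2 (h u) = q1 u" using u1 u2 by (auto elim: span_isoE)
    show "bcls n X Z (span_comp s s1) = bcls n X Z (span_comp s s2)"
      unfolding c1 c2
    proof (rule sp_eqI[OF g(1,2) e(3,4), where h = "on_snd h"])
      show "eqv n (gpull V q' U1 p1) (gpull V q' U2 p2) (on_snd h)"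
        using h t(4) u1(3) by (simp add: eqv_def)
      show "inj_on (on_snd h) (fst (gpull V q' U1 p1))"
        using h(2) unfolding inj_on_def by simp
      show "\<forall>v\<in>fst (gpull V q' U2 p2). \<exists>u\<in>fst (gpull V q' U1 p1). PPair (pfst u) (h (psnd u)) = v"
        using h by simp metis
      show "\<forall>u\<in>fst (gpull V q' U1 p1). p' (pfst (PPair (pfst u) (h (psnd u)))) = p' (pfst u) \<and>
          q2 (psnd (PPair (pfst u) (h (psnd u)))) = q1 (psnd u)"
        using h(4) by simp
    qed }
  have "bcls n X Z (span_comp s (span_sum s1 s2)) = sp n X Z (gpull V q' (U1 +\<^sub>G U2) (pcase p1 p2)) (\<lambda>w. p' (pfst w)) (\<lambda>w. (pcase q1 q2) (psnd w))"
    using u1 u2 t by (simp add: bcls_span_comp(1)[of V "U1 +\<^sub>G U2" X p' Y q' _ Z] sp_def span_sum_sp eqv_pcase)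
  also have "\<dots> = sp n X Z (gpull V q' U1 p1 +\<^sub>G gpull V q' U2 p2) (pcase (\<lambda>w. p' (pfst w)) (\<lambda>w. p' (pfst w))) (pcase (\<lambda>w. q1 (psnd w)) (\<lambda>w. q2 (psnd w)))"
  proof (rule sp_eqI[where h = "\<lambda>w. pcase (\<lambda>u. PInl (PPair (pfst w) u)) (\<lambda>u. PInr (PPair (pfst w) u)) (psnd w)"])
    show "eqv n (gpull V q' (U1 +\<^sub>G U2) (pcase p1 p2)) (gpull V q' U1 p1 +\<^sub>G gpull V q' U2 p2)
      (\<lambda>w. pcase (\<lambda>u. PInl (PPair (pfst w) u)) (\<lambda>u. PInr (PPair (pfst w) u)) (psnd w))"
      using u1(2,3) u2(2,3) t(2,4) by (simp add: eqv_def)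
  qed (use g e in \<open>simp_all add: eqv_pcase inj_on_def\<close>)
  finally show "bcls n X Z (span_comp s (span_sum s1 s2)) = bcls n X Z (span_comp s s1) \<otimes>\<^bsub>bhom n X Z\<^esub> bcls n X Z (span_comp s s2)"
    unfolding c1 c2 using g e by (simp add: sp_sum)
qed

lemma bprod_kills_left:
  assumes "t \<in> spans n Y Y'" "x \<in> brels n X X'"
  shows "ab_ext (bhom n (X \<times>\<^sub>G Y) (X' \<times>\<^sub>G Y')) (\<lambda>s. bcls n (X \<times>\<^sub>G Y) (X' \<times>\<^sub>G Y') (span_prod s t)) x
    = \<one>\<^bsub>bhom n (X \<times>\<^sub>G Y) (X' \<times>\<^sub>G Y')\<^esub>"
proof (rule brels_kill[OF bhom_comm_group _ _ _ assms(2)])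
  let ?P = "X \<times>\<^sub>G Y" and ?Q = "X' \<times>\<^sub>G Y'"
  obtain V p' q' where t: "t = (V, restrict p' (fst V), restrict q' (fst V))" "V \<in> gsets n" "eqv n V Y p'" "eqv n V Y' q'"
    using assms(1) by (rule spansE)
  show "(\<lambda>s. bcls n ?P ?Q (span_prod s t)) \<in> spans n X X' \<rightarrow> carrier (bhom n ?P ?Q)"
    using assms(1) by (intro funcsetI bcls_closed span_prod_spans)
  fix s1 s2 assume s1: "s1 \<in> spans n X X'" and s2: "s2 \<in> spans n X X'"
  obtain U1 p1 q1 where u1: "s1 = (U1, restrict p1 (fst U1), restrict q1 (fst U1))" "U1 \<in> gsets n" "eqv n U1 X p1" "eqv n U1 X' q1"
    using s1 by (rule spansE)
  obtain U2 p2 q2 where u2: "s2 = (U2, restrict p2 (fst U2), restrict q2 (fst U2))" "U2 \<in> gsets n" "eqv n U2 X p2" "eqv n U2 X' q2"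
    using s2 by (rule spansE)
  have c1: "bcls n ?P ?Q (span_prod s1 t) = sp n ?P ?Q (U1 \<times>\<^sub>G V) (\<lambda>w. PPair (p1 (pfst w)) (p' (psnd w))) (\<lambda>w. PPair (q1 (pfst w)) (q' (psnd w)))"
    and c2: "bcls n ?P ?Q (span_prod s2 t) = sp n ?P ?Q (U2 \<times>\<^sub>G V) (\<lambda>w. PPair (p2 (pfst w)) (p' (psnd w))) (\<lambda>w. PPair (q2 (pfst w)) (q' (psnd w)))"
    using u1 u2 t by (simp_all add: bcls_span_prod(1) sp_def)
  note e = bcls_span_prod(2,3)[OF u1(2) t(2) u1(3,4) t(3,4)] bcls_span_prod(2,3)[OF u2(2) t(2) u2(3,4) t(3,4)]
  { assume "span_iso n s1 s2"
    then obtain h where h: "eqv n U1 U2 h" "inj_on h (fst U1)" "\<forall>v\<in>fst U2. \<exists>u\<in>fst U1. h u = v"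
      "\<forall>u\<in>fst U1. p2 (h u) = p1 u \<and> q2 (h u) = q1 u" using u1 u2 by (auto elim: span_isoE)
    show "bcls n ?P ?Q (span_prod s1 t) = bcls n ?P ?Q (span_prod s2 t)"
      unfolding c1 c2
    proof (rule sp_eqI[OF gprod_gset[OF u1(2) t(2)] gprod_gset[OF u2(2) t(2)] e(3,4), where h = "on_fst h"])
      show "\<forall>v\<in>fst (U2 \<times>\<^sub>G V). \<exists>u\<in>fst (U1 \<times>\<^sub>G V). PPair (h (pfst u)) (psnd u) = v"
        using h(3) by simp
    qed (use h in \<open>simp_all add: eqv_def inj_on_def\<close>) }
  have "bcls n ?P ?Q (span_prod (span_sum s1 s2) t) = sp n ?P ?Q ((U1 +\<^sub>G U2) \<times>\<^sub>G V) (\<lambda>w. PPair ((pcase p1 p2) (pfst w)) (p' (psnd w))) (\<lambda>w. PPair ((pcase q1 q2) (pfst w)) (q' (psnd w)))"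
    using u1 u2 t by (simp add: bcls_span_prod(1)[of "U1 +\<^sub>G U2" V X _ X' _ Y p' Y' q'] sp_def span_sum_sp eqv_pcase)
  also have "\<dots> = sp n ?P ?Q (U1 \<times>\<^sub>G V +\<^sub>G U2 \<times>\<^sub>G V)
     (pcase (\<lambda>w. PPair (p1 (pfst w)) (p' (psnd w))) (\<lambda>w. PPair (p2 (pfst w)) (p' (psnd w))))
     (pcase (\<lambda>w. PPair (q1 (pfst w)) (q' (psnd w))) (\<lambda>w. PPair (q2 (pfst w)) (q' (psnd w))))"
  proof (rule sp_eqI[where h = "\<lambda>w. pcase (\<lambda>u. PInl (PPair u (psnd w))) (\<lambda>u. PInr (PPair u (psnd w))) (pfst w)"])
    show "eqv n ((U1 +\<^sub>G U2) \<times>\<^sub>G V) (U1 \<times>\<^sub>G V +\<^sub>G U2 \<times>\<^sub>G V)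
      (\<lambda>w. pcase (\<lambda>u. PInl (PPair u (psnd w))) (\<lambda>u. PInr (PPair u (psnd w))) (pfst w))"
      by (simp add: eqv_def)
  qed (use e u1(2) u2(2) t(2) in \<open>simp_all add: eqv_pcase inj_on_def\<close>)
  finally show "bcls n ?P ?Q (span_prod (span_sum s1 s2) t) = bcls n ?P ?Q (span_prod s1 t) \<otimes>\<^bsub>bhom n ?P ?Q\<^esub> bcls n ?P ?Q (span_prod s2 t)"
    unfolding c1 c2 using e u1(2) u2(2) t(2) by (simp add: sp_sum)
qed

lemma bprod_kills_right:
  assumes "s \<in> spans n X X'" "x \<in> brels n Y Y'"
  shows "ab_ext (bhom n (X \<times>\<^sub>G Y) (X' \<times>\<^sub>G Y')) (\<lambda>t. bcls n (X \<times>\<^sub>G Y) (X' \<times>\<^sub>G Y') (span_prod s t)) x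
    = \<one>\<^bsub>bhom n (X \<times>\<^sub>G Y) (X' \<times>\<^sub>G Y')\<^esub>"
proof (rule brels_kill[OF bhom_comm_group _ _ _ assms(2)])
  let ?P = "X \<times>\<^sub>G Y" and ?Q = "X' \<times>\<^sub>G Y'"
  obtain V p' q' where t: "s = (V, restrict p' (fst V), restrict q' (fst V))" "V \<in> gsets n" "eqv n V X p'" "eqv n V X' q'"
    using assms(1) by (rule spansE)
  show "(\<lambda>t. bcls n ?P ?Q (span_prod s t)) \<in> spans n Y Y' \<rightarrow> carrier (bhom n ?P ?Q)"
    using assms(1) by (intro funcsetI bcls_closed span_prod_spans)
  fix s1 s2 assume s1: "s1 \<in> spans n Y Y'" and s2: "s2 \<in> spans n Y Y'"
  obtain U1 p1 q1 where u1: "s1 = (U1, restrict p1 (fst U1), restrict q1 (fst U1))" "U1 \<in> gsets n" "eqv n U1 Y p1" "eqv n U1 Y' q1"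
    using s1 by (rule spansE)
  obtain U2 p2 q2 where u2: "s2 = (U2, restrict p2 (fst U2), restrict q2 (fst U2))" "U2 \<in> gsets n" "eqv n U2 Y p2" "eqv n U2 Y' q2"
    using s2 by (rule spansE)
  have c1: "bcls n ?P ?Q (span_prod s s1) = sp n ?P ?Q (V \<times>\<^sub>G U1) (\<lambda>w. PPair (p' (pfst w)) (p1 (psnd w))) (\<lambda>w. PPair (q' (pfst w)) (q1 (psnd w)))"
    and c2: "bcls n ?P ?Q (span_prod s s2) = sp n ?P ?Q (V \<times>\<^sub>G U2) (\<lambda>w. PPair (p' (pfst w)) (p2 (psnd w))) (\<lambda>w. PPair (q' (pfst w)) (q2 (psnd w)))"
    using u1 u2 t by (simp_all add: bcls_span_prod(1) sp_def)
  note e = bcls_span_prod(2,3)[OF t(2) u1(2) t(3,4) u1(3,4)] bcls_span_prod(2,3)[OF t(2) u2(2) t(3,4) u2(3,4)]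
  { assume "span_iso n s1 s2"
    then obtain h where h: "eqv n U1 U2 h" "inj_on h (fst U1)" "\<forall>v\<in>fst U2. \<exists>u\<in>fst U1. h u = v"
      "\<forall>u\<in>fst U1. p2 (h u) = p1 u \<and> q2 (h u) = q1 u" using u1 u2 by (auto elim: span_isoE)
    show "bcls n ?P ?Q (span_prod s s1) = bcls n ?P ?Q (span_prod s s2)"
      unfolding c1 c2
    proof (rule sp_eqI[OF gprod_gset[OF t(2) u1(2)] gprod_gset[OF t(2) u2(2)] e(3,4), where h = "on_snd h"])
      show "\<forall>v\<in>fst (V \<times>\<^sub>G U2). \<exists>u\<in>fst (V \<times>\<^sub>G U1). PPair (pfst u) (h (psnd u)) = v"
        using h(3) by simp
    qed (use h in \<open>simp_all add: eqv_def inj_on_def\<close>) }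
  have "bcls n ?P ?Q (span_prod s (span_sum s1 s2)) = sp n ?P ?Q (V \<times>\<^sub>G (U1 +\<^sub>G U2)) (\<lambda>w. PPair (p' (pfst w)) ((pcase p1 p2) (psnd w))) (\<lambda>w. PPair (q' (pfst w)) ((pcase q1 q2) (psnd w)))"
    using u1 u2 t by (simp add: bcls_span_prod(1)[of V "U1 +\<^sub>G U2" X p' X' q' Y _ Y' _] sp_def span_sum_sp eqv_pcase)
  also have "\<dots> = sp n ?P ?Q (V \<times>\<^sub>G U1 +\<^sub>G V \<times>\<^sub>G U2)
     (pcase (\<lambda>w. PPair (p' (pfst w)) (p1 (psnd w))) (\<lambda>w. PPair (p' (pfst w)) (p2 (psnd w))))
     (pcase (\<lambda>w. PPair (q' (pfst w)) (q1 (psnd w))) (\<lambda>w. PPair (q' (pfst w)) (q2 (psnd w))))"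
  proof (rule sp_eqI[where h = "\<lambda>w. pcase (\<lambda>u. PInl (PPair (pfst w) u)) (\<lambda>u. PInr (PPair (pfst w) u)) (psnd w)"])
    show "eqv n (V \<times>\<^sub>G (U1 +\<^sub>G U2)) (V \<times>\<^sub>G U1 +\<^sub>G V \<times>\<^sub>G U2)
      (\<lambda>w. pcase (\<lambda>u. PInl (PPair (pfst w) u)) (\<lambda>u. PInr (PPair (pfst w) u)) (psnd w))"
      by (simp add: eqv_def)
  qed (use e u1(2) u2(2) t(2) in \<open>simp_all add: eqv_pcase inj_on_def\<close>)
  finally show "bcls n ?P ?Q (span_prod s (span_sum s1 s2)) = bcls n ?P ?Q (span_prod s s1) \<otimes>\<^bsub>bhom n ?P ?Q\<^esub> bcls n ?P ?Q (span_prod s s2)"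
    unfolding c1 c2 using e u1(2) u2(2) t(2) by (simp add: sp_sum)
qed

lemmas bcomp_bilift = ab_bilift[OF brels_carrier brels_carrier bhom_comm_group bcls_closed[OF span_comp_spans] bcomp_kills_left bcomp_kills_right]

lemma bcomp_hom_left: "b \<in> carrier (bhom n Y Z) \<Longrightarrow> (\<lambda>a. bcomp n X Y Z a b) \<in> hom (bhom n X Y) (bhom n X Z)"
  unfolding bcomp_def unfolding bhom_def[of n Y Z] bhom_def[of n X Y]
  by (rule bcomp_bilift(1))

lemma bcomp_hom_right: "a \<in> carrier (bhom n X Y) \<Longrightarrow> bcomp n X Y Z a \<in> hom (bhom n Y Z) (bhom n X Z)"
  unfolding bcomp_def unfolding bhom_def[of n Y Z] bhom_def[of n X Y]
  by (rule bcomp_bilift(2))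

lemma bcomp_bcls: "s \<in> spans n X Y \<Longrightarrow> t \<in> spans n Y Z \<Longrightarrow>
   bcomp n X Y Z (bcls n X Y s) (bcls n Y Z t) = bcls n X Z (span_comp s t)"
  unfolding bcomp_def bcls_def[of n X Y] bcls_def[of n Y Z]
  by (rule bcomp_bilift(3))

lemmas bprod_bilift = ab_bilift[OF brels_carrier brels_carrier bhom_comm_group bcls_closed[OF span_prod_spans] bprod_kills_left bprod_kills_right]

lemma bprod_hom_left: "b \<in> carrier (bhom n Y Y') \<Longrightarrow> (\<lambda>a. bprod n X X' Y Y' a b) \<in> hom (bhom n X X') (bhom n (X \<times>\<^sub>G Y) (X' \<times>\<^sub>G Y'))"
  unfolding bprod_def unfolding bhom_def[of n Y Y'] bhom_def[of n X X']
  by (rule bprod_bilift(1))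

lemma bprod_hom_right: "a \<in> carrier (bhom n X X') \<Longrightarrow> bprod n X X' Y Y' a \<in> hom (bhom n Y Y') (bhom n (X \<times>\<^sub>G Y) (X' \<times>\<^sub>G Y'))"
  unfolding bprod_def unfolding bhom_def[of n Y Y'] bhom_def[of n X X']
  by (rule bprod_bilift(2))

lemma bprod_bcls: "s \<in> spans n X X' \<Longrightarrow> t \<in> spans n Y Y' \<Longrightarrow>
   bprod n X X' Y Y' (bcls n X X' s) (bcls n Y Y' t) = bcls n (X \<times>\<^sub>G Y) (X' \<times>\<^sub>G Y') (span_prod s t)"
  unfolding bprod_def bcls_def[of n X X'] bcls_def[of n Y Y']
  by (rule bprod_bilift(3))

lemma bcomp_closed [simp]:
  "a \<in> carrier (bhom n X Y) \<Longrightarrow> b \<in> carrier (bhom n Y Z) \<Longrightarrow> bcomp n X Y Z a b \<in> carrier (bhom n X Z)"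
  using bcomp_hom_right[of a X Y Z] by (auto simp: hom_def)

lemma bprod_closed [simp]:
  "a \<in> carrier (bhom n X X') \<Longrightarrow> b \<in> carrier (bhom n Y Y') \<Longrightarrow>
    bprod n X X' Y Y' a b \<in> carrier (bhom n (X \<times>\<^sub>G Y) (X' \<times>\<^sub>G Y'))"
  using bprod_hom_right[of a X X' Y Y'] by (auto simp: hom_def)

lemma bprod_sp:
  assumes "U \<in> gsets n" "V \<in> gsets n" "eqv n U X p" "eqv n U X' q" "eqv n V Y p'" "eqv n V Y' q'"
  shows "bprod n X X' Y Y' (sp n X X' U p q) (sp n Y Y' V p' q') =
    sp n (X \<times>\<^sub>G Y) (X' \<times>\<^sub>G Y') (U \<times>\<^sub>G V) (\<lambda>w. PPair (p (pfst w)) (p' (psnd w))) (\<lambda>w. PPair (q (pfst w)) (q' (psnd w)))"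
  unfolding sp_def using assms by (simp add: bprod_bcls spansI bcls_span_prod(1)[of U V X p X' q Y p' Y' q'])

text \<open>The composite is formed with a chosen pullback \<^const>\<open>gpull\<close>; any apex \<open>W\<close> with projections \<open>w1\<close>, \<open>w2\<close>
  that satisfies the universal property pointwise is isomorphic to it. So apexes can be chosen to
  suit a computation, and canonical isomorphisms between iterated products do not appear.\<close>

lemma bcomp_sp:
  assumes U: "U \<in> gsets n" "eqv n U X p" "eqv n U Y q" and V: "V \<in> gsets n" "eqv n V Y p'" "eqv n V Z q'"
    and W: "W \<in> gsets n" "eqv n W U w1" "eqv n W V w2"
    and comm: "\<forall>w\<in>fst W. q (w1 w) = p' (w2 w)"
    and ex: "\<forall>u\<in>fst U. \<forall>v\<in>fst V. q u = p' v \<longrightarrow> (\<exists>w\<in>fst W. w1 w = u \<and> w2 w = v)"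
    and uniq: "\<forall>w\<in>fst W. \<forall>w'\<in>fst W. w1 w = w1 w' \<longrightarrow> w2 w = w2 w' \<longrightarrow> w = w'"
  shows "bcomp n X Y Z (sp n X Y U p q) (sp n Y Z V p' q') = sp n X Z W (\<lambda>w. p (w1 w)) (\<lambda>w. q' (w2 w))"
proof -
  have "bcomp n X Y Z (sp n X Y U p q) (sp n Y Z V p' q') = sp n X Z (gpull U q V p') (\<lambda>w. p (pfst w)) (\<lambda>w. q' (psnd w))"
    unfolding sp_def using U V by (simp add: bcomp_bcls spansI bcls_span_comp(1)[of U V X p Y q p' Z q'])
  also have "\<dots> = sp n X Z W (\<lambda>w. p (w1 w)) (\<lambda>w. q' (w2 w))"
  proof (rule sp_eqI[symmetric, where h = "\<lambda>w. PPair (w1 w) (w2 w)"])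
    show "gpull U q V p' \<in> gsets n" using U V by simp
    show "eqv n W (gpull U q V p') (\<lambda>w. PPair (w1 w) (w2 w))" using W comm by (simp add: eqv_def)
    show "inj_on (\<lambda>w. PPair (w1 w) (w2 w)) (fst W)" using uniq by (simp add: inj_on_def)
    show "\<forall>v\<in>fst (gpull U q V p'). \<exists>u\<in>fst W. PPair (w1 u) (w2 u) = v" using ex by simp
  qed (use U V W bcls_span_comp(2,3)[OF U(1) V(1) U(2,3) V(2,3)] in simp_all)
  finally show ?thesis .
qed


section \<open>Composition laws of the Burnside category\<close>

lemma bid_sp: "bid n X = sp n X X X (\<lambda>x. x) (\<lambda>x. x)"
  by (simp add: bid_def bcov_def sp_def gid_def)

lemma bcov_sp: "bcov n X Y f = sp n X Y X (\<lambda>x. x) f"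
  by (simp add: bcov_def sp_def gid_def)

lemma bcon_sp: "bcon n X Y f = sp n Y X X f (\<lambda>x. x)"
  by (simp add: bcon_def sp_def gid_def)

lemma bid_closed [simp]: "X \<in> gsets n \<Longrightarrow> bid n X \<in> carrier (bhom n X X)"
  and bcov_closed [simp]: "X \<in> gsets n \<Longrightarrow> eqv n X Y f \<Longrightarrow> bcov n X Y f \<in> carrier (bhom n X Y)"
  and bcon_closed [simp]: "X \<in> gsets n \<Longrightarrow> eqv n X Y f \<Longrightarrow> bcon n X Y f \<in> carrier (bhom n Y X)"
  by (simp_all add: bid_sp bcov_sp bcon_sp)

lemma bcomp_mult_left: "a \<in> carrier (bhom n X Y) \<Longrightarrow> a' \<in> carrier (bhom n X Y) \<Longrightarrow> b \<in> carrier (bhom n Y Z) \<Longrightarrow>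
    bcomp n X Y Z (a \<otimes>\<^bsub>bhom n X Y\<^esub> a') b = bcomp n X Y Z a b \<otimes>\<^bsub>bhom n X Z\<^esub> bcomp n X Y Z a' b"
  using hom_mult[OF bcomp_hom_left] .

lemma bcomp_mult_right: "a \<in> carrier (bhom n X Y) \<Longrightarrow> b \<in> carrier (bhom n Y Z) \<Longrightarrow> b' \<in> carrier (bhom n Y Z) \<Longrightarrow>
    bcomp n X Y Z a (b \<otimes>\<^bsub>bhom n Y Z\<^esub> b') = bcomp n X Y Z a b \<otimes>\<^bsub>bhom n X Z\<^esub> bcomp n X Y Z a b'"
  using hom_mult[OF bcomp_hom_right] .

lemma bprod_mult_left: "a \<in> carrier (bhom n X X') \<Longrightarrow> a' \<in> carrier (bhom n X X') \<Longrightarrow> b \<in> carrier (bhom n Y Y') \<Longrightarrow>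
    bprod n X X' Y Y' (a \<otimes>\<^bsub>bhom n X X'\<^esub> a') b = bprod n X X' Y Y' a b \<otimes>\<^bsub>bhom n (X \<times>\<^sub>G Y) (X' \<times>\<^sub>G Y')\<^esub> bprod n X X' Y Y' a' b"
  using hom_mult[OF bprod_hom_left] .

lemma bprod_mult_right: "a \<in> carrier (bhom n X X') \<Longrightarrow> b \<in> carrier (bhom n Y Y') \<Longrightarrow> b' \<in> carrier (bhom n Y Y') \<Longrightarrow>
    bprod n X X' Y Y' a (b \<otimes>\<^bsub>bhom n Y Y'\<^esub> b') = bprod n X X' Y Y' a b \<otimes>\<^bsub>bhom n (X \<times>\<^sub>G Y) (X' \<times>\<^sub>G Y')\<^esub> bprod n X X' Y Y' a b'"
  using hom_mult[OF bprod_hom_right] .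

lemma bhom_mult_closed [simp]:
  "a \<in> carrier (bhom n X Y) \<Longrightarrow> b \<in> carrier (bhom n X Y) \<Longrightarrow> a \<otimes>\<^bsub>bhom n X Y\<^esub> b \<in> carrier (bhom n X Y)"
  using bhom_group[of X Y] by (simp add: group.is_monoid monoid.m_closed)

text \<open>Both sides are additive in each variable. On three spans both are represented by the same
  iterated pullback \<open>?A\<close>: the second composite is formed with \<open>?A\<close> as a pullback of the other
  bracketing.\<close>

lemma bcomp_assoc:
  assumes a: "a \<in> carrier (bhom n X Y)" and b: "b \<in> carrier (bhom n Y Z)" and c: "c \<in> carrier (bhom n Z W)"
  shows "bcomp n X Z W (bcomp n X Y Z a b) c = bcomp n X Y W a (bcomp n Y Z W b c)"
proof (rule bhom_hom_eq[OF bhom_group _ _ _ a, of _ X W])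
  show "(\<lambda>a. bcomp n X Z W (bcomp n X Y Z a b) c) \<in> hom (bhom n X Y) (bhom n X W)"
    "(\<lambda>a. bcomp n X Y W a (bcomp n Y Z W b c)) \<in> hom (bhom n X Y) (bhom n X W)"
    using b c by (simp_all add: hom_def bcomp_mult_left)
  fix U p q assume u: "U \<in> gsets n" "eqv n U X p" "eqv n U Y q"
  show "bcomp n X Z W (bcomp n X Y Z (sp n X Y U p q) b) c = bcomp n X Y W (sp n X Y U p q) (bcomp n Y Z W b c)"
  proof (rule bhom_hom_eq[OF bhom_group _ _ _ b, of _ X W])
    show "(\<lambda>b. bcomp n X Z W (bcomp n X Y Z (sp n X Y U p q) b) c) \<in> hom (bhom n Y Z) (bhom n X W)"
      "(\<lambda>b. bcomp n X Y W (sp n X Y U p q) (bcomp n Y Z W b c)) \<in> hom (bhom n Y Z) (bhom n X W)"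
      using c u by (simp_all add: hom_def bcomp_mult_left bcomp_mult_right)
    fix V p' q' assume v: "V \<in> gsets n" "eqv n V Y p'" "eqv n V Z q'"
    show "bcomp n X Z W (bcomp n X Y Z (sp n X Y U p q) (sp n Y Z V p' q')) c =
       bcomp n X Y W (sp n X Y U p q) (bcomp n Y Z W (sp n Y Z V p' q') c)"
    proof (rule bhom_hom_eq[OF bhom_group _ _ _ c, of _ X W])
      show "(\<lambda>c. bcomp n X Z W (bcomp n X Y Z (sp n X Y U p q) (sp n Y Z V p' q')) c) \<in> hom (bhom n Z W) (bhom n X W)"
        "(\<lambda>c. bcomp n X Y W (sp n X Y U p q) (bcomp n Y Z W (sp n Y Z V p' q') c)) \<in> hom (bhom n Z W) (bhom n X W)"
        using u v by (simp_all add: hom_def bcomp_mult_right)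
      fix T p'' q'' assume t: "T \<in> gsets n" "eqv n T Z p''" "eqv n T W q''"
      let ?UV = "gpull U q V p'" and ?VT = "gpull V q' T p''"
      let ?A = "gpull ?UV (\<lambda>w. q' (psnd w)) T p''"
      note uv = bcls_span_comp(2,3)[OF u(1) v(1) u(2,3) v(2,3)]
      note vt = bcls_span_comp(2,3)[OF v(1) t(1) v(2,3) t(2,3)]
      have g: "?UV \<in> gsets n" "?VT \<in> gsets n" using u v t by simp_all
      have gA: "?A \<in> gsets n" using g uv t by simp
      have 1: "bcomp n X Y Z (sp n X Y U p q) (sp n Y Z V p' q') = sp n X Z ?UV (\<lambda>w. p (pfst w)) (\<lambda>w. q' (psnd w))"
        using u v g by (intro bcomp_sp) (simp_all, simp_all add: eqv_def)
      have 2: "bcomp n Y Z W (sp n Y Z V p' q') (sp n Z W T p'' q'') = sp n Y W ?VT (\<lambda>w. p' (pfst w)) (\<lambda>w. q'' (psnd w))"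
        using v t g by (intro bcomp_sp) (simp_all, simp_all add: eqv_def)
      have "bcomp n X Z W (sp n X Z ?UV (\<lambda>w. p (pfst w)) (\<lambda>w. q' (psnd w))) (sp n Z W T p'' q'') =
        sp n X W ?A (\<lambda>w. p (pfst (pfst w))) (\<lambda>w. q'' (psnd w))"
        using g gA uv t u v by (intro bcomp_sp) (simp_all, simp_all add: eqv_def)
      moreover have "bcomp n X Y W (sp n X Y U p q) (sp n Y W ?VT (\<lambda>w. p' (pfst w)) (\<lambda>w. q'' (psnd w))) =
        sp n X W ?A (\<lambda>w. p (pfst (pfst w))) (\<lambda>w. q'' (psnd (PPair (psnd (pfst w)) (psnd w))))"
        using g gA vt t u v by (intro bcomp_sp) (simp_all, simp_all add: eqv_def)
      ultimately show "bcomp n X Z W (bcomp n X Y Z (sp n X Y U p q) (sp n Y Z V p' q')) (sp n Z W T p'' q'') =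
        bcomp n X Y W (sp n X Y U p q) (bcomp n Y Z W (sp n Y Z V p' q') (sp n Z W T p'' q''))"
        unfolding 1 2 by simp
    qed
  qed
qed

lemma hom_id: "(\<lambda>x. x) \<in> hom G G"
  by (simp add: hom_def)

lemma bcomp_id_left: 
  assumes X: "X \<in> gsets n" and a: "a \<in> carrier (bhom n X Y)"
  shows "bcomp n X X Y (bid n X) a = a"
proof (rule bhom_hom_eq[OF bhom_group _ hom_id _ a])
  show "bcomp n X X Y (bid n X) \<in> hom (bhom n X Y) (bhom n X Y)" using X by (intro bcomp_hom_right) simp
  fix U p q assume u: "U \<in> gsets n" "eqv n U X p" "eqv n U Y q"
  have "bcomp n X X Y (bid n X) (sp n X Y U p q) = sp n X Y U (\<lambda>w. p w) (\<lambda>w. q w)"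
    unfolding bid_sp using u X by (intro bcomp_sp) (simp_all add: eqvD)
  then show "bcomp n X X Y (bid n X) (sp n X Y U p q) = sp n X Y U p q" by simp
qed

lemma bcomp_id_right: 
  assumes Y: "Y \<in> gsets n" and a: "a \<in> carrier (bhom n X Y)"
  shows "bcomp n X Y Y a (bid n Y) = a"
proof (rule bhom_hom_eq[OF bhom_group _ hom_id _ a])
  show "(\<lambda>a. bcomp n X Y Y a (bid n Y)) \<in> hom (bhom n X Y) (bhom n X Y)" using Y by (intro bcomp_hom_left) simp
  fix U p q assume u: "U \<in> gsets n" "eqv n U X p" "eqv n U Y q"
  have "bcomp n X Y Y (sp n X Y U p q) (bid n Y) = sp n X Y U (\<lambda>w. p w) (\<lambda>w. q w)"
    unfolding bid_sp using u Y by (intro bcomp_sp) (simp_all add: eqvD)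
  then show "bcomp n X Y Y (sp n X Y U p q) (bid n Y) = sp n X Y U p q" by simp
qed

lemma bprod_bid: "X \<in> gsets n \<Longrightarrow> Y \<in> gsets n \<Longrightarrow> bprod n X X Y Y (bid n X) (bid n Y) = bid n (X \<times>\<^sub>G Y)"
  unfolding bid_sp by (subst bprod_sp) (auto intro!: sp_cong simp: gprod_def)

text \<open>The product of two pullbacks is a pullback of the products.\<close>

lemma bprod_bcomp:
  assumes a: "a \<in> carrier (bhom n X Y)" and b: "b \<in> carrier (bhom n Y Z)"
    and a': "a' \<in> carrier (bhom n X' Y')" and b': "b' \<in> carrier (bhom n Y' Z')"
  shows "bprod n X Z X' Z' (bcomp n X Y Z a b) (bcomp n X' Y' Z' a' b') =
    bcomp n (X \<times>\<^sub>G X') (Y \<times>\<^sub>G Y') (Z \<times>\<^sub>G Z') (bprod n X Y X' Y' a a') (bprod n Y Z Y' Z' b b')"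
    (is "?L a b a' b' = ?R a b a' b'")
proof (rule bhom_hom_eq[OF bhom_group _ _ _ a, of _ "X \<times>\<^sub>G X'" "Z \<times>\<^sub>G Z'"])
  let ?H = "bhom n (X \<times>\<^sub>G X') (Z \<times>\<^sub>G Z')"
  note add = hom_def bcomp_mult_left bcomp_mult_right bprod_mult_left bprod_mult_right
  show "(\<lambda>a. ?L a b a' b') \<in> hom (bhom n X Y) ?H" "(\<lambda>a. ?R a b a' b') \<in> hom (bhom n X Y) ?H"
    using b a' b' by (simp_all add: add)
  fix U p q assume u: "U \<in> gsets n" "eqv n U X p" "eqv n U Y q"
  let ?a = "sp n X Y U p q"
  show "?L ?a b a' b' = ?R ?a b a' b'"
  proof (rule bhom_hom_eq[OF bhom_group _ _ _ b, of _ "X \<times>\<^sub>G X'" "Z \<times>\<^sub>G Z'"])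
    show "(\<lambda>b. ?L ?a b a' b') \<in> hom (bhom n Y Z) ?H" "(\<lambda>b. ?R ?a b a' b') \<in> hom (bhom n Y Z) ?H"
      using u a' b' by (simp_all add: add)
    fix V r s assume v: "V \<in> gsets n" "eqv n V Y r" "eqv n V Z s"
    let ?b = "sp n Y Z V r s"
    show "?L ?a ?b a' b' = ?R ?a ?b a' b'"
    proof (rule bhom_hom_eq[OF bhom_group _ _ _ a', of _ "X \<times>\<^sub>G X'" "Z \<times>\<^sub>G Z'"])
      show "(\<lambda>a'. ?L ?a ?b a' b') \<in> hom (bhom n X' Y') ?H" "(\<lambda>a'. ?R ?a ?b a' b') \<in> hom (bhom n X' Y') ?H"
        using u v b' by (simp_all add: add)
      fix U' p' q' assume u': "U' \<in> gsets n" "eqv n U' X' p'" "eqv n U' Y' q'"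
      let ?a' = "sp n X' Y' U' p' q'"
      show "?L ?a ?b ?a' b' = ?R ?a ?b ?a' b'"
      proof (rule bhom_hom_eq[OF bhom_group _ _ _ b', of _ "X \<times>\<^sub>G X'" "Z \<times>\<^sub>G Z'"])
        show "(\<lambda>b'. ?L ?a ?b ?a' b') \<in> hom (bhom n Y' Z') ?H" "(\<lambda>b'. ?R ?a ?b ?a' b') \<in> hom (bhom n Y' Z') ?H"
          using u v u' by (simp_all add: add)
        fix V' r' s' assume v': "V' \<in> gsets n" "eqv n V' Y' r'" "eqv n V' Z' s'"
        let ?b' = "sp n Y' Z' V' r' s'"
        let ?P = "gpull U q V r" and ?P' = "gpull U' q' V' r'"
        have g: "?P \<in> gsets n" "?P' \<in> gsets n" using u v u' v' by simp_all
        note e = bcls_span_comp(2,3)[OF u(1) v(1) u(2,3) v(2,3)] bcls_span_comp(2,3)[OF u'(1) v'(1) u'(2,3) v'(2,3)]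
        have 1: "bcomp n X Y Z ?a ?b = sp n X Z ?P (\<lambda>w. p (pfst w)) (\<lambda>w. s (psnd w))"
          using u v g by (intro bcomp_sp) (simp_all, simp_all add: eqv_def)
        have 2: "bcomp n X' Y' Z' ?a' ?b' = sp n X' Z' ?P' (\<lambda>w. p' (pfst w)) (\<lambda>w. s' (psnd w))"
          using u' v' g by (intro bcomp_sp) (simp_all, simp_all add: eqv_def)
        have 3: "bprod n X Y X' Y' ?a ?a' = sp n (X \<times>\<^sub>G X') (Y \<times>\<^sub>G Y') (U \<times>\<^sub>G U')
            (\<lambda>w. PPair (p (pfst w)) (p' (psnd w))) (\<lambda>w. PPair (q (pfst w)) (q' (psnd w)))"
          using u u' by (simp add: bprod_sp)
        have 4: "bprod n Y Z Y' Z' ?b ?b' = sp n (Y \<times>\<^sub>G Y') (Z \<times>\<^sub>G Z') (V \<times>\<^sub>G V')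
            (\<lambda>w. PPair (r (pfst w)) (r' (psnd w))) (\<lambda>w. PPair (s (pfst w)) (s' (psnd w)))"
          using v v' by (simp add: bprod_sp)
        have "?L ?a ?b ?a' ?b' = sp n (X \<times>\<^sub>G X') (Z \<times>\<^sub>G Z') (?P \<times>\<^sub>G ?P')
            (\<lambda>w. PPair (p (pfst (pfst w))) (p' (pfst (psnd w)))) (\<lambda>w. PPair (s (psnd (pfst w))) (s' (psnd (psnd w))))"
          unfolding 1 2 using g e by (simp add: bprod_sp)
        also have "\<dots> = sp n (X \<times>\<^sub>G X') (Z \<times>\<^sub>G Z') (?P \<times>\<^sub>G ?P')
            (\<lambda>w. (\<lambda>w. PPair (p (pfst w)) (p' (psnd w))) (PPair (pfst (pfst w)) (pfst (psnd w))))
            (\<lambda>w. (\<lambda>w. PPair (s (pfst w)) (s' (psnd w))) (PPair (psnd (pfst w)) (psnd (psnd w))))"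
          by simp
        also have "\<dots> = ?R ?a ?b ?a' ?b'"
          unfolding 3 4
        proof (rule bcomp_sp[symmetric])
          show "eqv n (U \<times>\<^sub>G U') (X \<times>\<^sub>G X') (\<lambda>w. PPair (p (pfst w)) (p' (psnd w)))"
            "eqv n (U \<times>\<^sub>G U') (Y \<times>\<^sub>G Y') (\<lambda>w. PPair (q (pfst w)) (q' (psnd w)))"
            "eqv n (V \<times>\<^sub>G V') (Y \<times>\<^sub>G Y') (\<lambda>w. PPair (r (pfst w)) (r' (psnd w)))"
            "eqv n (V \<times>\<^sub>G V') (Z \<times>\<^sub>G Z') (\<lambda>w. PPair (s (pfst w)) (s' (psnd w)))"
            using u v u' v' by (simp_all add: eqv_def)
          show "eqv n (?P \<times>\<^sub>G ?P') (U \<times>\<^sub>G U') (\<lambda>w. PPair (pfst (pfst w)) (pfst (psnd w)))"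
            "eqv n (?P \<times>\<^sub>G ?P') (V \<times>\<^sub>G V') (\<lambda>w. PPair (psnd (pfst w)) (psnd (psnd w)))"
            by (simp_all add: eqv_def)
        qed (use g u v u' v' in simp_all)
        finally show "?L ?a ?b ?a' ?b' = ?R ?a ?b ?a' ?b'" .
      qed
    qed
  qed
qed

lemma bprod_split:
  assumes "a \<in> carrier (bhom n X X')" "b \<in> carrier (bhom n Y Y')" "X \<in> gsets n" "X' \<in> gsets n" "Y \<in> gsets n" "Y' \<in> gsets n"
  shows "bprod n X X' Y Y' a b = bcomp n (X \<times>\<^sub>G Y) (X' \<times>\<^sub>G Y) (X' \<times>\<^sub>G Y') (bprod n X X' Y Y a (bid n Y)) (bprod n X' X' Y Y' (bid n X') b)"
    "bprod n X X' Y Y' a b = bcomp n (X \<times>\<^sub>G Y) (X \<times>\<^sub>G Y') (X' \<times>\<^sub>G Y') (bprod n X X Y Y' (bid n X) b) (bprod n X X' Y' Y' a (bid n Y'))"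
  using assms by (simp_all add: bprod_bcomp[symmetric] bcomp_id_left bcomp_id_right)

lemma bprod_bcov:
  assumes "X \<in> gsets n" "Y \<in> gsets n" "eqv n X X' f" "eqv n Y Y' g"
  shows "bprod n X X' Y Y' (bcov n X X' f) (bcov n Y Y' g) =
     bcov n (X \<times>\<^sub>G Y) (X' \<times>\<^sub>G Y') (\<lambda>w. PPair (f (pfst w)) (g (psnd w)))"
  unfolding bcov_sp using assms by (subst bprod_sp) (auto intro!: sp_cong simp: gprod_def)

lemma bprod_bcon:
  assumes "X \<in> gsets n" "Y \<in> gsets n" "eqv n X X' f" "eqv n Y Y' g"
  shows "bprod n X' X Y' Y (bcon n X X' f) (bcon n Y Y' g) =
     bcon n (X \<times>\<^sub>G Y) (X' \<times>\<^sub>G Y') (\<lambda>w. PPair (f (pfst w)) (g (psnd w)))"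
  unfolding bcon_sp using assms by (subst bprod_sp) (auto intro!: sp_cong simp: gprod_def)

lemma bid_bcov: "bid n X = bcov n X X (\<lambda>x. x)" and bid_bcon: "bid n X = bcon n X X (\<lambda>x. x)"
  by (simp_all add: bid_sp bcov_sp bcon_sp)

lemma bcomp_bcov:
  assumes "X \<in> gsets n" "Y \<in> gsets n" "eqv n X Y f" "eqv n Y Z g"
  shows "bcomp n X Y Z (bcov n X Y f) (bcov n Y Z g) = bcov n X Z (\<lambda>x. g (f x))"
  unfolding bcov_sp using assms by (intro bcomp_sp[where ?w1.0 = "\<lambda>x. x"]) (simp_all add: eqvD)

lemma bcomp_bcon:
  assumes "X \<in> gsets n" "Y \<in> gsets n" "eqv n X Y f" "eqv n Y Z g"
  shows "bcomp n Z Y X (bcon n Y Z g) (bcon n X Y f) = bcon n X Z (\<lambda>x. g (f x))"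
  unfolding bcon_sp using assms by (intro bcomp_sp[where ?w2.0 = "\<lambda>x. x"]) (simp_all add: eqvD)

lemma bcomp_bcon_bcov:
  assumes "U \<in> gsets n" "eqv n U X p" "eqv n U Y q"
  shows "bcomp n X U Y (bcon n U X p) (bcov n U Y q) = sp n X Y U p q"
  unfolding bcon_sp bcov_sp using assms
  by (intro bcomp_sp[where ?w2.0 = "\<lambda>x. x" and ?w1.0 = "\<lambda>x. x"]) simp_all

lemma bcomp_bcov_bcon:
  assumes "U \<in> gsets n" "eqv n U Y q" "V \<in> gsets n" "eqv n V Y p" "W \<in> gsets n" "eqv n W U w1" "eqv n W V w2"
    "\<forall>w\<in>fst W. q (w1 w) = p (w2 w)"
    "\<forall>u\<in>fst U. \<forall>v\<in>fst V. q u = p v \<longrightarrow> (\<exists>w\<in>fst W. w1 w = u \<and> w2 w = v)"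
    "\<forall>w\<in>fst W. \<forall>w'\<in>fst W. w1 w = w1 w' \<longrightarrow> w2 w = w2 w' \<longrightarrow> w = w'"
  shows "bcomp n U Y V (bcov n U Y q) (bcon n V Y p) = sp n U V W w1 w2"
  unfolding bcon_sp bcov_sp using assms by (intro bcomp_sp) simp_all

section \<open>Mackey functors: transfers, restrictions and base change\<close>

lemma mackeyD:
  assumes "mackey_functor n M" "X \<in> gsets n"
  shows mackey_group: "comm_group (val M X)"
    and mor_hom: "Y \<in> gsets n \<Longrightarrow> b \<in> carrier (bhom n X Y) \<Longrightarrow> mor M X Y b \<in> hom (val M X) (val M Y)"
    and mor_id: "x \<in> carrier (val M X) \<Longrightarrow> mor M X X (bid n X) x = x"
    and mor_comp: "Y \<in> gsets n \<Longrightarrow> Z \<in> gsets n \<Longrightarrow> a \<in> carrier (bhom n X Y) \<Longrightarrow> b \<in> carrier (bhom n Y Z) \<Longrightarrow>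
      x \<in> carrier (val M X) \<Longrightarrow> mor M Y Z b (mor M X Y a x) = mor M X Z (bcomp n X Y Z a b) x"
    and mor_add: "Y \<in> gsets n \<Longrightarrow> a \<in> carrier (bhom n X Y) \<Longrightarrow> b \<in> carrier (bhom n X Y) \<Longrightarrow>
      x \<in> carrier (val M X) \<Longrightarrow> mor M X Y (a \<otimes>\<^bsub>bhom n X Y\<^esub> b) x = mor M X Y a x \<otimes>\<^bsub>val M Y\<^esub> mor M X Y b x"
  using assms unfolding mackey_functor_def by auto

lemma mackey_is_group: "mackey_functor n M \<Longrightarrow> X \<in> gsets n \<Longrightarrow> group (val M X)"
  by (rule comm_group.axioms(2)[OF mackey_group])

lemma mor_closed [simp]:
  "mackey_functor n M \<Longrightarrow> X \<in> gsets n \<Longrightarrow> Y \<in> gsets n \<Longrightarrow> b \<in> carrier (bhom n X Y) \<Longrightarrow> x \<in> carrier (val M X) \<Longrightarrow>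
    mor M X Y b x \<in> carrier (val M Y)"
  using mor_hom[of M X Y b] by (auto simp: hom_def)

lemma mor_mult:
  "mackey_functor n M \<Longrightarrow> X \<in> gsets n \<Longrightarrow> Y \<in> gsets n \<Longrightarrow> b \<in> carrier (bhom n X Y) \<Longrightarrow> x \<in> carrier (val M X) \<Longrightarrow>
    y \<in> carrier (val M X) \<Longrightarrow> mor M X Y b (x \<otimes>\<^bsub>val M X\<^esub> y) = mor M X Y b x \<otimes>\<^bsub>val M Y\<^esub> mor M X Y b y"
  using mor_hom[of M X Y b] by (auto simp: hom_def)

lemma val_mult_closed [simp]:
  "mackey_functor n M \<Longrightarrow> X \<in> gsets n \<Longrightarrow> x \<in> carrier (val M X) \<Longrightarrow> y \<in> carrier (val M X) \<Longrightarrow>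
    x \<otimes>\<^bsub>val M X\<^esub> y \<in> carrier (val M X)"
  using mackey_is_group[of M X] by (simp add: group.is_monoid monoid.m_closed)

lemma mor_add_hom:
  "mackey_functor n M \<Longrightarrow> X \<in> gsets n \<Longrightarrow> Y \<in> gsets n \<Longrightarrow> x \<in> carrier (val M X) \<Longrightarrow>
    (\<lambda>b. mor M X Y b x) \<in> hom (bhom n X Y) (val M Y)"
  by (auto simp: hom_def mor_add)

lemma tra_closed [simp]:
  "mackey_functor n M \<Longrightarrow> X \<in> gsets n \<Longrightarrow> Y \<in> gsets n \<Longrightarrow> eqv n X Y f \<Longrightarrow> x \<in> carrier (val M X) \<Longrightarrow>
    tra n M X Y f x \<in> carrier (val M Y)"
  by (simp add: tra_def)

lemma res_closed [simp]:
  "mackey_functor n M \<Longrightarrow> X \<in> gsets n \<Longrightarrow> Y \<in> gsets n \<Longrightarrow> eqv n X Y f \<Longrightarrow> y \<in> carrier (val M Y) \<Longrightarrow>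
    res n M X Y f y \<in> carrier (val M X)"
  by (simp add: res_def)

lemma tra_mult:
  "mackey_functor n M \<Longrightarrow> X \<in> gsets n \<Longrightarrow> Y \<in> gsets n \<Longrightarrow> eqv n X Y f \<Longrightarrow> x \<in> carrier (val M X) \<Longrightarrow>
    y \<in> carrier (val M X) \<Longrightarrow> tra n M X Y f (x \<otimes>\<^bsub>val M X\<^esub> y) = tra n M X Y f x \<otimes>\<^bsub>val M Y\<^esub> tra n M X Y f y"
  by (simp add: tra_def mor_mult)

lemma res_mult:
  "mackey_functor n M \<Longrightarrow> X \<in> gsets n \<Longrightarrow> Y \<in> gsets n \<Longrightarrow> eqv n X Y f \<Longrightarrow> x \<in> carrier (val M Y) \<Longrightarrow>
    y \<in> carrier (val M Y) \<Longrightarrow> res n M X Y f (x \<otimes>\<^bsub>val M Y\<^esub> y) = res n M X Y f x \<otimes>\<^bsub>val M X\<^esub> res n M X Y f y"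
  by (simp add: res_def mor_mult)

lemma tra_cong: "(\<And>x. x \<in> fst X \<Longrightarrow> f x = g x) \<Longrightarrow> tra n M X Y f = tra n M X Y g"
  unfolding tra_def bcov_sp by (rule arg_cong[where f = "mor M X Y"]) (rule sp_cong, simp_all)

lemma res_cong: "(\<And>x. x \<in> fst X \<Longrightarrow> f x = g x) \<Longrightarrow> res n M X Y f = res n M X Y g"
  unfolding res_def bcon_sp by (rule arg_cong[where f = "mor M Y X"]) (rule sp_cong, simp_all)

lemma tra_tra:
  "mackey_functor n M \<Longrightarrow> X \<in> gsets n \<Longrightarrow> Y \<in> gsets n \<Longrightarrow> Z \<in> gsets n \<Longrightarrow> eqv n X Y f \<Longrightarrow> eqv n Y Z g \<Longrightarrow>
    x \<in> carrier (val M X) \<Longrightarrow> tra n M Y Z g (tra n M X Y f x) = tra n M X Z (\<lambda>x. g (f x)) x"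
  by (simp add: tra_def mor_comp bcomp_bcov)

lemma res_res:
  "mackey_functor n M \<Longrightarrow> X \<in> gsets n \<Longrightarrow> Y \<in> gsets n \<Longrightarrow> Z \<in> gsets n \<Longrightarrow> eqv n X Y f \<Longrightarrow> eqv n Y Z g \<Longrightarrow>
    z \<in> carrier (val M Z) \<Longrightarrow> res n M X Y f (res n M Y Z g z) = res n M X Z (\<lambda>x. g (f x)) z"
  by (simp add: res_def mor_comp bcomp_bcon)

lemma tra_ident:
  "mackey_functor n M \<Longrightarrow> X \<in> gsets n \<Longrightarrow> x \<in> carrier (val M X) \<Longrightarrow> (\<And>x. x \<in> fst X \<Longrightarrow> f x = x) \<Longrightarrow> tra n M X X f x = x"
  using tra_cong[of X f "\<lambda>x. x" M X] mor_id[of M X x] by (simp add: tra_def bid_bcov)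

lemma res_ident:
  "mackey_functor n M \<Longrightarrow> X \<in> gsets n \<Longrightarrow> x \<in> carrier (val M X) \<Longrightarrow> (\<And>x. x \<in> fst X \<Longrightarrow> f x = x) \<Longrightarrow> res n M X X f x = x"
  using res_cong[of X f "\<lambda>x. x" M X] mor_id[of M X x] by (simp add: res_def bid_bcon)

lemma mor_sp:
  "mackey_functor n M \<Longrightarrow> X \<in> gsets n \<Longrightarrow> Y \<in> gsets n \<Longrightarrow> U \<in> gsets n \<Longrightarrow> eqv n U X p \<Longrightarrow> eqv n U Y q \<Longrightarrow>
    x \<in> carrier (val M X) \<Longrightarrow> mor M X Y (sp n X Y U p q) x = tra n M U Y q (res n M U X p x)"
  by (simp add: tra_def res_def mor_comp bcomp_bcon_bcov)

text \<open>The double coset formula in its general form, for any pullback square with apex \<open>W\<close> and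
  projections \<open>w1\<close>, \<open>w2\<close>. It is composition of spans read in \<open>M\<close>, and the main computational tool
  below.\<close>

lemma base_change:
  assumes "mackey_functor n M" "U \<in> gsets n" "V \<in> gsets n" "Y \<in> gsets n" "W \<in> gsets n"
    and "eqv n U Y q" "eqv n V Y p" "eqv n W U w1" "eqv n W V w2"
    and "\<forall>w\<in>fst W. q (w1 w) = p (w2 w)"
    and "\<forall>u\<in>fst U. \<forall>v\<in>fst V. q u = p v \<longrightarrow> (\<exists>w\<in>fst W. w1 w = u \<and> w2 w = v)"
    and "\<forall>w\<in>fst W. \<forall>w'\<in>fst W. w1 w = w1 w' \<longrightarrow> w2 w = w2 w' \<longrightarrow> w = w'"
    and "x \<in> carrier (val M U)"
  shows "res n M V Y p (tra n M U Y q x) = tra n M W V w2 (res n M W U w1 x)"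
  using assms by (simp add: mor_sp[symmetric]) (simp add: tra_def res_def mor_comp bcomp_bcov_bcon[of U Y q V p W w1 w2])

text \<open>Base change for the pullback square formed by a bijection and an identity.\<close>

lemma tra_iso:
  assumes "mackey_functor n M" "X \<in> gsets n" "Y \<in> gsets n" "eqv n X Y f" "eqv n Y X g"
    "\<forall>x\<in>fst X. g (f x) = x" "\<forall>y\<in>fst Y. f (g y) = y" "x \<in> carrier (val M X)"
  shows "tra n M X Y f x = res n M Y X g x"
proof -
  have "tra n M X Y f x = res n M Y Y (\<lambda>y. y) (tra n M X Y f x)"
    using assms by (simp add: res_ident)
  also have "\<dots> = tra n M Y Y (\<lambda>y. y) (res n M Y X g x)"
    using assms by (intro base_change) (auto simp: eqvD)
  finally show ?thesis using assms by (simp add: tra_ident)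
qed

section \<open>Natural homomorphisms and shifted Mackey functors\<close>

text \<open>A morphism of Mackey functors without the normalisation that \<^const>\<open>mackey_hom\<close> imposes outside of the
  values, so that formulas are natural as they stand and compose as functions.\<close>

definition nathom :: "('m, 'x) mackey_scheme \<Rightarrow> ('k, 'y) mackey_scheme \<Rightarrow> (gset \<Rightarrow> 'm \<Rightarrow> 'k) \<Rightarrow> bool" where
  "nathom M N f \<longleftrightarrow> (\<forall>X\<in>gsets n. f X \<in> hom (val M X) (val N X)) \<and>
     (\<forall>X\<in>gsets n. \<forall>Y\<in>gsets n. \<forall>b\<in>carrier (bhom n X Y). \<forall>x\<in>carrier (val M X).
        f Y (mor M X Y b x) = mor N X Y b (f X x))"

lemma nathomD:
  assumes "nathom M N f" "X \<in> gsets n"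
  shows nathom_hom: "f X \<in> hom (val M X) (val N X)"
    and nathom_closed: "x \<in> carrier (val M X) \<Longrightarrow> f X x \<in> carrier (val N X)"
    and nathom_mult: "x \<in> carrier (val M X) \<Longrightarrow> y \<in> carrier (val M X) \<Longrightarrow>
      f X (x \<otimes>\<^bsub>val M X\<^esub> y) = f X x \<otimes>\<^bsub>val N X\<^esub> f X y"
    and nathom_mor: "Y \<in> gsets n \<Longrightarrow> b \<in> carrier (bhom n X Y) \<Longrightarrow> x \<in> carrier (val M X) \<Longrightarrow>
      f Y (mor M X Y b x) = mor N X Y b (f X x)"
  using assms by (auto simp: nathom_def hom_def)

lemma nathom_tra: "nathom M N f \<Longrightarrow> X \<in> gsets n \<Longrightarrow> Y \<in> gsets n \<Longrightarrow> eqv n X Y h \<Longrightarrow> x \<in> carrier (val M X) \<Longrightarrow>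
    f Y (tra n M X Y h x) = tra n N X Y h (f X x)"
  by (simp add: tra_def nathom_mor)

lemma nathom_res: "nathom M N f \<Longrightarrow> X \<in> gsets n \<Longrightarrow> Y \<in> gsets n \<Longrightarrow> eqv n X Y h \<Longrightarrow> y \<in> carrier (val M Y) \<Longrightarrow>
    f X (res n M X Y h y) = res n N X Y h (f Y y)"
  by (simp add: res_def nathom_mor)

text \<open>Every morphism of the Burnside category is a combination of restrictions followed by transfers, so
  naturality need only be checked on these.\<close>

lemma nathomI:
  assumes M: "mackey_functor n M" and N: "mackey_functor n N"
    and hom: "\<And>X. X \<in> gsets n \<Longrightarrow> f X \<in> hom (val M X) (val N X)"
    and tra: "\<And>X Y h x. X \<in> gsets n \<Longrightarrow> Y \<in> gsets n \<Longrightarrow> eqv n X Y h \<Longrightarrow> x \<in> carrier (val M X) \<Longrightarrow>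
      f Y (tra n M X Y h x) = tra n N X Y h (f X x)"
    and res: "\<And>X Y h y. X \<in> gsets n \<Longrightarrow> Y \<in> gsets n \<Longrightarrow> eqv n X Y h \<Longrightarrow> y \<in> carrier (val M Y) \<Longrightarrow>
      f X (res n M X Y h y) = res n N X Y h (f Y y)"
  shows "nathom M N f"
  unfolding nathom_def
proof (intro conjI ballI)
  fix X assume "X \<in> gsets n" then show "f X \<in> hom (val M X) (val N X)" by (rule hom)
next
  fix X Y b x
  assume X: "X \<in> gsets n" and Y: "Y \<in> gsets n" and b: "b \<in> carrier (bhom n X Y)" and x: "x \<in> carrier (val M X)"
  have c: "f Z y \<in> carrier (val N Z)" if "Z \<in> gsets n" "y \<in> carrier (val M Z)" for Z y
    by (rule hom_in_carrier[OF hom[OF that(1)] that(2)])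
  show "f Y (mor M X Y b x) = mor N X Y b (f X x)"
  proof (rule bhom_hom_eq[OF mackey_is_group[OF N Y] _ mor_add_hom _ b])
    show "(\<lambda>b. f Y (mor M X Y b x)) \<in> hom (bhom n X Y) (val N Y)"
      using hom[OF Y] mor_add_hom[OF M X Y x] by (auto simp: hom_def)
    fix U p q assume "U \<in> gsets n" "eqv n U X p" "eqv n U Y q"
    then show "f Y (mor M X Y (sp n X Y U p q) x) = mor N X Y (sp n X Y U p q) (f X x)"
      using X Y x M N c by (simp add: mor_sp tra res)
  qed (use M N X Y x c in simp_all)
qed

lemma nathom_comp:
  assumes f: "nathom M N f" and g: "nathom N K g" shows "nathom M K (\<lambda>X x. g X (f X x))"
  unfolding nathom_def
proof (intro conjI ballI)
  fix X assume X: "X \<in> gsets n"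
  then show "(\<lambda>x. g X (f X x)) \<in> hom (val M X) (val K X)"
    using nathomD[OF f X] nathomD[OF g X] by (intro homI) simp_all
qed (simp add: nathomD[OF f] nathomD[OF g])

lemma nathom_id: "nathom M M (\<lambda>X x. x)"
  by (simp add: nathom_def hom_def)

lemma nathom_cong: 
  assumes "nathom M N f" "\<And>X x. X \<in> gsets n \<Longrightarrow> x \<in> carrier (val M X) \<Longrightarrow> g X x = f X x" "mackey_functor n M"
  shows "nathom M N g"
  unfolding nathom_def
proof (intro conjI ballI)
  fix X assume X: "X \<in> gsets n"
  then show "g X \<in> hom (val M X) (val N X)"
    using nathomD[OF assms(1) X] assms(2)[OF X] assms(3) by (intro homI) simp_all
qed (simp add: nathomD[OF assms(1)] assms(2,3))

lemma mackey_hom_nathom: "f \<in> mackey_hom n M N \<Longrightarrow> nathom M N f"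
  by (simp add: mackey_hom_def nathom_def)

lemma mk_nat_apply [simp]: "X \<in> gsets n \<Longrightarrow> x \<in> carrier (val M X) \<Longrightarrow> mk_nat n M f X x = f X x"
  by (simp add: mk_nat_def)

lemma mk_nat_eqI:
  assumes "\<And>X x. X \<in> gsets n \<Longrightarrow> x \<in> carrier (val M X) \<Longrightarrow> f X x = g X x"
  shows "mk_nat n M f = mk_nat n M g"
  using assms unfolding mk_nat_def by (intro restrict_ext)

lemma mackey_homI:
  assumes "nathom M N f" "mackey_functor n M" shows "mk_nat n M f \<in> mackey_hom n M N"
proof -
  have "nathom M N (mk_nat n M f)" using assms by (intro nathom_cong[OF assms(1)]) simp_all
  moreover have "mk_nat n M (mk_nat n M f) = mk_nat n M f" by (rule mk_nat_eqI) simp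
  ultimately show ?thesis by (simp add: mackey_hom_def nathom_def)
qed

lemma mackey_hom_mk_nat: "f \<in> mackey_hom n M N \<Longrightarrow> mk_nat n M f = f"
  by (simp add: mackey_hom_def)

text \<open>The Mackey functors \<open>Q(X \<times> -)\<close> and \<open>Q(- \<times> X)\<close>. A pairing is natural in one variable when it is a
  homomorphism into one of these.\<close>

definition lshift :: "('m, 'x) mackey_scheme \<Rightarrow> gset \<Rightarrow> 'm mackey" where
  "lshift Q X = \<lparr>val = \<lambda>Y. val Q (X \<times>\<^sub>G Y),
     mor = \<lambda>Y Y' b. mor Q (X \<times>\<^sub>G Y) (X \<times>\<^sub>G Y') (bprod n X X Y Y' (bid n X) b)\<rparr>"

definition rshift :: "('m, 'x) mackey_scheme \<Rightarrow> gset \<Rightarrow> 'm mackey" where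
  "rshift Q X = \<lparr>val = \<lambda>Y. val Q (Y \<times>\<^sub>G X),
     mor = \<lambda>Y Y' b. mor Q (Y \<times>\<^sub>G X) (Y' \<times>\<^sub>G X) (bprod n Y Y' X X b (bid n X))\<rparr>"

lemma val_lshift [simp]: "val (lshift Q X) Y = val Q (X \<times>\<^sub>G Y)"
  and val_rshift [simp]: "val (rshift Q X) Y = val Q (Y \<times>\<^sub>G X)"
  and mor_lshift: "mor (lshift Q X) Y Y' b = mor Q (X \<times>\<^sub>G Y) (X \<times>\<^sub>G Y') (bprod n X X Y Y' (bid n X) b)"
  and mor_rshift: "mor (rshift Q X) Y Y' b = mor Q (Y \<times>\<^sub>G X) (Y' \<times>\<^sub>G X) (bprod n Y Y' X X b (bid n X))"
  by (simp_all add: lshift_def rshift_def)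

lemma bprod_bcomp_id:
  assumes "X \<in> gsets n" "a \<in> carrier (bhom n Y Y')" "b \<in> carrier (bhom n Y' Z)"
  shows "bcomp n (X \<times>\<^sub>G Y) (X \<times>\<^sub>G Y') (X \<times>\<^sub>G Z) (bprod n X X Y Y' (bid n X) a) (bprod n X X Y' Z (bid n X) b) =
      bprod n X X Y Z (bid n X) (bcomp n Y Y' Z a b)"
    "bcomp n (Y \<times>\<^sub>G X) (Y' \<times>\<^sub>G X) (Z \<times>\<^sub>G X) (bprod n Y Y' X X a (bid n X)) (bprod n Y' Z X X b (bid n X)) =
      bprod n Y Z X X (bcomp n Y Y' Z a b) (bid n X)"
  using assms by (simp_all add: bprod_bcomp[symmetric] bcomp_id_left)

lemma mackey_lshift [simp]: "mackey_functor n Q \<Longrightarrow> X \<in> gsets n \<Longrightarrow> mackey_functor n (lshift Q X)"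
  unfolding mackey_functor_def[of n "lshift Q X"]
  by (auto simp: mor_lshift mackey_group intro!: mor_hom)
    (simp_all add: bprod_bid mor_id mor_comp bprod_bcomp_id bprod_mult_right mor_add)

lemma mackey_rshift [simp]: "mackey_functor n Q \<Longrightarrow> X \<in> gsets n \<Longrightarrow> mackey_functor n (rshift Q X)"
  unfolding mackey_functor_def[of n "rshift Q X"]
  by (auto simp: mor_rshift mackey_group intro!: mor_hom)
    (simp_all add: bprod_bid mor_id mor_comp bprod_bcomp_id bprod_mult_left mor_add)

lemma tra_lshift: "X \<in> gsets n \<Longrightarrow> Y \<in> gsets n \<Longrightarrow> eqv n Y Y' f \<Longrightarrow>
    tra n (lshift Q X) Y Y' f = tra n Q (X \<times>\<^sub>G Y) (X \<times>\<^sub>G Y') (on_snd f)"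
  and res_lshift: "X \<in> gsets n \<Longrightarrow> Y \<in> gsets n \<Longrightarrow> eqv n Y Y' f \<Longrightarrow>
    res n (lshift Q X) Y Y' f = res n Q (X \<times>\<^sub>G Y) (X \<times>\<^sub>G Y') (on_snd f)"
  and tra_rshift: "X \<in> gsets n \<Longrightarrow> Y \<in> gsets n \<Longrightarrow> eqv n Y Y' f \<Longrightarrow>
    tra n (rshift Q X) Y Y' f = tra n Q (Y \<times>\<^sub>G X) (Y' \<times>\<^sub>G X) (on_fst f)"
  and res_rshift: "X \<in> gsets n \<Longrightarrow> Y \<in> gsets n \<Longrightarrow> eqv n Y Y' f \<Longrightarrow>
    res n (rshift Q X) Y Y' f = res n Q (Y \<times>\<^sub>G X) (Y' \<times>\<^sub>G X) (on_fst f)"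
  unfolding tra_def res_def
  by (rule ext, simp add: mor_lshift mor_rshift bid_bcov[of X] bprod_bcov,
      simp add: mor_lshift mor_rshift bid_bcon[of X] bprod_bcon)+


section \<open>The universal property of the box product\<close>

text \<open>The maps \<open>M(Y) \<times> N(Z) \<rightarrow> L(Y \<times> Z)\<close> that are biadditive and natural in both variables, the
  naturality in each variable being that of a homomorphism into a shift of \<open>L\<close>.\<close>

definition pairing :: "('m, 'x) mackey_scheme \<Rightarrow> ('k, 'y) mackey_scheme \<Rightarrow> ('l, 'z) mackey_scheme \<Rightarrow>
  (gset \<Rightarrow> gset \<Rightarrow> 'm \<Rightarrow> 'k \<Rightarrow> 'l) \<Rightarrow> bool" where
  "pairing M N L h \<longleftrightarrow>
     (\<forall>Z\<in>gsets n. \<forall>k\<in>carrier (val N Z). nathom M (rshift L Z) (\<lambda>Y m. h Y Z m k)) \<and>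
     (\<forall>Y\<in>gsets n. \<forall>m\<in>carrier (val M Y). nathom N (lshift L Y) (\<lambda>Z k. h Y Z m k))"

lemma pairingD:
  assumes "pairing M N L h" "Y \<in> gsets n" "Z \<in> gsets n" "m \<in> carrier (val M Y)" "k \<in> carrier (val N Z)"
  shows pairing_closed: "h Y Z m k \<in> carrier (val L (Y \<times>\<^sub>G Z))"
    and pairing_mult_left: "m' \<in> carrier (val M Y) \<Longrightarrow>
      h Y Z (m \<otimes>\<^bsub>val M Y\<^esub> m') k = h Y Z m k \<otimes>\<^bsub>val L (Y \<times>\<^sub>G Z)\<^esub> h Y Z m' k"
    and pairing_mult_right: "k' \<in> carrier (val N Z) \<Longrightarrow>
      h Y Z m (k \<otimes>\<^bsub>val N Z\<^esub> k') = h Y Z m k \<otimes>\<^bsub>val L (Y \<times>\<^sub>G Z)\<^esub> h Y Z m k'"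
    and pairing_mor_left: "Y' \<in> gsets n \<Longrightarrow> a \<in> carrier (bhom n Y Y') \<Longrightarrow>
      h Y' Z (mor M Y Y' a m) k = mor L (Y \<times>\<^sub>G Z) (Y' \<times>\<^sub>G Z) (bprod n Y Y' Z Z a (bid n Z)) (h Y Z m k)"
    and pairing_mor_right: "Z' \<in> gsets n \<Longrightarrow> b \<in> carrier (bhom n Z Z') \<Longrightarrow>
      h Y Z' m (mor N Z Z' b k) = mor L (Y \<times>\<^sub>G Z) (Y \<times>\<^sub>G Z') (bprod n Y Y Z Z' (bid n Y) b) (h Y Z m k)"
proof -
  have l: "nathom M (rshift L Z) (\<lambda>Y m. h Y Z m k)" and r: "nathom N (lshift L Y) (\<lambda>Z k. h Y Z m k)"
    using assms by (simp_all add: pairing_def)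
  show "h Y Z m k \<in> carrier (val L (Y \<times>\<^sub>G Z))" using nathom_closed[OF l assms(2,4)] by simp
  show "m' \<in> carrier (val M Y) \<Longrightarrow>
      h Y Z (m \<otimes>\<^bsub>val M Y\<^esub> m') k = h Y Z m k \<otimes>\<^bsub>val L (Y \<times>\<^sub>G Z)\<^esub> h Y Z m' k"
    using nathom_mult[OF l assms(2,4)] by simp
  show "k' \<in> carrier (val N Z) \<Longrightarrow>
      h Y Z m (k \<otimes>\<^bsub>val N Z\<^esub> k') = h Y Z m k \<otimes>\<^bsub>val L (Y \<times>\<^sub>G Z)\<^esub> h Y Z m k'"
    using nathom_mult[OF r assms(3,5)] by simp
  show "Y' \<in> gsets n \<Longrightarrow> a \<in> carrier (bhom n Y Y') \<Longrightarrow>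
      h Y' Z (mor M Y Y' a m) k = mor L (Y \<times>\<^sub>G Z) (Y' \<times>\<^sub>G Z) (bprod n Y Y' Z Z a (bid n Z)) (h Y Z m k)"
    using nathom_mor[OF l assms(2) _ _ assms(4)] by (simp add: mor_rshift)
  show "Z' \<in> gsets n \<Longrightarrow> b \<in> carrier (bhom n Z Z') \<Longrightarrow>
      h Y Z' m (mor N Z Z' b k) = mor L (Y \<times>\<^sub>G Z) (Y \<times>\<^sub>G Z') (bprod n Y Y Z Z' (bid n Y) b) (h Y Z m k)"
    using nathom_mor[OF r assms(3) _ _ assms(5)] by (simp add: mor_lshift)
qed

lemma pairing_tra_left:
  assumes "pairing M N L h" "Y \<in> gsets n" "Z \<in> gsets n" "m \<in> carrier (val M Y)" "k \<in> carrier (val N Z)"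
    "Y' \<in> gsets n" "eqv n Y Y' f"
  shows "h Y' Z (tra n M Y Y' f m) k = tra n L (Y \<times>\<^sub>G Z) (Y' \<times>\<^sub>G Z) (on_fst f) (h Y Z m k)"
  using pairing_mor_left[OF assms(1-6), of "bcov n Y Y' f"] assms
  by (simp add: tra_def bid_bcov[of Z] bprod_bcov)

lemma pairing_tra_right:
  assumes "pairing M N L h" "Y \<in> gsets n" "Z \<in> gsets n" "m \<in> carrier (val M Y)" "k \<in> carrier (val N Z)"
    "Z' \<in> gsets n" "eqv n Z Z' f"
  shows "h Y Z' m (tra n N Z Z' f k) = tra n L (Y \<times>\<^sub>G Z) (Y \<times>\<^sub>G Z') (on_snd f) (h Y Z m k)"
  using pairing_mor_right[OF assms(1-6), of "bcov n Z Z' f"] assms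
  by (simp add: tra_def bid_bcov[of Y] bprod_bcov)

lemma pairing_res_left:
  assumes "pairing M N L h" "Y \<in> gsets n" "Z \<in> gsets n" "k \<in> carrier (val N Z)"
    "Y' \<in> gsets n" "eqv n Y Y' f" "m \<in> carrier (val M Y')"
  shows "h Y Z (res n M Y Y' f m) k = res n L (Y \<times>\<^sub>G Z) (Y' \<times>\<^sub>G Z) (on_fst f) (h Y' Z m k)"
  using pairing_mor_left[OF assms(1,5,3,7,4,2), of "bcon n Y Y' f"] assms
  by (simp add: res_def bid_bcon[of Z] bprod_bcon)

lemma pairing_res_right:
  assumes "pairing M N L h" "Y \<in> gsets n" "Z \<in> gsets n" "m \<in> carrier (val M Y)"
    "Z' \<in> gsets n" "eqv n Z Z' f" "k \<in> carrier (val N Z')"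
  shows "h Y Z m (res n N Z Z' f k) = res n L (Y \<times>\<^sub>G Z) (Y \<times>\<^sub>G Z') (on_snd f) (h Y Z' m k)"
  using pairing_mor_right[OF assms(1,2,5,4,7,3), of "bcon n Z Z' f"] assms
  by (simp add: res_def bid_bcon[of Y] bprod_bcon)

lemma pairing_mor2:
  assumes h: "pairing M N L h" and M: "mackey_functor n M" and N: "mackey_functor n N" and L: "mackey_functor n L"
    and g: "Y \<in> gsets n" "Z \<in> gsets n" "Y' \<in> gsets n" "Z' \<in> gsets n"
    and e: "m \<in> carrier (val M Y)" "k \<in> carrier (val N Z)"
    and ab: "a \<in> carrier (bhom n Y Y')" "b \<in> carrier (bhom n Z Z')"
  shows "h Y' Z' (mor M Y Y' a m) (mor N Z Z' b k) = mor L (Y \<times>\<^sub>G Z) (Y' \<times>\<^sub>G Z') (bprod n Y Y' Z Z' a b) (h Y Z m k)"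
  using assms by (simp add: pairing_closed[OF h] pairing_mor_left[OF h] pairing_mor_right[OF h] mor_comp bprod_split(1)[of a Y Y' b Z Z'])

text \<open>Naturality is reduced to transfers and restrictions in each variable, where base change applies.\<close>

lemma pairingI:
  assumes M: "mackey_functor n M" and N: "mackey_functor n N" and L: "mackey_functor n L"
    and closed: "\<And>Y Z m k. Y \<in> gsets n \<Longrightarrow> Z \<in> gsets n \<Longrightarrow> m \<in> carrier (val M Y) \<Longrightarrow> k \<in> carrier (val N Z) \<Longrightarrow>
      h Y Z m k \<in> carrier (val L (Y \<times>\<^sub>G Z))"
    and add_left: "\<And>Y Z m m' k. Y \<in> gsets n \<Longrightarrow> Z \<in> gsets n \<Longrightarrow> m \<in> carrier (val M Y) \<Longrightarrow> m' \<in> carrier (val M Y) \<Longrightarrow> k \<in> carrier (val N Z) \<Longrightarrow>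
      h Y Z (m \<otimes>\<^bsub>val M Y\<^esub> m') k = h Y Z m k \<otimes>\<^bsub>val L (Y \<times>\<^sub>G Z)\<^esub> h Y Z m' k"
    and add_right: "\<And>Y Z m k k'. Y \<in> gsets n \<Longrightarrow> Z \<in> gsets n \<Longrightarrow> m \<in> carrier (val M Y) \<Longrightarrow> k \<in> carrier (val N Z) \<Longrightarrow> k' \<in> carrier (val N Z) \<Longrightarrow>
      h Y Z m (k \<otimes>\<^bsub>val N Z\<^esub> k') = h Y Z m k \<otimes>\<^bsub>val L (Y \<times>\<^sub>G Z)\<^esub> h Y Z m k'"
    and tra_left: "\<And>Y Y' Z f m k. Y \<in> gsets n \<Longrightarrow> Y' \<in> gsets n \<Longrightarrow> Z \<in> gsets n \<Longrightarrow> eqv n Y Y' f \<Longrightarrow> m \<in> carrier (val M Y) \<Longrightarrow> k \<in> carrier (val N Z) \<Longrightarrow>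
      h Y' Z (tra n M Y Y' f m) k = tra n L (Y \<times>\<^sub>G Z) (Y' \<times>\<^sub>G Z) (on_fst f) (h Y Z m k)"
    and res_left: "\<And>Y Y' Z f m k. Y \<in> gsets n \<Longrightarrow> Y' \<in> gsets n \<Longrightarrow> Z \<in> gsets n \<Longrightarrow> eqv n Y Y' f \<Longrightarrow> m \<in> carrier (val M Y') \<Longrightarrow> k \<in> carrier (val N Z) \<Longrightarrow>
      h Y Z (res n M Y Y' f m) k = res n L (Y \<times>\<^sub>G Z) (Y' \<times>\<^sub>G Z) (on_fst f) (h Y' Z m k)"
    and tra_right: "\<And>Y Z Z' f m k. Y \<in> gsets n \<Longrightarrow> Z \<in> gsets n \<Longrightarrow> Z' \<in> gsets n \<Longrightarrow> eqv n Z Z' f \<Longrightarrow> m \<in> carrier (val M Y) \<Longrightarrow> k \<in> carrier (val N Z) \<Longrightarrow>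
      h Y Z' m (tra n N Z Z' f k) = tra n L (Y \<times>\<^sub>G Z) (Y \<times>\<^sub>G Z') (on_snd f) (h Y Z m k)"
    and res_right: "\<And>Y Z Z' f m k. Y \<in> gsets n \<Longrightarrow> Z \<in> gsets n \<Longrightarrow> Z' \<in> gsets n \<Longrightarrow> eqv n Z Z' f \<Longrightarrow> m \<in> carrier (val M Y) \<Longrightarrow> k \<in> carrier (val N Z') \<Longrightarrow>
      h Y Z m (res n N Z Z' f k) = res n L (Y \<times>\<^sub>G Z) (Y \<times>\<^sub>G Z') (on_snd f) (h Y Z' m k)"
  shows "pairing M N L h"
  unfolding pairing_def
  by (intro conjI ballI nathomI M N mackey_lshift mackey_rshift L homI)
    (simp_all add: closed add_left add_right tra_left res_left tra_right res_right
      tra_lshift res_lshift tra_rshift res_rshift)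

lemma box_gensI: "Y \<in> gsets n \<Longrightarrow> Z \<in> gsets n \<Longrightarrow> \<phi> \<in> carrier (bhom n (Y \<times>\<^sub>G Z) X) \<Longrightarrow>
     m \<in> carrier (val M Y) \<Longrightarrow> k \<in> carrier (val N Z) \<Longrightarrow> (Y, Z, \<phi>, m, k) \<in> box_gens n M N X"
  by (simp add: box_gens_def)

lemma box_gensE:
  assumes "t \<in> box_gens n M N X"
  obtains Y Z \<phi> m k where "t = (Y, Z, \<phi>, m, k)" "Y \<in> gsets n" "Z \<in> gsets n" "\<phi> \<in> carrier (bhom n (Y \<times>\<^sub>G Z) X)"
     "m \<in> carrier (val M Y)" "k \<in> carrier (val N Z)"
proof -
  obtain Y Z \<phi> m k where t: "t = (Y, Z, \<phi>, m, k)" by (rule prod_cases5)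
  show thesis using assms that[OF t] unfolding t by (simp add: box_gens_def)
qed

lemma box_rels_cases [consumes 1, case_names phi left right mor]:
  assumes "x \<in> box_rels n M N X"
  obtains Y Z \<phi> \<phi>' m k where "x = frag_of (Y, Z, \<phi> \<otimes>\<^bsub>bhom n (Y \<times>\<^sub>G Z) X\<^esub> \<phi>', m, k) - frag_of (Y, Z, \<phi>, m, k) - frag_of (Y, Z, \<phi>', m, k)"
      "(Y, Z, \<phi>, m, k) \<in> box_gens n M N X" "(Y, Z, \<phi>', m, k) \<in> box_gens n M N X"
  | Y Z \<phi> m m' k where "x = frag_of (Y, Z, \<phi>, m \<otimes>\<^bsub>val M Y\<^esub> m', k) - frag_of (Y, Z, \<phi>, m, k) - frag_of (Y, Z, \<phi>, m', k)"
      "(Y, Z, \<phi>, m, k) \<in> box_gens n M N X" "(Y, Z, \<phi>, m', k) \<in> box_gens n M N X"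
  | Y Z \<phi> m k k' where "x = frag_of (Y, Z, \<phi>, m, k \<otimes>\<^bsub>val N Z\<^esub> k') - frag_of (Y, Z, \<phi>, m, k) - frag_of (Y, Z, \<phi>, m, k')"
      "(Y, Z, \<phi>, m, k) \<in> box_gens n M N X" "(Y, Z, \<phi>, m, k') \<in> box_gens n M N X"
  | Y Y' Z Z' \<phi> a b m k where "x = frag_of (Y', Z', \<phi>, mor M Y Y' a m, mor N Z Z' b k)
         - frag_of (Y, Z, bcomp n (Y \<times>\<^sub>G Z) (Y' \<times>\<^sub>G Z') X (bprod n Y Y' Z Z' a b) \<phi>, m, k)"
      "Y \<in> gsets n" "Y' \<in> gsets n" "Z \<in> gsets n" "Z' \<in> gsets n" "\<phi> \<in> carrier (bhom n (Y' \<times>\<^sub>G Z') X)"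
       "a \<in> carrier (bhom n Y Y')" "b \<in> carrier (bhom n Z Z')"
       "m \<in> carrier (val M Y)" "k \<in> carrier (val N Z)"
  using assms unfolding box_rels_def
  by (elim UnE CollectE exE conjE)

lemma keys_frag_diff: "s \<in> S \<Longrightarrow> t \<in> S \<Longrightarrow> Poly_Mapping.keys (frag_of s - frag_of t) \<subseteq> S"
  using keys_diff[of "frag_of s" "frag_of t"] by auto

lemma keys_frag_diff_diff: "s \<in> S \<Longrightarrow> t \<in> S \<Longrightarrow> u \<in> S \<Longrightarrow> Poly_Mapping.keys (frag_of s - frag_of t - frag_of u) \<subseteq> S"
  using keys_diff[of "frag_of s - frag_of t" "frag_of u"] keys_frag_diff[of s S t] by auto

lemma box_rels_carrier:
  assumes M: "mackey_functor n M" and N: "mackey_functor n N"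
  shows "box_rels n M N X \<subseteq> carrier (free_Abelian_group (box_gens n M N X))"
proof
  fix x assume "x \<in> box_rels n M N X"
  then show "x \<in> carrier (free_Abelian_group (box_gens n M N X))"
    unfolding carrier_free_Abelian_group_iff
  proof (cases rule: box_rels_cases)
    case (phi Y Z \<phi> \<phi>' m k)
    then show "Poly_Mapping.keys x \<subseteq> box_gens n M N X" by (simp add: keys_frag_diff_diff box_gens_def)
  next
    case (left Y Z \<phi> m m' k)
    then show "Poly_Mapping.keys x \<subseteq> box_gens n M N X" using M by (simp add: keys_frag_diff_diff box_gens_def)
  next
    case (right Y Z \<phi> m k k')
    then show "Poly_Mapping.keys x \<subseteq> box_gens n M N X" using N by (simp add: keys_frag_diff_diff box_gens_def)
  next
    case (mor Y Y' Z Z' \<phi> a b m k)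
    then show "Poly_Mapping.keys x \<subseteq> box_gens n M N X" using M N by (simp add: keys_frag_diff box_gens_def)
  qed
qed

lemma val_box: "val (box n M N) X = ab_pres (box_gens n M N X) (box_rels n M N X)"
  by (simp add: box_def)

lemma box_group: "mackey_functor n M \<Longrightarrow> mackey_functor n N \<Longrightarrow> comm_group (val (box n M N) X)"
  unfolding val_box by (intro ab_pres_comm_group box_rels_carrier)

lemma box_gen_closed [simp]: "Y \<in> gsets n \<Longrightarrow> Z \<in> gsets n \<Longrightarrow> \<phi> \<in> carrier (bhom n (Y \<times>\<^sub>G Z) X) \<Longrightarrow>
     m \<in> carrier (val M Y) \<Longrightarrow> k \<in> carrier (val N Z) \<Longrightarrow> box_gen n M N X (Y, Z, \<phi>, m, k) \<in> carrier (val (box n M N) X)"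
  unfolding val_box box_gen_def by (intro ab_cls_closed box_gensI)

text \<open>At a fixed level the generators \<open>\<phi> \<otimes> m \<otimes> k\<close> determine a homomorphism, which need not be natural.
  This form is used for maps to a mere group, such as the trace.\<close>

lemma box_hom_eq:
  assumes M: "mackey_functor n M" and N: "mackey_functor n N" and G: "group G"
    and f: "f \<in> hom (val (box n M N) X) G" and g: "g \<in> hom (val (box n M N) X) G"
    and eq: "\<And>Y Z \<phi> m k. Y \<in> gsets n \<Longrightarrow> Z \<in> gsets n \<Longrightarrow> \<phi> \<in> carrier (bhom n (Y \<times>\<^sub>G Z) X) \<Longrightarrow>
      m \<in> carrier (val M Y) \<Longrightarrow> k \<in> carrier (val N Z) \<Longrightarrow>
      f (box_gen n M N X (Y, Z, \<phi>, m, k)) = g (box_gen n M N X (Y, Z, \<phi>, m, k))"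
    and z: "z \<in> carrier (val (box n M N) X)"
  shows "f z = g z"
proof (rule ab_pres_hom_eq[OF box_rels_carrier[OF M N] G f[unfolded val_box] g[unfolded val_box] _ z[unfolded val_box]])
  fix s assume "s \<in> box_gens n M N X"
  then obtain Y Z \<phi> m k where "s = (Y, Z, \<phi>, m, k)" "Y \<in> gsets n" "Z \<in> gsets n" "\<phi> \<in> carrier (bhom n (Y \<times>\<^sub>G Z) X)"
     "m \<in> carrier (val M Y)" "k \<in> carrier (val N Z)" by (rule box_gensE)
  then show "f (ab_cls (box_gens n M N X) (box_rels n M N X) s) = g (ab_cls (box_gens n M N X) (box_rels n M N X) s)"
    using eq[of Y Z \<phi> m k] by (simp add: box_gen_def)
qed

text \<open>The four kinds of relations in the presentation of the box product, as conditions on a function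
  of generators.\<close>

lemma box_lift:
  assumes M: "mackey_functor n M" and N: "mackey_functor n N" and G: "comm_group G"
    and closed: "\<And>Y Z \<phi> m k. Y \<in> gsets n \<Longrightarrow> Z \<in> gsets n \<Longrightarrow> \<phi> \<in> carrier (bhom n (Y \<times>\<^sub>G Z) X) \<Longrightarrow>
      m \<in> carrier (val M Y) \<Longrightarrow> k \<in> carrier (val N Z) \<Longrightarrow> F (Y, Z, \<phi>, m, k) \<in> carrier G"
    and phi: "\<And>Y Z \<phi> \<phi>' m k. Y \<in> gsets n \<Longrightarrow> Z \<in> gsets n \<Longrightarrow> \<phi> \<in> carrier (bhom n (Y \<times>\<^sub>G Z) X) \<Longrightarrow> \<phi>' \<in> carrier (bhom n (Y \<times>\<^sub>G Z) X) \<Longrightarrow>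
      m \<in> carrier (val M Y) \<Longrightarrow> k \<in> carrier (val N Z) \<Longrightarrow>
      F (Y, Z, \<phi> \<otimes>\<^bsub>bhom n (Y \<times>\<^sub>G Z) X\<^esub> \<phi>', m, k) = F (Y, Z, \<phi>, m, k) \<otimes>\<^bsub>G\<^esub> F (Y, Z, \<phi>', m, k)"
    and left: "\<And>Y Z \<phi> m m' k. Y \<in> gsets n \<Longrightarrow> Z \<in> gsets n \<Longrightarrow> \<phi> \<in> carrier (bhom n (Y \<times>\<^sub>G Z) X) \<Longrightarrow>
      m \<in> carrier (val M Y) \<Longrightarrow> m' \<in> carrier (val M Y) \<Longrightarrow> k \<in> carrier (val N Z) \<Longrightarrow>
      F (Y, Z, \<phi>, m \<otimes>\<^bsub>val M Y\<^esub> m', k) = F (Y, Z, \<phi>, m, k) \<otimes>\<^bsub>G\<^esub> F (Y, Z, \<phi>, m', k)"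
    and right: "\<And>Y Z \<phi> m k k'. Y \<in> gsets n \<Longrightarrow> Z \<in> gsets n \<Longrightarrow> \<phi> \<in> carrier (bhom n (Y \<times>\<^sub>G Z) X) \<Longrightarrow>
      m \<in> carrier (val M Y) \<Longrightarrow> k \<in> carrier (val N Z) \<Longrightarrow> k' \<in> carrier (val N Z) \<Longrightarrow>
      F (Y, Z, \<phi>, m, k \<otimes>\<^bsub>val N Z\<^esub> k') = F (Y, Z, \<phi>, m, k) \<otimes>\<^bsub>G\<^esub> F (Y, Z, \<phi>, m, k')"
    and mor: "\<And>Y Y' Z Z' \<phi> a b m k. Y \<in> gsets n \<Longrightarrow> Y' \<in> gsets n \<Longrightarrow> Z \<in> gsets n \<Longrightarrow> Z' \<in> gsets n \<Longrightarrow> \<phi> \<in> carrier (bhom n (Y' \<times>\<^sub>G Z') X) \<Longrightarrow>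
      a \<in> carrier (bhom n Y Y') \<Longrightarrow> b \<in> carrier (bhom n Z Z') \<Longrightarrow> m \<in> carrier (val M Y) \<Longrightarrow> k \<in> carrier (val N Z) \<Longrightarrow>
      F (Y', Z', \<phi>, mor M Y Y' a m, mor N Z Z' b k) =
      F (Y, Z, bcomp n (Y \<times>\<^sub>G Z) (Y' \<times>\<^sub>G Z') X (bprod n Y Y' Z Z' a b) \<phi>, m, k)"
  shows box_lift_hom: "ab_lift G F \<in> hom (val (box n M N) X) G"
    and box_lift_gen: "\<And>Y Z \<phi> m k. Y \<in> gsets n \<Longrightarrow> Z \<in> gsets n \<Longrightarrow> \<phi> \<in> carrier (bhom n (Y \<times>\<^sub>G Z) X) \<Longrightarrow>
      m \<in> carrier (val M Y) \<Longrightarrow> k \<in> carrier (val N Z) \<Longrightarrow>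
      ab_lift G F (box_gen n M N X (Y, Z, \<phi>, m, k)) = F (Y, Z, \<phi>, m, k)"
proof -
  interpret G: comm_group G by fact
  have cl: "F \<in> box_gens n M N X \<rightarrow> carrier G"
  proof
    fix t assume "t \<in> box_gens n M N X"
    then show "F t \<in> carrier G" by (rule box_gensE) (simp add: closed)
  qed
  have kill: "ab_ext G F x = \<one>\<^bsub>G\<^esub>" if "x \<in> box_rels n M N X" for x
    using that
  proof (cases rule: box_rels_cases)
    case (phi Y Z \<phi> \<phi>' m k)
    then show ?thesis using assms(5)[of Y Z \<phi> \<phi>' m k]
      by (simp only: phi(1), intro G.ab_ext_rel3[OF cl]) (simp_all add: box_gens_def)
  next
    case (left Y Z \<phi> m m' k)
    then show ?thesis using M assms(6)[of Y Z \<phi> m m' k]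
      by (simp only: left(1), intro G.ab_ext_rel3[OF cl]) (simp_all add: box_gens_def)
  next
    case (right Y Z \<phi> m k k')
    then show ?thesis using N assms(7)[of Y Z \<phi> m k k']
      by (simp only: right(1), intro G.ab_ext_rel3[OF cl]) (simp_all add: box_gens_def)
  next
    case (mor Y Y' Z Z' \<phi> a b m k)
    then show ?thesis using M N assms(8)[of Y Y' Z Z' \<phi> a b m k]
      by (simp only: mor(1), intro G.ab_ext_rel2[OF cl]) (simp_all add: box_gens_def)
  qed
  show "ab_lift G F \<in> hom (val (box n M N) X) G"
    unfolding val_box by (rule ab_lift_hom[OF box_rels_carrier[OF M N] G cl kill])
  show "ab_lift G F (box_gen n M N X (Y, Z, \<phi>, m, k)) = F (Y, Z, \<phi>, m, k)"
    if "Y \<in> gsets n" "Z \<in> gsets n" "\<phi> \<in> carrier (bhom n (Y \<times>\<^sub>G Z) X)" "m \<in> carrier (val M Y)" "k \<in> carrier (val N Z)"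
    for Y Z \<phi> m k
    unfolding box_gen_def by (rule ab_lift_cls[OF box_rels_carrier[OF M N] G cl kill box_gensI[OF that]])
qed

context
  fixes M :: "('m, 'x) mackey_scheme" and N :: "('k, 'y) mackey_scheme"
  assumes M: "mackey_functor n M" and N: "mackey_functor n N"
begin

lemma box_gen_phi:
  assumes "Y \<in> gsets n" "Z \<in> gsets n" "\<phi> \<in> carrier (bhom n (Y \<times>\<^sub>G Z) X)" "\<phi>' \<in> carrier (bhom n (Y \<times>\<^sub>G Z) X)"
      "m \<in> carrier (val M Y)" "k \<in> carrier (val N Z)"
  shows "box_gen n M N X (Y, Z, \<phi> \<otimes>\<^bsub>bhom n (Y \<times>\<^sub>G Z) X\<^esub> \<phi>', m, k) =
     box_gen n M N X (Y, Z, \<phi>, m, k) \<otimes>\<^bsub>val (box n M N) X\<^esub> box_gen n M N X (Y, Z, \<phi>', m, k)"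
  unfolding box_gen_def val_box
proof (rule ab_cls_rel3[OF box_rels_carrier[OF M N]])
  show "frag_of (Y, Z, \<phi> \<otimes>\<^bsub>bhom n (Y \<times>\<^sub>G Z) X\<^esub> \<phi>', m, k) - frag_of (Y, Z, \<phi>, m, k) - frag_of (Y, Z, \<phi>', m, k) \<in> box_rels n M N X"
    unfolding box_rels_def by (rule UnI1, rule UnI1, rule UnI1, intro CollectI exI conjI, rule refl) (use assms in \<open>simp_all add: box_gensI\<close>)
qed (use assms M N in \<open>simp_all add: box_gens_def\<close>)

lemma box_gen_left:
  assumes "Y \<in> gsets n" "Z \<in> gsets n" "\<phi> \<in> carrier (bhom n (Y \<times>\<^sub>G Z) X)"
      "m \<in> carrier (val M Y)" "m' \<in> carrier (val M Y)" "k \<in> carrier (val N Z)"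
  shows "box_gen n M N X (Y, Z, \<phi>, m \<otimes>\<^bsub>val M Y\<^esub> m', k) =
     box_gen n M N X (Y, Z, \<phi>, m, k) \<otimes>\<^bsub>val (box n M N) X\<^esub> box_gen n M N X (Y, Z, \<phi>, m', k)"
  unfolding box_gen_def val_box
proof (rule ab_cls_rel3[OF box_rels_carrier[OF M N]])
  show "frag_of (Y, Z, \<phi>, m \<otimes>\<^bsub>val M Y\<^esub> m', k) - frag_of (Y, Z, \<phi>, m, k) - frag_of (Y, Z, \<phi>, m', k) \<in> box_rels n M N X"
    unfolding box_rels_def by (rule UnI1, rule UnI1, rule UnI2, intro CollectI exI conjI, rule refl) (use assms in \<open>simp_all add: box_gensI\<close>)
qed (use assms M N in \<open>simp_all add: box_gens_def\<close>)

lemma box_gen_right: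
  assumes "Y \<in> gsets n" "Z \<in> gsets n" "\<phi> \<in> carrier (bhom n (Y \<times>\<^sub>G Z) X)"
      "m \<in> carrier (val M Y)" "k \<in> carrier (val N Z)" "k' \<in> carrier (val N Z)"
  shows "box_gen n M N X (Y, Z, \<phi>, m, k \<otimes>\<^bsub>val N Z\<^esub> k') =
     box_gen n M N X (Y, Z, \<phi>, m, k) \<otimes>\<^bsub>val (box n M N) X\<^esub> box_gen n M N X (Y, Z, \<phi>, m, k')"
  unfolding box_gen_def val_box
proof (rule ab_cls_rel3[OF box_rels_carrier[OF M N]])
  show "frag_of (Y, Z, \<phi>, m, k \<otimes>\<^bsub>val N Z\<^esub> k') - frag_of (Y, Z, \<phi>, m, k) - frag_of (Y, Z, \<phi>, m, k') \<in> box_rels n M N X"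
    unfolding box_rels_def by (rule UnI1, rule UnI2, intro CollectI exI conjI, rule refl) (use assms in \<open>simp_all add: box_gensI\<close>)
qed (use assms M N in \<open>simp_all add: box_gens_def\<close>)

lemma box_gen_mor:
  assumes "Y \<in> gsets n" "Y' \<in> gsets n" "Z \<in> gsets n" "Z' \<in> gsets n" "\<phi> \<in> carrier (bhom n (Y' \<times>\<^sub>G Z') X)"
      "a \<in> carrier (bhom n Y Y')" "b \<in> carrier (bhom n Z Z')" "m \<in> carrier (val M Y)" "k \<in> carrier (val N Z)"
  shows "box_gen n M N X (Y', Z', \<phi>, mor M Y Y' a m, mor N Z Z' b k) =
      box_gen n M N X (Y, Z, bcomp n (Y \<times>\<^sub>G Z) (Y' \<times>\<^sub>G Z') X (bprod n Y Y' Z Z' a b) \<phi>, m, k)"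
  unfolding box_gen_def val_box
proof (rule ab_cls_rel2[OF box_rels_carrier[OF M N]])
  show "frag_of (Y', Z', \<phi>, mor M Y Y' a m, mor N Z Z' b k) -
      frag_of (Y, Z, bcomp n (Y \<times>\<^sub>G Z) (Y' \<times>\<^sub>G Z') X (bprod n Y Y' Z Z' a b) \<phi>, m, k) \<in> box_rels n M N X"
    unfolding box_rels_def by (rule UnI2, intro CollectI exI conjI, rule refl) (use assms in simp_all)
qed (use assms M N in \<open>simp_all add: box_gens_def\<close>)

lemma
  assumes X: "X \<in> gsets n" "X' \<in> gsets n" and b: "b \<in> carrier (bhom n X X')"
  shows box_mor_hom: "mor (box n M N) X X' b \<in> hom (val (box n M N) X) (val (box n M N) X')"
    and box_mor_gen: "\<And>Y Z \<phi> m k. Y \<in> gsets n \<Longrightarrow> Z \<in> gsets n \<Longrightarrow> \<phi> \<in> carrier (bhom n (Y \<times>\<^sub>G Z) X) \<Longrightarrow>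
      m \<in> carrier (val M Y) \<Longrightarrow> k \<in> carrier (val N Z) \<Longrightarrow> mor (box n M N) X X' b (box_gen n M N X (Y, Z, \<phi>, m, k)) =
      box_gen n M N X' (Y, Z, bcomp n (Y \<times>\<^sub>G Z) X X' \<phi> b, m, k)"
proof -
  have e: "mor (box n M N) X X' b = ab_lift (val (box n M N) X')
        (\<lambda>(Y, Z, \<phi>, m, k). box_gen n M N X' (Y, Z, bcomp n (Y \<times>\<^sub>G Z) X X' \<phi> b, m, k))"
    by (simp add: box_def)
  let ?F = "\<lambda>(Y, Z, \<phi>, m, k). box_gen n M N X' (Y, Z, bcomp n (Y \<times>\<^sub>G Z) X X' \<phi> b, m, k)"
  have "ab_lift (val (box n M N) X') ?F \<in> hom (val (box n M N) X) (val (box n M N) X')"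
    using b M N by (intro box_lift_hom[OF M N box_group[OF M N]])
      (simp_all add: box_gen_phi box_gen_left box_gen_right box_gen_mor bcomp_mult_left bcomp_assoc)
  then show "mor (box n M N) X X' b \<in> hom (val (box n M N) X) (val (box n M N) X')" unfolding e .
  show "mor (box n M N) X X' b (box_gen n M N X (Y, Z, \<phi>, m, k)) =
      box_gen n M N X' (Y, Z, bcomp n (Y \<times>\<^sub>G Z) X X' \<phi> b, m, k)"
    if "Y \<in> gsets n" "Z \<in> gsets n" "\<phi> \<in> carrier (bhom n (Y \<times>\<^sub>G Z) X)" "m \<in> carrier (val M Y)" "k \<in> carrier (val N Z)"
    for Y Z \<phi> m k
    unfolding e using b M N that by (subst box_lift_gen[OF M N box_group[OF M N]])
      (simp_all add: box_gen_phi box_gen_left box_gen_right box_gen_mor bcomp_mult_left bcomp_assoc)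
qed

lemma box_mackey [simp]: "mackey_functor n (box n M N)"
  unfolding mackey_functor_def
proof (intro conjI ballI)
  fix X assume "X \<in> gsets n" show "comm_group (val (box n M N) X)" by (rule box_group[OF M N])
next
  fix X Y b assume "X \<in> gsets n" "Y \<in> gsets n" "b \<in> carrier (bhom n X Y)"
  then show "mor (box n M N) X Y b \<in> hom (val (box n M N) X) (val (box n M N) Y)" by (rule box_mor_hom)
next
  fix X x assume X: "X \<in> gsets n" and x: "x \<in> carrier (val (box n M N) X)"
  show "mor (box n M N) X X (bid n X) x = x"
    by (rule box_hom_eq[OF M N _ _ _ _ x, of "val (box n M N) X"])
      (use X box_group[OF M N] in \<open>simp_all add: box_mor_hom box_mor_gen hom_id bcomp_id_right comm_group_def\<close>)
next
  fix X Y Z a b x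
  assume g: "X \<in> gsets n" "Y \<in> gsets n" "Z \<in> gsets n" and a: "a \<in> carrier (bhom n X Y)" and b: "b \<in> carrier (bhom n Y Z)"
    and x: "x \<in> carrier (val (box n M N) X)"
  show "mor (box n M N) X Z (bcomp n X Y Z a b) x = mor (box n M N) Y Z b (mor (box n M N) X Y a x)"
  proof (rule box_hom_eq[OF M N _ _ _ _ x, of "val (box n M N) Z"])
    show "(\<lambda>x. mor (box n M N) Y Z b (mor (box n M N) X Y a x)) \<in> hom (val (box n M N) X) (val (box n M N) Z)"
      using Group.hom_compose[OF box_mor_hom[OF g(1,2) a] box_mor_hom[OF g(2,3) b]] by (simp add: comp_def)
    show "group (val (box n M N) Z)" using box_group[OF M N] by (simp add: comm_group_def)
  qed (use g a b in \<open>simp_all add: box_mor_hom box_mor_gen bcomp_assoc\<close>)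
next
  fix X Y a b x
  assume g: "X \<in> gsets n" "Y \<in> gsets n" and a: "a \<in> carrier (bhom n X Y)" and b: "b \<in> carrier (bhom n X Y)"
    and x: "x \<in> carrier (val (box n M N) X)"
  interpret B: comm_group "val (box n M N) Y" by (rule box_group[OF M N])
  show "mor (box n M N) X Y (a \<otimes>\<^bsub>bhom n X Y\<^esub> b) x = mor (box n M N) X Y a x \<otimes>\<^bsub>val (box n M N) Y\<^esub> mor (box n M N) X Y b x"
  proof (rule box_hom_eq[OF M N B.is_group _ _ _ x])
    show "(\<lambda>x. mor (box n M N) X Y a x \<otimes>\<^bsub>val (box n M N) Y\<^esub> mor (box n M N) X Y b x) \<in> hom (val (box n M N) X) (val (box n M N) Y)"
      using B.hom_group_mult box_mor_hom[OF g a] box_mor_hom[OF g b] .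
  qed (use g a b in \<open>simp_all add: box_mor_hom box_mor_gen bcomp_mult_right box_gen_phi\<close>)
qed

end


text \<open>The pure tensors \<open>m \<otimes> k\<close>; they generate a box product under its Mackey functor structure.\<close>

abbreviation tens :: "('m, 'x) mackey_scheme \<Rightarrow> ('k, 'y) mackey_scheme \<Rightarrow> gset \<Rightarrow> gset \<Rightarrow> 'm \<Rightarrow> 'k \<Rightarrow> ('m, 'k) box" where
  "tens M N Y Z m k \<equiv> box_gen n M N (Y \<times>\<^sub>G Z) (Y, Z, bid n (Y \<times>\<^sub>G Z), m, k)"

text \<open>The universal property: a pairing \<open>h\<close> corresponds to the homomorphism with \<open>m \<otimes> k \<mapsto> h(m, k)\<close>,
  which naturality forces to be this on \<open>\<phi> \<otimes> m \<otimes> k\<close>.\<close>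

definition blift :: "('l, 'z) mackey_scheme \<Rightarrow> (gset \<Rightarrow> gset \<Rightarrow> 'm \<Rightarrow> 'k \<Rightarrow> 'l) \<Rightarrow> gset \<Rightarrow> ('m, 'k) box \<Rightarrow> 'l" where
  "blift L h X = ab_lift (val L X) (\<lambda>(Y, Z, \<phi>, m, k). mor L (Y \<times>\<^sub>G Z) X \<phi> (h Y Z m k))"

context
  fixes M :: "('m, 'x) mackey_scheme" and N :: "('k, 'y) mackey_scheme"
  assumes M: "mackey_functor n M" and N: "mackey_functor n N"
begin

lemma box_gen_bid:
  assumes "Y \<in> gsets n" "Z \<in> gsets n" "X \<in> gsets n" "\<phi> \<in> carrier (bhom n (Y \<times>\<^sub>G Z) X)" "m \<in> carrier (val M Y)" "k \<in> carrier (val N Z)"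
  shows "box_gen n M N X (Y, Z, \<phi>, m, k) =
    mor (box n M N) (Y \<times>\<^sub>G Z) X \<phi> (tens M N Y Z m k)"
  using assms by (simp add: box_mor_gen[OF M N] bcomp_id_left)

lemma box_gen_pairing: "pairing M N (box n M N) (\<lambda>Y Z m k. tens M N Y Z m k)"
  unfolding pairing_def nathom_def
proof (intro conjI ballI homI)
  fix Z k Y Y' a m
  assume g: "Z \<in> gsets n" "k \<in> carrier (val N Z)" "Y \<in> gsets n" "Y' \<in> gsets n" "a \<in> carrier (bhom n Y Y')" "m \<in> carrier (val M Y)"
  show "tens M N Y' Z (mor M Y Y' a m) k =
    mor (rshift (box n M N) Z) Y Y' a (tens M N Y Z m k)"
    using box_gen_mor[OF M N g(3,4,1,1) bid_closed g(5) bid_closed g(6,2)] g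
    by (simp add: mor_id[OF N] mor_rshift box_mor_gen[OF M N] bcomp_id_left bcomp_id_right)
next
  fix Z Z' b k Y m
  assume g: "Y \<in> gsets n" "m \<in> carrier (val M Y)" "Z \<in> gsets n" "Z' \<in> gsets n" "b \<in> carrier (bhom n Z Z')" "k \<in> carrier (val N Z)"
  show "tens M N Y Z' m (mor N Z Z' b k) =
    mor (lshift (box n M N) Y) Z Z' b (tens M N Y Z m k)"
    using box_gen_mor[OF M N g(1,1,3,4) bid_closed bid_closed g(5) g(2,6)] g
    by (simp add: mor_id[OF M] mor_lshift box_mor_gen[OF M N] bcomp_id_left bcomp_id_right)
qed (simp_all add: box_gen_left[OF M N] box_gen_right[OF M N])

context
  fixes L :: "('l, 'z) mackey_scheme"
  assumes L: "mackey_functor n L"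
begin

lemma
  assumes h: "pairing M N L h" and X: "X \<in> gsets n"
  shows blift_hom: "blift L h X \<in> hom (val (box n M N) X) (val L X)"
    and blift_gen: "\<And>Y Z \<phi> m k. Y \<in> gsets n \<Longrightarrow> Z \<in> gsets n \<Longrightarrow> \<phi> \<in> carrier (bhom n (Y \<times>\<^sub>G Z) X) \<Longrightarrow>
      m \<in> carrier (val M Y) \<Longrightarrow> k \<in> carrier (val N Z) \<Longrightarrow>
      blift L h X (box_gen n M N X (Y, Z, \<phi>, m, k)) = mor L (Y \<times>\<^sub>G Z) X \<phi> (h Y Z m k)"
proof -
  show "blift L h X \<in> hom (val (box n M N) X) (val L X)"
    unfolding blift_def using X L
    by (intro box_lift_hom[OF M N mackey_group[OF L X]])
      (simp_all add: mor_add pairing_mult_left[OF h] pairing_mult_right[OF h] mor_mult pairing_closed[OF h] pairing_mor2[OF h M N L] mor_comp)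
  fix Y Z \<phi> m k assume "Y \<in> gsets n" "Z \<in> gsets n" "\<phi> \<in> carrier (bhom n (Y \<times>\<^sub>G Z) X)"
      "m \<in> carrier (val M Y)" "k \<in> carrier (val N Z)"
  then show "blift L h X (box_gen n M N X (Y, Z, \<phi>, m, k)) = mor L (Y \<times>\<^sub>G Z) X \<phi> (h Y Z m k)"
    unfolding blift_def using X L
    by (subst box_lift_gen[OF M N mackey_group[OF L X]])
      (simp_all add: mor_add pairing_mult_left[OF h] pairing_mult_right[OF h] mor_mult pairing_closed[OF h] pairing_mor2[OF h M N L] mor_comp)
qed

lemma blift_bid:
  assumes h: "pairing M N L h" and "Y \<in> gsets n" "Z \<in> gsets n" "m \<in> carrier (val M Y)" "k \<in> carrier (val N Z)"
  shows "blift L h (Y \<times>\<^sub>G Z) (tens M N Y Z m k) = h Y Z m k"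
  using assms L by (simp add: blift_gen mor_id pairing_closed[OF h])

lemma blift_nathom:
  assumes h: "pairing M N L h" shows "nathom (box n M N) L (blift L h)"
  unfolding nathom_def
proof (intro conjI ballI)
  fix X assume "X \<in> gsets n" then show "blift L h X \<in> hom (val (box n M N) X) (val L X)" by (rule blift_hom[OF h])
next
  fix X Y b z assume X: "X \<in> gsets n" and Y: "Y \<in> gsets n" and b: "b \<in> carrier (bhom n X Y)"
    and z: "z \<in> carrier (val (box n M N) X)"
  show "blift L h Y (mor (box n M N) X Y b z) = mor L X Y b (blift L h X z)"
  proof (rule box_hom_eq[OF M N mackey_is_group[OF L Y] _ _ _ z])
    show "(\<lambda>z. blift L h Y (mor (box n M N) X Y b z)) \<in> hom (val (box n M N) X) (val L Y)"
      using Group.hom_compose[OF box_mor_hom[OF M N X Y b] blift_hom[OF h Y]] by (simp add: comp_def)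
    show "(\<lambda>z. mor L X Y b (blift L h X z)) \<in> hom (val (box n M N) X) (val L Y)"
      using Group.hom_compose[OF blift_hom[OF h X] mor_hom[OF L X Y b]] by (simp add: comp_def)
  qed (use X Y b L in \<open>simp_all add: box_mor_gen[OF M N] blift_gen[OF h] mor_comp pairing_closed[OF h]\<close>)
qed

text \<open>The structure maps of the box product are defined by formulas on generators. Where such a formula
  comes from a pairing, the map is the \<^const>\<open>blift\<close> of that pairing and hence natural.\<close>

lemma ab_lift_blift:
  assumes h: "pairing M N L h" and X: "X \<in> gsets n" and z: "z \<in> carrier (val (box n M N) X)"
    and F: "\<And>Y Z \<phi> m k. Y \<in> gsets n \<Longrightarrow> Z \<in> gsets n \<Longrightarrow> \<phi> \<in> carrier (bhom n (Y \<times>\<^sub>G Z) X) \<Longrightarrow>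
      m \<in> carrier (val M Y) \<Longrightarrow> k \<in> carrier (val N Z) \<Longrightarrow> F (Y, Z, \<phi>, m, k) = mor L (Y \<times>\<^sub>G Z) X \<phi> (h Y Z m k)"
    and G: "G = val L X"
  shows "ab_lift G F z = blift L h X z"
  unfolding blift_def G
proof (rule ab_lift_cong[OF mackey_group[OF L X] _ _ z[unfolded val_box] box_rels_carrier[OF M N]])
  fix s assume "s \<in> box_gens n M N X"
  then show "F s = (case s of (Y, Z, \<phi>, m, k) \<Rightarrow> mor L (Y \<times>\<^sub>G Z) X \<phi> (h Y Z m k))"
    by (rule box_gensE) (simp add: F)
next
  show "(\<lambda>(Y, Z, \<phi>, m, k). mor L (Y \<times>\<^sub>G Z) X \<phi> (h Y Z m k)) \<in> box_gens n M N X \<rightarrow> carrier (val L X)"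
  proof
    fix s assume "s \<in> box_gens n M N X"
    then show "(case s of (Y, Z, \<phi>, m, k) \<Rightarrow> mor L (Y \<times>\<^sub>G Z) X \<phi> (h Y Z m k)) \<in> carrier (val L X)"
      by (rule box_gensE) (use L X in \<open>simp add: pairing_closed[OF h]\<close>)
  qed
qed

lemma box_nathom_eq:
  assumes f: "nathom (box n M N) L f" and g: "nathom (box n M N) L g"
    and eq: "\<And>Y Z m k. Y \<in> gsets n \<Longrightarrow> Z \<in> gsets n \<Longrightarrow> m \<in> carrier (val M Y) \<Longrightarrow> k \<in> carrier (val N Z) \<Longrightarrow>
      f (Y \<times>\<^sub>G Z) (tens M N Y Z m k) =
      g (Y \<times>\<^sub>G Z) (tens M N Y Z m k)"
    and X: "X \<in> gsets n" and z: "z \<in> carrier (val (box n M N) X)"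
  shows "f X z = g X z"
proof (rule box_hom_eq[OF M N mackey_is_group[OF L X] nathom_hom[OF f X] nathom_hom[OF g X] _ z])
  fix Y Z \<phi> m k assume a: "Y \<in> gsets n" "Z \<in> gsets n" "\<phi> \<in> carrier (bhom n (Y \<times>\<^sub>G Z) X)"
      "m \<in> carrier (val M Y)" "k \<in> carrier (val N Z)"
  show "f X (box_gen n M N X (Y, Z, \<phi>, m, k)) = g X (box_gen n M N X (Y, Z, \<phi>, m, k))"
    unfolding box_gen_bid[OF a(1,2) X a(3-5)]
    using X a by (simp add: nathom_mor[OF f] nathom_mor[OF g] eq)
qed

end

end

lemma nathom_rshift: "nathom L K f \<Longrightarrow> Z \<in> gsets n \<Longrightarrow> nathom (rshift L Z) (rshift K Z) (\<lambda>Y. f (Y \<times>\<^sub>G Z))"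
  and nathom_lshift: "nathom L K f \<Longrightarrow> Z \<in> gsets n \<Longrightarrow> nathom (lshift L Z) (lshift K Z) (\<lambda>Y. f (Z \<times>\<^sub>G Y))"
  by (simp_all add: nathom_def mor_rshift mor_lshift)

lemma pairing_nathom: 
  assumes "pairing M N L h" "nathom L K f" shows "pairing M N K (\<lambda>Y Z m k. f (Y \<times>\<^sub>G Z) (h Y Z m k))"
  unfolding pairing_def
proof (intro conjI ballI)
  fix Z k assume g: "Z \<in> gsets n" "k \<in> carrier (val N Z)"
  then have "nathom M (rshift L Z) (\<lambda>Y m. h Y Z m k)" using assms(1) by (simp add: pairing_def)
  from nathom_comp[OF this nathom_rshift[OF assms(2) g(1)]]
  show "nathom M (rshift K Z) (\<lambda>Y m. f (Y \<times>\<^sub>G Z) (h Y Z m k))" .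
next
  fix Y m assume g: "Y \<in> gsets n" "m \<in> carrier (val M Y)"
  then have "nathom N (lshift L Y) (\<lambda>Z k. h Y Z m k)" using assms(1) by (simp add: pairing_def)
  from nathom_comp[OF this nathom_lshift[OF assms(2) g(1)]]
  show "nathom N (lshift K Y) (\<lambda>Z k. f (Y \<times>\<^sub>G Z) (h Y Z m k))" .
qed

lemma pairing_comp:
  assumes h: "pairing M' N' L h" and f: "nathom M M' f" and g: "nathom N N' g"
  shows "pairing M N L (\<lambda>Y Z m k. h Y Z (f Y m) (g Z k))"
  unfolding pairing_def
proof (intro conjI ballI)
  fix Z k assume "Z \<in> gsets n" "k \<in> carrier (val N Z)"
  then show "nathom M (rshift L Z) (\<lambda>Y m. h Y Z (f Y m) (g Z k))"
    using h nathom_closed[OF g] by (intro nathom_comp[OF f, where g = "\<lambda>Y m. h Y Z m (g Z k)"]) (simp add: pairing_def)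
next
  fix Y m assume "Y \<in> gsets n" "m \<in> carrier (val M Y)"
  then show "nathom N (lshift L Y) (\<lambda>Z k. h Y Z (f Y m) (g Z k))"
    using h nathom_closed[OF f] by (intro nathom_comp[OF g, where g = "\<lambda>Z k. h Y Z (f Y m) k"]) (simp add: pairing_def)
qed

text \<open>The symmetry: a pairing on \<open>N\<close> and \<open>M\<close> gives one on \<open>M\<close> and \<open>N\<close>, by transfer along the bijection
  that exchanges the factors.\<close>

lemma pairing_swap:
  assumes h: "pairing N M L h" and M: "mackey_functor n M" and N: "mackey_functor n N" and L: "mackey_functor n L"
  shows "pairing M N L (\<lambda>Y Z m k. tra n L (Z \<times>\<^sub>G Y) (Y \<times>\<^sub>G Z) flip (h Z Y k m))"
proof (rule pairingI[OF M N L])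
  fix Y Z m k assume g: "Y \<in> gsets n" "Z \<in> gsets n" "m \<in> carrier (val M Y)" "k \<in> carrier (val N Z)"
  then show "tra n L (Z \<times>\<^sub>G Y) (Y \<times>\<^sub>G Z) flip (h Z Y k m) \<in> carrier (val L (Y \<times>\<^sub>G Z))"
    using L by (simp add: eqv_def pairing_closed[OF h])
next
  fix Y Z m m' k assume g: "Y \<in> gsets n" "Z \<in> gsets n" "m \<in> carrier (val M Y)" "m' \<in> carrier (val M Y)" "k \<in> carrier (val N Z)"
  then show "tra n L (Z \<times>\<^sub>G Y) (Y \<times>\<^sub>G Z) flip (h Z Y k (m \<otimes>\<^bsub>val M Y\<^esub> m')) =
     tra n L (Z \<times>\<^sub>G Y) (Y \<times>\<^sub>G Z) flip (h Z Y k m) \<otimes>\<^bsub>val L (Y \<times>\<^sub>G Z)\<^esub>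
     tra n L (Z \<times>\<^sub>G Y) (Y \<times>\<^sub>G Z) flip (h Z Y k m')"
    using L by (simp add: eqv_def pairing_closed[OF h] pairing_mult_right[OF h] tra_mult)
next
  fix Y Z m k k' assume g: "Y \<in> gsets n" "Z \<in> gsets n" "m \<in> carrier (val M Y)" "k' \<in> carrier (val N Z)" "k \<in> carrier (val N Z)"
  then show "tra n L (Z \<times>\<^sub>G Y) (Y \<times>\<^sub>G Z) flip (h Z Y (k \<otimes>\<^bsub>val N Z\<^esub> k') m) =
     tra n L (Z \<times>\<^sub>G Y) (Y \<times>\<^sub>G Z) flip (h Z Y k m) \<otimes>\<^bsub>val L (Y \<times>\<^sub>G Z)\<^esub>
     tra n L (Z \<times>\<^sub>G Y) (Y \<times>\<^sub>G Z) flip (h Z Y k' m)"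
    using L by (simp add: eqv_def pairing_closed[OF h] pairing_mult_left[OF h] tra_mult)
next
  fix Y Y' Z f m k assume g: "Y \<in> gsets n" "Y' \<in> gsets n" "Z \<in> gsets n" "eqv n Y Y' f" "m \<in> carrier (val M Y)" "k \<in> carrier (val N Z)"
  then show "tra n L (Z \<times>\<^sub>G Y') (Y' \<times>\<^sub>G Z) flip (h Z Y' k (tra n M Y Y' f m)) =
     tra n L (Y \<times>\<^sub>G Z) (Y' \<times>\<^sub>G Z) (on_fst f) (tra n L (Z \<times>\<^sub>G Y) (Y \<times>\<^sub>G Z) flip (h Z Y k m))"
    using L by (simp add: eqv_def pairing_closed[OF h] pairing_tra_right[OF h] tra_tra)
next
  fix Y Y' Z f m k assume g: "Y \<in> gsets n" "Y' \<in> gsets n" "Z \<in> gsets n" "eqv n Y Y' f" "m \<in> carrier (val M Y')" "k \<in> carrier (val N Z)"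
  then show "tra n L (Z \<times>\<^sub>G Y) (Y \<times>\<^sub>G Z) flip (h Z Y k (res n M Y Y' f m)) =
     res n L (Y \<times>\<^sub>G Z) (Y' \<times>\<^sub>G Z) (on_fst f) (tra n L (Z \<times>\<^sub>G Y') (Y' \<times>\<^sub>G Z) flip (h Z Y' k m))"
    using L by (subst base_change[where W = "Z \<times>\<^sub>G Y" and ?w1.0 = "on_snd f" and ?w2.0 = flip])
      (simp_all add: eqv_def pairing_closed[OF h] pairing_res_right[OF h])
next
  fix Y Z Z' f m k assume g: "Y \<in> gsets n" "Z \<in> gsets n" "Z' \<in> gsets n" "eqv n Z Z' f" "m \<in> carrier (val M Y)" "k \<in> carrier (val N Z)"
  then show "tra n L (Z' \<times>\<^sub>G Y) (Y \<times>\<^sub>G Z') flip (h Z' Y (tra n N Z Z' f k) m) =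
     tra n L (Y \<times>\<^sub>G Z) (Y \<times>\<^sub>G Z') (on_snd f) (tra n L (Z \<times>\<^sub>G Y) (Y \<times>\<^sub>G Z) flip (h Z Y k m))"
    using L by (simp add: eqv_def pairing_closed[OF h] pairing_tra_left[OF h] tra_tra)
next
  fix Y Z Z' f m k assume g: "Y \<in> gsets n" "Z \<in> gsets n" "Z' \<in> gsets n" "eqv n Z Z' f" "m \<in> carrier (val M Y)" "k \<in> carrier (val N Z')"
  then show "tra n L (Z \<times>\<^sub>G Y) (Y \<times>\<^sub>G Z) flip (h Z Y (res n N Z Z' f k) m) =
     res n L (Y \<times>\<^sub>G Z) (Y \<times>\<^sub>G Z') (on_snd f) (tra n L (Z' \<times>\<^sub>G Y) (Y \<times>\<^sub>G Z') flip (h Z' Y k m))"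
    using L by (subst base_change[where W = "Z \<times>\<^sub>G Y" and ?w1.0 = "on_fst f" and ?w2.0 = flip])
      (simp_all add: eqv_def pairing_closed[OF h] pairing_res_left[OF h])
qed



context
  fixes M :: "('m, 'x) mackey_scheme" and N :: "('k, 'y) mackey_scheme"
    and M' :: "('m1, 'x1) mackey_scheme" and N' :: "('k1, 'y1) mackey_scheme"
  assumes M: "mackey_functor n M" and N: "mackey_functor n N"
    and M': "mackey_functor n M'" and N': "mackey_functor n N'"
begin

text \<open>The formula on generators is that of the pairing \<open>(m, k) \<mapsto> f(m) \<otimes> h(k)\<close>.\<close>

lemma
  assumes f: "nathom M M' f" and h: "nathom N N' h"
  shows box_map_nathom: "nathom (box n M N) (box n M' N') (box_map n M' N' f h)"
    and box_map_gen: "\<And>X Y Z \<phi> m k. X \<in> gsets n \<Longrightarrow> Y \<in> gsets n \<Longrightarrow> Z \<in> gsets n \<Longrightarrow> \<phi> \<in> carrier (bhom n (Y \<times>\<^sub>G Z) X) \<Longrightarrow>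
      m \<in> carrier (val M Y) \<Longrightarrow> k \<in> carrier (val N Z) \<Longrightarrow>
      box_map n M' N' f h X (box_gen n M N X (Y, Z, \<phi>, m, k)) = box_gen n M' N' X (Y, Z, \<phi>, f Y m, h Z k)"
proof -
  let ?h = "\<lambda>Y Z m k. tens M' N' Y Z (f Y m) (h Z k)"
  have p: "pairing M N (box n M' N') ?h"
    using pairing_comp[OF box_gen_pairing[OF M' N'] f h] .
  note B = box_mackey[OF M' N']
  have g: "box_gen n M' N' X (Y, Z, \<phi>, f Y m, h Z k) = mor (box n M' N') (Y \<times>\<^sub>G Z) X \<phi> (?h Y Z m k)"
    if "X \<in> gsets n" "Y \<in> gsets n" "Z \<in> gsets n" "\<phi> \<in> carrier (bhom n (Y \<times>\<^sub>G Z) X)" "m \<in> carrier (val M Y)" "k \<in> carrier (val N Z)"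
    for X Y Z \<phi> m k
    using that by (intro box_gen_bid[OF M' N'] nathom_closed[OF f] nathom_closed[OF h])
  have e: "box_map n M' N' f h X z = blift (box n M' N') ?h X z"
    if "X \<in> gsets n" "z \<in> carrier (val (box n M N) X)" for X z
    unfolding box_map_def by (rule ab_lift_blift[OF M N B p that], unfold prod.case, rule g[OF that(1)]) simp_all
  show "nathom (box n M N) (box n M' N') (box_map n M' N' f h)"
    using nathom_cong[OF blift_nathom[OF M N B p] e box_mackey[OF M N]] .
  show "box_map n M' N' f h X (box_gen n M N X (Y, Z, \<phi>, m, k)) = box_gen n M' N' X (Y, Z, \<phi>, f Y m, h Z k)"
    if "X \<in> gsets n" "Y \<in> gsets n" "Z \<in> gsets n" "\<phi> \<in> carrier (bhom n (Y \<times>\<^sub>G Z) X)" "m \<in> carrier (val M Y)" "k \<in> carrier (val N Z)"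
    for X Y Z \<phi> m k
    using that by (subst g) (simp_all add: e blift_gen[OF M N B p])
qed

end

context
  fixes M :: "('m, 'x) mackey_scheme" and N :: "('k, 'y) mackey_scheme"
  assumes M: "mackey_functor n M" and N: "mackey_functor n N"
begin

text \<open>The formula on generators is that of the universal pairing with its variables exchanged.\<close>

lemma
  shows box_sym_nathom: "nathom (box n M N) (box n N M) (box_sym n M N)"
    and box_sym_gen: "\<And>X Y Z \<phi> m k. X \<in> gsets n \<Longrightarrow> Y \<in> gsets n \<Longrightarrow> Z \<in> gsets n \<Longrightarrow> \<phi> \<in> carrier (bhom n (Y \<times>\<^sub>G Z) X) \<Longrightarrow>
      m \<in> carrier (val M Y) \<Longrightarrow> k \<in> carrier (val N Z) \<Longrightarrow>
      box_sym n M N X (box_gen n M N X (Y, Z, \<phi>, m, k)) = mor (box n N M) (Y \<times>\<^sub>G Z) X \<phi>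
        (tra n (box n N M) (Z \<times>\<^sub>G Y) (Y \<times>\<^sub>G Z) flip
          (tens N M Z Y k m))"
proof -
  note B = box_mackey[OF N M]
  let ?h = "\<lambda>Y Z m k. tra n (box n N M) (Z \<times>\<^sub>G Y) (Y \<times>\<^sub>G Z) flip
          (tens N M Z Y k m)"
  have p: "pairing M N (box n N M) ?h" by (rule pairing_swap[OF box_gen_pairing[OF N M] M N B])
  have e: "box_sym n M N X z = blift (box n N M) ?h X z"
    if "X \<in> gsets n" "z \<in> carrier (val (box n M N) X)" for X z
    unfolding box_sym_def
    by (rule ab_lift_blift[OF M N B p that])
      (use that(1) in \<open>simp_all add: tra_def box_mor_gen[OF N M] bcomp_id_left eqv_def\<close>)
  show "nathom (box n M N) (box n N M) (box_sym n M N)"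
    using nathom_cong[OF blift_nathom[OF M N B p] e box_mackey[OF M N]] .
  show "box_sym n M N X (box_gen n M N X (Y, Z, \<phi>, m, k)) = mor (box n N M) (Y \<times>\<^sub>G Z) X \<phi> (?h Y Z m k)"
    if "X \<in> gsets n" "Y \<in> gsets n" "Z \<in> gsets n" "\<phi> \<in> carrier (bhom n (Y \<times>\<^sub>G Z) X)" "m \<in> carrier (val M Y)" "k \<in> carrier (val N Z)"
    for X Y Z \<phi> m k
    using that by (simp add: e blift_gen[OF M N B p])
qed

end

subsection \<open>Associativity\<close>

text \<open>From pairings \<open>p\<close> on \<open>L\<close>, \<open>Q\<close> and \<open>q\<close> on \<open>M\<close>, \<open>N\<close> with values in \<open>Q\<close>, the map \<open>p(l, q(m, k))\<close>
  rebracketed to be a pairing in \<open>l\<close> and \<open>m\<close> for fixed \<open>k\<close>; \<open>pairL\<close> is its mirror image. They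
  describe homomorphisms out of a threefold box product.\<close>

definition pairR :: "('r, 'v) mackey_scheme \<Rightarrow> (gset \<Rightarrow> gset \<Rightarrow> 'l \<Rightarrow> 'q \<Rightarrow> 'r) \<Rightarrow> (gset \<Rightarrow> gset \<Rightarrow> 'm \<Rightarrow> 'k \<Rightarrow> 'q) \<Rightarrow>
    gset \<Rightarrow> 'k \<Rightarrow> gset \<Rightarrow> gset \<Rightarrow> 'l \<Rightarrow> 'm \<Rightarrow> 'r" where
  "pairR K p q Z k Y V l m = tra n K (Y \<times>\<^sub>G (V \<times>\<^sub>G Z)) ((Y \<times>\<^sub>G V) \<times>\<^sub>G Z) assocR (p Y (V \<times>\<^sub>G Z) l (q V Z m k))"

definition pairL :: "('r, 'v) mackey_scheme \<Rightarrow> (gset \<Rightarrow> gset \<Rightarrow> 'q \<Rightarrow> 'k \<Rightarrow> 'r) \<Rightarrow> (gset \<Rightarrow> gset \<Rightarrow> 'l \<Rightarrow> 'm \<Rightarrow> 'q) \<Rightarrow>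
    gset \<Rightarrow> 'l \<Rightarrow> gset \<Rightarrow> gset \<Rightarrow> 'm \<Rightarrow> 'k \<Rightarrow> 'r" where
  "pairL K p q Y l V Z m k = tra n K ((Y \<times>\<^sub>G V) \<times>\<^sub>G Z) (Y \<times>\<^sub>G (V \<times>\<^sub>G Z)) assocL (p (Y \<times>\<^sub>G V) Z (q Y V l m) k)"

lemma bprod_interchange:
  assumes "Y \<in> gsets n" "Y' \<in> gsets n" "Z \<in> gsets n" "Z' \<in> gsets n" "a \<in> carrier (bhom n Y Y')" "b \<in> carrier (bhom n Z Z')"
    "mackey_functor n K" "x \<in> carrier (val K (Y \<times>\<^sub>G Z))"
  shows "mor K (Y \<times>\<^sub>G Z') (Y' \<times>\<^sub>G Z') (bprod n Y Y' Z' Z' a (bid n Z')) (mor K (Y \<times>\<^sub>G Z) (Y \<times>\<^sub>G Z') (bprod n Y Y Z Z' (bid n Y) b) x) =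
    mor K (Y' \<times>\<^sub>G Z) (Y' \<times>\<^sub>G Z') (bprod n Y' Y' Z Z' (bid n Y') b) (mor K (Y \<times>\<^sub>G Z) (Y' \<times>\<^sub>G Z) (bprod n Y Y' Z Z a (bid n Z)) x)"
  using assms by (simp add: mor_comp bprod_bcomp[symmetric] bcomp_id_left bcomp_id_right)

context
  fixes L :: "('l, 'w) mackey_scheme" and M :: "('m, 'x) mackey_scheme" and N :: "('k, 'y) mackey_scheme"
    and Q :: "('q, 'z) mackey_scheme" and K :: "('r, 'v) mackey_scheme"
    and p :: "gset \<Rightarrow> gset \<Rightarrow> 'l \<Rightarrow> 'q \<Rightarrow> 'r" and q :: "gset \<Rightarrow> gset \<Rightarrow> 'm \<Rightarrow> 'k \<Rightarrow> 'q"
  assumes L: "mackey_functor n L" and M: "mackey_functor n M" and N: "mackey_functor n N"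
    and Q: "mackey_functor n Q" and K: "mackey_functor n K"
    and p: "pairing L Q K p" and q: "pairing M N Q q"
begin

lemma pairR_closed: "Y \<in> gsets n \<Longrightarrow> V \<in> gsets n \<Longrightarrow> Z \<in> gsets n \<Longrightarrow> l \<in> carrier (val L Y) \<Longrightarrow>
    m \<in> carrier (val M V) \<Longrightarrow> k \<in> carrier (val N Z) \<Longrightarrow> pairR K p q Z k Y V l m \<in> carrier (val K ((Y \<times>\<^sub>G V) \<times>\<^sub>G Z))"
  using K by (simp add: pairR_def pairing_closed[OF p] pairing_closed[OF q] eqv_def)

lemma pairR_pairing:
  assumes Z: "Z \<in> gsets n" and k: "k \<in> carrier (val N Z)"
  shows "pairing L M (rshift K Z) (pairR K p q Z k)"
proof (rule pairingI[OF L M mackey_rshift[OF K Z]])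
  fix Y Y' V f l m assume g: "Y \<in> gsets n" "Y' \<in> gsets n" "V \<in> gsets n" "eqv n Y Y' f" "l \<in> carrier (val L Y')" "m \<in> carrier (val M V)"
  then show "pairR K p q Z k Y V (res n L Y Y' f l) m =
     res n (rshift K Z) (Y \<times>\<^sub>G V) (Y' \<times>\<^sub>G V) (on_fst f) (pairR K p q Z k Y' V l m)"
    using K Z k unfolding pairR_def
    by (simp add: res_rshift eqv_def)
      (subst base_change[where W = "Y \<times>\<^sub>G (V \<times>\<^sub>G Z)" and ?w1.0 = "on_fst f" and ?w2.0 = assocR],
        simp_all add: eqv_def pairing_closed[OF p] pairing_closed[OF q] pairing_res_left[OF p])
next
  fix Y V V' f l m assume g: "Y \<in> gsets n" "V \<in> gsets n" "V' \<in> gsets n" "eqv n V V' f" "l \<in> carrier (val L Y)" "m \<in> carrier (val M V')"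
  then show "pairR K p q Z k Y V l (res n M V V' f m) =
     res n (rshift K Z) (Y \<times>\<^sub>G V) (Y \<times>\<^sub>G V') (on_snd f) (pairR K p q Z k Y V' l m)"
    using K Z k unfolding pairR_def
    by (simp add: res_rshift eqv_def)
      (subst base_change[where W = "Y \<times>\<^sub>G (V \<times>\<^sub>G Z)" and ?w1.0 = "\<lambda>w. PPair (pfst w) (PPair (f (pfst (psnd w))) (psnd (psnd w)))" and ?w2.0 = assocR],
        simp_all add: eqv_def pairing_closed[OF p] pairing_closed[OF q] pairing_res_right[OF p] pairing_res_left[OF q])
qed (use K Z k in \<open>simp_all add: pairR_def pairing_closed[OF p] pairing_closed[OF q] eqv_def tra_rshift tra_tra
      pairing_tra_left[OF p] pairing_tra_right[OF p] pairing_tra_left[OF q] pairing_mult_left[OF p] pairing_mult_left[OF q] pairing_mult_right[OF p] tra_mult\<close>)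

lemma pairR_nathom:
  assumes g: "Y \<in> gsets n" "V \<in> gsets n" "l \<in> carrier (val L Y)" "m \<in> carrier (val M V)"
  shows "nathom N (lshift K (Y \<times>\<^sub>G V)) (\<lambda>Z k. pairR K p q Z k Y V l m)"
proof (rule nathomI[OF N mackey_lshift[OF K gprod_gset[OF g(1,2)]]])
  fix Z assume "Z \<in> gsets n"
  then show "(\<lambda>k. pairR K p q Z k Y V l m) \<in> hom (val N Z) (val (lshift K (Y \<times>\<^sub>G V)) Z)"
    using g K by (intro homI) (simp_all add: pairR_def eqv_def pairing_closed[OF p] pairing_closed[OF q] pairing_mult_right[OF q] pairing_mult_right[OF p] tra_mult)
next
  fix Z Z' f k assume z: "Z \<in> gsets n" "Z' \<in> gsets n" "eqv n Z Z' f" "k \<in> carrier (val N Z')"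
  then show "pairR K p q Z (res n N Z Z' f k) Y V l m = res n (lshift K (Y \<times>\<^sub>G V)) Z Z' f (pairR K p q Z' k Y V l m)"
    using K g unfolding pairR_def
    by (simp add: res_lshift eqv_def)
      (subst base_change[where W = "Y \<times>\<^sub>G (V \<times>\<^sub>G Z)" and ?w1.0 = "\<lambda>w. PPair (pfst w) (PPair (pfst (psnd w)) (f (psnd (psnd w))))" and ?w2.0 = assocR],
        simp_all add: eqv_def pairing_closed[OF p] pairing_closed[OF q] pairing_res_right[OF p] pairing_res_right[OF q])
qed (use K g in \<open>simp_all add: pairR_def pairing_closed[OF p] pairing_closed[OF q] eqv_def tra_lshift tra_tra
      pairing_tra_right[OF p] pairing_tra_right[OF q]\<close>)

text \<open>The pairings in \<open>l\<close> and \<open>m\<close> for varying \<open>k\<close> lift to the box product of \<open>L\<close> and \<open>M\<close>; additivity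
  and naturality in \<open>k\<close> of the lifts are compared on generators, where they are those of \<open>p\<close> and
  \<open>q\<close>.\<close>

lemma boxR_pairing: "pairing (box n L M) N K (\<lambda>U Z t k. blift (rshift K Z) (pairR K p q Z k) U t)"
  unfolding pairing_def
proof (intro conjI ballI)
  fix Z k assume "Z \<in> gsets n" "k \<in> carrier (val N Z)"
  then show "nathom (box n L M) (rshift K Z) (\<lambda>U t. blift (rshift K Z) (pairR K p q Z k) U t)"
    using blift_nathom[OF L M mackey_rshift[OF K] pairR_pairing] by simp
next
  fix U t assume U: "U \<in> gsets n" and t: "t \<in> carrier (val (box n L M) U)"
  note bl = blift_gen[OF L M mackey_rshift[OF K] pairR_pairing]
  note bh = blift_hom[OF L M mackey_rshift[OF K] pairR_pairing]
  show "nathom N (lshift K U) (\<lambda>Z k. blift (rshift K Z) (pairR K p q Z k) U t)"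
    unfolding nathom_def
  proof (intro conjI ballI homI)
    fix Z k assume Z: "Z \<in> gsets n" and k: "k \<in> carrier (val N Z)"
    show "blift (rshift K Z) (pairR K p q Z k) U t \<in> carrier (val (lshift K U) Z)"
      using hom_in_carrier[OF bh[OF Z Z k U] t] by simp
    fix k' assume k': "k' \<in> carrier (val N Z)"
    have kk: "k \<otimes>\<^bsub>val N Z\<^esub> k' \<in> carrier (val N Z)" using N Z k k' by simp
    interpret C: comm_group "val K (U \<times>\<^sub>G Z)" using mackey_group[OF K] U Z by simp
    have "blift (rshift K Z) (pairR K p q Z (k \<otimes>\<^bsub>val N Z\<^esub> k')) U t = blift (rshift K Z) (pairR K p q Z k) U t \<otimes>\<^bsub>val K (U \<times>\<^sub>G Z)\<^esub> blift (rshift K Z) (pairR K p q Z k') U t"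
    proof (rule box_hom_eq[OF L M C.is_group _ _ _ t])
      show "blift (rshift K Z) (pairR K p q Z (k \<otimes>\<^bsub>val N Z\<^esub> k')) U \<in> hom (val (box n L M) U) (val K (U \<times>\<^sub>G Z))"
        using bh[OF Z Z kk U] by simp
      show "(\<lambda>t. blift (rshift K Z) (pairR K p q Z k) U t \<otimes>\<^bsub>val K (U \<times>\<^sub>G Z)\<^esub> blift (rshift K Z) (pairR K p q Z k') U t) \<in> hom (val (box n L M) U) (val K (U \<times>\<^sub>G Z))"
        by (rule C.hom_group_mult) (use bh[OF Z Z k U] bh[OF Z Z k' U] in simp_all)
      fix Y V \<psi> l m assume a: "Y \<in> gsets n" "V \<in> gsets n" "\<psi> \<in> carrier (bhom n (Y \<times>\<^sub>G V) U)" "l \<in> carrier (val L Y)" "m \<in> carrier (val M V)"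
      then show "blift (rshift K Z) (pairR K p q Z (k \<otimes>\<^bsub>val N Z\<^esub> k')) U (box_gen n L M U (Y, V, \<psi>, l, m)) =
        blift (rshift K Z) (pairR K p q Z k) U (box_gen n L M U (Y, V, \<psi>, l, m)) \<otimes>\<^bsub>val K (U \<times>\<^sub>G Z)\<^esub> blift (rshift K Z) (pairR K p q Z k') U (box_gen n L M U (Y, V, \<psi>, l, m))"
        using nathom_mult[OF pairR_nathom[OF a(1,2,4,5)] Z k k'] K U Z
        by (simp add: bl[OF Z Z k U] bl[OF Z Z k' U] bl[OF Z Z kk U] mor_rshift mor_mult pairR_closed k k')
    qed
    then show "blift (rshift K Z) (pairR K p q Z (k \<otimes>\<^bsub>val N Z\<^esub> k')) U t = blift (rshift K Z) (pairR K p q Z k) U t \<otimes>\<^bsub>val (lshift K U) Z\<^esub> blift (rshift K Z) (pairR K p q Z k') U t"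
      by simp
  next
    fix Z Z' b k assume Z: "Z \<in> gsets n" "Z' \<in> gsets n" and b: "b \<in> carrier (bhom n Z Z')" and k: "k \<in> carrier (val N Z)"
    have bk: "mor N Z Z' b k \<in> carrier (val N Z')" using N Z k b by simp
    let ?m = "mor K (U \<times>\<^sub>G Z) (U \<times>\<^sub>G Z') (bprod n U U Z Z' (bid n U) b)"
    have mh: "?m \<in> hom (val K (U \<times>\<^sub>G Z)) (val K (U \<times>\<^sub>G Z'))" using K U Z b by (intro mor_hom) simp_all
    have "blift (rshift K Z') (pairR K p q Z' (mor N Z Z' b k)) U t = ?m (blift (rshift K Z) (pairR K p q Z k) U t)"
    proof (rule box_hom_eq[OF L M _ _ _ _ t])
      show "group (val K (U \<times>\<^sub>G Z'))" using mackey_is_group[OF K] U Z by simp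
      show "blift (rshift K Z') (pairR K p q Z' (mor N Z Z' b k)) U \<in> hom (val (box n L M) U) (val K (U \<times>\<^sub>G Z'))"
        using bh[OF Z(2,2) bk U] by simp
      show "(\<lambda>t. ?m (blift (rshift K Z) (pairR K p q Z k) U t)) \<in> hom (val (box n L M) U) (val K (U \<times>\<^sub>G Z'))"
        using Group.hom_compose[OF bh[OF Z(1,1) k U, unfolded val_rshift] mh] by (simp add: comp_def)
      fix Y V \<psi> l m assume a: "Y \<in> gsets n" "V \<in> gsets n" "\<psi> \<in> carrier (bhom n (Y \<times>\<^sub>G V) U)" "l \<in> carrier (val L Y)" "m \<in> carrier (val M V)"
      then show "blift (rshift K Z') (pairR K p q Z' (mor N Z Z' b k)) U (box_gen n L M U (Y, V, \<psi>, l, m)) =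
        ?m (blift (rshift K Z) (pairR K p q Z k) U (box_gen n L M U (Y, V, \<psi>, l, m)))"
        using nathom_mor[OF pairR_nathom[OF a(1,2,4,5)] Z b k] K U Z
        by (simp add: bl[OF Z(1,1) k U] bl[OF Z(2,2) bk U] mor_rshift mor_lshift bprod_interchange b pairR_closed k)
    qed
    then show "blift (rshift K Z') (pairR K p q Z' (mor N Z Z' b k)) U t = mor (lshift K U) Z Z' b (blift (rshift K Z) (pairR K p q Z k) U t)"
      by (simp add: mor_lshift)
  qed
qed

end


context
  fixes L :: "('l, 'w) mackey_scheme" and M :: "('m, 'x) mackey_scheme" and N :: "('k, 'y) mackey_scheme"
    and Q :: "('q, 'z) mackey_scheme" and K :: "('r, 'v) mackey_scheme"
    and p :: "gset \<Rightarrow> gset \<Rightarrow> 'q \<Rightarrow> 'k \<Rightarrow> 'r" and q :: "gset \<Rightarrow> gset \<Rightarrow> 'l \<Rightarrow> 'm \<Rightarrow> 'q"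
  assumes L: "mackey_functor n L" and M: "mackey_functor n M" and N: "mackey_functor n N"
    and Q: "mackey_functor n Q" and K: "mackey_functor n K"
    and p: "pairing Q N K p" and q: "pairing L M Q q"
begin

lemma pairL_closed: "Y \<in> gsets n \<Longrightarrow> V \<in> gsets n \<Longrightarrow> Z \<in> gsets n \<Longrightarrow> l \<in> carrier (val L Y) \<Longrightarrow>
    m \<in> carrier (val M V) \<Longrightarrow> k \<in> carrier (val N Z) \<Longrightarrow> pairL K p q Y l V Z m k \<in> carrier (val K (Y \<times>\<^sub>G (V \<times>\<^sub>G Z)))"
  using K by (simp add: pairL_def pairing_closed[OF p] pairing_closed[OF q] eqv_def)

lemma pairL_pairing:
  assumes Y: "Y \<in> gsets n" and l: "l \<in> carrier (val L Y)"
  shows "pairing M N (lshift K Y) (pairL K p q Y l)"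
proof (rule pairingI[OF M N mackey_lshift[OF K Y]])
  fix Z Z' V f k m assume g: "V \<in> gsets n" "Z \<in> gsets n" "Z' \<in> gsets n" "eqv n Z Z' f" "m \<in> carrier (val M V)" "k \<in> carrier (val N Z')"
  then show "pairL K p q Y l V Z m (res n N Z Z' f k) =
     res n (lshift K Y) (V \<times>\<^sub>G Z) (V \<times>\<^sub>G Z') (on_snd f) (pairL K p q Y l V Z' m k)"
    using K Y l unfolding pairL_def
    by (simp add: res_lshift eqv_def)
      (subst base_change[where W = "(Y \<times>\<^sub>G V) \<times>\<^sub>G Z" and ?w1.0 = "on_snd f" and ?w2.0 = assocL],
        simp_all add: eqv_def pairing_closed[OF p] pairing_closed[OF q] pairing_res_right[OF p])
next
  fix Z V V' f k m assume g: "V \<in> gsets n" "V' \<in> gsets n" "Z \<in> gsets n" "eqv n V V' f" "m \<in> carrier (val M V')" "k \<in> carrier (val N Z)"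
  then show "pairL K p q Y l V Z (res n M V V' f m) k =
     res n (lshift K Y) (V \<times>\<^sub>G Z) (V' \<times>\<^sub>G Z) (on_fst f) (pairL K p q Y l V' Z m k)"
    using K Y l unfolding pairL_def
    by (simp add: res_lshift eqv_def)
      (subst base_change[where W = "(Y \<times>\<^sub>G V) \<times>\<^sub>G Z" and ?w1.0 = "\<lambda>w. PPair (PPair (pfst (pfst w)) (f (psnd (pfst w)))) (psnd w)" and ?w2.0 = assocL],
        simp_all add: eqv_def pairing_closed[OF p] pairing_closed[OF q] pairing_res_left[OF p] pairing_res_right[OF q])
qed (use K Y l in \<open>simp_all add: pairL_def pairing_closed[OF p] pairing_closed[OF q] eqv_def tra_lshift tra_tra
      pairing_tra_left[OF p] pairing_tra_right[OF p] pairing_tra_right[OF q] pairing_mult_right[OF p] pairing_mult_right[OF q] pairing_mult_left[OF p] tra_mult\<close>)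

lemma pairL_nathom:
  assumes g: "V \<in> gsets n" "Z \<in> gsets n" "m \<in> carrier (val M V)" "k \<in> carrier (val N Z)"
  shows "nathom L (rshift K (V \<times>\<^sub>G Z)) (\<lambda>Y l. pairL K p q Y l V Z m k)"
proof (rule nathomI[OF L mackey_rshift[OF K gprod_gset[OF g(1,2)]]])
  fix Y assume "Y \<in> gsets n"
  then show "(\<lambda>l. pairL K p q Y l V Z m k) \<in> hom (val L Y) (val (rshift K (V \<times>\<^sub>G Z)) Y)"
    using g K by (intro homI) (simp_all add: pairL_def eqv_def pairing_closed[OF p] pairing_closed[OF q] pairing_mult_left[OF q] pairing_mult_left[OF p] tra_mult)
next
  fix Y Y' f l assume z: "Y \<in> gsets n" "Y' \<in> gsets n" "eqv n Y Y' f" "l \<in> carrier (val L Y')"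
  then show "pairL K p q Y (res n L Y Y' f l) V Z m k = res n (rshift K (V \<times>\<^sub>G Z)) Y Y' f (pairL K p q Y' l V Z m k)"
    using K g unfolding pairL_def
    by (simp add: res_rshift eqv_def)
      (subst base_change[where W = "(Y \<times>\<^sub>G V) \<times>\<^sub>G Z" and ?w1.0 = "\<lambda>w. PPair (PPair (f (pfst (pfst w))) (psnd (pfst w))) (psnd w)" and ?w2.0 = assocL],
        simp_all add: eqv_def pairing_closed[OF p] pairing_closed[OF q] pairing_res_left[OF p] pairing_res_left[OF q])
qed (use K g in \<open>simp_all add: pairL_def pairing_closed[OF p] pairing_closed[OF q] eqv_def tra_rshift tra_tra
      pairing_tra_left[OF p] pairing_tra_left[OF q]\<close>)

lemma boxL_pairing: "pairing L (box n M N) K (\<lambda>Y U l t. blift (lshift K Y) (pairL K p q Y l) U t)"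
  unfolding pairing_def
proof (intro conjI ballI)
  fix Y l assume "Y \<in> gsets n" "l \<in> carrier (val L Y)"
  then show "nathom (box n M N) (lshift K Y) (\<lambda>U t. blift (lshift K Y) (pairL K p q Y l) U t)"
    using blift_nathom[OF M N mackey_lshift[OF K] pairL_pairing] by simp
next
  fix U t assume U: "U \<in> gsets n" and t: "t \<in> carrier (val (box n M N) U)"
  note bl = blift_gen[OF M N mackey_lshift[OF K] pairL_pairing]
  note bh = blift_hom[OF M N mackey_lshift[OF K] pairL_pairing]
  show "nathom L (rshift K U) (\<lambda>Y l. blift (lshift K Y) (pairL K p q Y l) U t)"
    unfolding nathom_def
  proof (intro conjI ballI homI)
    fix Z k assume Z: "Z \<in> gsets n" and k: "k \<in> carrier (val L Z)"
    show "blift (lshift K Z) (pairL K p q Z k) U t \<in> carrier (val (rshift K U) Z)"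
      using hom_in_carrier[OF bh[OF Z Z k U] t] by simp
    fix k' assume k': "k' \<in> carrier (val L Z)"
    have kk: "k \<otimes>\<^bsub>val L Z\<^esub> k' \<in> carrier (val L Z)" using L Z k k' by simp
    interpret C: comm_group "val K (Z \<times>\<^sub>G U)" using mackey_group[OF K] U Z by simp
    have "blift (lshift K Z) (pairL K p q Z (k \<otimes>\<^bsub>val L Z\<^esub> k')) U t = blift (lshift K Z) (pairL K p q Z k) U t \<otimes>\<^bsub>val K (Z \<times>\<^sub>G U)\<^esub> blift (lshift K Z) (pairL K p q Z k') U t"
    proof (rule box_hom_eq[OF M N C.is_group _ _ _ t])
      show "blift (lshift K Z) (pairL K p q Z (k \<otimes>\<^bsub>val L Z\<^esub> k')) U \<in> hom (val (box n M N) U) (val K (Z \<times>\<^sub>G U))"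
        using bh[OF Z Z kk U] by simp
      show "(\<lambda>t. blift (lshift K Z) (pairL K p q Z k) U t \<otimes>\<^bsub>val K (Z \<times>\<^sub>G U)\<^esub> blift (lshift K Z) (pairL K p q Z k') U t) \<in> hom (val (box n M N) U) (val K (Z \<times>\<^sub>G U))"
        by (rule C.hom_group_mult) (use bh[OF Z Z k U] bh[OF Z Z k' U] in simp_all)
      fix Y V \<psi> l m assume a: "Y \<in> gsets n" "V \<in> gsets n" "\<psi> \<in> carrier (bhom n (Y \<times>\<^sub>G V) U)" "l \<in> carrier (val M Y)" "m \<in> carrier (val N V)"
      then show "blift (lshift K Z) (pairL K p q Z (k \<otimes>\<^bsub>val L Z\<^esub> k')) U (box_gen n M N U (Y, V, \<psi>, l, m)) =
        blift (lshift K Z) (pairL K p q Z k) U (box_gen n M N U (Y, V, \<psi>, l, m)) \<otimes>\<^bsub>val K (Z \<times>\<^sub>G U)\<^esub> blift (lshift K Z) (pairL K p q Z k') U (box_gen n M N U (Y, V, \<psi>, l, m))"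
        using nathom_mult[OF pairL_nathom[OF a(1,2,4,5)] Z k k'] K U Z
        by (simp add: bl[OF Z Z k U] bl[OF Z Z k' U] bl[OF Z Z kk U] mor_lshift mor_mult pairL_closed k k')
    qed
    then show "blift (lshift K Z) (pairL K p q Z (k \<otimes>\<^bsub>val L Z\<^esub> k')) U t = blift (lshift K Z) (pairL K p q Z k) U t \<otimes>\<^bsub>val (rshift K U) Z\<^esub> blift (lshift K Z) (pairL K p q Z k') U t"
      by simp
  next
    fix Z Z' b k assume Z: "Z \<in> gsets n" "Z' \<in> gsets n" and b: "b \<in> carrier (bhom n Z Z')" and k: "k \<in> carrier (val L Z)"
    have bk: "mor L Z Z' b k \<in> carrier (val L Z')" using L Z k b by simp
    let ?m = "mor K (Z \<times>\<^sub>G U) (Z' \<times>\<^sub>G U) (bprod n Z Z' U U b (bid n U))"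
    have mh: "?m \<in> hom (val K (Z \<times>\<^sub>G U)) (val K (Z' \<times>\<^sub>G U))" using K U Z b by (intro mor_hom) simp_all
    have "blift (lshift K Z') (pairL K p q Z' (mor L Z Z' b k)) U t = ?m (blift (lshift K Z) (pairL K p q Z k) U t)"
    proof (rule box_hom_eq[OF M N _ _ _ _ t])
      show "group (val K (Z' \<times>\<^sub>G U))" using mackey_is_group[OF K] U Z by simp
      show "blift (lshift K Z') (pairL K p q Z' (mor L Z Z' b k)) U \<in> hom (val (box n M N) U) (val K (Z' \<times>\<^sub>G U))"
        using bh[OF Z(2,2) bk U] by simp
      show "(\<lambda>t. ?m (blift (lshift K Z) (pairL K p q Z k) U t)) \<in> hom (val (box n M N) U) (val K (Z' \<times>\<^sub>G U))"
        using Group.hom_compose[OF bh[OF Z(1,1) k U, unfolded val_lshift] mh] by (simp add: comp_def)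
      fix Y V \<psi> l m assume a: "Y \<in> gsets n" "V \<in> gsets n" "\<psi> \<in> carrier (bhom n (Y \<times>\<^sub>G V) U)" "l \<in> carrier (val M Y)" "m \<in> carrier (val N V)"
      then show "blift (lshift K Z') (pairL K p q Z' (mor L Z Z' b k)) U (box_gen n M N U (Y, V, \<psi>, l, m)) =
        ?m (blift (lshift K Z) (pairL K p q Z k) U (box_gen n M N U (Y, V, \<psi>, l, m)))"
        using nathom_mor[OF pairL_nathom[OF a(1,2,4,5)] Z b k] K U Z
        by (simp add: bl[OF Z(1,1) k U] bl[OF Z(2,2) bk U] mor_rshift mor_lshift bprod_interchange[symmetric] b pairL_closed k)
    qed
    then show "blift (lshift K Z') (pairL K p q Z' (mor L Z Z' b k)) U t = mor (rshift K U) Z Z' b (blift (lshift K Z) (pairL K p q Z k) U t)"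
      by (simp add: mor_rshift)
  qed
qed

end

text \<open>The associator is defined by two nested lifts, and the inner one has values that the outer
  generator pushes forward. Here \<open>j\<close> is that push-forward.\<close>

lemma ab_lift_blift_comp:
  assumes M: "mackey_functor n M" and N: "mackey_functor n N" and L: "mackey_functor n L" and h: "pairing M N L h"
    and X: "X \<in> gsets n" and G: "comm_group G" and j: "j \<in> hom (val L X) G" and z: "z \<in> carrier (val (box n M N) X)"
    and F: "\<And>Y Z \<phi> m k. Y \<in> gsets n \<Longrightarrow> Z \<in> gsets n \<Longrightarrow> \<phi> \<in> carrier (bhom n (Y \<times>\<^sub>G Z) X) \<Longrightarrow>
      m \<in> carrier (val M Y) \<Longrightarrow> k \<in> carrier (val N Z) \<Longrightarrow> F (Y, Z, \<phi>, m, k) = j (mor L (Y \<times>\<^sub>G Z) X \<phi> (h Y Z m k))"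
  shows "ab_lift G F z = j (blift L h X z)"
proof -
  note hyps = mor_add pairing_mult_left[OF h] pairing_mult_right[OF h] mor_mult pairing_closed[OF h] pairing_mor2[OF h M N L] mor_comp
    hom_mult[OF j] hom_in_carrier[OF j] F
  have hm: "ab_lift G F \<in> hom (val (box n M N) X) G"
    using X L M N by (intro box_lift_hom[OF M N G]) (simp_all add: hyps)
  have "ab_lift G F (box_gen n M N X (Y, Z, \<phi>, m, k)) = F (Y, Z, \<phi>, m, k)"
    if "Y \<in> gsets n" "Z \<in> gsets n" "\<phi> \<in> carrier (bhom n (Y \<times>\<^sub>G Z) X)" "m \<in> carrier (val M Y)" "k \<in> carrier (val N Z)" for Y Z \<phi> m k
    using X L M N that by (intro box_lift_gen[OF M N G]) (simp_all add: hyps)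
  moreover have "(\<lambda>z. j (blift L h X z)) \<in> hom (val (box n M N) X) G"
    using Group.hom_compose[OF blift_hom[OF M N L h X] j] by (simp add: comp_def)
  ultimately show ?thesis using G X z
    by (intro box_hom_eq[OF M N _ hm _ _ z]) (simp_all add: comm_group_def blift_gen[OF M N L h] F)
qed

context
  fixes L :: "('l, 'w) mackey_scheme" and M :: "('m, 'x) mackey_scheme" and N :: "('k, 'y) mackey_scheme"
  assumes L: "mackey_functor n L" and M: "mackey_functor n M" and N: "mackey_functor n N"
begin

text \<open>The associator is the lift of the iterated universal pairing \<open>l \<otimes> (m \<otimes> k)\<close>, rebracketed.\<close>

lemma
  shows box_assoc_nathom: "nathom (box n (box n L M) N) (box n L (box n M N)) (box_assoc n L M N)"
    and box_assoc_gen: "\<And>Y V Z l m k. Y \<in> gsets n \<Longrightarrow> V \<in> gsets n \<Longrightarrow> Z \<in> gsets n \<Longrightarrow>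
      l \<in> carrier (val L Y) \<Longrightarrow> m \<in> carrier (val M V) \<Longrightarrow> k \<in> carrier (val N Z) \<Longrightarrow>
      box_assoc n L M N ((Y \<times>\<^sub>G V) \<times>\<^sub>G Z) (tens (box n L M) N (Y \<times>\<^sub>G V) Z (tens L M Y V l m) k) =
      tra n (box n L (box n M N)) (Y \<times>\<^sub>G (V \<times>\<^sub>G Z)) ((Y \<times>\<^sub>G V) \<times>\<^sub>G Z) assocR
        (tens L (box n M N) Y (V \<times>\<^sub>G Z) l (tens M N V Z m k))"
proof -
  let ?MN = "box n M N" let ?K = "box n L ?MN" let ?LM = "box n L M"
  let ?p = "\<lambda>Y Z m k. tens L ?MN Y Z m k"
  let ?q = "\<lambda>Y Z m k. tens M N Y Z m k"
  note MN = box_mackey[OF M N] note K = box_mackey[OF L MN] note LM = box_mackey[OF L M]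
  note ctx = L M N MN K box_gen_pairing[OF L MN] box_gen_pairing[OF M N]
  let ?h = "\<lambda>U Z t k. blift (rshift ?K Z) (pairR ?K ?p ?q Z k) U t"
  have pr: "pairing ?LM N ?K ?h" by (rule boxR_pairing[OF ctx])
  have pR: "pairing L M (rshift ?K Z) (pairR ?K ?p ?q Z k)" if "Z \<in> gsets n" "k \<in> carrier (val N Z)" for Z k
    by (rule pairR_pairing[OF ctx that])
  have inner: "ab_lift (val ?K X) (\<lambda>(Y, V, \<psi>, l, m). box_gen n L ?MN X
         (Y, V \<times>\<^sub>G Z,
          bcomp n (Y \<times>\<^sub>G (V \<times>\<^sub>G Z)) ((Y \<times>\<^sub>G V) \<times>\<^sub>G Z) X
            (bcov n (Y \<times>\<^sub>G (V \<times>\<^sub>G Z)) ((Y \<times>\<^sub>G V) \<times>\<^sub>G Z) assocR)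
            (bcomp n ((Y \<times>\<^sub>G V) \<times>\<^sub>G Z) (U \<times>\<^sub>G Z) X (bprod n (Y \<times>\<^sub>G V) U Z Z \<psi> (bid n Z)) \<phi>),
          l, tens M N V Z m k)) t = mor ?K (U \<times>\<^sub>G Z) X \<phi> (?h U Z t k)"
    if g: "X \<in> gsets n" "U \<in> gsets n" "Z \<in> gsets n" and phi: "\<phi> \<in> carrier (bhom n (U \<times>\<^sub>G Z) X)"
      and t: "t \<in> carrier (val ?LM U)" and k: "k \<in> carrier (val N Z)" for X U Z \<phi> t k
  proof (rule ab_lift_blift_comp[OF L M mackey_rshift[OF K g(3)] pR[OF g(3) k] g(2) mackey_group[OF K g(1)] _ t])
    show "mor ?K (U \<times>\<^sub>G Z) X \<phi> \<in> hom (val (rshift ?K Z) U) (val ?K X)"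
      using mor_hom[OF K _ g(1) phi] g by simp
  qed (use g phi k M N L in \<open>simp_all add: mor_rshift pairR_def tra_def box_mor_gen[OF L MN] bcomp_id_left bcomp_assoc eqv_def\<close>)
  have e: "box_assoc n L M N X z = blift ?K ?h X z" if "X \<in> gsets n" "z \<in> carrier (val (box n ?LM N) X)" for X z
    unfolding box_assoc_def
    by (rule ab_lift_blift[OF LM N K pr that], unfold prod.case, rule inner[OF that(1)]) simp_all
  show "nathom (box n ?LM N) ?K (box_assoc n L M N)"
    using nathom_cong[OF blift_nathom[OF LM N K pr] e box_mackey[OF LM N]] .
  fix Y V Z l m k assume a: "Y \<in> gsets n" "V \<in> gsets n" "Z \<in> gsets n" "l \<in> carrier (val L Y)" "m \<in> carrier (val M V)" "k \<in> carrier (val N Z)"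
  show "box_assoc n L M N ((Y \<times>\<^sub>G V) \<times>\<^sub>G Z) (tens ?LM N (Y \<times>\<^sub>G V) Z (tens L M Y V l m) k) =
      tra n ?K (Y \<times>\<^sub>G (V \<times>\<^sub>G Z)) ((Y \<times>\<^sub>G V) \<times>\<^sub>G Z) assocR (?p Y (V \<times>\<^sub>G Z) l (?q V Z m k))"
    using a by (simp add: e blift_bid[OF LM N K pr] blift_bid[OF L M mackey_rshift[OF K a(3)] pR[OF a(3,6)]] pairR_def)
qed

lemma
  shows box_assoc_inv_nathom: "nathom (box n L (box n M N)) (box n (box n L M) N) (box_assoc_inv n L M N)"
    and box_assoc_inv_gen: "\<And>Y V Z l m k. Y \<in> gsets n \<Longrightarrow> V \<in> gsets n \<Longrightarrow> Z \<in> gsets n \<Longrightarrow>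
      l \<in> carrier (val L Y) \<Longrightarrow> m \<in> carrier (val M V) \<Longrightarrow> k \<in> carrier (val N Z) \<Longrightarrow>
      box_assoc_inv n L M N (Y \<times>\<^sub>G (V \<times>\<^sub>G Z)) (tens L (box n M N) Y (V \<times>\<^sub>G Z) l (tens M N V Z m k)) =
      tra n (box n (box n L M) N) ((Y \<times>\<^sub>G V) \<times>\<^sub>G Z) (Y \<times>\<^sub>G (V \<times>\<^sub>G Z)) assocL
       (tens (box n L M) N (Y \<times>\<^sub>G V) Z (tens L M Y V l m) k)"
proof -
  let ?MN = "box n M N" let ?LM = "box n L M" let ?K = "box n ?LM N" 
  let ?p = "\<lambda>Y Z m k. tens ?LM N Y Z m k"
  let ?q = "\<lambda>Y Z m k. tens L M Y Z m k"
  note MN = box_mackey[OF M N] note LM = box_mackey[OF L M] note K = box_mackey[OF LM N]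
  note ctx = L M N LM K box_gen_pairing[OF LM N] box_gen_pairing[OF L M]
  let ?h = "\<lambda>Y U l t. blift (lshift ?K Y) (pairL ?K ?p ?q Y l) U t"
  have pr: "pairing L ?MN ?K ?h" by (rule boxL_pairing[OF ctx])
  have pL: "pairing M N (lshift ?K Z) (pairL ?K ?p ?q Z k)" if "Z \<in> gsets n" "k \<in> carrier (val L Z)" for Z k
    by (rule pairL_pairing[OF ctx that])
  have inner: "ab_lift (val ?K X) (\<lambda>(V, Z, \<psi>, m, k). box_gen n ?LM N X
         (Y \<times>\<^sub>G V, Z,
          bcomp n ((Y \<times>\<^sub>G V) \<times>\<^sub>G Z) (Y \<times>\<^sub>G (V \<times>\<^sub>G Z)) X
            (bcov n ((Y \<times>\<^sub>G V) \<times>\<^sub>G Z) (Y \<times>\<^sub>G (V \<times>\<^sub>G Z)) assocL)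
            (bcomp n (Y \<times>\<^sub>G (V \<times>\<^sub>G Z)) (Y \<times>\<^sub>G U) X (bprod n Y Y (V \<times>\<^sub>G Z) U (bid n Y) \<psi>) \<phi>),
          tens L M Y V l m, k)) t = mor ?K (Y \<times>\<^sub>G U) X \<phi> (?h Y U l t)"
    if g: "X \<in> gsets n" "U \<in> gsets n" "Y \<in> gsets n" and phi: "\<phi> \<in> carrier (bhom n (Y \<times>\<^sub>G U) X)"
      and t: "t \<in> carrier (val ?MN U)" and k: "l \<in> carrier (val L Y)" for X U Y \<phi> t l
  proof (rule ab_lift_blift_comp[OF M N mackey_lshift[OF K g(3)] pL[OF g(3) k] g(2) mackey_group[OF K g(1)] _ t])
    show "mor ?K (Y \<times>\<^sub>G U) X \<phi> \<in> hom (val (lshift ?K Y) U) (val ?K X)"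
      using mor_hom[OF K _ g(1) phi] g by simp
  qed (use g phi k M N L in \<open>simp_all add: mor_lshift pairL_def tra_def box_mor_gen[OF LM N] bcomp_id_left bcomp_assoc eqv_def\<close>)
  have e: "box_assoc_inv n L M N X z = blift ?K ?h X z" if "X \<in> gsets n" "z \<in> carrier (val (box n L ?MN) X)" for X z
    unfolding box_assoc_inv_def
    by (rule ab_lift_blift[OF L MN K pr that], unfold prod.case, rule inner[OF that(1)]) simp_all
  show "nathom (box n L ?MN) ?K (box_assoc_inv n L M N)"
    using nathom_cong[OF blift_nathom[OF L MN K pr] e box_mackey[OF L MN]] .
  fix Y V Z l m k assume a: "Y \<in> gsets n" "V \<in> gsets n" "Z \<in> gsets n" "l \<in> carrier (val L Y)" "m \<in> carrier (val M V)" "k \<in> carrier (val N Z)"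
  show "box_assoc_inv n L M N (Y \<times>\<^sub>G (V \<times>\<^sub>G Z)) (tens L ?MN Y (V \<times>\<^sub>G Z) l (tens M N V Z m k)) =
      tra n ?K ((Y \<times>\<^sub>G V) \<times>\<^sub>G Z) (Y \<times>\<^sub>G (V \<times>\<^sub>G Z)) assocL (?p (Y \<times>\<^sub>G V) Z (?q Y V l m) k)"
    using a by (simp add: e blift_bid[OF L MN K pr] blift_bid[OF M N mackey_lshift[OF K a(1)] pL[OF a(1,4)]] pairL_def)
qed

text \<open>Pure tensors of three factors suffice: for fixed \<open>k\<close> both maps are homomorphisms in the element
  of the inner box product.\<close>

lemma box3_nathom_eq:
  assumes K: "mackey_functor n K" and f: "nathom (box n (box n L M) N) K f" and g: "nathom (box n (box n L M) N) K g"
    and eq: "\<And>Y V Z l m k. Y \<in> gsets n \<Longrightarrow> V \<in> gsets n \<Longrightarrow> Z \<in> gsets n \<Longrightarrow>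
      l \<in> carrier (val L Y) \<Longrightarrow> m \<in> carrier (val M V) \<Longrightarrow> k \<in> carrier (val N Z) \<Longrightarrow>
      f ((Y \<times>\<^sub>G V) \<times>\<^sub>G Z) (tens (box n L M) N (Y \<times>\<^sub>G V) Z (tens L M Y V l m) k) =
      g ((Y \<times>\<^sub>G V) \<times>\<^sub>G Z) (tens (box n L M) N (Y \<times>\<^sub>G V) Z (tens L M Y V l m) k)"
    and X: "X \<in> gsets n" and z: "z \<in> carrier (val (box n (box n L M) N) X)"
  shows "f X z = g X z"
proof (rule box_nathom_eq[OF box_mackey[OF L M] N K f g _ X z])
  fix U Z t k assume a: "U \<in> gsets n" "Z \<in> gsets n" "t \<in> carrier (val (box n L M) U)" "k \<in> carrier (val N Z)"
  note gp = box_gen_pairing[OF box_mackey[OF L M] N]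
  have "nathom (box n L M) (rshift K Z) (\<lambda>U t. f (U \<times>\<^sub>G Z) (tens (box n L M) N U Z t k))"
    "nathom (box n L M) (rshift K Z) (\<lambda>U t. g (U \<times>\<^sub>G Z) (tens (box n L M) N U Z t k))"
    using pairing_nathom[OF gp f] pairing_nathom[OF gp g] a(2,4) by (simp_all add: pairing_def)
  from box_nathom_eq[OF L M mackey_rshift[OF K a(2)] this _ a(1,3)] eq a
  show "f (U \<times>\<^sub>G Z) (tens (box n L M) N U Z t k) =
    g (U \<times>\<^sub>G Z) (tens (box n L M) N U Z t k)" by simp
qed

end


section \<open>Green functors and modules in terms of external products\<close>

lemma val_rep [simp]: "val (rep n X) Y = bhom n X Y"
  and mor_rep [simp]: "mor (rep n X) Y Z b a = bcomp n X Y Z a b"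
  by (simp_all add: rep_def)

lemma rep_mackey [simp]:
  assumes X: "X \<in> gsets n" shows "mackey_functor n (rep n X)"
  unfolding mackey_functor_def
proof (intro conjI ballI)
  fix Y Z b assume g: "Y \<in> gsets n" "Z \<in> gsets n" "b \<in> carrier (bhom n Y Z)"
  have "mor (rep n X) Y Z b = (\<lambda>a. bcomp n X Y Z a b)" by (simp add: fun_eq_iff)
  then show "mor (rep n X) Y Z b \<in> hom (val (rep n X) Y) (val (rep n X) Z)"
    using bcomp_hom_left[OF g(3), of X] by simp
qed (simp_all add: bhom_comm_group bcomp_id_right bcomp_assoc bcomp_mult_right)

lemma nat_id_nathom: "nathom M M nat_id"
  by (simp add: nathom_def hom_def nat_id_def)

lemma nat_id_apply [simp]: "nat_id X x = x"
  by (simp add: nat_id_def)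

text \<open>The unit isomorphism transfers along \<open>Y \<cong> Y \<times> C\<^sub>n/C\<^sub>n\<close>; its naturality is that of this transfer.\<close>

lemma tra_right_one_nathom:
  assumes M: "mackey_functor n M"
  shows "nathom M (rshift M (gone n)) (\<lambda>Y. tra n M Y (Y \<times>\<^sub>G gone n) (\<lambda>y. PPair y (pnt n)))"
proof (rule nathomI[OF M mackey_rshift[OF M gone_gset]])
  fix X Y h y assume "X \<in> gsets n" "Y \<in> gsets n" "eqv n X Y h" "y \<in> carrier (val M Y)"
  then show "tra n M X (X \<times>\<^sub>G gone n) (\<lambda>y. PPair y (pnt n)) (res n M X Y h y) =
     res n (rshift M (gone n)) X Y h (tra n M Y (Y \<times>\<^sub>G gone n) (\<lambda>y. PPair y (pnt n)) y)"
    using M by (simp add: res_rshift)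
      (subst base_change[where W = X and ?w1.0 = h and ?w2.0 = "\<lambda>y. PPair y (pnt n)"], simp_all add: eqv_def)
qed (use M in \<open>simp_all add: hom_def Pi_iff tra_mult tra_rshift tra_tra eqv_def\<close>)

text \<open>By the Yoneda lemma a pairing of \<open>L\<close> with \<open>A\<^sub>X\<close> is determined by the values at the identity of
  \<open>X\<close>, and these can be any natural family \<open>d : L(Y) \<rightarrow> M(Y \<times> X)\<close>.\<close>

lemma rep_pairing:
  assumes M: "mackey_functor n M" and X: "X \<in> gsets n" and d: "nathom L (rshift M X) d"
  shows "pairing L (rep n X) M (\<lambda>Y Z m a. mor M (Y \<times>\<^sub>G X) (Y \<times>\<^sub>G Z) (bprod n Y Y X Z (bid n Y) a) (d Y m))"
  unfolding pairing_def
proof (intro conjI ballI)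
  fix Z a assume Z: "Z \<in> gsets n" and "a \<in> carrier (val (rep n X) Z)"
  then have "nathom (rshift M X) (rshift M Z) (\<lambda>Y. mor M (Y \<times>\<^sub>G X) (Y \<times>\<^sub>G Z) (bprod n Y Y X Z (bid n Y) a))"
    using M X unfolding nathom_def
    by (simp add: mor_rshift bprod_interchange[symmetric] mor_hom)
  from nathom_comp[OF d this]
  show "nathom L (rshift M Z) (\<lambda>Y m. mor M (Y \<times>\<^sub>G X) (Y \<times>\<^sub>G Z) (bprod n Y Y X Z (bid n Y) a) (d Y m))" .
next
  fix Y m assume Y: "Y \<in> gsets n" and m: "m \<in> carrier (val L Y)"
  have "d Y m \<in> carrier (val M (Y \<times>\<^sub>G X))" using nathom_closed[OF d Y m] by simp
  then show "nathom (rep n X) (lshift M Y) (\<lambda>Z a. mor M (Y \<times>\<^sub>G X) (Y \<times>\<^sub>G Z) (bprod n Y Y X Z (bid n Y) a) (d Y m))"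
    using M X Y unfolding nathom_def
    by (simp add: mor_lshift hom_def Pi_iff bprod_mult_right mor_add mor_comp bprod_bcomp_id)
qed

lemma
  assumes M: "mackey_functor n M"
  shows box_runit_nathom: "nathom (box n M (rep n (gone n))) M (box_runit n M)"
    and box_runit_gen: "\<And>Y Z m a. Y \<in> gsets n \<Longrightarrow> Z \<in> gsets n \<Longrightarrow> m \<in> carrier (val M Y) \<Longrightarrow> a \<in> carrier (bhom n (gone n) Z) \<Longrightarrow>
      box_runit n M (Y \<times>\<^sub>G Z) (tens M (rep n (gone n)) Y Z m a) =
      mor M (Y \<times>\<^sub>G gone n) (Y \<times>\<^sub>G Z) (bprod n Y Y (gone n) Z (bid n Y) a) (tra n M Y (Y \<times>\<^sub>G gone n) (\<lambda>y. PPair y (pnt n)) m)"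
proof -
  let ?N = "rep n (gone n)"
  note N = rep_mackey[OF gone_gset]
  let ?h = "\<lambda>Y Z m a. mor M (Y \<times>\<^sub>G gone n) (Y \<times>\<^sub>G Z) (bprod n Y Y (gone n) Z (bid n Y) a) (tra n M Y (Y \<times>\<^sub>G gone n) (\<lambda>y. PPair y (pnt n)) m)"
  note T = tra_right_one_nathom[OF M]
  have p: "pairing M ?N M ?h" by (rule rep_pairing[OF M gone_gset T])
  have e: "box_runit n M X z = blift M ?h X z" if "X \<in> gsets n" "z \<in> carrier (val (box n M ?N) X)" for X z
    unfolding box_runit_def by (rule ab_lift_blift[OF M N M p that]) simp_all
  show "nathom (box n M ?N) M (box_runit n M)"
    using nathom_cong[OF blift_nathom[OF M N M p] e box_mackey[OF M N]] .
  show "box_runit n M (Y \<times>\<^sub>G Z) (tens M ?N Y Z m a) = ?h Y Z m a"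
    if "Y \<in> gsets n" "Z \<in> gsets n" "m \<in> carrier (val M Y)" "a \<in> carrier (bhom n (gone n) Z)" for Y Z m a
    using that by (simp add: e box_gen_closed blift_bid[OF M N M p])
qed

end

lemma regular_simps [simp]: "val (regular R) = val R" "mor (regular R) = mor R" "lact (regular R) = mul R"
  by (simp_all add: regular_def)

lemma regular_box [simp]:
  "box_gens n M (regular R) = box_gens n M R" "box_rels n M (regular R) = box_rels n M R"
  "box_gen n M (regular R) = box_gen n M R" "box n M (regular R) = box n M R"
  "box_map n M' (regular R) = box_map n M' R" "box_assoc n L M (regular R) = box_assoc n L M R"
  "box_lunit n (regular R) = box_lunit n R"
  "xact n R (regular R) = xmul n R" "tra n (regular R) = tra n R" "res n (regular R) = res n R"
  "mk_nat n (regular R) = mk_nat n R" "mackey_functor n (regular R) = mackey_functor n R"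
  "mackey_hom n M (regular R) = mackey_hom n M R"
proof -
  show g: "box_gens n M (regular R) = box_gens n M R" "box_rels n M (regular R) = box_rels n M R" for M
    by (simp_all add: box_gens_def box_rels_def fun_eq_iff)
  show bg: "box_gen n M (regular R) = box_gen n M R" for M
    by (simp add: box_gen_def g fun_eq_iff)
  show b: "box n M (regular R) = box n M R" for M
    by (simp add: box_def g bg)
  show "box_map n M' (regular R) = box_map n M' R" "box_assoc n L M (regular R) = box_assoc n L M R"
    by (simp_all add: box_map_def box_assoc_def g b bg fun_eq_iff)
  show t: "tra n (regular R) = tra n R" "res n (regular R) = res n R"
    by (simp_all add: tra_def res_def fun_eq_iff)
  show "box_lunit n (regular R) = box_lunit n R"
    by (simp add: box_lunit_def t fun_eq_iff)
  show "xact n R (regular R) = xmul n R"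
    by (simp add: xact_def xmul_def bg fun_eq_iff)
  show "mk_nat n (regular R) = mk_nat n R" by (simp add: mk_nat_def fun_eq_iff)
  then show "mackey_hom n M (regular R) = mackey_hom n M R" by (simp add: mackey_hom_def)
  show "mackey_functor n (regular R) = mackey_functor n R" by (simp add: mackey_functor_def)
qed

lemma (in burnside) regular_nathom [simp]:
  "nathom M (regular R) = nathom M R" "nathom (regular R) M = nathom R M" "lshift (regular R) X = lshift R X"
  "rshift (regular R) X = rshift R X"
  by (simp_all add: nathom_def lshift_def rshift_def fun_eq_iff)

locale comm_green = burnside +
  fixes R :: "('r, 'z) green_scheme"
  assumes comm_green: "comm_green_functor n R"
begin

lemma green: "green_functor n R" and R_mackey [simp]: "mackey_functor n R"
  using comm_green by (simp_all add: comm_green_functor_def green_functor_def)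

text \<open>Two weakenings of \<^const>\<open>rmodule\<close>. For \<^const>\<open>shift\<close> it is enough to know that the action is natural;
  \<open>extmod\<close> adds associativity, in terms of the external product \<open>R(U) \<times> P(V) \<rightarrow> P(U \<times> V)\<close> and thus
  without the associator of the box product.\<close>

definition premod :: "('r, 'p, 'x) rmod_scheme \<Rightarrow> bool" where
  "premod P \<longleftrightarrow> mackey_functor n P \<and> nathom (box n R P) P (lact P)"

definition extmod :: "('r, 'p, 'x) rmod_scheme \<Rightarrow> bool" where
  "extmod P \<longleftrightarrow> premod P \<and> (\<forall>U\<in>gsets n. \<forall>V\<in>gsets n. \<forall>W\<in>gsets n. \<forall>a\<in>carrier (val R U). \<forall>b\<in>carrier (val R V). \<forall>p\<in>carrier (val P W).
     xact n R P (U \<times>\<^sub>G V) W (xmul n R U V a b) p =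
     tra n P (U \<times>\<^sub>G (V \<times>\<^sub>G W)) ((U \<times>\<^sub>G V) \<times>\<^sub>G W) assocR (xact n R P U (V \<times>\<^sub>G W) a (xact n R P V W b p)))"

lemma premod_mackey: "premod P \<Longrightarrow> mackey_functor n P"
  and premod_lact: "premod P \<Longrightarrow> nathom (box n R P) P (lact P)"
  and extmod_premod: "extmod P \<Longrightarrow> premod P"
  and extmod_assoc: "extmod P \<Longrightarrow> U \<in> gsets n \<Longrightarrow> V \<in> gsets n \<Longrightarrow> W \<in> gsets n \<Longrightarrow> a \<in> carrier (val R U) \<Longrightarrow>
     b \<in> carrier (val R V) \<Longrightarrow> p \<in> carrier (val P W) \<Longrightarrow>
     xact n R P (U \<times>\<^sub>G V) W (xmul n R U V a b) p =
     tra n P (U \<times>\<^sub>G (V \<times>\<^sub>G W)) ((U \<times>\<^sub>G V) \<times>\<^sub>G W) assocR (xact n R P U (V \<times>\<^sub>G W) a (xact n R P V W b p))"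
  by (simp_all add: premod_def extmod_def)

lemma xact_pairing: "premod P \<Longrightarrow> pairing R P P (xact n R P)"
  unfolding xact_def by (rule pairing_nathom[OF box_gen_pairing[OF R_mackey premod_mackey] premod_lact])

lemma lact_gen:
  assumes P: "premod P" and g: "U \<in> gsets n" "V \<in> gsets n" "X \<in> gsets n" "\<phi> \<in> carrier (bhom n (U \<times>\<^sub>G V) X)" "a \<in> carrier (val R U)" "p \<in> carrier (val P V)"
  shows "lact P X (box_gen n R P X (U, V, \<phi>, a, p)) = mor P (U \<times>\<^sub>G V) X \<phi> (xact n R P U V a p)"
  unfolding box_gen_bid[OF R_mackey premod_mackey[OF P] g] xact_def
  using g by (simp add: nathom_mor[OF premod_lact[OF P]])

lemma rmod_hom_nathom: "f \<in> rmod_hom n R P Q \<Longrightarrow> nathom P Q f"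
  by (simp add: rmod_hom_def mackey_hom_nathom)

lemma rmod_hom_mk_nat: "f \<in> rmod_hom n R P Q \<Longrightarrow> mk_nat n P f = f"
  using mackey_hom_mk_nat[of f P Q] by (simp add: rmod_hom_def)

lemma rmod_hom_xact:
  assumes P: "premod P" and Q: "premod Q" and f: "f \<in> rmod_hom n R P Q"
    and g: "U \<in> gsets n" "V \<in> gsets n" "a \<in> carrier (val R U)" "p \<in> carrier (val P V)"
  shows "f (U \<times>\<^sub>G V) (xact n R P U V a p) = xact n R Q U V a (f V p)"
proof -
  note PM = premod_mackey[OF P] and QM = premod_mackey[OF Q]
  have "f (U \<times>\<^sub>G V) (lact P (U \<times>\<^sub>G V) z) = lact Q (U \<times>\<^sub>G V) (box_map n R Q nat_id f (U \<times>\<^sub>G V) z)"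
    if "z \<in> carrier (val (box n R P) (U \<times>\<^sub>G V))" for z using f g that by (simp add: rmod_hom_def)
  from this[of "tens R P U V a p"] g
  show ?thesis
    by (simp add: xact_def box_map_gen[OF R_mackey PM R_mackey QM nat_id_nathom rmod_hom_nathom[OF f]])
qed

text \<open>A linear map need only be compatible with external products, since pure tensors generate.\<close>

lemma rmod_homI:
  assumes P: "premod P" and Q: "premod Q" and f: "nathom P Q f"
    and x: "\<And>U V a p. U \<in> gsets n \<Longrightarrow> V \<in> gsets n \<Longrightarrow> a \<in> carrier (val R U) \<Longrightarrow> p \<in> carrier (val P V) \<Longrightarrow>
      f (U \<times>\<^sub>G V) (xact n R P U V a p) = xact n R Q U V a (f V p)"
  shows "mk_nat n P f \<in> rmod_hom n R P Q"
proof -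
  note PM = premod_mackey[OF P] and QM = premod_mackey[OF Q]
  have f': "nathom P Q (mk_nat n P f)" using nathom_cong[OF f _ PM] by simp
  have "mk_nat n P f X (lact P X z) = lact Q X (box_map n R Q nat_id (mk_nat n P f) X z)"
    if X: "X \<in> gsets n" and z: "z \<in> carrier (val (box n R P) X)" for X z
  proof (rule box_nathom_eq[OF R_mackey PM QM _ _ _ X z])
    show "nathom (box n R P) Q (\<lambda>X z. mk_nat n P f X (lact P X z))" using nathom_comp[OF premod_lact[OF P] f'] .
    show "nathom (box n R P) Q (\<lambda>X z. lact Q X (box_map n R Q nat_id (mk_nat n P f) X z))"
      using nathom_comp[OF box_map_nathom[OF R_mackey PM R_mackey QM nat_id_nathom f'] premod_lact[OF Q]] .
    fix Y Z m k assume "Y \<in> gsets n" "Z \<in> gsets n" "m \<in> carrier (val R Y)" "k \<in> carrier (val P Z)"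
    then show "mk_nat n P f (Y \<times>\<^sub>G Z) (lact P (Y \<times>\<^sub>G Z) (tens R P Y Z m k)) =
      lact Q (Y \<times>\<^sub>G Z) (box_map n R Q nat_id (mk_nat n P f) (Y \<times>\<^sub>G Z) (tens R P Y Z m k))"
      using x[of Y Z m k] pairing_closed[OF xact_pairing[OF P], of Y Z m k]
      by (simp add: box_map_gen[OF R_mackey PM R_mackey QM nat_id_nathom f'] xact_def)
  qed
  then show ?thesis using mackey_homI[OF f PM] by (simp add: rmod_hom_def)
qed

text \<open>The associativity law of the module, evaluated on a pure tensor \<open>(a \<otimes> b) \<otimes> p\<close>.\<close>

lemma rmodule_extmod:
  assumes P: "rmodule n R P" and m: "nathom (box n R R) R (mul R)" shows "extmod P"
proof -
  have PM: "mackey_functor n P" and lh: "nathom (box n R P) P (lact P)"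
    using P by (simp_all add: rmodule_def mackey_hom_nathom)
  have pre: "premod P" using PM lh by (simp add: premod_def)
  have "xact n R P (U \<times>\<^sub>G V) W (xmul n R U V a b) p =
     tra n P (U \<times>\<^sub>G (V \<times>\<^sub>G W)) ((U \<times>\<^sub>G V) \<times>\<^sub>G W) assocR (xact n R P U (V \<times>\<^sub>G W) a (xact n R P V W b p))"
    if g: "U \<in> gsets n" "V \<in> gsets n" "W \<in> gsets n" "a \<in> carrier (val R U)" "b \<in> carrier (val R V)" "p \<in> carrier (val P W)" for U V W a b p
  proof -
    let ?X = "(U \<times>\<^sub>G V) \<times>\<^sub>G W" and ?Y = "U \<times>\<^sub>G (V \<times>\<^sub>G W)"
    let ?z = "tens (box n R R) P (U \<times>\<^sub>G V) W (tens R R U V a b) p"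
    let ?y = "tens R (box n R P) U (V \<times>\<^sub>G W) a (tens R P V W b p)"
    note RR = box_mackey[OF R_mackey R_mackey] and RP = box_mackey[OF R_mackey PM]
    have z: "?z \<in> carrier (val (box n (box n R R) P) ?X)" using g by simp
    have y: "?y \<in> carrier (val (box n R (box n R P)) ?Y)" using g by simp
    have law: "lact P ?X (box_map n R P (mul R) nat_id ?X ?z) = lact P ?X (box_map n R P nat_id (lact P) ?X (box_assoc n R R P ?X ?z))"
      using P z g by (simp add: rmodule_def)
    have l: "box_map n R P (mul R) nat_id ?X ?z = tens R P (U \<times>\<^sub>G V) W (xmul n R U V a b) p"
      using g by (simp add: box_map_gen[OF RR PM R_mackey PM m nat_id_nathom] xmul_def)
    note bm = box_map_nathom[OF R_mackey RP R_mackey PM nat_id_nathom lh]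
    have "box_assoc n R R P ?X ?z = tra n (box n R (box n R P)) ?Y ?X assocR ?y"
      using box_assoc_gen[OF R_mackey R_mackey PM] g by simp
    then have r: "box_map n R P nat_id (lact P) ?X (box_assoc n R R P ?X ?z) = tra n (box n R P) ?Y ?X assocR (box_map n R P nat_id (lact P) ?Y ?y)"
      using g y by (simp add: nathom_tra[OF bm] eqv_def)
    have r2: "box_map n R P nat_id (lact P) ?Y ?y = tens R P U (V \<times>\<^sub>G W) a (xact n R P V W b p)"
      using g by (simp add: box_map_gen[OF R_mackey RP R_mackey PM nat_id_nathom lh] xact_def)
    have "lact P ?X (tra n (box n R P) ?Y ?X assocR (tens R P U (V \<times>\<^sub>G W) a (xact n R P V W b p))) =
       tra n P ?Y ?X assocR (xact n R P U (V \<times>\<^sub>G W) a (xact n R P V W b p))"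
      using g pairing_closed[OF xact_pairing[OF pre] g(2,3,5,6)]
      by (subst nathom_tra[OF lh]) (simp_all add: eqv_def xact_def)
    then show ?thesis using law unfolding l r r2 by (simp add: xact_def)
  qed
  then show ?thesis using pre by (simp add: extmod_def)
qed

lemma mul_nathom: "nathom (box n R R) R (mul R)"
  using green by (simp add: green_functor_def mackey_hom_nathom)

lemma regular_rmodule: "rmodule n R (regular R)"
  using green by (simp add: green_functor_def rmodule_def)

lemma extmod_rmodule: "rmodule n R P \<Longrightarrow> extmod P"
  using rmodule_extmod mul_nathom by blast

lemma extmod_regular [simp]: "extmod (regular R)"
  by (rule extmod_rmodule[OF regular_rmodule])

lemma premod_regular [simp]: "premod (regular R)"
  by (rule extmod_premod[OF extmod_regular])

lemma xmul_pairing: "pairing R R R (xmul n R)"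
proof -
  have "pairing R (regular R) (regular R) (xact n R (regular R))" by (rule xact_pairing[OF premod_regular])
  then show ?thesis by (simp add: pairing_def)
qed

lemma mul_gen:
  assumes "U \<in> gsets n" "V \<in> gsets n" "X \<in> gsets n" "\<phi> \<in> carrier (bhom n (U \<times>\<^sub>G V) X)" "a \<in> carrier (val R U)" "b \<in> carrier (val R V)"
  shows "mul R X (box_gen n R R X (U, V, \<phi>, a, b)) = mor R (U \<times>\<^sub>G V) X \<phi> (xmul n R U V a b)"
  using lact_gen[OF premod_regular] assms by simp

lemma xmul_comm:
  assumes g: "U \<in> gsets n" "V \<in> gsets n" "a \<in> carrier (val R U)" "b \<in> carrier (val R V)"
  shows "tra n R (V \<times>\<^sub>G U) (U \<times>\<^sub>G V) flip (xmul n R V U b a) = xmul n R U V a b"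
proof -
  let ?X = "U \<times>\<^sub>G V" let ?z = "tens R R U V a b"
  have "mul R ?X (box_sym n R R ?X ?z) = mul R ?X ?z" using comm_green g by (simp add: comm_green_functor_def)
  moreover have "box_sym n R R ?X ?z = tra n (box n R R) (V \<times>\<^sub>G U) ?X flip (tens R R V U b a)"
    using g by (simp add: box_sym_gen[OF R_mackey R_mackey] mor_id[OF box_mackey[OF R_mackey R_mackey]] eqv_def tra_closed[OF box_mackey[OF R_mackey R_mackey]])
  ultimately show ?thesis using g
    by (simp add: nathom_tra[OF mul_nathom] eqv_def xmul_def)
qed

definition rone :: 'r where "rone = unt R (gone n) (bid n (gone n))"

lemma unt_nathom: "nathom (rep n (gone n)) R (unt R)"
  using green by (simp add: green_functor_def mackey_hom_nathom)

lemma rone_closed [simp]: "rone \<in> carrier (val R (gone n))"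
  using nathom_closed[OF unt_nathom gone_gset, of "bid n (gone n)"] by (simp add: rone_def)

text \<open>The unit law on \<open>a \<otimes> 1\<close>, where the unit isomorphism becomes the transfer along \<open>Y \<cong> Y \<times> C\<^sub>n/C\<^sub>n\<close>.\<close>

lemma xmul_one:
  assumes g: "Y \<in> gsets n" "a \<in> carrier (val R Y)"
  shows "xmul n R Y (gone n) a rone = tra n R Y (Y \<times>\<^sub>G gone n) (\<lambda>y. PPair y (pnt n)) a"
proof -
  let ?X = "Y \<times>\<^sub>G gone n" let ?z = "tens R (rep n (gone n)) Y (gone n) a (bid n (gone n))"
  have z: "?z \<in> carrier (val (box n R (rep n (gone n))) ?X)" using g by simp
  have "mul R ?X (box_map n R R nat_id (unt R) ?X ?z) = box_runit n R ?X ?z"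
    using green z g by (simp add: green_functor_def)
  moreover have "box_map n R R nat_id (unt R) ?X ?z = tens R R Y (gone n) a rone"
    using g by (simp add: box_map_gen[OF R_mackey rep_mackey R_mackey R_mackey nat_id_nathom unt_nathom] rone_def)
  moreover have "box_runit n R ?X ?z = tra n R Y ?X (\<lambda>y. PPair y (pnt n)) a"
    using g by (simp add: box_runit_gen bprod_bid mor_id eqv_def)
  ultimately show ?thesis by (simp add: xmul_def)
qed

end

context comm_green
begin

section \<open>Shifted modules and the internal Hom\<close>

lemma shift_simps [simp]:
  "val (shift n R Q X) Y = val Q (X \<times>\<^sub>G Y)"
  "mackey_functor n (shift n R Q X) = mackey_functor n (lshift Q X)"
  "nathom M (shift n R Q X) = nathom M (lshift Q X)"
  "tra n (shift n R Q X) = tra n (lshift Q X)"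
  "res n (shift n R Q X) = res n (lshift Q X)"
  by (simp_all add: shift_def lshift_def mackey_functor_def nathom_def tra_def res_def fun_eq_iff)

text \<open>The action on \<open>Q(X \<times> -)\<close> is defined by a lift; its pairing moves the new factor \<open>U\<close> past \<open>X\<close>.\<close>

lemma
  assumes Q: "premod Q" and X: "X \<in> gsets n"
  shows premod_shift: "premod (shift n R Q X)"
    and xact_shift: "\<And>U V a q. U \<in> gsets n \<Longrightarrow> V \<in> gsets n \<Longrightarrow> a \<in> carrier (val R U) \<Longrightarrow> q \<in> carrier (val Q (X \<times>\<^sub>G V)) \<Longrightarrow>
      xact n R (shift n R Q X) U V a q = tra n Q (U \<times>\<^sub>G (X \<times>\<^sub>G V)) (X \<times>\<^sub>G (U \<times>\<^sub>G V)) swap_left (xact n R Q U (X \<times>\<^sub>G V) a q)"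
proof -
  let ?S = "shift n R Q X"
  let ?h = "\<lambda>U V a q. tra n Q (U \<times>\<^sub>G (X \<times>\<^sub>G V)) (X \<times>\<^sub>G (U \<times>\<^sub>G V)) swap_left (xact n R Q U (X \<times>\<^sub>G V) a q)"
  note QM = premod_mackey[OF Q] and x = xact_pairing[OF Q]
  have SM: "mackey_functor n ?S" using QM X by simp
  have p: "pairing R ?S ?S ?h"
  proof (rule pairingI[OF R_mackey SM SM])
    fix Y Y' V f a q assume g: "Y \<in> gsets n" "Y' \<in> gsets n" "V \<in> gsets n" "eqv n Y Y' f" "a \<in> carrier (val R Y')" "q \<in> carrier (val ?S V)"
    then show "?h Y V (res n R Y Y' f a) q = res n ?S (Y \<times>\<^sub>G V) (Y' \<times>\<^sub>G V) (on_fst f) (?h Y' V a q)"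
      using QM X
      by (simp add: res_lshift eqv_def)
        (subst base_change[where W = "Y \<times>\<^sub>G (X \<times>\<^sub>G V)" and ?w1.0 = "on_fst f" and ?w2.0 = swap_left],
          simp_all add: eqv_def pairing_closed[OF x] pairing_res_left[OF x])
  next
    fix Y V V' f a q assume g: "Y \<in> gsets n" "V \<in> gsets n" "V' \<in> gsets n" "eqv n V V' f" "a \<in> carrier (val R Y)" "q \<in> carrier (val ?S V')"
    then show "?h Y V a (res n ?S V V' f q) = res n ?S (Y \<times>\<^sub>G V) (Y \<times>\<^sub>G V') (on_snd f) (?h Y V' a q)"
      using QM X
      by (simp add: res_lshift eqv_def)
        (subst base_change[where W = "Y \<times>\<^sub>G (X \<times>\<^sub>G V)" and ?w1.0 = "\<lambda>w. PPair (pfst w) (PPair (pfst (psnd w)) (f (psnd (psnd w))))" and ?w2.0 = swap_left],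
          simp_all add: eqv_def pairing_closed[OF x] pairing_res_right[OF x])
  qed (use QM X in \<open>simp_all add: pairing_closed[OF x] eqv_def tra_lshift tra_tra
      pairing_tra_left[OF x] pairing_tra_right[OF x] pairing_mult_left[OF x] pairing_mult_right[OF x] tra_mult\<close>)
  have l: "lact ?S Y = ab_lift (val ?S Y) (\<lambda>(U, V, \<phi>, a, q). mor ?S (U \<times>\<^sub>G V) Y \<phi> (?h U V a q))" for Y
    unfolding shift_def rmod.simps mackey.simps ..
  have e: "lact ?S Y z = blift ?S ?h Y z" for Y z
    unfolding l blift_def ..
  have "nathom (box n R ?S) ?S (lact ?S)"
    using nathom_cong[OF blift_nathom[OF R_mackey SM SM p] e box_mackey[OF R_mackey SM]] .
  then show "premod ?S" unfolding premod_def using SM by (rule conjI[rotated])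
  show "xact n R ?S U V a q = ?h U V a q"
    if u: "U \<in> gsets n" "V \<in> gsets n" "a \<in> carrier (val R U)" "q \<in> carrier (val Q (X \<times>\<^sub>G V))" for U V a q
  proof -
    have q: "q \<in> carrier (val ?S V)" using u(4) by simp
    show ?thesis unfolding xact_def[of n R ?S] e by (rule blift_bid[OF R_mackey SM SM p u(1-3) q])
  qed
qed

text \<open>The values of the internal Hom are groups under pointwise operations.\<close>

lemma nathom_mult_pointwise:
  assumes S: "mackey_functor n S" and f: "nathom P S f" and g: "nathom P S g"
  shows "nathom P S (\<lambda>Y p. f Y p \<otimes>\<^bsub>val S Y\<^esub> g Y p)"
  unfolding nathom_def
proof (intro conjI ballI)
  fix Y assume Y: "Y \<in> gsets n"
  interpret C: comm_group "val S Y" by (rule mackey_group[OF S Y])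
  show "(\<lambda>p. f Y p \<otimes>\<^bsub>val S Y\<^esub> g Y p) \<in> hom (val P Y) (val S Y)"
    by (rule C.hom_group_mult[OF nathom_hom[OF f Y] nathom_hom[OF g Y]])
qed (use S in \<open>simp add: nathom_mor[OF f] nathom_mor[OF g] mor_mult nathom_closed[OF f] nathom_closed[OF g]\<close>)

lemma nathom_one:
  assumes S: "mackey_functor n S" shows "nathom P S (\<lambda>Y p. \<one>\<^bsub>val S Y\<^esub>)"
  unfolding nathom_def
proof (intro conjI ballI)
  fix Y assume Y: "Y \<in> gsets n"
  interpret C: comm_group "val S Y" by (rule mackey_group[OF S Y])
  show "(\<lambda>p. \<one>\<^bsub>val S Y\<^esub>) \<in> hom (val P Y) (val S Y)" by (simp add: hom_def)
next
  fix X Y b assume "X \<in> gsets n" "Y \<in> gsets n" "b \<in> carrier (bhom n X Y)"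
  then show "\<one>\<^bsub>val S Y\<^esub> = mor S X Y b \<one>\<^bsub>val S X\<^esub>"
    using hom_one[OF mor_hom[OF S] mackey_is_group[OF S] mackey_is_group[OF S]] by simp
qed

lemma nathom_inv:
  assumes S: "mackey_functor n S" shows "nathom S S (\<lambda>Y y. inv\<^bsub>val S Y\<^esub> y)"
  unfolding nathom_def
proof (intro conjI ballI)
  fix Y assume Y: "Y \<in> gsets n"
  interpret C: comm_group "val S Y" by (rule mackey_group[OF S Y])
  show "(\<lambda>y. inv\<^bsub>val S Y\<^esub> y) \<in> hom (val S Y) (val S Y)" by (simp add: hom_def C.inv_mult)
next
  fix X Y b x assume g: "X \<in> gsets n" "Y \<in> gsets n" "b \<in> carrier (bhom n X Y)" "x \<in> carrier (val S X)"
  interpret h: group_hom "val S X" "val S Y" "mor S X Y b"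
    using mackey_is_group[OF S] mor_hom[OF S] g by (simp add: group_hom_def group_hom_axioms_def)
  show "inv\<^bsub>val S Y\<^esub> (mor S X Y b x) = mor S X Y b (inv\<^bsub>val S X\<^esub> x)" using g by simp
qed

lemma rmod_hom_add:
  assumes P: "premod P" and S: "premod S" and f: "f \<in> rmod_hom n R P S" and g: "g \<in> rmod_hom n R P S"
  shows "mk_nat n P (\<lambda>Y p. f Y p \<otimes>\<^bsub>val S Y\<^esub> g Y p) \<in> rmod_hom n R P S"
proof (rule rmod_homI[OF P S])
  note fn = rmod_hom_nathom[OF f] and gn = rmod_hom_nathom[OF g]
  show "nathom P S (\<lambda>Y p. f Y p \<otimes>\<^bsub>val S Y\<^esub> g Y p)" by (rule nathom_mult_pointwise[OF premod_mackey[OF S] fn gn])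
  fix U V a p assume "U \<in> gsets n" "V \<in> gsets n" "a \<in> carrier (val R U)" "p \<in> carrier (val P V)"
  then show "f (U \<times>\<^sub>G V) (xact n R P U V a p) \<otimes>\<^bsub>val S (U \<times>\<^sub>G V)\<^esub> g (U \<times>\<^sub>G V) (xact n R P U V a p) =
       xact n R S U V a (f V p \<otimes>\<^bsub>val S V\<^esub> g V p)"
    by (simp add: rmod_hom_xact[OF P S f] rmod_hom_xact[OF P S g] pairing_mult_right[OF xact_pairing[OF S]] nathom_closed[OF fn] nathom_closed[OF gn])
qed

lemma xact_right_hom: "premod S \<Longrightarrow> U \<in> gsets n \<Longrightarrow> V \<in> gsets n \<Longrightarrow> a \<in> carrier (val R U) \<Longrightarrow>
    group_hom (val S V) (val S (U \<times>\<^sub>G V)) (xact n R S U V a)"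
  unfolding group_hom_def group_hom_axioms_def
  by (intro conjI mackey_is_group[OF premod_mackey] homI)
    (simp_all add: pairing_mult_right[OF xact_pairing] pairing_closed[OF xact_pairing])

lemma rmod_hom_one:
  assumes P: "premod P" and S: "premod S"
  shows "mk_nat n P (\<lambda>Y p. \<one>\<^bsub>val S Y\<^esub>) \<in> rmod_hom n R P S"
proof (rule rmod_homI[OF P S nathom_one[OF premod_mackey[OF S]]])
  fix U V a p assume "U \<in> gsets n" "V \<in> gsets n" "a \<in> carrier (val R U)" "p \<in> carrier (val P V)"
  then show "\<one>\<^bsub>val S (U \<times>\<^sub>G V)\<^esub> = xact n R S U V a \<one>\<^bsub>val S V\<^esub>"
    using group_hom.hom_one[OF xact_right_hom[OF S]] by simp
qed

lemma rmod_hom_inv: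
  assumes P: "premod P" and S: "premod S" and f: "f \<in> rmod_hom n R P S"
  shows "mk_nat n P (\<lambda>Y p. inv\<^bsub>val S Y\<^esub> f Y p) \<in> rmod_hom n R P S"
proof (rule rmod_homI[OF P S])
  note fn = rmod_hom_nathom[OF f]
  show "nathom P S (\<lambda>Y p. inv\<^bsub>val S Y\<^esub> f Y p)" by (rule nathom_comp[OF fn nathom_inv[OF premod_mackey[OF S]]])
  fix U V a p assume "U \<in> gsets n" "V \<in> gsets n" "a \<in> carrier (val R U)" "p \<in> carrier (val P V)"
  then show "inv\<^bsub>val S (U \<times>\<^sub>G V)\<^esub> f (U \<times>\<^sub>G V) (xact n R P U V a p) = xact n R S U V a (inv\<^bsub>val S V\<^esub> f V p)"
    using group_hom.hom_inv[OF xact_right_hom[OF S]] by (simp add: rmod_hom_xact[OF P S f] nathom_closed[OF fn])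
qed

lemma rmod_hom_comp:
  assumes P: "premod P" and Q: "premod Q" and S: "premod S" and f: "f \<in> rmod_hom n R P Q" and g: "g \<in> rmod_hom n R Q S"
  shows "mk_nat n P (\<lambda>Y p. g Y (f Y p)) \<in> rmod_hom n R P S"
proof (rule rmod_homI[OF P S nathom_comp[OF rmod_hom_nathom[OF f] rmod_hom_nathom[OF g]]])
  fix U V a p assume "U \<in> gsets n" "V \<in> gsets n" "a \<in> carrier (val R U)" "p \<in> carrier (val P V)"
  then show "g (U \<times>\<^sub>G V) (f (U \<times>\<^sub>G V) (xact n R P U V a p)) = xact n R S U V a (g V (f V p))"
    by (simp add: rmod_hom_xact[OF P Q f] rmod_hom_xact[OF Q S g] nathom_closed[OF rmod_hom_nathom[OF f]])
qed

lemma rmod_hom_comm_group: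
  assumes P: "premod P" and S: "premod S"
  shows "comm_group \<lparr>carrier = rmod_hom n R P S,
        mult = \<lambda>\<theta> \<theta>'. mk_nat n P (\<lambda>Y p. \<theta> Y p \<otimes>\<^bsub>val S Y\<^esub> \<theta>' Y p), one = mk_nat n P (\<lambda>Y p. \<one>\<^bsub>val S Y\<^esub>)\<rparr>" (is "comm_group ?G")
proof -
  note SM = premod_mackey[OF S]
  note cl = nathom_closed[OF rmod_hom_nathom]
  note C = mackey_group[OF SM]
  note mo = comm_group.axioms(1)[OF C, THEN comm_monoid.axioms(1)]
  note ma = monoid.m_assoc[OF mo] and mc = comm_monoid.m_comm[OF comm_group.axioms(1)[OF C]]
    and lo = monoid.l_one[OF mo] and li = group.l_inv[OF mackey_is_group[OF SM]] and ic = group.inv_closed[OF mackey_is_group[OF SM]]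
  show ?thesis
  proof (rule comm_groupI)
    fix f g assume f: "f \<in> carrier ?G" and g: "g \<in> carrier ?G"
    show "f \<otimes>\<^bsub>?G\<^esub> g \<in> carrier ?G" using f g rmod_hom_add[OF P S] by simp
    show "f \<otimes>\<^bsub>?G\<^esub> g = g \<otimes>\<^bsub>?G\<^esub> f" using f g by (simp, intro mk_nat_eqI) (simp add: mc cl)
    fix h assume h: "h \<in> carrier ?G"
    show "f \<otimes>\<^bsub>?G\<^esub> g \<otimes>\<^bsub>?G\<^esub> h = f \<otimes>\<^bsub>?G\<^esub> (g \<otimes>\<^bsub>?G\<^esub> h)"
      using f g h by (simp, intro mk_nat_eqI) (simp add: ma cl)
  next
    show "\<one>\<^bsub>?G\<^esub> \<in> carrier ?G" using rmod_hom_one[OF P S] by simp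
  next
    fix f assume f: "f \<in> carrier ?G"
    have "mk_nat n P (\<lambda>Y p. mk_nat n P (\<lambda>Y p. \<one>\<^bsub>val S Y\<^esub>) Y p \<otimes>\<^bsub>val S Y\<^esub> f Y p) = mk_nat n P f"
      using f by (intro mk_nat_eqI) (simp add: lo cl)
    then show "\<one>\<^bsub>?G\<^esub> \<otimes>\<^bsub>?G\<^esub> f = f" using f rmod_hom_mk_nat[of f P S] by simp
    have "mk_nat n P (\<lambda>Y p. mk_nat n P (\<lambda>Y p. inv\<^bsub>val S Y\<^esub> f Y p) Y p \<otimes>\<^bsub>val S Y\<^esub> f Y p) = mk_nat n P (\<lambda>Y p. \<one>\<^bsub>val S Y\<^esub>)"
      using f by (intro mk_nat_eqI) (simp add: li cl)
    then show "\<exists>g\<in>carrier ?G. g \<otimes>\<^bsub>?G\<^esub> f = \<one>\<^bsub>?G\<^esub>"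
      using f rmod_hom_inv[OF P S, of f] by (intro bexI[of _ "mk_nat n P (\<lambda>Y p. inv\<^bsub>val S Y\<^esub> f Y p)"]) simp_all
  qed
qed

lemma inthom_simps:
  "carrier (val (inthom n R P Q) X) = rmod_hom n R P (shift n R Q X)"
  "\<theta> \<otimes>\<^bsub>val (inthom n R P Q) X\<^esub> \<theta>' = mk_nat n P (\<lambda>Y p. \<theta> Y p \<otimes>\<^bsub>val Q (X \<times>\<^sub>G Y)\<^esub> \<theta>' Y p)"
  "\<one>\<^bsub>val (inthom n R P Q) X\<^esub> = mk_nat n P (\<lambda>Y p. \<one>\<^bsub>val Q (X \<times>\<^sub>G Y)\<^esub>)"
  "mor (inthom n R P Q) X X' b \<theta> = mk_nat n P
        (\<lambda>Y p. mor Q (X \<times>\<^sub>G Y) (X' \<times>\<^sub>G Y) (bprod n X X' Y Y b (bid n Y)) (\<theta> Y p))"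
  by (simp_all add: inthom_def)

lemma shift_hom_closed:
  assumes "\<theta> \<in> rmod_hom n R P (shift n R Q X)" "Y \<in> gsets n" "p \<in> carrier (val P Y)"
  shows "\<theta> Y p \<in> carrier (val Q (X \<times>\<^sub>G Y))"
  using nathom_closed[OF rmod_hom_nathom[OF assms(1)] assms(2,3)] by simp

lemma tra_inthom: "X \<in> gsets n \<Longrightarrow> eqv n X X' f \<Longrightarrow> tra n (inthom n R P Q) X X' f \<theta> =
    mk_nat n P (\<lambda>Y p. tra n Q (X \<times>\<^sub>G Y) (X' \<times>\<^sub>G Y) (on_fst f) (\<theta> Y p))"
  unfolding tra_def inthom_simps by (rule mk_nat_eqI) (simp add: bid_bcov bprod_bcov)

lemma res_inthom: "X \<in> gsets n \<Longrightarrow> eqv n X X' f \<Longrightarrow> res n (inthom n R P Q) X X' f \<theta> =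
    mk_nat n P (\<lambda>Y p. res n Q (X \<times>\<^sub>G Y) (X' \<times>\<^sub>G Y) (on_fst f) (\<theta> Y p))"
  unfolding res_def inthom_simps by (rule mk_nat_eqI) (simp add: bid_bcon bprod_bcon)

text \<open>Functoriality of the internal Hom in its level: a morphism \<open>X \<rightarrow> X'\<close> acts linearly from \<open>Q(X \<times> -)\<close>
  to \<open>Q(X' \<times> -)\<close>, because it acts on a factor other than the one in which \<open>R\<close> acts.\<close>

lemma shift_map_rmod:
  assumes Q: "premod Q" and g: "X \<in> gsets n" "X' \<in> gsets n" "b \<in> carrier (bhom n X X')"
  shows "nathom (shift n R Q X) (shift n R Q X') (\<lambda>Y. mor Q (X \<times>\<^sub>G Y) (X' \<times>\<^sub>G Y) (bprod n X X' Y Y b (bid n Y)))" (is ?A)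
    and "\<And>U V a q. U \<in> gsets n \<Longrightarrow> V \<in> gsets n \<Longrightarrow> a \<in> carrier (val R U) \<Longrightarrow> q \<in> carrier (val Q (X \<times>\<^sub>G V)) \<Longrightarrow>
      mor Q (X \<times>\<^sub>G (U \<times>\<^sub>G V)) (X' \<times>\<^sub>G (U \<times>\<^sub>G V)) (bprod n X X' (U \<times>\<^sub>G V) (U \<times>\<^sub>G V) b (bid n (U \<times>\<^sub>G V))) (xact n R (shift n R Q X) U V a q) =
      xact n R (shift n R Q X') U V a (mor Q (X \<times>\<^sub>G V) (X' \<times>\<^sub>G V) (bprod n X X' V V b (bid n V)) q)"
proof -
  note QM = premod_mackey[OF Q] and x = xact_pairing[OF Q]
  have "nathom (lshift Q X) (lshift Q X') (\<lambda>Y. mor Q (X \<times>\<^sub>G Y) (X' \<times>\<^sub>G Y) (bprod n X X' Y Y b (bid n Y)))"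
    using QM g unfolding nathom_def by (simp add: mor_hom mor_lshift bprod_interchange)
  then show ?A using nathom_def shift_def lshift_def by (simp add: nathom_def shift_def lshift_def)
  fix U V a q assume u: "U \<in> gsets n" "V \<in> gsets n" "a \<in> carrier (val R U)" "q \<in> carrier (val Q (X \<times>\<^sub>G V))"
  have n: "nathom (rshift (lshift Q U) V) (rshift Q (U \<times>\<^sub>G V)) (\<lambda>X. tra n Q (U \<times>\<^sub>G (X \<times>\<^sub>G V)) (X \<times>\<^sub>G (U \<times>\<^sub>G V)) swap_left)"
  proof (rule nathomI)
    show "mackey_functor n (rshift (lshift Q U) V)" "mackey_functor n (rshift Q (U \<times>\<^sub>G V))" using QM u by simp_all
    fix X Y h y assume "X \<in> gsets n" "Y \<in> gsets n" "eqv n X Y h" "y \<in> carrier (val (rshift (lshift Q U) V) Y)"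
    then show "tra n Q (U \<times>\<^sub>G (X \<times>\<^sub>G V)) (X \<times>\<^sub>G (U \<times>\<^sub>G V)) swap_left (res n (rshift (lshift Q U) V) X Y h y) =
       res n (rshift Q (U \<times>\<^sub>G V)) X Y h (tra n Q (U \<times>\<^sub>G (Y \<times>\<^sub>G V)) (Y \<times>\<^sub>G (U \<times>\<^sub>G V)) swap_left y)"
      using QM u by (simp add: res_rshift res_lshift eqv_def)
        (subst base_change[where W = "U \<times>\<^sub>G (X \<times>\<^sub>G V)" and ?w1.0 = "\<lambda>w. PPair (pfst w) (PPair (h (pfst (psnd w))) (psnd (psnd w)))" and ?w2.0 = swap_left],
          simp_all add: eqv_def)
  qed (use QM u in \<open>simp_all add: hom_def Pi_iff tra_mult tra_rshift tra_lshift tra_tra eqv_def\<close>)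
  have "tra n Q (U \<times>\<^sub>G (X' \<times>\<^sub>G V)) (X' \<times>\<^sub>G (U \<times>\<^sub>G V)) swap_left (mor (rshift (lshift Q U) V) X X' b (xact n R Q U (X \<times>\<^sub>G V) a q)) =
      mor (rshift Q (U \<times>\<^sub>G V)) X X' b (tra n Q (U \<times>\<^sub>G (X \<times>\<^sub>G V)) (X \<times>\<^sub>G (U \<times>\<^sub>G V)) swap_left (xact n R Q U (X \<times>\<^sub>G V) a q))"
    using nathom_mor[OF n g(1,2,3)] u g pairing_closed[OF x] by simp
  moreover have "xact n R Q U (X' \<times>\<^sub>G V) a (mor Q (X \<times>\<^sub>G V) (X' \<times>\<^sub>G V) (bprod n X X' V V b (bid n V)) q) = mor (rshift (lshift Q U) V) X X' b (xact n R Q U (X \<times>\<^sub>G V) a q)"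
    using u g QM by (simp add: pairing_mor_right[OF x] mor_rshift mor_lshift)
  ultimately show "mor Q (X \<times>\<^sub>G (U \<times>\<^sub>G V)) (X' \<times>\<^sub>G (U \<times>\<^sub>G V)) (bprod n X X' (U \<times>\<^sub>G V) (U \<times>\<^sub>G V) b (bid n (U \<times>\<^sub>G V))) (xact n R (shift n R Q X) U V a q) =
      xact n R (shift n R Q X') U V a (mor Q (X \<times>\<^sub>G V) (X' \<times>\<^sub>G V) (bprod n X X' V V b (bid n V)) q)"
    using u g QM by (simp add: xact_shift[OF Q] mor_rshift)
qed

lemma inthom_mor_closed:
  assumes P: "premod P" and Q: "premod Q" and g: "X \<in> gsets n" "X' \<in> gsets n" "b \<in> carrier (bhom n X X')"
    and t: "\<theta> \<in> rmod_hom n R P (shift n R Q X)"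
  shows "mor (inthom n R P Q) X X' b \<theta> \<in> rmod_hom n R P (shift n R Q X')"
  unfolding inthom_simps
proof (rule rmod_homI[OF P premod_shift[OF Q g(2)]])
  show "nathom P (shift n R Q X') (\<lambda>Y p. mor Q (X \<times>\<^sub>G Y) (X' \<times>\<^sub>G Y) (bprod n X X' Y Y b (bid n Y)) (\<theta> Y p))"
    by (rule nathom_comp[OF rmod_hom_nathom[OF t] shift_map_rmod(1)[OF Q g]])
qed (use g t in \<open>simp add: rmod_hom_xact[OF P premod_shift[OF Q]] shift_map_rmod(2)[OF Q] shift_hom_closed\<close>)

lemma inthom_mackey:
  assumes P: "premod P" and Q: "premod Q"
  shows "mackey_functor n (inthom n R P Q)"
  unfolding mackey_functor_def
proof (intro conjI ballI)
  note QM = premod_mackey[OF Q]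
  { fix X assume X: "X \<in> gsets n"
    show "comm_group (val (inthom n R P Q) X)"
      using rmod_hom_comm_group[OF P premod_shift[OF Q X]] by (simp add: inthom_def)
    fix Y b assume Y: "Y \<in> gsets n" and b: "b \<in> carrier (bhom n X Y)"
    show "mor (inthom n R P Q) X Y b \<in> hom (val (inthom n R P Q) X) (val (inthom n R P Q) Y)"
    proof (rule homI)
      fix \<theta> \<theta>' assume "\<theta> \<in> carrier (val (inthom n R P Q) X)" "\<theta>' \<in> carrier (val (inthom n R P Q) X)"
      then show "mor (inthom n R P Q) X Y b (\<theta> \<otimes>\<^bsub>val (inthom n R P Q) X\<^esub> \<theta>') =
          mor (inthom n R P Q) X Y b \<theta> \<otimes>\<^bsub>val (inthom n R P Q) Y\<^esub> mor (inthom n R P Q) X Y b \<theta>'"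
        using X Y b QM unfolding inthom_simps by (intro mk_nat_eqI) (simp add: mor_mult shift_hom_closed)
    qed (use X Y b in \<open>simp add: inthom_simps(1) inthom_mor_closed[OF P Q]\<close>) }
  fix X \<theta> assume X: "X \<in> gsets n" and t: "\<theta> \<in> carrier (val (inthom n R P Q) X)"
  note t' = t[unfolded inthom_simps(1)]
  have "mk_nat n P (\<lambda>Y p. mor Q (X \<times>\<^sub>G Y) (X \<times>\<^sub>G Y) (bprod n X X Y Y (bid n X) (bid n Y)) (\<theta> Y p)) = mk_nat n P \<theta>"
    using X QM t' by (intro mk_nat_eqI) (simp add: bprod_bid mor_id shift_hom_closed)
  then show "mor (inthom n R P Q) X X (bid n X) \<theta> = \<theta>"
    unfolding inthom_simps using rmod_hom_mk_nat[OF t'] by simp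
  fix Y a assume Y: "Y \<in> gsets n" and a: "a \<in> carrier (bhom n X Y)"
  { fix Z b assume Z: "Z \<in> gsets n" and b: "b \<in> carrier (bhom n Y Z)"
    show "mor (inthom n R P Q) X Z (bcomp n X Y Z a b) \<theta> = mor (inthom n R P Q) Y Z b (mor (inthom n R P Q) X Y a \<theta>)"
      using X Y Z a b t' QM unfolding inthom_simps
      by (intro mk_nat_eqI) (simp add: mor_comp bprod_bcomp_id shift_hom_closed) }
  fix b assume b: "b \<in> carrier (bhom n X Y)"
  show "mor (inthom n R P Q) X Y (a \<otimes>\<^bsub>bhom n X Y\<^esub> b) \<theta> =
     mor (inthom n R P Q) X Y a \<theta> \<otimes>\<^bsub>val (inthom n R P Q) Y\<^esub> mor (inthom n R P Q) X Y b \<theta>"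
    using X Y a b t' QM unfolding inthom_simps
    by (intro mk_nat_eqI) (simp add: bprod_mult_left mor_add shift_hom_closed)
qed

lemma dual_mackey: "premod P \<Longrightarrow> mackey_functor n (dual n R P)"
  unfolding dual_def by (rule inthom_mackey) simp_all

section \<open>The pairing of the dual with a module\<close>

text \<open>The tensor-Hom map \<open>(\<theta> \<otimes> q)(p) = \<theta>(p) q\<close> on pure tensors. For \<open>\<theta>\<close> at level \<open>U\<close>, \<open>q\<close> at level \<open>V\<close>
  and \<open>p\<close> at level \<open>Y\<close> the product lies over \<open>(U \<times> Y) \<times> V\<close>, and \<^const>\<open>inthom\<close> expects it over
  \<open>(U \<times> V) \<times> Y\<close>.\<close>

definition hompair :: "('r, 'p, 'x) rmod_scheme \<Rightarrow> ('r, 'q, 'y) rmod_scheme \<Rightarrow> gset \<Rightarrow> gset \<Rightarrow> (gset \<Rightarrow> 'p \<Rightarrow> 'r) \<Rightarrow> 'q \<Rightarrow> gset \<Rightarrow> 'p \<Rightarrow> 'q" where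
  "hompair P Q U V \<theta> q = mk_nat n P (\<lambda>Y p. tra n Q ((U \<times>\<^sub>G Y) \<times>\<^sub>G V) ((U \<times>\<^sub>G V) \<times>\<^sub>G Y) swap_right (xact n R Q (U \<times>\<^sub>G Y) V (\<theta> Y p) q))"

lemma hompair_nathom:
  assumes Q: "premod Q" and g: "U \<in> gsets n" "V \<in> gsets n" "q \<in> carrier (val Q V)"
  shows "nathom (lshift R U) (lshift Q (U \<times>\<^sub>G V)) (\<lambda>Y c. tra n Q ((U \<times>\<^sub>G Y) \<times>\<^sub>G V) ((U \<times>\<^sub>G V) \<times>\<^sub>G Y) swap_right (xact n R Q (U \<times>\<^sub>G Y) V c q))"
proof (rule nathomI)
  note QM = premod_mackey[OF Q] and x = xact_pairing[OF Q]
  show "mackey_functor n (lshift R U)" "mackey_functor n (lshift Q (U \<times>\<^sub>G V))" using QM g by simp_all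
  fix X Y h y assume "X \<in> gsets n" "Y \<in> gsets n" "eqv n X Y h" "y \<in> carrier (val (lshift R U) Y)"
  then show "tra n Q ((U \<times>\<^sub>G X) \<times>\<^sub>G V) ((U \<times>\<^sub>G V) \<times>\<^sub>G X) swap_right (xact n R Q (U \<times>\<^sub>G X) V (res n (lshift R U) X Y h y) q) =
     res n (lshift Q (U \<times>\<^sub>G V)) X Y h (tra n Q ((U \<times>\<^sub>G Y) \<times>\<^sub>G V) ((U \<times>\<^sub>G V) \<times>\<^sub>G Y) swap_right (xact n R Q (U \<times>\<^sub>G Y) V y q))"
    using QM g by (simp add: res_lshift eqv_def)
      (subst base_change[where W = "(U \<times>\<^sub>G X) \<times>\<^sub>G V" and ?w1.0 = "\<lambda>w. PPair (PPair (pfst (pfst w)) (h (psnd (pfst w)))) (psnd w)" and ?w2.0 = swap_right],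
        simp_all add: eqv_def pairing_closed[OF x] pairing_res_left[OF x])
qed (use premod_mackey[OF Q] g in \<open>simp_all add: hom_def Pi_iff eqv_def tra_lshift tra_tra tra_mult
      pairing_closed[OF xact_pairing[OF Q]] pairing_mult_left[OF xact_pairing[OF Q]] pairing_tra_left[OF xact_pairing[OF Q]]\<close>)

text \<open>Linearity in \<open>p\<close> is associativity of the action on \<open>Q\<close>: \<open>\<theta>(a p) q = (a \<theta>(p)) q = a (\<theta>(p) q)\<close>.\<close>

lemma hompair_closed:
  assumes P: "premod P" and Q: "extmod Q" and g: "U \<in> gsets n" "V \<in> gsets n" "q \<in> carrier (val Q V)"
    and t: "\<theta> \<in> rmod_hom n R P (shift n R (regular R) U)"
  shows "hompair P Q U V \<theta> q \<in> rmod_hom n R P (shift n R Q (U \<times>\<^sub>G V))"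
  unfolding hompair_def
proof (rule rmod_homI[OF P])
  note Q' = extmod_premod[OF Q] note QM = premod_mackey[OF Q'] and x = xact_pairing[OF Q']
  have tn: "nathom P (lshift R U) \<theta>" using rmod_hom_nathom[OF t] by simp
  show "premod (shift n R Q (U \<times>\<^sub>G V))" using premod_shift[OF Q'] g by simp
  show "nathom P (shift n R Q (U \<times>\<^sub>G V)) (\<lambda>Y p. tra n Q ((U \<times>\<^sub>G Y) \<times>\<^sub>G V) ((U \<times>\<^sub>G V) \<times>\<^sub>G Y) swap_right (xact n R Q (U \<times>\<^sub>G Y) V (\<theta> Y p) q))"
    using nathom_comp[OF tn hompair_nathom[OF Q' g]] by simp
  fix W Y a p assume w: "W \<in> gsets n" "Y \<in> gsets n" "a \<in> carrier (val R W)" "p \<in> carrier (val P Y)"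
  have c: "\<theta> Y p \<in> carrier (val R (U \<times>\<^sub>G Y))" using shift_hom_closed[OF t w(2,4)] by simp
  have "\<theta> (W \<times>\<^sub>G Y) (xact n R P W Y a p) = tra n R (W \<times>\<^sub>G (U \<times>\<^sub>G Y)) (U \<times>\<^sub>G (W \<times>\<^sub>G Y)) swap_left (xmul n R W (U \<times>\<^sub>G Y) a (\<theta> Y p))"
    using rmod_hom_xact[OF P premod_shift[OF premod_regular g(1)] t w] xact_shift[OF premod_regular g(1) w(1,2,3)] c by simp
  then show "tra n Q ((U \<times>\<^sub>G (W \<times>\<^sub>G Y)) \<times>\<^sub>G V) ((U \<times>\<^sub>G V) \<times>\<^sub>G (W \<times>\<^sub>G Y)) swap_right
        (xact n R Q (U \<times>\<^sub>G (W \<times>\<^sub>G Y)) V (\<theta> (W \<times>\<^sub>G Y) (xact n R P W Y a p)) q) =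
       xact n R (shift n R Q (U \<times>\<^sub>G V)) W Y a (tra n Q ((U \<times>\<^sub>G Y) \<times>\<^sub>G V) ((U \<times>\<^sub>G V) \<times>\<^sub>G Y) swap_right (xact n R Q (U \<times>\<^sub>G Y) V (\<theta> Y p) q))"
    using c w g QM
    by (simp add: xact_shift[OF Q'] eqv_def pairing_closed[OF x] pairing_closed[OF xmul_pairing] pairing_tra_left[OF x] pairing_tra_right[OF x] extmod_assoc[OF Q] tra_tra)
qed

lemma hompair_apply: "Y \<in> gsets n \<Longrightarrow> p \<in> carrier (val P Y) \<Longrightarrow> hompair P Q U V \<theta> q Y p =
    tra n Q ((U \<times>\<^sub>G Y) \<times>\<^sub>G V) ((U \<times>\<^sub>G V) \<times>\<^sub>G Y) swap_right (xact n R Q (U \<times>\<^sub>G Y) V (\<theta> Y p) q)"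
  by (simp add: hompair_def)

lemma dual_carrier: "\<theta> \<in> carrier (val (dual n R P) U) \<longleftrightarrow> \<theta> \<in> rmod_hom n R P (shift n R (regular R) U)"
  by (simp add: dual_def inthom_simps)

lemma dual_closed: "\<theta> \<in> carrier (val (dual n R P) U) \<Longrightarrow> Y \<in> gsets n \<Longrightarrow> p \<in> carrier (val P Y) \<Longrightarrow> \<theta> Y p \<in> carrier (val R (U \<times>\<^sub>G Y))"
  unfolding dual_carrier using shift_hom_closed[of \<theta> P "regular R"] by simp

text \<open>Restrictions are moved past \<open>swap_right\<close> by base change, as \<open>swap_right\<close> is applied as a
  transfer; transfers only have to be composed.\<close>

lemma hompair_pairing:
  assumes P: "premod P" and Q: "extmod Q"
  shows "pairing (dual n R P) Q (inthom n R P Q) (hompair P Q)"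
proof (rule pairingI)
  note Q' = extmod_premod[OF Q] note QM = premod_mackey[OF Q'] and x = xact_pairing[OF Q']
  show "mackey_functor n (dual n R P)" "mackey_functor n Q" "mackey_functor n (inthom n R P Q)"
    using P Q' QM by (simp_all add: dual_mackey inthom_mackey)
  fix U U' V f \<theta> q assume "U \<in> gsets n" "U' \<in> gsets n" "V \<in> gsets n" "eqv n U U' f" "\<theta> \<in> carrier (val (dual n R P) U')" "q \<in> carrier (val Q V)"
  then show "hompair P Q U V (res n (dual n R P) U U' f \<theta>) q =
     res n (inthom n R P Q) (U \<times>\<^sub>G V) (U' \<times>\<^sub>G V) (on_fst f) (hompair P Q U' V \<theta> q)"
    using QM unfolding dual_def by (subst res_inthom, simp, simp add: eqv_def, unfold hompair_def, intro mk_nat_eqI,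
        simp add: res_inthom dual_closed[unfolded dual_def] pairing_res_left[OF x] eqv_def)
      (subst base_change[where W = "(U \<times>\<^sub>G _) \<times>\<^sub>G V" and ?w1.0 = "\<lambda>w. PPair (PPair (f (pfst (pfst w))) (psnd (pfst w))) (psnd w)" and ?w2.0 = swap_right],
        simp_all add: eqv_def dual_closed[unfolded dual_def] pairing_closed[OF x])
next
  note Q' = extmod_premod[OF Q] note QM = premod_mackey[OF Q'] and x = xact_pairing[OF Q']
  fix U V V' f \<theta> q assume "U \<in> gsets n" "V \<in> gsets n" "V' \<in> gsets n" "eqv n V V' f" "\<theta> \<in> carrier (val (dual n R P) U)" "q \<in> carrier (val Q V')"
  then show "hompair P Q U V \<theta> (res n Q V V' f q) =
     res n (inthom n R P Q) (U \<times>\<^sub>G V) (U \<times>\<^sub>G V') (on_snd f) (hompair P Q U V' \<theta> q)"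
    using QM by (subst res_inthom, simp, simp add: eqv_def, unfold hompair_def, intro mk_nat_eqI,
        simp add: dual_closed pairing_res_right[OF x] eqv_def)
      (subst base_change[where W = "(U \<times>\<^sub>G _) \<times>\<^sub>G V" and ?w1.0 = "on_snd f" and ?w2.0 = swap_right],
        simp_all add: eqv_def dual_closed pairing_closed[OF x])
next
  note Q' = extmod_premod[OF Q] note QM = premod_mackey[OF Q'] and x = xact_pairing[OF Q']
  fix U U' V f \<theta> q assume "U \<in> gsets n" "U' \<in> gsets n" "V \<in> gsets n" "eqv n U U' f" "\<theta> \<in> carrier (val (dual n R P) U)" "q \<in> carrier (val Q V)"
  then show "hompair P Q U' V (tra n (dual n R P) U U' f \<theta>) q =
     tra n (inthom n R P Q) (U \<times>\<^sub>G V) (U' \<times>\<^sub>G V) (on_fst f) (hompair P Q U V \<theta> q)"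
    using QM unfolding dual_def by (subst tra_inthom, simp, simp add: eqv_def, unfold hompair_def, intro mk_nat_eqI,
        simp add: tra_inthom dual_closed[unfolded dual_def] pairing_tra_left[OF x] pairing_closed[OF x] tra_tra eqv_def)
next
  note Q' = extmod_premod[OF Q] note QM = premod_mackey[OF Q'] and x = xact_pairing[OF Q']
  fix U V V' f \<theta> q assume "U \<in> gsets n" "V \<in> gsets n" "V' \<in> gsets n" "eqv n V V' f" "\<theta> \<in> carrier (val (dual n R P) U)" "q \<in> carrier (val Q V)"
  then show "hompair P Q U V' \<theta> (tra n Q V V' f q) =
     tra n (inthom n R P Q) (U \<times>\<^sub>G V) (U \<times>\<^sub>G V') (on_snd f) (hompair P Q U V \<theta> q)"
    using QM by (subst tra_inthom, simp, simp add: eqv_def, unfold hompair_def, intro mk_nat_eqI,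
        simp add: dual_closed pairing_tra_right[OF x] pairing_closed[OF x] tra_tra eqv_def)
next
  note Q' = extmod_premod[OF Q] note QM = premod_mackey[OF Q'] and x = xact_pairing[OF Q']
  fix U V \<theta> q assume g: "U \<in> gsets n" "V \<in> gsets n" "\<theta> \<in> carrier (val (dual n R P) U)" "q \<in> carrier (val Q V)"
  then show "hompair P Q U V \<theta> q \<in> carrier (val (inthom n R P Q) (U \<times>\<^sub>G V))"
    by (simp add: inthom_simps(1) hompair_closed[OF P Q] dual_carrier)
  { fix \<theta>' assume "\<theta>' \<in> carrier (val (dual n R P) U)"
    then show "hompair P Q U V (\<theta> \<otimes>\<^bsub>val (dual n R P) U\<^esub> \<theta>') q = hompair P Q U V \<theta> q \<otimes>\<^bsub>val (inthom n R P Q) (U \<times>\<^sub>G V)\<^esub> hompair P Q U V \<theta>' q"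
      using g QM unfolding inthom_simps hompair_def dual_def by (intro mk_nat_eqI)
        (simp add: dual_closed[unfolded dual_carrier] inthom_simps(2) pairing_mult_left[OF x] pairing_closed[OF x] tra_mult eqv_def) }
  fix q' assume "q' \<in> carrier (val Q V)"
  then show "hompair P Q U V \<theta> (q \<otimes>\<^bsub>val Q V\<^esub> q') = hompair P Q U V \<theta> q \<otimes>\<^bsub>val (inthom n R P Q) (U \<times>\<^sub>G V)\<^esub> hompair P Q U V \<theta> q'"
    using g QM unfolding inthom_simps hompair_def by (intro mk_nat_eqI)
      (simp add: dual_closed pairing_mult_right[OF x] pairing_closed[OF x] tra_mult eqv_def)
qed

end

section \<open>Coequalizers of abelian groups\<close>

lemma coeq_group:
  assumes G: "group G" and H: "comm_group H" and d: "d \<in> hom G H" and e: "e \<in> hom G H"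
  defines "S \<equiv> {d z \<otimes>\<^bsub>H\<^esub> inv\<^bsub>H\<^esub> e z | z. z \<in> carrier G}"
  shows "subgroup S H" "comm_group (H Mod S)" "(\<lambda>x. S #>\<^bsub>H\<^esub> x) \<in> hom H (H Mod S)"
    "\<And>z. z \<in> carrier G \<Longrightarrow> S #>\<^bsub>H\<^esub> d z = S #>\<^bsub>H\<^esub> e z"
proof -
  interpret H: comm_group H by fact
  interpret G: group G by fact
  have ei: "(\<lambda>z. inv\<^bsub>H\<^esub> e z) \<in> hom G H"
    using e by (auto simp: hom_def H.inv_mult Pi_iff)
  have h: "(\<lambda>z. d z \<otimes>\<^bsub>H\<^esub> inv\<^bsub>H\<^esub> e z) \<in> hom G H" by (rule H.hom_group_mult[OF d ei])
  interpret h: group_hom G H "\<lambda>z. d z \<otimes>\<^bsub>H\<^esub> inv\<^bsub>H\<^esub> e z" using h by unfold_locales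
  have S: "S = (\<lambda>z. d z \<otimes>\<^bsub>H\<^esub> inv\<^bsub>H\<^esub> e z) ` carrier G" by (auto simp: S_def)
  show sub: "subgroup S H" unfolding S by (rule h.img_is_subgroup)
  then show "comm_group (H Mod S)" by (rule H.abelian_FactGroup)
  show "(\<lambda>x. S #>\<^bsub>H\<^esub> x) \<in> hom H (H Mod S)"
    using normal.r_coset_hom_Mod[OF H.subgroup_imp_normal[OF sub]] .
  fix z assume z: "z \<in> carrier G"
  have c: "d z \<in> carrier H" "e z \<in> carrier H" using z d e by (auto simp: hom_def)
  have "d z \<otimes>\<^bsub>H\<^esub> inv\<^bsub>H\<^esub> e z \<in> S" using z by (auto simp: S_def)
  then have "d z \<in> S #>\<^bsub>H\<^esub> e z" using c by (auto simp: r_coset_def H.m_assoc intro!: bexI[of _ "d z \<otimes>\<^bsub>H\<^esub> inv\<^bsub>H\<^esub> e z"])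
  then show "S #>\<^bsub>H\<^esub> d z = S #>\<^bsub>H\<^esub> e z" using H.repr_independence[OF _ c(2) sub] by simp
qed

section \<open>Twists and twisted Hochschild homology\<close>

lemma twist_simps [simp]: "val (twist n R g P) = val P" "mor (twist n R g P) = mor P"
  by (simp_all add: twist_def)

lemma twist_box:
  "box_gens n M (twist n R g P) = box_gens n M P" "box_rels n M (twist n R g P) = box_rels n M P"
  "box_gen n M (twist n R g P) = box_gen n M P" "box n M (twist n R g P) = box n M P"
proof -
  show g: "box_gens n M (twist n R g P) = box_gens n M P" "box_rels n M (twist n R g P) = box_rels n M P" for M
    by (simp_all add: box_gens_def box_rels_def fun_eq_iff)
  show bg: "box_gen n M (twist n R g P) = box_gen n M P" for M
    by (simp_all add: box_gen_def g fun_eq_iff)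
  show b: "box n M (twist n R g P) = box n M P" for M
    by (simp_all add: box_def g bg)
qed

lemma twist_tra [simp]:
  "tra n (twist n R g P) = tra n P" "res n (twist n R g P) = res n P"
  "mk_nat n (twist n R g P) = mk_nat n P" "mackey_functor n (twist n R g P) = mackey_functor n P"
  by (simp_all add: tra_def res_def mk_nat_def mackey_functor_def fun_eq_iff)

lemma (in burnside) twist_nathom [simp]:
  "nathom M (twist n R g P) = nathom M P" "nathom (twist n R g P) M = nathom P M" "lshift (twist n R g P) X = lshift P X"
  "rshift (twist n R g P) X = rshift P X"
  by (simp_all add: nathom_def lshift_def rshift_def fun_eq_iff)

locale twisted_green = comm_green n R for n :: nat and R :: "('r, 'z) green_scheme" +
  fixes g :: complex
  assumes g: "g \<in> carrier (Cn n)"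
begin

lemma eqv_act [simp]: "X \<in> gsets n \<Longrightarrow> eqv n X X (snd X g)"
  using g by (simp add: eqv_def gsets_act_mult mult.commute)

text \<open>Acting by \<open>g\<close> commutes with every equivariant map \<open>h\<close>. For transfers this is base change along
  the square with sides \<open>h\<close> and the bijections given by \<open>g\<close>.\<close>

lemma alpha_nathom: "nathom R R (alpha n R g)"
proof (rule nathomI[OF R_mackey R_mackey])
  fix X assume "X \<in> gsets n"
  then show "alpha n R g X \<in> hom (val R X) (val R X)"
    by (simp add: alpha_def hom_def Pi_iff res_mult)
next
  fix X Y h x assume a: "X \<in> gsets n" "Y \<in> gsets n" "eqv n X Y h" "x \<in> carrier (val R X)"
  show "alpha n R g Y (tra n R X Y h x) = tra n R X Y h (alpha n R g X x)"
    unfolding alpha_def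
  proof (rule base_change)
    have inv: "inverse g \<in> carrier (Cn n)" using g by simp
    have i1: "snd X (inverse g) (snd X g u) = u" "snd X g (snd X (inverse g) u) = u" if "u \<in> fst X" for u
      using that a(1) g inv Cn_inverse[OF g] by (simp_all add: gsets_act_mult)
    have i2: "snd Y (inverse g) (snd Y g u) = u" if "u \<in> fst Y" for u
      using that a(2) g inv Cn_inverse[OF g] by (simp add: gsets_act_mult)
    show "\<forall>w\<in>fst X. h (snd X g w) = snd Y g (h w)" using eqvD(2)[OF a(3) _ g] by simp
    show "\<forall>u\<in>fst X. \<forall>v\<in>fst Y. h u = snd Y g v \<longrightarrow> (\<exists>w\<in>fst X. snd X g w = u \<and> h w = v)"
    proof (intro ballI impI)
      fix u v assume uv: "u \<in> fst X" "v \<in> fst Y" "h u = snd Y g v"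
      have "h (snd X (inverse g) u) = v" using eqvD(2)[OF a(3) uv(1) inv] uv i2 by simp
      then show "\<exists>w\<in>fst X. snd X g w = u \<and> h w = v"
        using uv(1) i1 a(1) inv by (intro bexI[of _ "snd X (inverse g) u"]) simp_all
    qed
    show "\<forall>w\<in>fst X. \<forall>w'\<in>fst X. snd X g w = snd X g w' \<longrightarrow> h w = h w' \<longrightarrow> w = w'"
      using i1 by metis
  qed (use a in simp_all)
next
  fix X Y h y assume a: "X \<in> gsets n" "Y \<in> gsets n" "eqv n X Y h" "y \<in> carrier (val R Y)"
  have "res n R X Y (\<lambda>x. h (snd X g x)) y = res n R X Y (\<lambda>x. snd Y g (h x)) y"
    using a(3) g by (intro fun_cong[OF res_cong]) (simp add: eqvD)
  then show "alpha n R g X (res n R X Y h y) = res n R X Y h (alpha n R g Y y)"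
    using a unfolding alpha_def by (simp add: res_res)
qed

lemma alpha_closed [simp]: "X \<in> gsets n \<Longrightarrow> x \<in> carrier (val R X) \<Longrightarrow> alpha n R g X x \<in> carrier (val R X)"
  by (rule nathom_closed[OF alpha_nathom])

text \<open>The action on \<open>U \<times> V\<close> is diagonal, so \<open>\<alpha>\<close> is multiplicative for external products.\<close>

lemma alpha_xmul:
  assumes "U \<in> gsets n" "V \<in> gsets n" "a \<in> carrier (val R U)" "b \<in> carrier (val R V)"
  shows "alpha n R g (U \<times>\<^sub>G V) (xmul n R U V a b) = xmul n R U V (alpha n R g U a) (alpha n R g V b)"
proof -
  have "res n R (U \<times>\<^sub>G V) (U \<times>\<^sub>G V) (snd (U \<times>\<^sub>G V) g) = res n R (U \<times>\<^sub>G V) (U \<times>\<^sub>G V) (\<lambda>w. PPair (snd U g (pfst w)) (snd V g (psnd w)))"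
  proof (rule res_cong)
    fix x assume "x \<in> fst (U \<times>\<^sub>G V)"
    moreover have "\<forall>x\<in>fst (U \<times>\<^sub>G V). snd (U \<times>\<^sub>G V) g x = PPair (snd U g (pfst x)) (snd V g (psnd x))" by simp
    ultimately show "snd (U \<times>\<^sub>G V) g x = PPair (snd U g (pfst x)) (snd V g (psnd x))" by blast
  qed
  moreover have "eqv n (U \<times>\<^sub>G V) (U \<times>\<^sub>G V) (\<lambda>w. PPair (snd U g (pfst w)) (psnd w))" "eqv n (U \<times>\<^sub>G V) (U \<times>\<^sub>G V) (\<lambda>w. PPair (pfst w) (snd V g (psnd w)))"
    using eqv_act[OF assms(1)] eqv_act[OF assms(2)] by (simp_all add: eqv_def)
  ultimately show ?thesis using assms unfolding alpha_def
    by (simp add: pairing_res_left[OF xmul_pairing] pairing_res_right[OF xmul_pairing] pairing_closed[OF xmul_pairing] res_res)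
qed

lemma premod_twist: assumes P: "premod P" shows "premod (twist n R g P)"
proof -
  note PM = premod_mackey[OF P]
  have "nathom (box n R P) P (\<lambda>X z. lact P X (box_map n R P (alpha n R g) nat_id X z))"
    by (rule nathom_comp[OF box_map_nathom[OF R_mackey PM R_mackey PM alpha_nathom nat_id_nathom] premod_lact[OF P]])
  moreover have "lact (twist n R g P) = (\<lambda>X z. lact P X (box_map n R P (alpha n R g) nat_id X z))" by (simp add: twist_def)
  ultimately show ?thesis using PM by (simp add: premod_def twist_box)
qed

lemma xact_twist:
  assumes P: "premod P" and "U \<in> gsets n" "V \<in> gsets n" "a \<in> carrier (val R U)" "p \<in> carrier (val P V)"
  shows "xact n R (twist n R g P) U V a p = xact n R P U V (alpha n R g U a) p"
proof -
  have l: "lact (twist n R g P) = (\<lambda>X z. lact P X (box_map n R P (alpha n R g) nat_id X z))" by (simp add: twist_def)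
  show ?thesis using assms(2-) premod_mackey[OF P]
    by (simp add: xact_def l twist_box box_map_gen[OF R_mackey premod_mackey[OF P] R_mackey premod_mackey[OF P] alpha_nathom nat_id_nathom])
qed

lemma extmod_twist: assumes P: "extmod P" shows "extmod (twist n R g P)"
proof -
  note P' = extmod_premod[OF P] note x = xact_pairing[OF P']
  show ?thesis unfolding extmod_def
  proof (intro conjI ballI)
    show "premod (twist n R g P)" by (rule premod_twist[OF P'])
    fix U V W a b p assume "U \<in> gsets n" "V \<in> gsets n" "W \<in> gsets n" "a \<in> carrier (val R U)" "b \<in> carrier (val R V)"
      "p \<in> carrier (val (twist n R g P) W)"
    then show "xact n R (twist n R g P) (U \<times>\<^sub>G V) W (xmul n R U V a b) p =
       tra n (twist n R g P) (U \<times>\<^sub>G (V \<times>\<^sub>G W)) ((U \<times>\<^sub>G V) \<times>\<^sub>G W) assocR (xact n R (twist n R g P) U (V \<times>\<^sub>G W) a (xact n R (twist n R g P) V W b p))"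
      by (simp add: xact_twist[OF P'] pairing_closed[OF xmul_pairing] pairing_closed[OF x] alpha_xmul extmod_assoc[OF P])
  qed
qed

lemma hh_left_nathom: "nathom (box n R R) R (hh_left n R g)"
proof -
  have "hh_left n R g = (\<lambda>X z. mul R X (box_map n R R (alpha n R g) nat_id X z))" by (simp add: hh_left_def fun_eq_iff)
  then show ?thesis
    using nathom_comp[OF box_map_nathom[OF R_mackey R_mackey R_mackey R_mackey alpha_nathom nat_id_nathom] mul_nathom] by simp
qed

lemma hh_right_nathom: "nathom (box n R R) R (hh_right n R)"
proof -
  have "hh_right n R = (\<lambda>X z. mul R X (box_sym n R R X z))" by (simp add: hh_right_def fun_eq_iff)
  then show ?thesis using nathom_comp[OF box_sym_nathom[OF R_mackey R_mackey] mul_nathom] by simp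
qed

lemma
  assumes X: "X \<in> gsets n"
  shows HH0_group: "comm_group (val (HH0 n R g) X)"
    and HH0_map_hom: "HH0_map n R g X \<in> hom (val R X) (val (HH0 n R g) X)"
    and HH0_map_eq: "\<And>z. z \<in> carrier (val (box n R R) X) \<Longrightarrow> HH0_map n R g X (hh_left n R g X z) = HH0_map n R g X (hh_right n R X z)"
proof -
  note c = coeq_group[OF mackey_is_group[OF box_mackey[OF R_mackey R_mackey] X] mackey_group[OF R_mackey X]
      nathom_hom[OF hh_left_nathom X] nathom_hom[OF hh_right_nathom X], folded coeq_rel_def]
  show "comm_group (val (HH0 n R g) X)" using c(2) by (simp add: HH0_def coeq_def)
  show "HH0_map n R g X \<in> hom (val R X) (val (HH0 n R g) X)" using c(3) by (simp add: HH0_def HH0_map_def coeq_def coeq_map_def[abs_def])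
  show "HH0_map n R g X (hh_left n R g X z) = HH0_map n R g X (hh_right n R X z)" if "z \<in> carrier (val (box n R R) X)" for z
    using c(4)[OF that] by (simp add: HH0_map_def coeq_map_def)
qed

text \<open>In \<open>HH\<^sub>0\<close> one may insert the twist in the first factor of a product. As \<open>R\<close> is commutative, the
  swap in the definition can be undone.\<close>

lemma HH0_twist:
  assumes X: "X \<in> gsets n" and "Y \<in> gsets n" "Z \<in> gsets n" "\<psi> \<in> carrier (bhom n (Y \<times>\<^sub>G Z) X)" "a \<in> carrier (val R Y)" "b \<in> carrier (val R Z)"
  shows "HH0_map n R g X (mor R (Y \<times>\<^sub>G Z) X \<psi> (xmul n R Y Z (alpha n R g Y a) b)) =
    HH0_map n R g X (mor R (Y \<times>\<^sub>G Z) X \<psi> (xmul n R Y Z a b))"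
proof -
  let ?z = "box_gen n R R X (Y, Z, \<psi>, a, b)"
  have z: "?z \<in> carrier (val (box n R R) X)" using assms by simp
  have "hh_left n R g X ?z = mor R (Y \<times>\<^sub>G Z) X \<psi> (xmul n R Y Z (alpha n R g Y a) b)"
    using assms by (simp add: hh_left_def box_map_gen[OF R_mackey R_mackey R_mackey R_mackey alpha_nathom nat_id_nathom] mul_gen)
  moreover have "hh_right n R X ?z = mul R X ?z" 
    using comm_green X z by (simp add: hh_right_def comm_green_functor_def)
  ultimately show ?thesis using HH0_map_eq[OF X z] assms by (simp add: mul_gen)
qed

end

context comm_green
begin

section \<open>Contraction and dual bases\<close>

text \<open>\<open>contract\<close> is the sum \<open>\<Sum> c(x, y) p(x)\<close> over the points \<open>x\<close> of \<open>X\<close>, and \<open>diag_span X\<close> the counit of the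
  self-duality of \<open>X\<close> in the Burnside category.\<close>

definition contract :: "('r, 'q, 'y) rmod_scheme \<Rightarrow> gset \<Rightarrow> gset \<Rightarrow> 'r \<Rightarrow> 'q \<Rightarrow> 'q" where
  "contract Q X Y c p = tra n Q (X \<times>\<^sub>G Y) Y psnd (res n Q (X \<times>\<^sub>G Y) ((X \<times>\<^sub>G Y) \<times>\<^sub>G X) (\<lambda>w. PPair w (pfst w)) (xact n R Q (X \<times>\<^sub>G Y) X c p))"

definition diag_span :: "gset \<Rightarrow> bmor" where
  "diag_span X = sp n (X \<times>\<^sub>G X) (gone n) X (\<lambda>x. PPair x x) (\<lambda>x. pnt n)"

lemma diag_span_closed [simp]: "X \<in> gsets n \<Longrightarrow> diag_span X \<in> carrier (bhom n (X \<times>\<^sub>G X) (gone n))"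
  unfolding diag_span_def by (rule sp_closed) (simp_all add: eqv_def)

lemma eqv_contract: "X \<in> gsets n \<Longrightarrow> Y \<in> gsets n \<Longrightarrow> eqv n (X \<times>\<^sub>G Y) ((X \<times>\<^sub>G Y) \<times>\<^sub>G X) (\<lambda>w. PPair w (pfst w))"
  "eqv n (X \<times>\<^sub>G Y) Y psnd"
  by (simp_all add: eqv_def)

lemma contract_closed: "premod Q \<Longrightarrow> X \<in> gsets n \<Longrightarrow> Y \<in> gsets n \<Longrightarrow> c \<in> carrier (val R (X \<times>\<^sub>G Y)) \<Longrightarrow> p \<in> carrier (val Q X) \<Longrightarrow>
    contract Q X Y c p \<in> carrier (val Q Y)"
  unfolding contract_def using premod_mackey[of Q] by (simp add: eqv_contract pairing_closed[OF xact_pairing])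

lemma contract_rmod_hom:
  assumes P: "premod P" and Q: "premod Q" and f: "f \<in> rmod_hom n R P Q"
    and g: "X \<in> gsets n" "Y \<in> gsets n" "c \<in> carrier (val R (X \<times>\<^sub>G Y))" "p \<in> carrier (val P X)"
  shows "f Y (contract P X Y c p) = contract Q X Y c (f X p)"
  unfolding contract_def using g premod_mackey[OF P]
  by (simp add: nathom_tra[OF rmod_hom_nathom[OF f]] nathom_res[OF rmod_hom_nathom[OF f]] rmod_hom_xact[OF P Q f] eqv_contract pairing_closed[OF xact_pairing[OF P]])

text \<open>The composite of \<open>\<theta> \<otimes> q\<close> with the counit is \<open>p \<mapsto> \<Sum> \<theta>(p)(x) q(x)\<close>. The remaining transfer
  identifies \<open>Y\<close> with \<open>C\<^sub>n/C\<^sub>n \<times> Y\<close>, as in \<^const>\<open>hom_elt\<close>.\<close>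

lemma hompair_diag:
  fixes P :: "('r, 'p) rmod" and Q :: "('r, 'q) rmod"
  assumes P: "premod P" and Q: "premod Q" and X: "X \<in> gsets n" and t: "\<theta> \<in> carrier (val (dual n R P) X)" and q: "q \<in> carrier (val Q X)"
    and Y: "Y \<in> gsets n" and p: "p \<in> carrier (val P Y)"
  shows "mor (inthom n R P Q) (X \<times>\<^sub>G X) (gone n) (diag_span X) (hompair P Q X X \<theta> q) Y p =
    tra n Q Y (gone n \<times>\<^sub>G Y) (\<lambda>y. PPair (pnt n) y) (contract Q X Y (\<theta> Y p) q)"
proof -
  note QM = premod_mackey[OF Q]
  let ?A = "xact n R Q (X \<times>\<^sub>G Y) X (\<theta> Y p) q"
  have A: "?A \<in> carrier (val Q ((X \<times>\<^sub>G Y) \<times>\<^sub>G X))"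
    using pairing_closed[OF xact_pairing[OF Q]] X Y q dual_closed[OF t Y p] by simp
  have b: "bprod n (X \<times>\<^sub>G X) (gone n) Y Y (diag_span X) (bid n Y) =
     sp n ((X \<times>\<^sub>G X) \<times>\<^sub>G Y) (gone n \<times>\<^sub>G Y) (X \<times>\<^sub>G Y) (\<lambda>w. PPair (PPair (pfst w) (pfst w)) (psnd w)) (\<lambda>w. PPair (pnt n) (psnd w))"
    unfolding diag_span_def bid_sp using X Y by (subst bprod_sp) (simp_all add: eqv_def)
  have "mor (inthom n R P Q) (X \<times>\<^sub>G X) (gone n) (diag_span X) (hompair P Q X X \<theta> q) Y p =
     tra n Q (X \<times>\<^sub>G Y) (gone n \<times>\<^sub>G Y) (\<lambda>w. PPair (pnt n) (psnd w)) (res n Q (X \<times>\<^sub>G Y) ((X \<times>\<^sub>G X) \<times>\<^sub>G Y) (\<lambda>w. PPair (PPair (pfst w) (pfst w)) (psnd w))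
       (tra n Q ((X \<times>\<^sub>G Y) \<times>\<^sub>G X) ((X \<times>\<^sub>G X) \<times>\<^sub>G Y) swap_right ?A))"
    using X Y p QM A by (simp add: inthom_simps hompair_apply b mor_sp eqv_def)
  also have "res n Q (X \<times>\<^sub>G Y) ((X \<times>\<^sub>G X) \<times>\<^sub>G Y) (\<lambda>w. PPair (PPair (pfst w) (pfst w)) (psnd w))
       (tra n Q ((X \<times>\<^sub>G Y) \<times>\<^sub>G X) ((X \<times>\<^sub>G X) \<times>\<^sub>G Y) swap_right ?A) =
     tra n Q (X \<times>\<^sub>G Y) (X \<times>\<^sub>G Y) (\<lambda>w. w) (res n Q (X \<times>\<^sub>G Y) ((X \<times>\<^sub>G Y) \<times>\<^sub>G X) (\<lambda>w. PPair w (pfst w)) ?A)"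
    using X Y QM A by (intro base_change) (simp_all add: eqv_def)
  finally show ?thesis using X Y QM A unfolding contract_def by (simp add: tra_ident eqv_contract tra_tra) (simp add: eqv_def tra_tra)
qed

text \<open>The identification of \<open>Q(C\<^sub>n/C\<^sub>n \<times> -)\<close> with \<open>Q\<close>, which turns elements of the internal Hom at level
  \<open>C\<^sub>n/C\<^sub>n\<close> into linear maps.\<close>

lemma shift_one_rmod:
  assumes Q: "premod Q"
  shows "mk_nat n (shift n R Q (gone n)) (\<lambda>Y. tra n Q (gone n \<times>\<^sub>G Y) Y psnd) \<in> rmod_hom n R (shift n R Q (gone n)) Q"
proof (rule rmod_homI[OF premod_shift[OF Q gone_gset] Q])
  note QM = premod_mackey[OF Q] and x = xact_pairing[OF Q]
  have "nathom (lshift Q (gone n)) Q (\<lambda>Y. tra n Q (gone n \<times>\<^sub>G Y) Y psnd)"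
  proof (rule nathomI)
    fix X Y h y assume "X \<in> gsets n" "Y \<in> gsets n" "eqv n X Y h" "y \<in> carrier (val (lshift Q (gone n)) Y)"
    then show "tra n Q (gone n \<times>\<^sub>G X) X psnd (res n (lshift Q (gone n)) X Y h y) = res n Q X Y h (tra n Q (gone n \<times>\<^sub>G Y) Y psnd y)"
      using QM by (simp add: res_lshift)
        (subst base_change[where W = "gone n \<times>\<^sub>G X" and ?w1.0 = "on_snd h" and ?w2.0 = psnd], simp_all add: eqv_def)
  qed (use QM in \<open>simp_all add: hom_def Pi_iff tra_mult tra_lshift tra_tra eqv_def\<close>)
  then show "nathom (shift n R Q (gone n)) Q (\<lambda>Y. tra n Q (gone n \<times>\<^sub>G Y) Y psnd)"
    unfolding nathom_def shift_def lshift_def by simp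
  fix U V a p assume "U \<in> gsets n" "V \<in> gsets n" "a \<in> carrier (val R U)" "p \<in> carrier (val (shift n R Q (gone n)) V)"
  then show "tra n Q (gone n \<times>\<^sub>G (U \<times>\<^sub>G V)) (U \<times>\<^sub>G V) psnd (xact n R (shift n R Q (gone n)) U V a p) =
       xact n R Q U V a (tra n Q (gone n \<times>\<^sub>G V) V psnd p)"
    using QM by (simp add: xact_shift[OF Q] eqv_def pairing_tra_right[OF x] pairing_closed[OF x] tra_tra)
qed

text \<open>The map \<open>p \<mapsto> \<Sum> \<theta>(p)(x) q(x)\<close> is linear because it is the image of \<open>\<theta> \<otimes> q\<close> under the tensor-Hom
  map followed by the counit of \<open>X\<close>.\<close>

lemma contract_dual_rmod:
  fixes P :: "('r, 'p) rmod" and Q :: "('r, 'q) rmod"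
  assumes P: "premod P" and Q: "extmod Q" and X: "X \<in> gsets n" and t: "\<theta> \<in> carrier (val (dual n R P) X)" and q: "q \<in> carrier (val Q X)"
  shows "mk_nat n P (\<lambda>Y p. contract Q X Y (\<theta> Y p) q) \<in> rmod_hom n R P Q"
proof -
  note Q' = extmod_premod[OF Q] note QM = premod_mackey[OF Q']
  let ?F = "mor (inthom n R P Q) (X \<times>\<^sub>G X) (gone n) (diag_span X) (hompair P Q X X \<theta> q)"
  let ?S = "shift n R Q (gone n)"
  have F: "?F \<in> rmod_hom n R P ?S"
    using X t q by (intro inthom_mor_closed[OF P Q'] hompair_closed[OF P Q]) (simp_all add: dual_carrier)
  have "mk_nat n P (\<lambda>Y p. mk_nat n ?S (\<lambda>Y. tra n Q (gone n \<times>\<^sub>G Y) Y psnd) Y (?F Y p)) \<in> rmod_hom n R P Q"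
    by (rule rmod_hom_comp[OF P premod_shift[OF Q' gone_gset] Q' F shift_one_rmod[OF Q']])
  also have "mk_nat n P (\<lambda>Y p. mk_nat n ?S (\<lambda>Y. tra n Q (gone n \<times>\<^sub>G Y) Y psnd) Y (?F Y p)) = mk_nat n P (\<lambda>Y p. contract Q X Y (\<theta> Y p) q)"
  proof (rule mk_nat_eqI)
    fix Y p assume Y: "Y \<in> gsets n" and p: "p \<in> carrier (val P Y)"
    have c: "contract Q X Y (\<theta> Y p) q \<in> carrier (val Q Y)" using contract_closed[OF Q' X Y dual_closed[OF t Y p] q] .
    show "mk_nat n ?S (\<lambda>Y. tra n Q (gone n \<times>\<^sub>G Y) Y psnd) Y (?F Y p) = contract Q X Y (\<theta> Y p) q"
      unfolding hompair_diag[OF P Q' X t q Y p] using Y c QM by (simp add: eqv_def tra_tra tra_ident)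
  qed
  finally show ?thesis .
qed

text \<open>The usual \<open>q = \<Sum> \<theta>\<^sub>0(q)(x) p\<^sub>0(x)\<close>, indexed by the points of a finite \<open>C\<^sub>n\<close>-set \<open>X\<close>: \<open>p0\<close> is the
  family of basis elements and \<open>\<theta>0\<close> the family of coordinate functionals.\<close>

definition dual_basis :: "('r, 'p) rmod \<Rightarrow> gset \<Rightarrow> 'p \<Rightarrow> (gset \<Rightarrow> 'p \<Rightarrow> 'r) \<Rightarrow> bool" where
  "dual_basis P X p0 \<theta>0 \<longleftrightarrow> X \<in> gsets n \<and> p0 \<in> carrier (val P X) \<and> \<theta>0 \<in> carrier (val (dual n R P) X) \<and>
     (\<forall>Y\<in>gsets n. \<forall>q\<in>carrier (val P Y). contract P X Y (\<theta>0 Y q) p0 = q)"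

end

context twisted_green
begin

section \<open>The Hattori--Stallings trace through a dual basis\<close>

context
  fixes P :: "('r, 'p) rmod"
  assumes P: "extmod P"
begin

abbreviation "gP \<equiv> twist n R g P"
abbreviation "Pd \<equiv> dual n R P"

lemma P_pre: "premod P" and P_mackey: "mackey_functor n P" and gP_ext: "extmod gP" and gP_pre: "premod gP" and gP_mackey: "mackey_functor n gP"
    and Pd_mackey: "mackey_functor n Pd" and H_mackey: "mackey_functor n (inthom n R P gP)"
proof -
  show p: "premod P" by (rule extmod_premod[OF P])
  show "mackey_functor n P" by (rule premod_mackey[OF p])
  show g: "extmod gP" by (rule extmod_twist[OF P])
  show g': "premod gP" by (rule extmod_premod[OF g])
  show "mackey_functor n gP" by (rule premod_mackey[OF g'])
  show "mackey_functor n Pd" by (rule dual_mackey[OF p])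
  show "mackey_functor n (inthom n R P gP)" by (rule inthom_mackey[OF p g'])
qed

text \<open>The tensor-Hom map on the box product over the Burnside functor; \<^const>\<open>hs_delta\<close> is what it induces on
  the box product over \<open>R\<close>. Likewise \<open>bal_left\<close> and \<open>bal_right\<close> below are the two maps of which
  the latter is the coequalizer, and \<open>pi0\<close> is the map that induces \<open>\<pi>\<close>.\<close>

abbreviation "delta0 \<equiv> blift (inthom n R P gP) (hompair P gP)"

lemmas hompair_twist = hompair_pairing[OF P_pre gP_ext]
lemmas delta0_nathom = blift_nathom[OF Pd_mackey gP_mackey H_mackey hompair_twist]
lemmas delta0_gen = blift_gen[OF Pd_mackey gP_mackey H_mackey hompair_twist]
lemmas delta0_bid = blift_bid[OF Pd_mackey gP_mackey H_mackey hompair_twist]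

lemma ract_pairing: "pairing Pd R Pd (hompair P (regular R))"
proof -
  have "pairing Pd (regular R) (inthom n R P (regular R)) (hompair P (regular R))" by (rule hompair_pairing[OF P_pre extmod_regular])
  then show ?thesis by (simp add: pairing_def dual_def)
qed

lemma dual_ract_eq:
  assumes X: "X \<in> gsets n" and z: "z \<in> carrier (val (box n Pd R) X)"
  shows "dual_ract n R P X z = blift Pd (hompair P (regular R)) X z"
  unfolding dual_ract_def
proof (rule ab_lift_blift[OF Pd_mackey R_mackey Pd_mackey ract_pairing X z], unfold prod.case)
  fix Y Z \<phi> m k assume a: "Y \<in> gsets n" "Z \<in> gsets n" "\<phi> \<in> carrier (bhom n (Y \<times>\<^sub>G Z) X)" "m \<in> carrier (val Pd Y)" "k \<in> carrier (val R Z)"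
  show "mk_nat n P (\<lambda>Ya p. mor R ((Y \<times>\<^sub>G Z) \<times>\<^sub>G Ya) (X \<times>\<^sub>G Ya) (bprod n (Y \<times>\<^sub>G Z) X Ya Ya \<phi> (bid n Ya))
       (tra n R ((Y \<times>\<^sub>G Ya) \<times>\<^sub>G Z) ((Y \<times>\<^sub>G Z) \<times>\<^sub>G Ya) swap_right (xmul n R (Y \<times>\<^sub>G Ya) Z (m Ya p) k))) =
    mor Pd (Y \<times>\<^sub>G Z) X \<phi> (hompair P (regular R) Y Z m k)"
    unfolding dual_def inthom_simps by (rule mk_nat_eqI) (simp add: hompair_apply)
qed simp

lemma dual_ract_nathom: "nathom (box n Pd R) Pd (dual_ract n R P)"
  using nathom_cong[OF blift_nathom[OF Pd_mackey R_mackey Pd_mackey ract_pairing] dual_ract_eq box_mackey[OF Pd_mackey R_mackey]] .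

abbreviation "bal_left \<equiv> box_map n Pd gP (dual_ract n R P) nat_id"
abbreviation "bal_right \<equiv> \<lambda>X z. box_map n Pd gP nat_id (lact gP) X (box_assoc n Pd R gP X z)"

lemma bal_left_nathom: "nathom (box n (box n Pd R) gP) (box n Pd gP) bal_left"
  by (rule box_map_nathom[OF box_mackey[OF Pd_mackey R_mackey] gP_mackey Pd_mackey gP_mackey dual_ract_nathom nat_id_nathom])

lemma bal_right_nathom: "nathom (box n (box n Pd R) gP) (box n Pd gP) bal_right"
  by (rule nathom_comp[OF box_assoc_nathom[OF Pd_mackey R_mackey gP_mackey]
      box_map_nathom[OF Pd_mackey box_mackey[OF R_mackey gP_mackey] Pd_mackey gP_mackey nat_id_nathom premod_lact[OF gP_pre]]])

text \<open>The tensor-Hom map is balanced: \<open>(\<theta> r)(p) q = \<theta>(p) (r q)\<close> is associativity of the action.\<close>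

lemma delta0_balanced:
  assumes X: "X \<in> gsets n" and z: "z \<in> carrier (val (box n (box n Pd R) gP) X)"
  shows "delta0 X (bal_left X z) = delta0 X (bal_right X z)"
proof (rule box3_nathom_eq[OF Pd_mackey R_mackey gP_mackey H_mackey nathom_comp[OF bal_left_nathom delta0_nathom] nathom_comp[OF bal_right_nathom delta0_nathom] _ X z])
  fix Y V Z \<theta> r k assume a: "Y \<in> gsets n" "V \<in> gsets n" "Z \<in> gsets n" "\<theta> \<in> carrier (val Pd Y)" "r \<in> carrier (val R V)" "k \<in> carrier (val gP Z)"
  let ?X = "(Y \<times>\<^sub>G V) \<times>\<^sub>G Z" and ?Y = "Y \<times>\<^sub>G (V \<times>\<^sub>G Z)"
  let ?t = "tens Pd R Y V \<theta> r"
  let ?z = "tens (box n Pd R) gP (Y \<times>\<^sub>G V) Z ?t k"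
  note RP = box_mackey[OF R_mackey gP_mackey] and x = xact_pairing[OF gP_pre]
  have t: "?t \<in> carrier (val (box n Pd R) (Y \<times>\<^sub>G V))" using a by simp
  let ?endo_trace = "hompair P (regular R) Y V \<theta> r"
  have endo_trace: "?endo_trace \<in> carrier (val Pd (Y \<times>\<^sub>G V))" by (rule pairing_closed[OF ract_pairing a(1,2,4,5)])
  have bl0: "bal_left ?X ?z = tens Pd gP (Y \<times>\<^sub>G V) Z (dual_ract n R P (Y \<times>\<^sub>G V) ?t) (nat_id Z k)"
    using a t by (intro box_map_gen[OF box_mackey[OF Pd_mackey R_mackey] gP_mackey Pd_mackey gP_mackey dual_ract_nathom nat_id_nathom]) simp_all
  have dr: "dual_ract n R P (Y \<times>\<^sub>G V) ?t = ?endo_trace"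
    using dual_ract_eq[OF _ t] blift_bid[OF Pd_mackey R_mackey Pd_mackey ract_pairing a(1,2,4,5)] a by simp
  have bl: "bal_left ?X ?z = tens Pd gP (Y \<times>\<^sub>G V) Z ?endo_trace k"
    unfolding bl0 dr nat_id_apply ..
  have L: "delta0 ?X (bal_left ?X ?z) = hompair P gP (Y \<times>\<^sub>G V) Z ?endo_trace k"
    unfolding bl by (rule delta0_bid[OF gprod_gset[OF a(1,2)] a(3) endo_trace a(6)])
  let ?q = "xact n R gP V Z r k"
  have q: "?q \<in> carrier (val gP (V \<times>\<^sub>G Z))" by (rule pairing_closed[OF x a(2,3,5,6)])
  let ?y = "tens Pd (box n R gP) Y (V \<times>\<^sub>G Z) \<theta> (tens R gP V Z r k)"
  let ?w = "tens Pd gP Y (V \<times>\<^sub>G Z) \<theta> ?q"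
  have y: "?y \<in> carrier (val (box n Pd (box n R gP)) ?Y)" and w: "?w \<in> carrier (val (box n Pd gP) ?Y)"
    using a q by (auto intro!: box_gen_closed)
  note bm = box_map_nathom[OF Pd_mackey RP Pd_mackey gP_mackey nat_id_nathom premod_lact[OF gP_pre]]
  have e: "eqv n ?Y ?X assocR" by (simp add: eqv_def)
  have gs: "?X \<in> gsets n" "?Y \<in> gsets n" using a by simp_all
  have "box_assoc n Pd R gP ?X ?z = tra n (box n Pd (box n R gP)) ?Y ?X assocR ?y"
    by (rule box_assoc_gen[OF Pd_mackey R_mackey gP_mackey a])
  then have "bal_right ?X ?z = tra n (box n Pd gP) ?Y ?X assocR (box_map n Pd gP nat_id (lact gP) ?Y ?y)"
    using nathom_tra[OF bm gs(2,1) e y] by simp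
  also have "box_map n Pd gP nat_id (lact gP) ?Y ?y = ?w"
    using box_map_gen[OF Pd_mackey RP Pd_mackey gP_mackey nat_id_nathom premod_lact[OF gP_pre] gs(2) a(1) _ _ a(4), of "V \<times>\<^sub>G Z" "bid n ?Y" "tens R gP V Z r k"] a
    by (simp add: xact_def)
  finally have br: "bal_right ?X ?z = tra n (box n Pd gP) ?Y ?X assocR ?w" .
  have "delta0 ?X (bal_right ?X ?z) = tra n (inthom n R P gP) ?Y ?X assocR (delta0 ?Y ?w)"
    unfolding br by (rule nathom_tra[OF delta0_nathom gs(2,1) e w])
  also have "delta0 ?Y ?w = hompair P gP Y (V \<times>\<^sub>G Z) \<theta> ?q" using delta0_bid[OF a(1) _ a(4) q] a by simp
  finally have Rr: "delta0 ?X (bal_right ?X ?z) = tra n (inthom n R P gP) ?Y ?X assocR (hompair P gP Y (V \<times>\<^sub>G Z) \<theta> ?q)" .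
  show "delta0 ?X (bal_left ?X ?z) = delta0 ?X (bal_right ?X ?z)"
    unfolding L Rr tra_inthom[OF gs(2) e]
    unfolding hompair_def[of P gP "Y \<times>\<^sub>G V"]
  proof (rule mk_nat_eqI)
    fix T p assume T: "T \<in> gsets n" and p: "p \<in> carrier (val P T)"
    have c: "\<theta> T p \<in> carrier (val R (Y \<times>\<^sub>G T))" by (rule dual_closed[OF a(4) T p])
    show "tra n gP (((Y \<times>\<^sub>G V) \<times>\<^sub>G T) \<times>\<^sub>G Z) (?X \<times>\<^sub>G T) swap_right (xact n R gP ((Y \<times>\<^sub>G V) \<times>\<^sub>G T) Z (?endo_trace T p) k) =
       tra n gP (?Y \<times>\<^sub>G T) (?X \<times>\<^sub>G T) (on_fst assocR) (hompair P gP Y (V \<times>\<^sub>G Z) \<theta> ?q T p)"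
      using a T p c q gP_mackey
      by (simp del: twist_simps twist_tra add: hompair_apply eqv_def pairing_closed[OF x] pairing_closed[OF xmul_pairing] pairing_tra_left[OF x] extmod_assoc[OF gP_ext]
          pairing_tra_right[OF x] tra_tra)
  qed
qed

abbreviation "bal_rel X \<equiv> coeq_rel (box n (box n Pd R) gP) (box n Pd gP) bal_left bal_right X"

text \<open>\<open>delta0\<close> is balanced, hence constant on the cosets of the relation, and \<^const>\<open>hs_delta\<close> is well
  defined.\<close>

lemma hs_delta_coset:
  assumes X: "X \<in> gsets n" and x: "x \<in> carrier (val (box n Pd gP) X)"
  shows "bal_rel X #>\<^bsub>val (box n Pd gP) X\<^esub> x \<noteq> {}"
    and "\<And>y. y \<in> bal_rel X #>\<^bsub>val (box n Pd gP) X\<^esub> x \<Longrightarrow> y \<in> carrier (val (box n Pd gP) X) \<and> delta0 X y = delta0 X x"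
    and "hs_delta n R g P X (bal_rel X #>\<^bsub>val (box n Pd gP) X\<^esub> x) = delta0 X x"
proof -
  let ?B = "val (box n Pd gP) X" and ?Z = "val (box n (box n Pd R) gP) X" and ?I = "val (inthom n R P gP) X"
  interpret B: comm_group ?B by (rule box_group[OF Pd_mackey gP_mackey])
  interpret Z: comm_group ?Z by (rule box_group[OF box_mackey[OF Pd_mackey R_mackey] gP_mackey])
  interpret I: comm_group ?I by (rule mackey_group[OF H_mackey X])
  interpret d: group_hom ?B ?I "delta0 X" using nathom_hom[OF delta0_nathom X] by unfold_locales
  note cl = hom_in_carrier[OF nathom_hom[OF bal_left_nathom X]] hom_in_carrier[OF nathom_hom[OF bal_right_nathom X]]
  show ne: "bal_rel X #>\<^bsub>?B\<^esub> x \<noteq> {}"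
    using Z.one_closed unfolding coeq_rel_def r_coset_def by blast
  show inv: "y \<in> carrier ?B \<and> delta0 X y = delta0 X x" if y: "y \<in> bal_rel X #>\<^bsub>?B\<^esub> x" for y
  proof -
    obtain z where z: "z \<in> carrier ?Z" "y = (bal_left X z \<otimes>\<^bsub>?B\<^esub> inv\<^bsub>?B\<^esub> bal_right X z) \<otimes>\<^bsub>?B\<^esub> x"
      using y unfolding coeq_rel_def r_coset_def by blast
    have "delta0 X y = (delta0 X (bal_left X z) \<otimes>\<^bsub>?I\<^esub> inv\<^bsub>?I\<^esub> delta0 X (bal_right X z)) \<otimes>\<^bsub>?I\<^esub> delta0 X x"
      using z x cl[OF z(1)] by simp
    then show ?thesis using delta0_balanced[OF X z(1)] cl[OF z(1)] z x by simp
  qed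
  have "hs_delta n R g P X (bal_rel X #>\<^bsub>?B\<^esub> x) = descend (ab_lift ?I
     (\<lambda>(U, V, \<phi>, \<theta>, q). mk_nat n P
       (\<lambda>Y p. mor P ((U \<times>\<^sub>G V) \<times>\<^sub>G Y) (X \<times>\<^sub>G Y) (bprod n (U \<times>\<^sub>G V) X Y Y \<phi> (bid n Y))
          (tra n P ((U \<times>\<^sub>G Y) \<times>\<^sub>G V) ((U \<times>\<^sub>G V) \<times>\<^sub>G Y) swap_right (xact n R gP (U \<times>\<^sub>G Y) V (\<theta> Y p) q))))) (bal_rel X #>\<^bsub>?B\<^esub> x)"
    (is "_ = descend (ab_lift ?I ?F) _") by (simp only: hs_delta_def)
  also have "\<dots> = delta0 X x"
  proof (rule descend_eqI[OF ne])
    fix y assume "y \<in> bal_rel X #>\<^bsub>?B\<^esub> x"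
    note y = inv[OF this]
    have "ab_lift ?I ?F y = delta0 X y"
    proof (rule ab_lift_blift[OF Pd_mackey gP_mackey H_mackey hompair_twist X conjunct1[OF y]], unfold prod.case)
      fix Y Z \<phi> m k assume a: "Y \<in> gsets n" "Z \<in> gsets n" "\<phi> \<in> carrier (bhom n (Y \<times>\<^sub>G Z) X)" "m \<in> carrier (val Pd Y)" "k \<in> carrier (val gP Z)"
      show "mk_nat n P (\<lambda>Ya p. mor P ((Y \<times>\<^sub>G Z) \<times>\<^sub>G Ya) (X \<times>\<^sub>G Ya) (bprod n (Y \<times>\<^sub>G Z) X Ya Ya \<phi> (bid n Ya))
           (tra n P ((Y \<times>\<^sub>G Ya) \<times>\<^sub>G Z) ((Y \<times>\<^sub>G Z) \<times>\<^sub>G Ya) swap_right (xact n R gP (Y \<times>\<^sub>G Ya) Z (m Ya p) k))) =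
        mor (inthom n R P gP) (Y \<times>\<^sub>G Z) X \<phi> (hompair P gP Y Z m k)"
        unfolding inthom_simps by (rule mk_nat_eqI) (simp add: hompair_apply)
    qed simp
    then show "ab_lift ?I ?F y = delta0 X x" using y by simp
  qed
  finally show "hs_delta n R g P X (bal_rel X #>\<^bsub>?B\<^esub> x) = delta0 X x" .
qed

lemma dual_nathom: 
  assumes "\<theta> \<in> carrier (val Pd U)" shows "nathom P (lshift R U) \<theta>"
proof -
  have "nathom P (shift n R (regular R) U) \<theta>" using assms unfolding dual_carrier by (rule rmod_hom_nathom)
  then show ?thesis by simp
qed

text \<open>Evaluation is a pairing by the naturality of the single functional \<open>\<theta>\<close> in one variable, and by
  the definition of the dual in the other.\<close>

lemma eval_pairing: "pairing gP Pd R (\<lambda>V U p \<theta>. tra n R (U \<times>\<^sub>G V) (V \<times>\<^sub>G U) flip (\<theta> V p))"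
proof (rule pairing_swap[OF _ gP_mackey Pd_mackey R_mackey])
  show "pairing Pd gP R (\<lambda>U V \<theta>. \<theta> V)"
  proof (rule pairingI[OF Pd_mackey gP_mackey R_mackey])
    fix Y Z \<theta> k k' assume a: "Y \<in> gsets n" "Z \<in> gsets n" "\<theta> \<in> carrier (val Pd Y)" "k \<in> carrier (val gP Z)" "k' \<in> carrier (val gP Z)"
    note tn = dual_nathom[OF a(3)]
    show "\<theta> Z (k \<otimes>\<^bsub>val gP Z\<^esub> k') = \<theta> Z k \<otimes>\<^bsub>val R (Y \<times>\<^sub>G Z)\<^esub> \<theta> Z k'"
      using nathom_mult[OF tn a(2)] a by simp
  next
    fix Y Z Z' f \<theta> k assume a: "Y \<in> gsets n" "Z \<in> gsets n" "Z' \<in> gsets n" "eqv n Z Z' f" "\<theta> \<in> carrier (val Pd Y)" "k \<in> carrier (val gP Z)"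
    note tn = dual_nathom[OF a(5)]
    show "\<theta> Z' (tra n gP Z Z' f k) = tra n R (Y \<times>\<^sub>G Z) (Y \<times>\<^sub>G Z') (on_snd f) (\<theta> Z k)"
      using nathom_tra[OF tn a(2-4)] a by (simp add: tra_lshift)
  next
    fix Y Z Z' f \<theta> k assume a: "Y \<in> gsets n" "Z \<in> gsets n" "Z' \<in> gsets n" "eqv n Z Z' f" "\<theta> \<in> carrier (val Pd Y)" "k \<in> carrier (val gP Z')"
    note tn = dual_nathom[OF a(5)]
    show "\<theta> Z (res n gP Z Z' f k) = res n R (Y \<times>\<^sub>G Z) (Y \<times>\<^sub>G Z') (on_snd f) (\<theta> Z' k)"
      using nathom_res[OF tn a(2-4)] a by (simp add: res_lshift)
  next
    fix Y Z \<theta> \<theta>' k assume a: "Y \<in> gsets n" "Z \<in> gsets n" "\<theta> \<in> carrier (val Pd Y)" "\<theta>' \<in> carrier (val Pd Y)" "k \<in> carrier (val gP Z)"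
    then show "(\<theta> \<otimes>\<^bsub>val Pd Y\<^esub> \<theta>') Z k = \<theta> Z k \<otimes>\<^bsub>val R (Y \<times>\<^sub>G Z)\<^esub> \<theta>' Z k"
      unfolding dual_def inthom_simps by simp
  next
    fix Y Y' Z f \<theta> k assume a: "Y \<in> gsets n" "Y' \<in> gsets n" "Z \<in> gsets n" "eqv n Y Y' f" "\<theta> \<in> carrier (val Pd Y)" "k \<in> carrier (val gP Z)"
    then show "tra n Pd Y Y' f \<theta> Z k = tra n R (Y \<times>\<^sub>G Z) (Y' \<times>\<^sub>G Z) (on_fst f) (\<theta> Z k)"
      unfolding dual_def by (simp add: tra_inthom)
  next
    fix Y Y' Z f \<theta> k assume a: "Y \<in> gsets n" "Y' \<in> gsets n" "Z \<in> gsets n" "eqv n Y Y' f" "\<theta> \<in> carrier (val Pd Y')" "k \<in> carrier (val gP Z)"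
    then show "res n Pd Y Y' f \<theta> Z k = res n R (Y \<times>\<^sub>G Z) (Y' \<times>\<^sub>G Z) (on_fst f) (\<theta> Z k)"
      unfolding dual_def by (simp add: res_inthom)
  qed (simp add: dual_closed)
qed

lemma evaluation_eq: "evaluation n R = blift R (\<lambda>V U p \<theta>. tra n R (U \<times>\<^sub>G V) (V \<times>\<^sub>G U) flip (\<theta> V p))"
  by (simp add: evaluation_def blift_def fun_eq_iff)

abbreviation "pi0 \<equiv> \<lambda>X z. HH0_map n R g X (evaluation n R X (box_sym n Pd gP X z))"

lemma pi0_hom: "X \<in> gsets n \<Longrightarrow> pi0 X \<in> hom (val (box n Pd gP) X) (val (HH0 n R g) X)"
  using Group.hom_compose[OF nathom_hom[OF nathom_comp[OF box_sym_nathom[OF Pd_mackey gP_mackey] blift_nathom[OF gP_mackey Pd_mackey R_mackey eval_pairing]]] HH0_map_hom]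
  unfolding evaluation_eq comp_def .

text \<open>The symmetry before the evaluation and the flip inside of it cancel.\<close>

lemma pi0_gen:
  assumes a: "X \<in> gsets n" "U \<in> gsets n" "V \<in> gsets n" "\<phi> \<in> carrier (bhom n (U \<times>\<^sub>G V) X)" "\<theta> \<in> carrier (val Pd U)" "q \<in> carrier (val P V)"
  shows "pi0 X (box_gen n Pd gP X (U, V, \<phi>, \<theta>, q)) = HH0_map n R g X (mor R (U \<times>\<^sub>G V) X \<phi> (\<theta> V q))"
proof -
  let ?sw = flip
  let ?y = "tens gP Pd V U q \<theta>"
  note ev = blift_nathom[OF gP_mackey Pd_mackey R_mackey eval_pairing, folded evaluation_eq]
  have q: "q \<in> carrier (val gP V)" using a by simp
  have y: "?y \<in> carrier (val (box n gP Pd) (V \<times>\<^sub>G U))" using a q by (intro box_gen_closed) simp_all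
  have e: "eqv n (V \<times>\<^sub>G U) (U \<times>\<^sub>G V) ?sw" "eqv n (U \<times>\<^sub>G V) (V \<times>\<^sub>G U) ?sw" by (simp_all add: eqv_def)
  have gs: "V \<times>\<^sub>G U \<in> gsets n" "U \<times>\<^sub>G V \<in> gsets n" using a by simp_all
  have B: "mackey_functor n (box n gP Pd)" by (rule box_mackey[OF gP_mackey Pd_mackey])
  have "box_sym n Pd gP X (box_gen n Pd gP X (U, V, \<phi>, \<theta>, q)) = mor (box n gP Pd) (U \<times>\<^sub>G V) X \<phi> (tra n (box n gP Pd) (V \<times>\<^sub>G U) (U \<times>\<^sub>G V) ?sw ?y)"
    by (rule box_sym_gen[OF Pd_mackey gP_mackey a(1-5) q])
  then have "evaluation n R X (box_sym n Pd gP X (box_gen n Pd gP X (U, V, \<phi>, \<theta>, q))) =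
     mor R (U \<times>\<^sub>G V) X \<phi> (tra n R (V \<times>\<^sub>G U) (U \<times>\<^sub>G V) ?sw (evaluation n R (V \<times>\<^sub>G U) ?y))"
    using nathom_mor[OF ev gs(2) a(1,4) tra_closed[OF B gs e(1) y]] nathom_tra[OF ev gs e(1) y] by simp
  also have "evaluation n R (V \<times>\<^sub>G U) ?y = tra n R (U \<times>\<^sub>G V) (V \<times>\<^sub>G U) ?sw (\<theta> V q)"
    unfolding evaluation_eq by (rule blift_bid[OF gP_mackey Pd_mackey R_mackey eval_pairing a(3,2) q a(5)])
  also have "tra n R (V \<times>\<^sub>G U) (U \<times>\<^sub>G V) ?sw (tra n R (U \<times>\<^sub>G V) (V \<times>\<^sub>G U) ?sw (\<theta> V q)) = \<theta> V q"
  proof -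
    have "PPair (pfst w) (psnd w) = w" if "w \<in> fst (U \<times>\<^sub>G V)" for w using that by (auto simp: gprod_def)
    then show ?thesis using gs e dual_closed[OF a(5,3,6)] by (simp add: tra_tra tra_ident)
  qed
  finally show ?thesis by simp
qed

context
  fixes X :: gset and p0 :: 'p and \<theta>0 :: "gset \<Rightarrow> 'p \<Rightarrow> 'r"
  assumes db: "dual_basis P X p0 \<theta>0"
begin

lemma basis_gset: "X \<in> gsets n" and basis_elt: "p0 \<in> carrier (val P X)" and basis_dual: "\<theta>0 \<in> carrier (val Pd X)"
    and basis_expand: "Y \<in> gsets n \<Longrightarrow> q \<in> carrier (val P Y) \<Longrightarrow> contract P X Y (\<theta>0 Y q) p0 = q"
  using db by (simp_all add: dual_basis_def)

lemmas basis_dual_nathom = dual_nathom[OF basis_dual]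

text \<open>Linearity of a functional, unfolded: its level \<open>U\<close> stays in front of the factor \<open>W\<close> of the
  scalar.\<close>

lemma dual_xact:
  assumes t: "\<theta> \<in> carrier (val Pd U)" and U: "U \<in> gsets n" and a: "W \<in> gsets n" "V \<in> gsets n" "a \<in> carrier (val R W)" "p \<in> carrier (val P V)"
  shows "\<theta> (W \<times>\<^sub>G V) (xact n R P W V a p) = tra n R (W \<times>\<^sub>G (U \<times>\<^sub>G V)) (U \<times>\<^sub>G (W \<times>\<^sub>G V)) swap_left (xmul n R W (U \<times>\<^sub>G V) a (\<theta> V p))"
  using rmod_hom_xact[OF P_pre premod_shift[OF premod_regular U] t[unfolded dual_carrier] a]
    xact_shift[OF premod_regular U a(1-3)] dual_closed[OF t a(2,4)] by simp

text \<open>The sum \<open>\<Sum> w(x, y, x)\<close> over the points \<open>x\<close> of \<open>X\<close>.\<close>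

definition partial_trace :: "gset \<Rightarrow> 'r \<Rightarrow> 'r" where
  "partial_trace Y w = tra n R (X \<times>\<^sub>G Y) Y psnd (res n R (X \<times>\<^sub>G Y) (X \<times>\<^sub>G (Y \<times>\<^sub>G X)) (\<lambda>w. PPair (pfst w) (PPair (psnd w) (pfst w))) w)"

lemma partial_trace_nathom: "nathom (rshift (lshift R X) X) R partial_trace"
proof (rule nathomI)
  show "mackey_functor n (rshift (lshift R X) X)" using basis_gset by simp
  fix Z Y h y assume a: "Z \<in> gsets n" "Y \<in> gsets n" "eqv n Z Y h" "y \<in> carrier (val (rshift (lshift R X) X) Y)"
  then show "partial_trace Z (res n (rshift (lshift R X) X) Z Y h y) = res n R Z Y h (partial_trace Y y)"
    using basis_gset unfolding partial_trace_def
    by (simp add: res_rshift res_lshift eqv_def)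
      (subst base_change[where W = "X \<times>\<^sub>G Z" and ?w1.0 = "on_snd h" and ?w2.0 = psnd],
        simp_all add: eqv_def res_res)
next
  fix Z Y h y assume a: "Z \<in> gsets n" "Y \<in> gsets n" "eqv n Z Y h" "y \<in> carrier (val (rshift (lshift R X) X) Z)"
  then show "partial_trace Y (tra n (rshift (lshift R X) X) Z Y h y) = tra n R Z Y h (partial_trace Z y)"
    using basis_gset unfolding partial_trace_def
    by (simp add: tra_rshift tra_lshift eqv_def)
      (subst base_change[where W = "X \<times>\<^sub>G Z" and ?w1.0 = "\<lambda>w. PPair (pfst w) (PPair (psnd w) (pfst w))" and ?w2.0 = "on_snd h"],
        simp_all add: eqv_def tra_tra)
qed (use basis_gset in \<open>simp_all add: partial_trace_def hom_def Pi_iff eqv_def tra_mult res_mult\<close>)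

text \<open>The sum \<open>\<Sum> w(u, x, x, v)\<close> over the points \<open>x\<close> of \<open>X\<close>, a matrix product.\<close>

definition contract_mid :: "gset \<Rightarrow> gset \<Rightarrow> 'r \<Rightarrow> 'r" where
  "contract_mid U V w = tra n R ((U \<times>\<^sub>G X) \<times>\<^sub>G V) (U \<times>\<^sub>G V) (on_fst pfst)
     (res n R ((U \<times>\<^sub>G X) \<times>\<^sub>G V) ((U \<times>\<^sub>G X) \<times>\<^sub>G (X \<times>\<^sub>G V)) (\<lambda>w. PPair (pfst w) (PPair (psnd (pfst w)) (psnd w))) w)"

lemma contract_mid_mor:
  assumes "U \<in> gsets n" "V \<in> gsets n" "w \<in> carrier (val R ((U \<times>\<^sub>G X) \<times>\<^sub>G (X \<times>\<^sub>G V)))"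
  shows "contract_mid U V w = mor R ((U \<times>\<^sub>G X) \<times>\<^sub>G (X \<times>\<^sub>G V)) (U \<times>\<^sub>G V)
     (sp n ((U \<times>\<^sub>G X) \<times>\<^sub>G (X \<times>\<^sub>G V)) (U \<times>\<^sub>G V) ((U \<times>\<^sub>G X) \<times>\<^sub>G V) (\<lambda>w. PPair (pfst w) (PPair (psnd (pfst w)) (psnd w))) (on_fst pfst)) w"
  using assms basis_gset unfolding contract_mid_def by (simp add: mor_sp eqv_def)

text \<open>The trace of \<open>\<theta> \<otimes> q\<close> through the dual basis. The endomorphism sends \<open>p\<^sub>0\<close> to \<open>\<alpha>(\<theta>(p\<^sub>0)) q\<close>, the
  twist coming from the action on the target; \<open>\<theta>\<^sub>0\<close> is linear for the untwisted action and sends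
  this to \<open>\<alpha>(\<theta>(p\<^sub>0)) \<theta>\<^sub>0(q)\<close>. The sum over the diagonal of \<open>X\<close> is then a matrix product.\<close>

lemma delta0_traced:
  assumes g: "U \<in> gsets n" "V \<in> gsets n" "Y \<in> gsets n" "\<phi> \<in> carrier (bhom n (U \<times>\<^sub>G V) Y)" "\<theta> \<in> carrier (val Pd U)" "q \<in> carrier (val P V)"
  shows "partial_trace Y (\<theta>0 (Y \<times>\<^sub>G X) (mor (inthom n R P gP) (U \<times>\<^sub>G V) Y \<phi> (hompair P gP U V \<theta> q) X p0)) =
    mor R (U \<times>\<^sub>G V) Y \<phi> (contract_mid U V (xmul n R (U \<times>\<^sub>G X) (X \<times>\<^sub>G V) (alpha n R g (U \<times>\<^sub>G X) (\<theta> X p0)) (\<theta>0 V q)))"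
proof -
  let ?a = "alpha n R g (U \<times>\<^sub>G X) (\<theta> X p0)"
  let ?A = "xact n R P (U \<times>\<^sub>G X) V ?a q"
  let ?B = "xmul n R (U \<times>\<^sub>G X) (X \<times>\<^sub>G V) ?a (\<theta>0 V q)"
  have t: "\<theta> X p0 \<in> carrier (val R (U \<times>\<^sub>G X))" by (rule dual_closed[OF g(5) basis_gset basis_elt])
  have a: "?a \<in> carrier (val R (U \<times>\<^sub>G X))" using t g basis_gset by simp
  have t0: "\<theta>0 V q \<in> carrier (val R (X \<times>\<^sub>G V))" by (rule dual_closed[OF basis_dual g(2,6)])
  have UX: "U \<times>\<^sub>G X \<in> gsets n" and XV: "X \<times>\<^sub>G V \<in> gsets n" using g basis_gset by simp_all
  have A: "?A \<in> carrier (val P ((U \<times>\<^sub>G X) \<times>\<^sub>G V))" by (rule pairing_closed[OF xact_pairing[OF P_pre] UX g(2) a g(6)])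
  have B: "?B \<in> carrier (val R ((U \<times>\<^sub>G X) \<times>\<^sub>G (X \<times>\<^sub>G V)))" by (rule pairing_closed[OF xmul_pairing UX XV a t0])
  have F: "mor (inthom n R P gP) (U \<times>\<^sub>G V) Y \<phi> (hompair P gP U V \<theta> q) X p0 =
    mor P ((U \<times>\<^sub>G V) \<times>\<^sub>G X) (Y \<times>\<^sub>G X) (bprod n (U \<times>\<^sub>G V) Y X X \<phi> (bid n X)) (tra n P ((U \<times>\<^sub>G X) \<times>\<^sub>G V) ((U \<times>\<^sub>G V) \<times>\<^sub>G X) swap_right ?A)"
    using basis_gset basis_elt t g by (simp add: inthom_simps hompair_apply xact_twist[OF P_pre])
  have C: "tra n P ((U \<times>\<^sub>G X) \<times>\<^sub>G V) ((U \<times>\<^sub>G V) \<times>\<^sub>G X) swap_right ?A \<in> carrier (val P ((U \<times>\<^sub>G V) \<times>\<^sub>G X))"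
    using A g basis_gset P_mackey by (simp add: eqv_def)
  let ?C = "tra n R ((U \<times>\<^sub>G X) \<times>\<^sub>G (X \<times>\<^sub>G V)) (X \<times>\<^sub>G ((U \<times>\<^sub>G V) \<times>\<^sub>G X)) (\<lambda>w. PPair (pfst (psnd w)) (PPair (PPair (pfst (pfst w)) (psnd (psnd w))) (psnd (pfst w)))) ?B"
  have th: "\<theta>0 ((U \<times>\<^sub>G V) \<times>\<^sub>G X) (tra n P ((U \<times>\<^sub>G X) \<times>\<^sub>G V) ((U \<times>\<^sub>G V) \<times>\<^sub>G X) swap_right ?A) = ?C"
    using g basis_gset A B a by (simp add: nathom_tra[OF basis_dual_nathom] tra_lshift dual_xact[OF basis_dual] eqv_def tra_tra)
  have Cc: "?C \<in> carrier (val (rshift (lshift R X) X) (U \<times>\<^sub>G V))" using g basis_gset B by (simp add: eqv_def)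
  have "\<theta>0 (Y \<times>\<^sub>G X) (mor P ((U \<times>\<^sub>G V) \<times>\<^sub>G X) (Y \<times>\<^sub>G X) (bprod n (U \<times>\<^sub>G V) Y X X \<phi> (bid n X)) (tra n P ((U \<times>\<^sub>G X) \<times>\<^sub>G V) ((U \<times>\<^sub>G V) \<times>\<^sub>G X) swap_right ?A)) =
     mor (rshift (lshift R X) X) (U \<times>\<^sub>G V) Y \<phi> ?C"
    using g basis_gset C by (simp add: nathom_mor[OF basis_dual_nathom] th mor_rshift)
  then have "partial_trace Y (\<theta>0 (Y \<times>\<^sub>G X) (mor (inthom n R P gP) (U \<times>\<^sub>G V) Y \<phi> (hompair P gP U V \<theta> q) X p0)) =
     mor R (U \<times>\<^sub>G V) Y \<phi> (partial_trace (U \<times>\<^sub>G V) ?C)"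
    unfolding F using nathom_mor[OF partial_trace_nathom _ g(3,4) Cc] g by simp
  also have "partial_trace (U \<times>\<^sub>G V) ?C = contract_mid U V ?B"
    unfolding partial_trace_def contract_mid_def using g basis_gset B
    by (subst base_change[where W = "(U \<times>\<^sub>G X) \<times>\<^sub>G V" and ?w1.0 = "\<lambda>w. PPair (pfst w) (PPair (psnd (pfst w)) (psnd w))"
          and ?w2.0 = "\<lambda>w. PPair (psnd (pfst w)) (PPair (pfst (pfst w)) (psnd w))"])
      (simp_all add: eqv_def tra_tra)
  finally show ?thesis .
qed

text \<open>Apply \<open>\<theta>\<close> to \<open>q = \<Sum> \<theta>\<^sub>0(q)(x) p\<^sub>0(x)\<close>. Linearity gives the product \<open>\<theta>\<^sub>0(q) \<theta>(p\<^sub>0)\<close>, and commutativity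
  of \<open>R\<close> brings its factors into the order in which they occur in \<open>delta0_traced\<close>.\<close>

lemma dual_through_basis:
  assumes g: "U \<in> gsets n" "V \<in> gsets n" "\<theta> \<in> carrier (val Pd U)" "q \<in> carrier (val P V)"
  shows "contract_mid U V (xmul n R (U \<times>\<^sub>G X) (X \<times>\<^sub>G V) (\<theta> X p0) (\<theta>0 V q)) = \<theta> V q"
proof -
  let ?B = "xmul n R (U \<times>\<^sub>G X) (X \<times>\<^sub>G V) (\<theta> X p0) (\<theta>0 V q)"
  have t: "\<theta> X p0 \<in> carrier (val R (U \<times>\<^sub>G X))" by (rule dual_closed[OF g(3) basis_gset basis_elt])
  have t0: "\<theta>0 V q \<in> carrier (val R (X \<times>\<^sub>G V))" by (rule dual_closed[OF basis_dual g(2,4)])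
  have UX: "U \<times>\<^sub>G X \<in> gsets n" and XV: "X \<times>\<^sub>G V \<in> gsets n" using g basis_gset by simp_all
  have B: "?B \<in> carrier (val R ((U \<times>\<^sub>G X) \<times>\<^sub>G (X \<times>\<^sub>G V)))" by (rule pairing_closed[OF xmul_pairing UX XV t t0])
  have A: "xact n R P (X \<times>\<^sub>G V) X (\<theta>0 V q) p0 \<in> carrier (val P ((X \<times>\<^sub>G V) \<times>\<^sub>G X))"
    by (rule pairing_closed[OF xact_pairing[OF P_pre] XV basis_gset t0 basis_elt])
  have c: "xmul n R (X \<times>\<^sub>G V) (U \<times>\<^sub>G X) (\<theta>0 V q) (\<theta> X p0) = tra n R ((U \<times>\<^sub>G X) \<times>\<^sub>G (X \<times>\<^sub>G V)) ((X \<times>\<^sub>G V) \<times>\<^sub>G (U \<times>\<^sub>G X)) flip ?B"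
    by (rule xmul_comm[OF XV UX t0 t, symmetric])
  have "\<theta> V q = \<theta> V (contract P X V (\<theta>0 V q) p0)" using basis_expand[OF g(2,4)] by simp
  also have "\<dots> = tra n R (U \<times>\<^sub>G (X \<times>\<^sub>G V)) (U \<times>\<^sub>G V) (on_snd psnd)
      (res n R (U \<times>\<^sub>G (X \<times>\<^sub>G V)) (U \<times>\<^sub>G ((X \<times>\<^sub>G V) \<times>\<^sub>G X)) (\<lambda>w. PPair (pfst w) (PPair (psnd w) (pfst (psnd w))))
        (tra n R ((U \<times>\<^sub>G X) \<times>\<^sub>G (X \<times>\<^sub>G V)) (U \<times>\<^sub>G ((X \<times>\<^sub>G V) \<times>\<^sub>G X)) (\<lambda>w. PPair (pfst (pfst w)) (PPair (psnd w) (psnd (pfst w)))) ?B))"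
    unfolding contract_def using g basis_gset A B t0 basis_elt P_mackey
    by (simp add: nathom_tra[OF dual_nathom[OF g(3)]] nathom_res[OF dual_nathom[OF g(3)]] eqv_contract tra_lshift res_lshift dual_xact[OF g(3)] c)
      (simp add: eqv_def tra_tra)
  also have "\<dots> = contract_mid U V ?B"
    unfolding contract_mid_def using g basis_gset B
    by (subst base_change[where W = "(U \<times>\<^sub>G X) \<times>\<^sub>G V" and ?w1.0 = "\<lambda>w. PPair (pfst w) (PPair (psnd (pfst w)) (psnd w))"
          and ?w2.0 = "\<lambda>w. PPair (pfst (pfst w)) (PPair (psnd (pfst w)) (psnd w))"])
      (simp_all add: eqv_def tra_tra)
  finally show ?thesis ..
qed

text \<open>The trace of the matrix of \<open>F\<close> in the dual basis, as a class in \<open>HH\<^sub>0\<close>. In contrast to \<^const>\<open>hs_trace\<close>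
  it is additive in \<open>F\<close> by construction.\<close>

definition basis_trace :: "(gset \<Rightarrow> 'p \<Rightarrow> 'p) \<Rightarrow> 'r set" where
  "basis_trace F = HH0_map n R g (gone n) (partial_trace (gone n) (\<theta>0 (gone n \<times>\<^sub>G X) (F X p0)))"

lemma basis_trace_hom: "basis_trace \<in> hom (val (inthom n R P gP) (gone n)) (val (HH0 n R g) (gone n))"
proof (rule homI)
  have cl: "F X p0 \<in> carrier (val P (gone n \<times>\<^sub>G X))" if "F \<in> carrier (val (inthom n R P gP) (gone n))" for F
    using shift_hom_closed[OF that[unfolded inthom_simps] basis_gset basis_elt] by simp
  note h = HH0_map_hom[OF gone_gset]
  have c: "\<theta>0 (gone n \<times>\<^sub>G X) p \<in> carrier (val R (X \<times>\<^sub>G (gone n \<times>\<^sub>G X)))" if "p \<in> carrier (val P (gone n \<times>\<^sub>G X))" for p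
    using dual_closed[OF basis_dual _ that] basis_gset by simp
  have cg: "partial_trace (gone n) w \<in> carrier (val R (gone n))" if "w \<in> carrier (val R (X \<times>\<^sub>G (gone n \<times>\<^sub>G X)))" for w
    using nathom_closed[OF partial_trace_nathom gone_gset] that by simp
  fix F assume F: "F \<in> carrier (val (inthom n R P gP) (gone n))"
  show "basis_trace F \<in> carrier (val (HH0 n R g) (gone n))"
    unfolding basis_trace_def by (rule hom_in_carrier[OF h cg[OF c[OF cl[OF F]]]])
  fix G assume G: "G \<in> carrier (val (inthom n R P gP) (gone n))"
  have gX: "gone n \<times>\<^sub>G X \<in> gsets n" using basis_gset by simp
  have "(F \<otimes>\<^bsub>val (inthom n R P gP) (gone n)\<^esub> G) X p0 = F X p0 \<otimes>\<^bsub>val P (gone n \<times>\<^sub>G X)\<^esub> G X p0"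
    using basis_gset basis_elt by (simp add: inthom_simps)
  moreover have "\<theta>0 (gone n \<times>\<^sub>G X) (F X p0 \<otimes>\<^bsub>val P (gone n \<times>\<^sub>G X)\<^esub> G X p0) =
     \<theta>0 (gone n \<times>\<^sub>G X) (F X p0) \<otimes>\<^bsub>val R (X \<times>\<^sub>G (gone n \<times>\<^sub>G X))\<^esub> \<theta>0 (gone n \<times>\<^sub>G X) (G X p0)"
    using nathom_mult[OF basis_dual_nathom gX cl[OF F] cl[OF G]] by simp
  moreover have "partial_trace (gone n) (\<theta>0 (gone n \<times>\<^sub>G X) (F X p0) \<otimes>\<^bsub>val R (X \<times>\<^sub>G (gone n \<times>\<^sub>G X))\<^esub> \<theta>0 (gone n \<times>\<^sub>G X) (G X p0)) =
     partial_trace (gone n) (\<theta>0 (gone n \<times>\<^sub>G X) (F X p0)) \<otimes>\<^bsub>val R (gone n)\<^esub> partial_trace (gone n) (\<theta>0 (gone n \<times>\<^sub>G X) (G X p0))"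
    using nathom_mult[OF partial_trace_nathom gone_gset] c[OF cl[OF F]] c[OF cl[OF G]] by simp
  ultimately show "basis_trace (F \<otimes>\<^bsub>val (inthom n R P gP) (gone n)\<^esub> G) = basis_trace F \<otimes>\<^bsub>val (HH0 n R g) (gone n)\<^esub> basis_trace G"
    unfolding basis_trace_def using hom_mult[OF h cg[OF c[OF cl[OF F]]] cg[OF c[OF cl[OF G]]]] by simp
qed

text \<open>By \<open>delta0_traced\<close> the right hand side at \<open>\<theta> \<otimes> q\<close> is the class of \<open>\<Sum> \<alpha>(\<theta>(p\<^sub>0(x))) \<theta>\<^sub>0(q)(x)\<close>, in
  \<open>HH\<^sub>0\<close> the twist may be removed, and what is left is \<open>\<theta>(q)\<close> by \<open>dual_through_basis\<close>.
  Consequently the left hand side depends on \<open>z\<close> only through the endomorphism that \<open>z\<close> induces.\<close>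

lemma pi0_basis_trace:
  assumes z: "z \<in> carrier (val (box n Pd gP) (gone n))"
  shows "pi0 (gone n) z = basis_trace (delta0 (gone n) z)"
proof (rule box_hom_eq[OF Pd_mackey gP_mackey _ pi0_hom[OF gone_gset] _ _ z])
  show "group (val (HH0 n R g) (gone n))" using HH0_group[OF gone_gset] by (rule comm_group.axioms(2))
  show "(\<lambda>z. basis_trace (delta0 (gone n) z)) \<in> hom (val (box n Pd gP) (gone n)) (val (HH0 n R g) (gone n))"
    using Group.hom_compose[OF nathom_hom[OF delta0_nathom gone_gset] basis_trace_hom] unfolding comp_def .
  fix U V \<phi> \<theta> q assume g: "U \<in> gsets n" "V \<in> gsets n" "\<phi> \<in> carrier (bhom n (U \<times>\<^sub>G V) (gone n))" "\<theta> \<in> carrier (val Pd U)" "q \<in> carrier (val gP V)"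
  have q: "q \<in> carrier (val P V)" using g by simp
  have t: "\<theta> X p0 \<in> carrier (val R (U \<times>\<^sub>G X))" by (rule dual_closed[OF g(4) basis_gset basis_elt])
  have t0: "\<theta>0 V q \<in> carrier (val R (X \<times>\<^sub>G V))" by (rule dual_closed[OF basis_dual g(2) q])
  have UX: "U \<times>\<^sub>G X \<in> gsets n" and XV: "X \<times>\<^sub>G V \<in> gsets n" and UV: "U \<times>\<^sub>G V \<in> gsets n" and W: "(U \<times>\<^sub>G X) \<times>\<^sub>G (X \<times>\<^sub>G V) \<in> gsets n" using g basis_gset by simp_all
  note B = pairing_closed[OF xmul_pairing UX XV _ t0]
  let ?s = "sp n ((U \<times>\<^sub>G X) \<times>\<^sub>G (X \<times>\<^sub>G V)) (U \<times>\<^sub>G V) ((U \<times>\<^sub>G X) \<times>\<^sub>G V) (\<lambda>w. PPair (pfst w) (PPair (psnd (pfst w)) (psnd w))) (on_fst pfst)"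
  have s: "?s \<in> carrier (bhom n ((U \<times>\<^sub>G X) \<times>\<^sub>G (X \<times>\<^sub>G V)) (U \<times>\<^sub>G V))" using g basis_gset by (intro sp_closed) (simp_all add: eqv_def)
  \<comment> \<open>the contraction is absorbed into the outer morphism, so that the relation of \<open>HH\<^sub>0\<close> applies to a bare product\<close>
  let ?psi = "bcomp n ((U \<times>\<^sub>G X) \<times>\<^sub>G (X \<times>\<^sub>G V)) (U \<times>\<^sub>G V) (gone n) ?s \<phi>"
  have psi: "?psi \<in> carrier (bhom n ((U \<times>\<^sub>G X) \<times>\<^sub>G (X \<times>\<^sub>G V)) (gone n))" using s g by simp
  have m: "mor R (U \<times>\<^sub>G V) (gone n) \<phi> (contract_mid U V (xmul n R (U \<times>\<^sub>G X) (X \<times>\<^sub>G V) a (\<theta>0 V q))) = mor R ((U \<times>\<^sub>G X) \<times>\<^sub>G (X \<times>\<^sub>G V)) (gone n) ?psi (xmul n R (U \<times>\<^sub>G X) (X \<times>\<^sub>G V) a (\<theta>0 V q))"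
    if "a \<in> carrier (val R (U \<times>\<^sub>G X))" for a
    unfolding contract_mid_mor[OF g(1,2) B[OF that]] by (rule mor_comp[OF R_mackey W UV gone_gset s g(3) B[OF that]])
  have "basis_trace (delta0 (gone n) (box_gen n Pd gP (gone n) (U, V, \<phi>, \<theta>, q))) =
     HH0_map n R g (gone n) (mor R (U \<times>\<^sub>G V) (gone n) \<phi> (contract_mid U V (xmul n R (U \<times>\<^sub>G X) (X \<times>\<^sub>G V) (alpha n R g (U \<times>\<^sub>G X) (\<theta> X p0)) (\<theta>0 V q))))"
    unfolding basis_trace_def delta0_gen[OF gone_gset g] delta0_traced[OF g(1,2) gone_gset g(3,4) q] ..
  also have "\<dots> = HH0_map n R g (gone n) (mor R (U \<times>\<^sub>G V) (gone n) \<phi> (contract_mid U V (xmul n R (U \<times>\<^sub>G X) (X \<times>\<^sub>G V) (\<theta> X p0) (\<theta>0 V q))))"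
    unfolding m[OF alpha_closed[OF UX t]] m[OF t] by (rule HH0_twist[OF gone_gset UX XV psi t t0])
  also have "\<dots> = pi0 (gone n) (box_gen n Pd gP (gone n) (U, V, \<phi>, \<theta>, q))"
    unfolding dual_through_basis[OF g(1,2,4) q] pi0_gen[OF gone_gset g(1-4) q] ..
  finally show "pi0 (gone n) (box_gen n Pd gP (gone n) (U, V, \<phi>, \<theta>, q)) = basis_trace (delta0 (gone n) (box_gen n Pd gP (gone n) (U, V, \<phi>, \<theta>, q)))" ..
qed

text \<open>\<^const>\<open>hs_trace\<close> picks a preimage of the endomorphism and a representative of it. By \<open>pi0_basis_trace\<close>
  the value of \<open>pi0\<close> at any such representative is determined by the endomorphism.\<close>

lemma hs_trace_eq_pi0:
  assumes z: "z \<in> carrier (val (box n Pd gP) (gone n))"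
  shows "hs_trace n R g P (gone n) (delta0 (gone n) z) = pi0 (gone n) z"
proof -
  let ?B = "val (box n Pd gP) (gone n)" and ?C = "carrier (val (dual_rbox n R g P) (gone n))" and ?F = "delta0 (gone n) z"
  have C: "?C = (\<lambda>x. bal_rel (gone n) #>\<^bsub>?B\<^esub> x) ` carrier ?B"
    by (simp add: dual_rbox_def rbox_def coeq_def carrier_FactGroup)
  let ?c = "inv_into ?C (hs_delta n R g P (gone n)) ?F"
  have im: "?F \<in> hs_delta n R g P (gone n) ` ?C"
  proof (rule image_eqI)
    show "?F = hs_delta n R g P (gone n) (bal_rel (gone n) #>\<^bsub>?B\<^esub> z)" by (rule hs_delta_coset(3)[OF gone_gset z, symmetric])
    show "bal_rel (gone n) #>\<^bsub>?B\<^esub> z \<in> ?C" unfolding C by (rule imageI[OF z])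
  qed
  have "?c \<in> ?C" by (rule inv_into_into[OF im])
  then obtain x where x: "x \<in> carrier ?B" "?c = bal_rel (gone n) #>\<^bsub>?B\<^esub> x" unfolding C by blast
  have "hs_delta n R g P (gone n) ?c = ?F" by (rule f_inv_into_f[OF im])
  then have delta_x: "delta0 (gone n) x = ?F" unfolding x(2) hs_delta_coset(3)[OF gone_gset x(1)] .
  show ?thesis
    unfolding hs_trace_def hs_pi_def
  proof (rule descend_eqI)
    show "?c \<noteq> {}" unfolding x(2) by (rule hs_delta_coset(1)[OF gone_gset x(1)])
    fix y assume "y \<in> ?c"
    then have y: "y \<in> carrier ?B" "delta0 (gone n) y = delta0 (gone n) x"
      unfolding x(2) using hs_delta_coset(2)[OF gone_gset x(1)] by blast+
    show "pi0 (gone n) y = pi0 (gone n) z"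
      unfolding pi0_basis_trace[OF y(1)] pi0_basis_trace[OF z] y(2) delta_x ..
  qed
qed

end

end

end

section \<open>Dual bases of finitely generated projective modules\<close>

lemma free_simps [simp]:
  "val (free_rmod n R X) = val (box n R (rep n X))" "mor (free_rmod n R X) = mor (box n R (rep n X))"
  "tra n (free_rmod n R X) = tra n (box n R (rep n X))" "res n (free_rmod n R X) = res n (box n R (rep n X))"
  "mackey_functor n (free_rmod n R X) = mackey_functor n (box n R (rep n X))"
  by (simp_all add: free_rmod_def tra_def res_def mackey_functor_def fun_eq_iff)

lemma free_box:
  "box_gens n M (free_rmod n R X) = box_gens n M (box n R (rep n X))" "box_rels n M (free_rmod n R X) = box_rels n M (box n R (rep n X))"
  "box_gen n M (free_rmod n R X) = box_gen n M (box n R (rep n X))" "box n M (free_rmod n R X) = box n M (box n R (rep n X))"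
proof -
  show g: "box_gens n M (free_rmod n R X) = box_gens n M (box n R (rep n X))" "box_rels n M (free_rmod n R X) = box_rels n M (box n R (rep n X))" for M
    by (simp_all add: box_gens_def box_rels_def fun_eq_iff)
  show bg: "box_gen n M (free_rmod n R X) = box_gen n M (box n R (rep n X))" for M
    by (simp_all add: box_gen_def g fun_eq_iff)
  show "box n M (free_rmod n R X) = box n M (box n R (rep n X))"
    by (simp add: box_def[of n M] g bg)
qed

lemma (in burnside) free_nathom [simp]:
  "nathom M (free_rmod n R X) = nathom M (box n R (rep n X))" "nathom (free_rmod n R X) M = nathom (box n R (rep n X)) M"
  "lshift (free_rmod n R X) Y = lshift (box n R (rep n X)) Y"
  "rshift (free_rmod n R X) Y = rshift (box n R (rep n X)) Y"
  by (simp_all add: nathom_def lshift_def rshift_def fun_eq_iff)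

context comm_green
begin

lemma shift_lshift [simp]: "lshift (shift n R Q X) U = lshift (lshift Q X) U"
  by (simp add: lshift_def shift_def)

context
  fixes X :: gset
  assumes X: "X \<in> gsets n"
begin

abbreviation "FX \<equiv> free_rmod n R X"
abbreviation "BX \<equiv> box n R (rep n X)"

lemma BX_mackey [simp]: "mackey_functor n BX"
  using X by (simp add: box_mackey)

lemma free_lact: "lact FX = (\<lambda>Y z. box_map n R (rep n X) (mul R) nat_id Y (box_assoc_inv n R R (rep n X) Y z))"
  by (simp add: free_rmod_def)

lemma premod_free: "premod FX"
proof -
  note rX = rep_mackey[OF X]
  have "nathom (box n R BX) BX (\<lambda>Y z. box_map n R (rep n X) (mul R) nat_id Y (box_assoc_inv n R R (rep n X) Y z))"
    by (rule nathom_comp[OF box_assoc_inv_nathom[OF R_mackey R_mackey rX]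
        box_map_nathom[OF box_mackey[OF R_mackey R_mackey] rX R_mackey rX mul_nathom nat_id_nathom]])
  then show ?thesis unfolding premod_def free_lact free_box by simp
qed

text \<open>The elements \<open>b \<otimes> 1\<close> of \<open>R \<box> A\<^sub>X\<close>, with \<open>1\<close> the identity of \<open>X\<close>. By the Yoneda lemma they
  generate.\<close>

definition free_elt :: "gset \<Rightarrow> 'r \<Rightarrow> ('r, bmor) box" where
  "free_elt Y b = tens R (rep n X) Y X b (bid n X)"

lemma free_elt_nathom: "nathom R (rshift BX X) free_elt"
  using box_gen_pairing[OF R_mackey rep_mackey[OF X]] X unfolding pairing_def free_elt_def[abs_def] by simp

lemma free_elt_closed: "Y \<in> gsets n \<Longrightarrow> b \<in> carrier (val R Y) \<Longrightarrow> free_elt Y b \<in> carrier (val BX (Y \<times>\<^sub>G X))"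
  using nathom_closed[OF free_elt_nathom] by simp

lemma free_nathom_eq:
  assumes L: "mackey_functor n L" and f: "nathom BX L f" and h: "nathom BX L h"
    and eq: "\<And>Y b. Y \<in> gsets n \<Longrightarrow> b \<in> carrier (val R Y) \<Longrightarrow> f (Y \<times>\<^sub>G X) (free_elt Y b) = h (Y \<times>\<^sub>G X) (free_elt Y b)"
    and W: "W \<in> gsets n" and z: "z \<in> carrier (val BX W)"
  shows "f W z = h W z"
proof (rule box_nathom_eq[OF R_mackey rep_mackey[OF X] L f h _ W z])
  fix Y Z m k assume a: "Y \<in> gsets n" "Z \<in> gsets n" "m \<in> carrier (val R Y)" "k \<in> carrier (val (rep n X) Z)"
  have YX: "Y \<times>\<^sub>G X \<in> gsets n" and YZ: "Y \<times>\<^sub>G Z \<in> gsets n" using a X by simp_all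
  have k: "k \<in> carrier (bhom n X Z)" using a by simp
  have b: "bprod n Y Y X Z (bid n Y) k \<in> carrier (bhom n (Y \<times>\<^sub>G X) (Y \<times>\<^sub>G Z))" using a k by simp
  have i: "bid n X \<in> carrier (val (rep n X) X)" using X by simp
  have "tens R (rep n X) Y Z m k = mor BX (Y \<times>\<^sub>G X) (Y \<times>\<^sub>G Z) (bprod n Y Y X Z (bid n Y) k) (free_elt Y m)"
    using pairing_mor_right[OF box_gen_pairing[OF R_mackey rep_mackey[OF X]] a(1) X a(3) i a(2) k] bcomp_id_left[OF X k]
    by (simp add: free_elt_def)
  then show "f (Y \<times>\<^sub>G Z) (tens R (rep n X) Y Z m k) =
      h (Y \<times>\<^sub>G Z) (tens R (rep n X) Y Z m k)"
    using nathom_mor[OF f YX YZ b free_elt_closed[OF a(1,3)]] nathom_mor[OF h YX YZ b free_elt_closed[OF a(1,3)]] eq[OF a(1,3)] by simp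
qed

lemma xact_free_elt:
  assumes a: "U \<in> gsets n" "V \<in> gsets n" "a \<in> carrier (val R U)" "b \<in> carrier (val R V)"
  shows "xact n R FX U (V \<times>\<^sub>G X) a (free_elt V b) = tra n BX ((U \<times>\<^sub>G V) \<times>\<^sub>G X) (U \<times>\<^sub>G (V \<times>\<^sub>G X)) assocL (free_elt (U \<times>\<^sub>G V) (xmul n R U V a b))"
proof -
  note rX = rep_mackey[OF X]
  let ?X = "(U \<times>\<^sub>G V) \<times>\<^sub>G X" and ?Y = "U \<times>\<^sub>G (V \<times>\<^sub>G X)"
  let ?y = "tens (box n R R) (rep n X) (U \<times>\<^sub>G V) X (tens R R U V a b) (bid n X)"
  have i: "bid n X \<in> carrier (val (rep n X) X)" using X by simp
  have gs: "?X \<in> gsets n" "?Y \<in> gsets n" "U \<times>\<^sub>G V \<in> gsets n" using a X by simp_all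
  have e: "eqv n ?X ?Y assocL" by (simp add: eqv_def)
  have t: "tens R R U V a b \<in> carrier (val (box n R R) (U \<times>\<^sub>G V))" using a by simp
  have y: "?y \<in> carrier (val (box n (box n R R) (rep n X)) ?X)" by (rule box_gen_closed[OF gs(3) X bid_closed[OF gs(1)] t i])
  have 1: "box_assoc_inv n R R (rep n X) ?Y (tens R BX U (V \<times>\<^sub>G X) a (free_elt V b)) = tra n (box n (box n R R) (rep n X)) ?X ?Y assocL ?y"
    unfolding free_elt_def by (rule box_assoc_inv_gen[OF R_mackey R_mackey rX a(1,2) X a(3,4) i])
  have "box_map n R (rep n X) (mul R) nat_id ?X ?y = tens R (rep n X) (U \<times>\<^sub>G V) X (mul R (U \<times>\<^sub>G V) (tens R R U V a b)) (nat_id X (bid n X))"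
    by (rule box_map_gen[OF box_mackey[OF R_mackey R_mackey] rX R_mackey rX mul_nathom nat_id_nathom gs(1,3) X bid_closed[OF gs(1)] t i])
  also have "\<dots> = free_elt (U \<times>\<^sub>G V) (xmul n R U V a b)" by (simp add: free_elt_def xmul_def)
  finally have 2: "box_map n R (rep n X) (mul R) nat_id ?X ?y = free_elt (U \<times>\<^sub>G V) (xmul n R U V a b)" .
  show ?thesis
    unfolding xact_def free_lact free_box 1
    unfolding nathom_tra[OF box_map_nathom[OF box_mackey[OF R_mackey R_mackey] rX R_mackey rX mul_nathom nat_id_nathom] gs(1,2) e y] 2 ..
qed

text \<open>The unit of the self-duality of \<open>X\<close> applied to \<open>R\<close>: an element over \<open>Y\<close> is pulled back to \<open>Y \<times> X\<close>
  and spread over the diagonal of the two copies of \<open>X\<close>. In terms of points its value at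
  \<open>(x, y, x')\<close> is that of \<open>a\<close> at \<open>y\<close> if \<open>x = x'\<close>, and zero otherwise.\<close>

definition spread :: "gset \<Rightarrow> 'r \<Rightarrow> 'r" where
  "spread Y a = tra n R (Y \<times>\<^sub>G X) (X \<times>\<^sub>G (Y \<times>\<^sub>G X)) (\<lambda>w. PPair (psnd w) w) (res n R (Y \<times>\<^sub>G X) Y pfst a)"

lemma spread_nathom: "nathom R (rshift (lshift R X) X) spread"
proof (rule nathomI)
  show "mackey_functor n (rshift (lshift R X) X)" using X by simp
  fix Z Y h y assume a: "Z \<in> gsets n" "Y \<in> gsets n" "eqv n Z Y h" "y \<in> carrier (val R Y)"
  then show "spread Z (res n R Z Y h y) = res n (rshift (lshift R X) X) Z Y h (spread Y y)"
    using X unfolding spread_def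
    by (simp add: res_rshift res_lshift eqv_def)
      (subst base_change[where W = "Z \<times>\<^sub>G X" and ?w1.0 = "on_fst h" and ?w2.0 = "\<lambda>w. PPair (psnd w) w"],
        simp_all add: eqv_def res_res)
next
  fix Z Y h y assume a: "Z \<in> gsets n" "Y \<in> gsets n" "eqv n Z Y h" "y \<in> carrier (val R Z)"
  then show "spread Y (tra n R Z Y h y) = tra n (rshift (lshift R X) X) Z Y h (spread Z y)"
    using X unfolding spread_def
    by (simp add: tra_rshift tra_lshift eqv_def)
      (subst base_change[where W = "Z \<times>\<^sub>G X" and ?w1.0 = pfst and ?w2.0 = "on_fst h"],
        simp_all add: eqv_def tra_tra)
qed (use X in \<open>simp_all add: spread_def hom_def Pi_iff eqv_def tra_mult res_mult\<close>)

text \<open>The isomorphism of the free module with \<open>R(X \<times> -)\<close>, in the direction that provides coordinate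
  functionals.\<close>

definition free_to_shift :: "gset \<Rightarrow> ('r, bmor) box \<Rightarrow> 'r" where
  "free_to_shift = blift (lshift R X) (\<lambda>Y Z m a. mor (lshift R X) (Y \<times>\<^sub>G X) (Y \<times>\<^sub>G Z) (bprod n Y Y X Z (bid n Y) a) (spread Y m))"

lemma free_to_shift_nathom: "nathom BX (lshift R X) free_to_shift"
  and free_to_shift_elt: "Y \<in> gsets n \<Longrightarrow> b \<in> carrier (val R Y) \<Longrightarrow> free_to_shift (Y \<times>\<^sub>G X) (free_elt Y b) = spread Y b"
proof -
  note lM = mackey_lshift[OF R_mackey X]
  note p = rep_pairing[OF lM X spread_nathom]
  show "nathom BX (lshift R X) free_to_shift"
    unfolding free_to_shift_def by (rule blift_nathom[OF R_mackey rep_mackey[OF X] lM p])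
  assume a: "Y \<in> gsets n" "b \<in> carrier (val R Y)"
  have i: "bid n X \<in> carrier (val (rep n X) X)" using X by simp
  have d: "spread Y b \<in> carrier (val (lshift R X) (Y \<times>\<^sub>G X))" using nathom_closed[OF spread_nathom a] by simp
  show "free_to_shift (Y \<times>\<^sub>G X) (free_elt Y b) = spread Y b"
    unfolding free_to_shift_def free_elt_def blift_bid[OF R_mackey rep_mackey[OF X] lM p a(1) X a(2) i]
    using a X d by (simp add: bprod_bid mor_id[OF lM])
qed

text \<open>Both sides of the linearity condition are natural in the module element, so that it can be taken
  to be \<open>b \<otimes> 1\<close>. There both are the product \<open>a b\<close>, spread over the diagonal of \<open>X\<close>.\<close>

lemma free_to_shift_rmod: "mk_nat n FX free_to_shift \<in> rmod_hom n R FX (shift n R (regular R) X)"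
proof (rule rmod_homI[OF premod_free premod_shift[OF premod_regular X]])
  let ?S = "shift n R (regular R) X"
  note pS = premod_shift[OF premod_regular X]
  show "nathom FX ?S free_to_shift" using free_to_shift_nathom by simp
  fix U V a t assume a: "U \<in> gsets n" "V \<in> gsets n" "a \<in> carrier (val R U)" "t \<in> carrier (val FX V)"
  have t: "t \<in> carrier (val BX V)" using a by simp
  have f: "nathom BX (lshift (lshift R X) U) (\<lambda>V t. free_to_shift (U \<times>\<^sub>G V) (xact n R FX U V a t))"
  proof -
    have "nathom FX (lshift FX U) (\<lambda>V. xact n R FX U V a)" using xact_pairing[OF premod_free] a by (simp add: pairing_def)
    then have "nathom BX (lshift BX U) (\<lambda>V. xact n R FX U V a)" by simp
    from nathom_comp[OF this nathom_lshift[OF free_to_shift_nathom a(1)]] show ?thesis .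
  qed
  have h: "nathom BX (lshift (lshift R X) U) (\<lambda>V t. xact n R ?S U V a (free_to_shift V t))"
  proof -
    have "nathom ?S (lshift ?S U) (\<lambda>V. xact n R ?S U V a)" using xact_pairing[OF pS] a unfolding pairing_def by blast
    then have "nathom ?S (lshift (lshift R X) U) (\<lambda>V. xact n R ?S U V a)" by simp
    then have "nathom (lshift R X) (lshift (lshift R X) U) (\<lambda>V. xact n R ?S U V a)" unfolding nathom_def by (simp add: shift_def lshift_def)
    from nathom_comp[OF free_to_shift_nathom this] show ?thesis .
  qed
  show "free_to_shift (U \<times>\<^sub>G V) (xact n R FX U V a t) = xact n R ?S U V a (free_to_shift V t)"
  proof (rule free_nathom_eq[OF mackey_lshift[OF mackey_lshift[OF R_mackey X] a(1)] f h _ a(2) t])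
    fix Y b assume b: "Y \<in> gsets n" "b \<in> carrier (val R Y)"
    let ?y = "xmul n R U Y a b"
    have y: "?y \<in> carrier (val R (U \<times>\<^sub>G Y))" by (rule pairing_closed[OF xmul_pairing a(1) b(1) a(3) b(2)])
    have UY: "U \<times>\<^sub>G Y \<in> gsets n" using a b by simp
    have d: "spread Y b \<in> carrier (val R (X \<times>\<^sub>G (Y \<times>\<^sub>G X)))" using nathom_closed[OF spread_nathom b] by simp
    have "free_to_shift (U \<times>\<^sub>G (Y \<times>\<^sub>G X)) (xact n R FX U (Y \<times>\<^sub>G X) a (free_elt Y b)) =
       tra n R (X \<times>\<^sub>G ((U \<times>\<^sub>G Y) \<times>\<^sub>G X)) (X \<times>\<^sub>G (U \<times>\<^sub>G (Y \<times>\<^sub>G X))) (on_snd assocL) (spread (U \<times>\<^sub>G Y) ?y)"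
      using a b X y UY free_elt_closed[OF UY y]
      by (simp add: xact_free_elt nathom_tra[OF free_to_shift_nathom] free_to_shift_elt tra_lshift eqv_def)
    also have "\<dots> = tra n R (U \<times>\<^sub>G (Y \<times>\<^sub>G X)) (X \<times>\<^sub>G (U \<times>\<^sub>G (Y \<times>\<^sub>G X))) (\<lambda>w. PPair (psnd (psnd w)) w)
       (tra n R ((U \<times>\<^sub>G Y) \<times>\<^sub>G X) (U \<times>\<^sub>G (Y \<times>\<^sub>G X)) assocL (res n R ((U \<times>\<^sub>G Y) \<times>\<^sub>G X) (U \<times>\<^sub>G Y) pfst ?y))"
      using a b X y unfolding spread_def by (simp add: eqv_def tra_tra)
    \<comment> \<open>the rebracketing is a bijection; as a restriction it can be merged with the projection\<close>
    also have "tra n R ((U \<times>\<^sub>G Y) \<times>\<^sub>G X) (U \<times>\<^sub>G (Y \<times>\<^sub>G X)) assocL (res n R ((U \<times>\<^sub>G Y) \<times>\<^sub>G X) (U \<times>\<^sub>G Y) pfst ?y) =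
       res n R (U \<times>\<^sub>G (Y \<times>\<^sub>G X)) (U \<times>\<^sub>G Y) (on_snd pfst) ?y"
      using a b X y by (subst tra_iso[where g = assocR]) (simp_all add: eqv_def res_res)
    also have "tra n R (U \<times>\<^sub>G (Y \<times>\<^sub>G X)) (X \<times>\<^sub>G (U \<times>\<^sub>G (Y \<times>\<^sub>G X))) (\<lambda>w. PPair (psnd (psnd w)) w)
       (res n R (U \<times>\<^sub>G (Y \<times>\<^sub>G X)) (U \<times>\<^sub>G Y) (on_snd pfst) ?y) =
       tra n R (U \<times>\<^sub>G (X \<times>\<^sub>G (Y \<times>\<^sub>G X))) (X \<times>\<^sub>G (U \<times>\<^sub>G (Y \<times>\<^sub>G X))) swap_left (xmul n R U (X \<times>\<^sub>G (Y \<times>\<^sub>G X)) a (spread Y b))"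
      using a b X y unfolding spread_def
      by (simp add: eqv_def pairing_tra_right[OF xmul_pairing] pairing_res_right[OF xmul_pairing] pairing_closed[OF xmul_pairing] tra_tra)
        (rule fun_cong[OF tra_cong], auto simp: gprod_def)
    also have "\<dots> = xact n R ?S U (Y \<times>\<^sub>G X) a (free_to_shift (Y \<times>\<^sub>G X) (free_elt Y b))"
      using a b X d by (simp add: free_to_shift_elt xact_shift[OF premod_regular X])
    finally show "free_to_shift (U \<times>\<^sub>G (Y \<times>\<^sub>G X)) (xact n R FX U (Y \<times>\<^sub>G X) a (free_elt Y b)) = xact n R ?S U (Y \<times>\<^sub>G X) a (free_to_shift (Y \<times>\<^sub>G X) (free_elt Y b))" .
  qed
qed

lemma contract_nathom:
  assumes P: "premod P" and p: "p \<in> carrier (val P X)"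
  shows "nathom (lshift R X) P (\<lambda>Y c. contract P X Y c p)"
proof (rule nathomI)
  note PM = premod_mackey[OF P] and x = xact_pairing[OF P]
  show "mackey_functor n (lshift R X)" "mackey_functor n P" using PM X by simp_all
  fix Z Y h y assume a: "Z \<in> gsets n" "Y \<in> gsets n" "eqv n Z Y h" "y \<in> carrier (val (lshift R X) Y)"
  then show "contract P X Z (res n (lshift R X) Z Y h y) p = res n P Z Y h (contract P X Y y p)"
    using X p PM unfolding contract_def
    by (simp add: res_lshift eqv_def pairing_res_left[OF x])
      (subst base_change[where W = "X \<times>\<^sub>G Z" and ?w1.0 = "on_snd h" and ?w2.0 = psnd],
        simp_all add: eqv_def pairing_closed[OF x] res_res)
next
  note PM = premod_mackey[OF P] and x = xact_pairing[OF P]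
  fix Z Y h y assume a: "Z \<in> gsets n" "Y \<in> gsets n" "eqv n Z Y h" "y \<in> carrier (val (lshift R X) Z)"
  then show "contract P X Y (tra n (lshift R X) Z Y h y) p = tra n P Z Y h (contract P X Z y p)"
    using X p PM unfolding contract_def
    by (simp add: tra_lshift eqv_def pairing_tra_left[OF x])
      (subst base_change[where W = "X \<times>\<^sub>G Z" and ?w1.0 = "\<lambda>w. PPair w (pfst w)" and ?w2.0 = "on_snd h"],
        simp_all add: eqv_def pairing_closed[OF x] tra_tra)
next
  note PM = premod_mackey[OF P] and x = xact_pairing[OF P]
  fix Y assume "Y \<in> gsets n"
  then show "(\<lambda>c. contract P X Y c p) \<in> hom (val (lshift R X) Y) (val P Y)"
    using X p PM by (intro homI) (simp_all add: contract_closed[OF P], simp add: contract_def eqv_contract pairing_mult_left[OF x] pairing_closed[OF x] tra_mult res_mult)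
qed

text \<open>The triangle identity of the self-duality of \<open>X\<close>.\<close>

lemma contract_spread:
  assumes P: "premod P" and p: "p \<in> carrier (val P X)" and b: "Y \<in> gsets n" "b \<in> carrier (val R Y)"
  shows "contract P X (Y \<times>\<^sub>G X) (spread Y b) p = xact n R P Y X b p"
proof -
  note PM = premod_mackey[OF P] and x = xact_pairing[OF P]
  have A: "xact n R P Y X b p \<in> carrier (val P (Y \<times>\<^sub>G X))" by (rule pairing_closed[OF x b(1) X b(2) p])
  have id: "PPair (pfst w) (psnd w) = w" if "w \<in> fst (Y \<times>\<^sub>G X)" for w using that by (auto simp: gprod_def)
  show ?thesis
    using X p PM b A unfolding contract_def spread_def
    by (simp add: eqv_def pairing_tra_left[OF x] pairing_res_left[OF x])
      (subst base_change[where W = "Y \<times>\<^sub>G X" and ?w1.0 = "\<lambda>w. PPair w (psnd w)" and ?w2.0 = "\<lambda>w. PPair (psnd w) w"],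
        simp_all add: eqv_def tra_tra res_res tra_ident res_ident id)
qed

text \<open>The element \<open>1 \<otimes> 1\<close> over \<open>C\<^sub>n/C\<^sub>n \<times> X \<cong> X\<close> is the universal basis element: \<open>b\<close> times it is \<open>b \<otimes> 1\<close>.\<close>

lemma free_elt_xact_one:
  assumes b: "Y \<in> gsets n" "b \<in> carrier (val R Y)"
  shows "xact n R FX Y X b (tra n BX (gone n \<times>\<^sub>G X) X psnd (free_elt (gone n) rone)) = free_elt Y b"
proof -
  note x = xact_pairing[OF premod_free]
  have e1: "free_elt (gone n) rone \<in> carrier (val FX (gone n \<times>\<^sub>G X))" using free_elt_closed[OF gone_gset rone_closed] by simp
  have oX: "gone n \<times>\<^sub>G X \<in> gsets n" and Yo: "Y \<times>\<^sub>G gone n \<in> gsets n" using X b by simp_all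
  have id: "PPair (pfst w) (psnd w) = w" if "w \<in> fst (Y \<times>\<^sub>G X)" for w using that by (auto simp: gprod_def)
  have xb: "xmul n R Y (gone n) b rone \<in> carrier (val R (Y \<times>\<^sub>G gone n))" by (rule pairing_closed[OF xmul_pairing b(1) gone_gset b(2) rone_closed])
  have "free_elt (Y \<times>\<^sub>G gone n) (xmul n R Y (gone n) b rone) = tra n BX (Y \<times>\<^sub>G X) ((Y \<times>\<^sub>G gone n) \<times>\<^sub>G X) (\<lambda>w. PPair (PPair (pfst w) (pnt n)) (psnd w)) (free_elt Y b)"
    unfolding xmul_one[OF b] using X b by (subst nathom_tra[OF free_elt_nathom]) (simp_all add: eqv_def tra_rshift)
  then have "xact n R FX Y (gone n \<times>\<^sub>G X) b (free_elt (gone n) rone) =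
     tra n BX (Y \<times>\<^sub>G X) (Y \<times>\<^sub>G (gone n \<times>\<^sub>G X)) (\<lambda>w. PPair (pfst w) (PPair (pnt n) (psnd w))) (free_elt Y b)"
    using X b free_elt_closed[OF b] by (simp add: xact_free_elt tra_tra eqv_def)
  moreover have "xact n R FX Y X b (tra n FX (gone n \<times>\<^sub>G X) X psnd (free_elt (gone n) rone)) =
     tra n FX (Y \<times>\<^sub>G (gone n \<times>\<^sub>G X)) (Y \<times>\<^sub>G X) (on_snd psnd) (xact n R FX Y (gone n \<times>\<^sub>G X) b (free_elt (gone n) rone))"
    by (rule pairing_tra_right[OF x b(1) oX b(2) e1 X]) (simp add: eqv_def)
  ultimately show ?thesis using X b free_elt_closed[OF b] by (simp add: tra_tra tra_ident eqv_def id)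
qed

text \<open>With \<open>i\<close> the inclusion and \<open>s\<close> the retraction, \<open>p\<^sub>0\<close> is the image of the universal basis element
  under \<open>s\<close>, and \<open>\<theta>\<^sub>0\<close> is \<open>i\<close> followed by the coordinates of the free module. Expanding \<open>i(q)\<close> in
  the free module and applying \<open>s\<close> gives \<open>q\<close>.\<close>

lemma dual_basis_retract:
  assumes P: "premod P" and i: "i \<in> rmod_hom n R P FX" and s: "s \<in> rmod_hom n R FX P"
    and si: "\<And>Y p. Y \<in> gsets n \<Longrightarrow> p \<in> carrier (val P Y) \<Longrightarrow> s Y (i Y p) = p"
  shows "\<exists>p0 \<theta>0. dual_basis P X p0 \<theta>0"
proof -
  let ?u = "tra n BX (gone n \<times>\<^sub>G X) X psnd (free_elt (gone n) rone)"
  have u: "?u \<in> carrier (val BX X)"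
    using X free_elt_closed[OF gone_gset rone_closed] by (simp add: eqv_def)
  let ?p0 = "s X ?u"
  let ?t = "mk_nat n P (\<lambda>Y p. mk_nat n FX free_to_shift Y (i Y p))"
  have sn: "nathom BX P s" using rmod_hom_nathom[OF s] by simp
  have p0: "?p0 \<in> carrier (val P X)" by (rule nathom_closed[OF sn X u])
  have t: "?t \<in> carrier (val (dual n R P) X)"
    unfolding dual_carrier by (rule rmod_hom_comp[OF P premod_free premod_shift[OF premod_regular X] i free_to_shift_rmod])
  have eps: "contract P X Y (free_to_shift Y z) ?p0 = s Y z" if "Y \<in> gsets n" "z \<in> carrier (val BX Y)" for Y z
  proof (rule free_nathom_eq[OF premod_mackey[OF P] nathom_comp[OF free_to_shift_nathom contract_nathom[OF P p0]] sn _ that])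
    fix Y b assume b: "Y \<in> gsets n" "b \<in> carrier (val R Y)"
    have uF: "?u \<in> carrier (val FX X)" using u by simp
    have "s (Y \<times>\<^sub>G X) (xact n R FX Y X b ?u) = xact n R P Y X b ?p0"
      by (rule rmod_hom_xact[OF premod_free P s b(1) X b(2) uF])
    then show "contract P X (Y \<times>\<^sub>G X) (free_to_shift (Y \<times>\<^sub>G X) (free_elt Y b)) ?p0 = s (Y \<times>\<^sub>G X) (free_elt Y b)"
      unfolding free_to_shift_elt[OF b] contract_spread[OF P p0 b] free_elt_xact_one[OF b] by simp
  qed
  have "contract P X Y (?t Y q) ?p0 = q" if q: "Y \<in> gsets n" "q \<in> carrier (val P Y)" for Y q
  proof -
    have "i Y q \<in> carrier (val BX Y)" using nathom_closed[OF rmod_hom_nathom[OF i] q] by simp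
    then show ?thesis using q eps si[OF q] by simp
  qed
  then show ?thesis using X p0 t unfolding dual_basis_def by blast
qed

end

lemma fg_projective_dual_basis:
  assumes "fg_projective n R P"
  shows "extmod P" "\<exists>X p0 \<theta>0. dual_basis P X p0 \<theta>0"
proof -
  show e: "extmod P" using assms extmod_rmodule[of P] by (simp add: fg_projective_def)
  obtain X i s where "X \<in> gsets n" "i \<in> rmod_hom n R P (free_rmod n R X)" "s \<in> rmod_hom n R (free_rmod n R X) P"
    "\<forall>Y\<in>gsets n. \<forall>p\<in>carrier (val P Y). s Y (i Y p) = p"
    using assms unfolding fg_projective_def by blast
  then show "\<exists>X p0 \<theta>0. dual_basis P X p0 \<theta>0"
    using dual_basis_retract[OF _ extmod_premod[OF e]] by blast
qed

text \<open>\<open>R\<close> is a retract of \<open>R \<box> A\<close> for the unit \<open>A = A\<^sub>X\<close> with \<open>X = C\<^sub>n/C\<^sub>n\<close>, by the unit isomorphism and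
  its inverse \<open>r \<mapsto> r \<otimes> 1\<close>.\<close>

lemma fg_projective_regular: "fg_projective n R (regular R)"
proof -
  let ?o = "gone n" let ?F = "free_rmod n R ?o" and ?B = "box n R (rep n (gone n))"
  note BM = BX_mackey[OF gone_gset] and pf = premod_free[OF gone_gset]
  note e = free_elt_nathom[OF gone_gset] and ec = free_elt_closed[OF gone_gset] and xe = xact_free_elt[OF gone_gset]
  let ?i = "\<lambda>Y r. tra n ?B (Y \<times>\<^sub>G ?o) Y pfst (free_elt ?o Y r)"
  have t: "nathom (rshift ?B ?o) ?B (\<lambda>Y. tra n ?B (Y \<times>\<^sub>G ?o) Y pfst)"
  proof (rule nathomI)
    show "mackey_functor n (rshift ?B ?o)" "mackey_functor n ?B" using BM by simp_all
    fix Z Y h y assume "Z \<in> gsets n" "Y \<in> gsets n" "eqv n Z Y h" "y \<in> carrier (val (rshift ?B ?o) Y)"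
    then show "tra n ?B (Z \<times>\<^sub>G ?o) Z pfst (res n (rshift ?B ?o) Z Y h y) = res n ?B Z Y h (tra n ?B (Y \<times>\<^sub>G ?o) Y pfst y)"
      using BM by (simp add: res_rshift)
        (subst base_change[where W = "Z \<times>\<^sub>G ?o" and ?w1.0 = "on_fst h" and ?w2.0 = pfst], simp_all add: eqv_def)
  qed (use BM in \<open>simp_all add: hom_def Pi_iff tra_mult tra_rshift tra_tra eqv_def\<close>)
  have i: "mk_nat n (regular R) ?i \<in> rmod_hom n R (regular R) ?F"
  proof (rule rmod_homI[OF premod_regular pf])
    show "nathom (regular R) ?F ?i" using nathom_comp[OF e t] by simp
    fix U V a r assume a: "U \<in> gsets n" "V \<in> gsets n" "a \<in> carrier (val R U)" "r \<in> carrier (val (regular R) V)"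
    have r: "r \<in> carrier (val R V)" using a by simp
    have eF: "free_elt ?o V r \<in> carrier (val ?F (V \<times>\<^sub>G ?o))" using ec[OF a(2) r] by simp
    have y: "xmul n R U V a r \<in> carrier (val R (U \<times>\<^sub>G V))" by (rule pairing_closed[OF xmul_pairing a(1-3) r])
    have Vo: "V \<times>\<^sub>G ?o \<in> gsets n" and UV: "U \<times>\<^sub>G V \<in> gsets n" using a by simp_all
    have "xact n R ?F U V a (tra n ?F (V \<times>\<^sub>G ?o) V pfst (free_elt ?o V r)) =
       tra n ?F (U \<times>\<^sub>G (V \<times>\<^sub>G ?o)) (U \<times>\<^sub>G V) (on_snd pfst) (xact n R ?F U (V \<times>\<^sub>G ?o) a (free_elt ?o V r))"
      by (rule pairing_tra_right[OF xact_pairing[OF pf] a(1) Vo a(3) eF a(2)]) (simp add: eqv_def)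
    then have "xact n R ?F U V a (tra n ?B (V \<times>\<^sub>G ?o) V pfst (free_elt ?o V r)) =
       tra n ?B ((U \<times>\<^sub>G V) \<times>\<^sub>G ?o) (U \<times>\<^sub>G V) (\<lambda>w. PPair (pfst (pfst w)) (psnd (pfst w))) (free_elt ?o (U \<times>\<^sub>G V) (xmul n R U V a r))"
      using a r ec[OF UV y] BM by (simp add: xe tra_tra eqv_def)
    also have "\<dots> = tra n ?B ((U \<times>\<^sub>G V) \<times>\<^sub>G ?o) (U \<times>\<^sub>G V) pfst (free_elt ?o (U \<times>\<^sub>G V) (xmul n R U V a r))"
      by (rule fun_cong[OF tra_cong]) (auto simp: gprod_def)
    finally show "tra n ?B ((U \<times>\<^sub>G V) \<times>\<^sub>G ?o) (U \<times>\<^sub>G V) pfst (free_elt ?o (U \<times>\<^sub>G V) (xact n R (regular R) U V a r)) =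
       xact n R ?F U V a (tra n ?B (V \<times>\<^sub>G ?o) V pfst (free_elt ?o V r))" by simp
  qed
  note rn = box_runit_nathom[OF R_mackey]
  have ru: "box_runit n R (Y \<times>\<^sub>G ?o) (free_elt ?o Y b) = tra n R Y (Y \<times>\<^sub>G ?o) (\<lambda>y. PPair y (pnt n)) b"
    if "Y \<in> gsets n" "b \<in> carrier (val R Y)" for Y b
    using that by (simp add: free_elt_def[OF gone_gset] box_runit_gen bprod_bid mor_id eqv_def)
  have s: "mk_nat n ?F (box_runit n R) \<in> rmod_hom n R ?F (regular R)"
  proof (rule rmod_homI[OF pf premod_regular])
    show "nathom ?F (regular R) (box_runit n R)" using rn by simp
    fix U V a t assume a: "U \<in> gsets n" "V \<in> gsets n" "a \<in> carrier (val R U)" "t \<in> carrier (val ?F V)"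
    have t: "t \<in> carrier (val ?B V)" using a by simp
    have f: "nathom ?B (lshift R U) (\<lambda>V t. box_runit n R (U \<times>\<^sub>G V) (xact n R ?F U V a t))"
    proof -
      have "nathom ?F (lshift ?F U) (\<lambda>V. xact n R ?F U V a)" using xact_pairing[OF pf] a by (simp add: pairing_def)
      then have "nathom ?B (lshift ?B U) (\<lambda>V. xact n R ?F U V a)" by simp
      from nathom_comp[OF this nathom_lshift[OF rn a(1)]] show ?thesis .
    qed
    have h: "nathom ?B (lshift R U) (\<lambda>V t. xmul n R U V a (box_runit n R V t))"
    proof -
      have "nathom R (lshift R U) (\<lambda>V. xmul n R U V a)" using xmul_pairing a by (simp add: pairing_def)
      from nathom_comp[OF rn this] show ?thesis .
    qed
    have "box_runit n R (U \<times>\<^sub>G V) (xact n R ?F U V a t) = xmul n R U V a (box_runit n R V t)"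
    proof (rule free_nathom_eq[OF gone_gset mackey_lshift[OF R_mackey a(1)] f h _ a(2) t])
      fix Y b assume b: "Y \<in> gsets n" "b \<in> carrier (val R Y)"
      have y: "xmul n R U Y a b \<in> carrier (val R (U \<times>\<^sub>G Y))" by (rule pairing_closed[OF xmul_pairing a(1) b(1) a(3) b(2)])
      have UY: "U \<times>\<^sub>G Y \<in> gsets n" using a b by simp
      have "tra n R (U \<times>\<^sub>G Y) (U \<times>\<^sub>G (Y \<times>\<^sub>G ?o)) (\<lambda>w. PPair (pfst w) (PPair (psnd w) (pnt n))) (xmul n R U Y a b) = xmul n R U (Y \<times>\<^sub>G ?o) a (tra n R Y (Y \<times>\<^sub>G ?o) (\<lambda>y. PPair y (pnt n)) b)"
        using a b by (simp add: pairing_tra_right[OF xmul_pairing] eqv_def)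
      then show "box_runit n R (U \<times>\<^sub>G (Y \<times>\<^sub>G ?o)) (xact n R ?F U (Y \<times>\<^sub>G ?o) a (free_elt ?o Y b)) = xmul n R U (Y \<times>\<^sub>G ?o) a (box_runit n R (Y \<times>\<^sub>G ?o) (free_elt ?o Y b))"
        using a b y UY ec[OF UY y] by (simp add: xe nathom_tra[OF rn] ru tra_tra eqv_def)
    qed
    then show "box_runit n R (U \<times>\<^sub>G V) (xact n R ?F U V a t) = xact n R (regular R) U V a (box_runit n R V t)" by simp
  qed
  have "mk_nat n ?F (box_runit n R) Y (mk_nat n (regular R) ?i Y p) = p" if p: "Y \<in> gsets n" "p \<in> carrier (val (regular R) Y)" for Y p
  proof -
    have "?i Y p \<in> carrier (val ?F Y)" using p ec BM by (simp add: eqv_def)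
    then show ?thesis using p ec BM by (simp add: nathom_tra[OF rn] ru tra_tra tra_ident eqv_def)
  qed
  then show ?thesis unfolding fg_projective_def
    using regular_rmodule i s gone_gset by blast
qed

end

context twisted_green
begin

section \<open>Additivity of the trace\<close>

text \<open>The class of \<open>\<Sum> w(x, x)\<close> in \<open>HH\<^sub>0\<close>.\<close>

definition diag_trace :: "gset \<Rightarrow> 'r \<Rightarrow> 'r set" where
  "diag_trace X w = HH0_map n R g (gone n) (mor R (X \<times>\<^sub>G X) (gone n) (diag_span X) w)"

lemma diag_trace_hom: 
  assumes X: "X \<in> gsets n" shows "diag_trace X \<in> hom (val R (X \<times>\<^sub>G X)) (val (HH0 n R g) (gone n))"
  using Group.hom_compose[OF mor_hom[OF R_mackey gprod_gset[OF X X] gone_gset diag_span_closed[OF X]] HH0_map_hom[OF gone_gset]]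
  by (simp add: diag_trace_def[abs_def] comp_def)

text \<open>An endomorphism of the form \<open>p \<mapsto> \<Sum> \<theta>(p)(x) q(x) + \<Sum> \<theta>'(p)(x') q'(x')\<close> is the image under the
  tensor-Hom map of the sum of the elements \<open>\<theta> \<otimes> q\<close> and \<open>\<theta>' \<otimes> q'\<close>, each composed with a counit.
  The dual basis only guarantees that the trace may be computed on this preimage.\<close>

lemma trace_sum:
  fixes P :: "('r, 'p) rmod"
  assumes P: "extmod P" and db: "dual_basis P X0 p0 \<theta>0"
    and X: "X \<in> gsets n" "\<theta> \<in> carrier (val (dual n R P) X)" "q \<in> carrier (val P X)"
    and X': "X' \<in> gsets n" "\<theta>' \<in> carrier (val (dual n R P) X')" "q' \<in> carrier (val P X')"
    and f: "\<And>Y p. Y \<in> gsets n \<Longrightarrow> p \<in> carrier (val P Y) \<Longrightarrow>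
      f Y p = contract (twist n R g P) X Y (\<theta> Y p) q \<otimes>\<^bsub>val P Y\<^esub> contract (twist n R g P) X' Y (\<theta>' Y p) q'"
  shows "hs_trace n R g P (gone n) (hom_elt n P (twist n R g P) f) =
     diag_trace X (\<theta> X q) \<otimes>\<^bsub>val (HH0 n R g) (gone n)\<^esub> diag_trace X' (\<theta>' X' q')"
proof -
  let ?gP = "twist n R g P" and ?Pd = "dual n R P"
  let ?B = "val (box n ?Pd ?gP) (gone n)" and ?I = "inthom n R P ?gP"
  let ?d = "blift ?I (hompair P ?gP) (gone n)"
  let ?z = "box_gen n ?Pd ?gP (gone n) (X, X, diag_span X, \<theta>, q)" and ?z' = "box_gen n ?Pd ?gP (gone n) (X', X', diag_span X', \<theta>', q')"
  have qg: "q \<in> carrier (val ?gP X)" "q' \<in> carrier (val ?gP X')" using X X' by simp_all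
  have z: "?z \<in> carrier ?B" by (rule box_gen_closed[OF X(1) X(1) diag_span_closed[OF X(1)] X(2) qg(1)])
  have z': "?z' \<in> carrier ?B" by (rule box_gen_closed[OF X'(1) X'(1) diag_span_closed[OF X'(1)] X'(2) qg(2)])
  interpret B: comm_group ?B by (rule box_group[OF Pd_mackey[OF P] gP_mackey[OF P]])
  note dh = nathom_hom[OF delta0_nathom[OF P] gone_gset]
  note hd = hompair_diag[OF P_pre[OF P] gP_pre[OF P]]
  have "?d (?z \<otimes>\<^bsub>?B\<^esub> ?z') = ?d ?z \<otimes>\<^bsub>val ?I (gone n)\<^esub> ?d ?z'" by (rule hom_mult[OF dh z z'])
  also have "\<dots> = hom_elt n P ?gP f"
    unfolding delta0_gen[OF P gone_gset X(1) X(1) diag_span_closed[OF X(1)] X(2) qg(1)]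
      delta0_gen[OF P gone_gset X'(1) X'(1) diag_span_closed[OF X'(1)] X'(2) qg(2)]
    unfolding inthom_simps(2) hom_elt_def
  proof (rule mk_nat_eqI)
    fix Y p assume Y: "Y \<in> gsets n" and p: "p \<in> carrier (val P Y)"
    have c: "contract ?gP X Y (\<theta> Y p) q \<in> carrier (val ?gP Y)" by (rule contract_closed[OF gP_pre[OF P] X(1) Y dual_closed[OF X(2) Y p] qg(1)])
    have c': "contract ?gP X' Y (\<theta>' Y p) q' \<in> carrier (val ?gP Y)" by (rule contract_closed[OF gP_pre[OF P] X'(1) Y dual_closed[OF X'(2) Y p] qg(2)])
    show "mor ?I (X \<times>\<^sub>G X) (gone n) (diag_span X) (hompair P ?gP X X \<theta> q) Y p \<otimes>\<^bsub>val ?gP (gone n \<times>\<^sub>G Y)\<^esub>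
        mor ?I (X' \<times>\<^sub>G X') (gone n) (diag_span X') (hompair P ?gP X' X' \<theta>' q') Y p =
      tra n ?gP Y (gone n \<times>\<^sub>G Y) (\<lambda>y. PPair (pnt n) y) (f Y p)"
      unfolding hd[OF X(1,2) qg(1) Y p] hd[OF X'(1,2) qg(2) Y p] f[OF Y p]
      using tra_mult[OF gP_mackey[OF P] Y _ _ c c', of "gone n \<times>\<^sub>G Y" "\<lambda>y. PPair (pnt n) y"] Y by (simp add: eqv_def)
  qed
  finally have "hs_trace n R g P (gone n) (hom_elt n P ?gP f) = HH0_map n R g (gone n) (evaluation n R (gone n) (box_sym n ?Pd ?gP (gone n) (?z \<otimes>\<^bsub>?B\<^esub> ?z')))"
    using hs_trace_eq_pi0[OF P db B.m_closed[OF z z']] by simp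
  also have "\<dots> = diag_trace X (\<theta> X q) \<otimes>\<^bsub>val (HH0 n R g) (gone n)\<^esub> diag_trace X' (\<theta>' X' q')"
    using hom_mult[OF pi0_hom[OF P gone_gset] z z'] pi0_gen[OF P gone_gset X(1) X(1) diag_span_closed[OF X(1)] X(2,3)]
      pi0_gen[OF P gone_gset X'(1) X'(1) diag_span_closed[OF X'(1)] X'(2,3)] by (simp add: diag_trace_def)
  finally show ?thesis .
qed

lemma trace_single:
  fixes P :: "('r, 'p) rmod"
  assumes P: "extmod P" and db: "dual_basis P X0 p0 \<theta>0"
    and X: "X \<in> gsets n" "\<theta> \<in> carrier (val (dual n R P) X)" "q \<in> carrier (val P X)"
    and f: "\<And>Y p. Y \<in> gsets n \<Longrightarrow> p \<in> carrier (val P Y) \<Longrightarrow> f Y p = contract (twist n R g P) X Y (\<theta> Y p) q"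
  shows "hs_trace n R g P (gone n) (hom_elt n P (twist n R g P) f) = diag_trace X (\<theta> X q)"
proof -
  let ?gP = "twist n R g P" and ?Pd = "dual n R P"
  let ?z = "box_gen n ?Pd ?gP (gone n) (X, X, diag_span X, \<theta>, q)"
  have qg: "q \<in> carrier (val ?gP X)" using X by simp
  have z: "?z \<in> carrier (val (box n ?Pd ?gP) (gone n))" by (rule box_gen_closed[OF X(1) X(1) diag_span_closed[OF X(1)] X(2) qg])
  have "blift (inthom n R P ?gP) (hompair P ?gP) (gone n) ?z = hom_elt n P ?gP f"
    unfolding delta0_gen[OF P gone_gset X(1) X(1) diag_span_closed[OF X(1)] X(2) qg]
  proof -
    have "mor (inthom n R P ?gP) (X \<times>\<^sub>G X) (gone n) (diag_span X) (hompair P ?gP X X \<theta> q) =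
      mk_nat n P (mor (inthom n R P ?gP) (X \<times>\<^sub>G X) (gone n) (diag_span X) (hompair P ?gP X X \<theta> q))"
      unfolding inthom_simps(4) by (rule mk_nat_eqI) simp
    also have "\<dots> = hom_elt n P ?gP f"
      unfolding hom_elt_def by (rule mk_nat_eqI) (simp only: hompair_diag[OF P_pre[OF P] gP_pre[OF P] X(1,2) qg] f)
    finally show "mor (inthom n R P ?gP) (X \<times>\<^sub>G X) (gone n) (diag_span X) (hompair P ?gP X X \<theta> q) = hom_elt n P ?gP f" .
  qed
  then show ?thesis
    using hs_trace_eq_pi0[OF P db z] pi0_gen[OF P gone_gset X(1) X(1) diag_span_closed[OF X(1)] X(2,3)] by (simp add: diag_trace_def)
qed

text \<open>A linear \<open>f\<close> is \<open>q \<mapsto> \<Sum> \<theta>\<^sub>0(q)(x) f(p\<^sub>0)(x)\<close>.\<close>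

lemma trace_dual_basis:
  fixes P :: "('r, 'p) rmod"
  assumes P: "extmod P" and db: "dual_basis P X p0 \<theta>0" and f: "f \<in> rmod_hom n R P (twist n R g P)"
  shows "hs_trace n R g P (gone n) (hom_elt n P (twist n R g P) f) = diag_trace X (\<theta>0 X (f X p0))"
    and "\<theta>0 X (f X p0) \<in> carrier (val R (X \<times>\<^sub>G X))"
proof -
  note b = basis_gset[OF P db] basis_elt[OF P db] basis_dual[OF P db]
  have fp: "f X p0 \<in> carrier (val P X)" using nathom_closed[OF rmod_hom_nathom[OF f] b(1,2)] by simp
  then show "\<theta>0 X (f X p0) \<in> carrier (val R (X \<times>\<^sub>G X))" by (rule dual_closed[OF b(3,1)])
  show "hs_trace n R g P (gone n) (hom_elt n P (twist n R g P) f) = diag_trace X (\<theta>0 X (f X p0))"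
  proof (rule trace_single[OF P db b(1,3) fp])
    fix Y p assume Y: "Y \<in> gsets n" and p: "p \<in> carrier (val P Y)"
    show "f Y p = contract (twist n R g P) X Y (\<theta>0 Y p) (f X p0)"
      using contract_rmod_hom[OF P_pre[OF P] gP_pre[OF P] f b(1) Y dual_closed[OF b(3) Y p] b(2)] basis_expand[OF P db Y p] by simp
  qed
qed

text \<open>The pointwise preimage is unique, which forces it to be additive, natural and linear.\<close>

lemma rmod_hom_factor:
  assumes P: "premod P" and Q: "premod Q" and S: "premod S" and w: "w \<in> rmod_hom n R P S" and u: "u \<in> rmod_hom n R Q S"
    and inj: "\<And>Y. Y \<in> gsets n \<Longrightarrow> inj_on (u Y) (carrier (val Q Y))"
    and im: "\<And>Y p. Y \<in> gsets n \<Longrightarrow> p \<in> carrier (val P Y) \<Longrightarrow> w Y p \<in> u Y ` carrier (val Q Y)"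
  shows "\<exists>\<rho>\<in>rmod_hom n R P Q. \<forall>Y\<in>gsets n. \<forall>p\<in>carrier (val P Y). u Y (\<rho> Y p) = w Y p"
proof -
  note un = rmod_hom_nathom[OF u] and wn = rmod_hom_nathom[OF w]
  note PM = premod_mackey[OF P] and QM = premod_mackey[OF Q]
  define r where "r = (\<lambda>Y p. inv_into (carrier (val Q Y)) (u Y) (w Y p))"
  have r: "r Y p \<in> carrier (val Q Y)" "u Y (r Y p) = w Y p" if "Y \<in> gsets n" "p \<in> carrier (val P Y)" for Y p
    using inv_into_into[OF im[OF that]] f_inv_into_f[OF im[OF that]] by (simp_all add: r_def)
  have eq: "r Y p = x" if "Y \<in> gsets n" "p \<in> carrier (val P Y)" "x \<in> carrier (val Q Y)" "u Y x = w Y p" for Y p x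
    using inj_onD[OF inj[OF that(1)], of "r Y p" x] r[OF that(1,2)] that(3,4) by simp
  have rn: "nathom P Q r"
    unfolding nathom_def
  proof (intro conjI ballI homI)
    fix Y p q assume a: "Y \<in> gsets n" "p \<in> carrier (val P Y)" "q \<in> carrier (val P Y)"
    show "r Y (p \<otimes>\<^bsub>val P Y\<^esub> q) = r Y p \<otimes>\<^bsub>val Q Y\<^esub> r Y q"
      using a r PM QM by (intro eq) (simp_all add: nathom_mult[OF un] nathom_mult[OF wn])
  next
    fix X Y b p assume a: "X \<in> gsets n" "Y \<in> gsets n" "b \<in> carrier (bhom n X Y)" "p \<in> carrier (val P X)"
    then show "r Y (mor P X Y b p) = mor Q X Y b (r X p)"
      using r PM QM by (intro eq) (simp_all add: nathom_mor[OF un] nathom_mor[OF wn])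
  qed (simp add: r(1))
  have "mk_nat n P r \<in> rmod_hom n R P Q"
  proof (rule rmod_homI[OF P Q rn])
    fix U V a p assume a: "U \<in> gsets n" "V \<in> gsets n" "a \<in> carrier (val R U)" "p \<in> carrier (val P V)"
    then show "r (U \<times>\<^sub>G V) (xact n R P U V a p) = xact n R Q U V a (r V p)"
      using r by (intro eq) (simp_all add: pairing_closed[OF xact_pairing[OF P]] pairing_closed[OF xact_pairing[OF Q]] rmod_hom_xact[OF P S w] rmod_hom_xact[OF Q S u])
  qed
  then show ?thesis using r(2) by (intro bexI[of _ "mk_nat n P r"]) simp_all
qed

lemma rmod_hom_id: "premod P \<Longrightarrow> mk_nat n P (\<lambda>Y p. p) \<in> rmod_hom n R P P"
  by (rule rmod_homI) (simp_all add: nathom_id)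

text \<open>Lifting the dual basis of the quotient along \<open>v\<close> splits the sequence. With the section \<open>\<sigma>\<close> and
  the resulting retraction \<open>\<rho>\<close>, every \<open>q\<close> is \<open>u(\<rho>(q)) + \<sigma>(v(q))\<close>, and expanding \<open>\<rho>(q)\<close> and \<open>v(q)\<close>
  in the dual bases of the outer terms writes \<open>f\<close> in the form of \<open>trace_sum\<close>. The two summands
  obtained are the traces of \<open>f'\<close> and \<open>f''\<close>, because \<open>f\<close> is compatible with these along \<open>u\<close> and
  \<open>v\<close>.\<close>

lemma trace_additive:
  assumes ex: "(E', E, E'') \<in> end_exact n R g"
  shows "hs_trace n R g (fst E) (gone n) (hom_elt n (fst E) (twist n R g (fst E)) (snd E)) =
     hs_trace n R g (fst E') (gone n) (hom_elt n (fst E') (twist n R g (fst E')) (snd E')) \<otimes>\<^bsub>val (HH0 n R g) (gone n)\<^esub>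
     hs_trace n R g (fst E'') (gone n) (hom_elt n (fst E'') (twist n R g (fst E'')) (snd E''))"
proof -
  obtain P f P' f' P'' f'' where E: "E = (P, f)" "E' = (P', f')" "E'' = (P'', f'')" by (metis surj_pair)
  obtain u v where uv: "u \<in> end_hom n R E' E" "v \<in> end_hom n R E E''" "short_exact n P' u P v P''"
    and obj: "E' \<in> end_objs n R g" "E \<in> end_objs n R g" "E'' \<in> end_objs n R g"
    using ex unfolding end_exact_def E by auto
  have fg: "fg_projective n R P" "fg_projective n R P'" "fg_projective n R P''"
    and f: "f \<in> rmod_hom n R P (twist n R g P)" and f': "f' \<in> rmod_hom n R P' (twist n R g P')" and f'': "f'' \<in> rmod_hom n R P'' (twist n R g P'')"
    using obj unfolding E end_objs_def proj_objs_def by auto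
  have u: "u \<in> rmod_hom n R P' P" and uf: "\<And>Y p. Y \<in> gsets n \<Longrightarrow> p \<in> carrier (val P' Y) \<Longrightarrow> u Y (f' Y p) = f Y (u Y p)"
    and v: "v \<in> rmod_hom n R P P''" and vf: "\<And>Y p. Y \<in> gsets n \<Longrightarrow> p \<in> carrier (val P Y) \<Longrightarrow> v Y (f Y p) = f'' Y (v Y p)"
    using uv(1,2) unfolding end_hom_def E by simp_all
  have se: "\<And>Y. Y \<in> gsets n \<Longrightarrow> inj_on (u Y) (carrier (val P' Y))"
    "\<And>Y. Y \<in> gsets n \<Longrightarrow> u Y ` carrier (val P' Y) = kernel (val P Y) (val P'' Y) (v Y)"
    "\<And>Y. Y \<in> gsets n \<Longrightarrow> v Y ` carrier (val P Y) = carrier (val P'' Y)"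
    using uv(3) unfolding short_exact_def by blast+
  note e = fg_projective_dual_basis(1)[OF fg(1)] and e' = fg_projective_dual_basis(1)[OF fg(2)] and e'' = fg_projective_dual_basis(1)[OF fg(3)]
  note p = P_pre[OF e] and p' = P_pre[OF e'] and p'' = P_pre[OF e'']
  note PM = P_mackey[OF e] and P'M = P_mackey[OF e'] and P''M = P_mackey[OF e'']
  note un = rmod_hom_nathom[OF u] and vn = rmod_hom_nathom[OF v] and fn = rmod_hom_nathom[OF f] and fn' = rmod_hom_nathom[OF f'] and fn'' = rmod_hom_nathom[OF f'']
  obtain X p0 \<theta>0 where db: "dual_basis P X p0 \<theta>0" using fg_projective_dual_basis(2)[OF fg(1)] by blast
  obtain X1 p1 \<theta>1 where db1: "dual_basis P' X1 p1 \<theta>1" using fg_projective_dual_basis(2)[OF fg(2)] by blast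
  obtain X2 p2 \<theta>2 where db2: "dual_basis P'' X2 p2 \<theta>2" using fg_projective_dual_basis(2)[OF fg(3)] by blast
  note b1 = basis_gset[OF e' db1] basis_elt[OF e' db1] basis_dual[OF e' db1] and b2 = basis_gset[OF e'' db2] basis_elt[OF e'' db2] basis_dual[OF e'' db2]
  obtain h where h: "h \<in> carrier (val P X2)" "v X2 h = p2" using se(3)[OF b2(1)] b2(2) by (metis imageE)
  \<comment> \<open>the section of \<open>v\<close> that sends the dual basis elements to lifts\<close>
  define \<sigma> where "\<sigma> = mk_nat n P'' (\<lambda>Y q. contract P X2 Y (\<theta>2 Y q) h)"
  have \<sigma>: "\<sigma> \<in> rmod_hom n R P'' P" unfolding \<sigma>_def by (rule contract_dual_rmod[OF p'' e b2(1,3) h(1)])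
  note \<sigma>n = rmod_hom_nathom[OF \<sigma>]
  have v\<sigma>: "v Y (\<sigma> Y q) = q" if "Y \<in> gsets n" "q \<in> carrier (val P'' Y)" for Y q
    using that contract_rmod_hom[OF p p'' v b2(1) that(1) dual_closed[OF b2(3) that] h(1)] h(2) basis_expand[OF e'' db2 that] by (simp add: \<sigma>_def)
  have vc: "v Y q \<in> carrier (val P'' Y)" if "Y \<in> gsets n" "q \<in> carrier (val P Y)" for Y q by (rule nathom_closed[OF vn that])
  have sc: "\<sigma> Y q \<in> carrier (val P Y)" if "Y \<in> gsets n" "q \<in> carrier (val P'' Y)" for Y q by (rule nathom_closed[OF \<sigma>n that])
  define s where "s = mk_nat n P (\<lambda>Y q. \<sigma> Y (v Y q))"
  have s: "s \<in> rmod_hom n R P P" unfolding s_def by (rule rmod_hom_comp[OF p p'' p v \<sigma>])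
  \<comment> \<open>the projection \<open>1 - \<sigma>v\<close> onto the kernel of \<open>v\<close>, which is the image of \<open>u\<close>\<close>
  define w where "w = mk_nat n P (\<lambda>Y q. mk_nat n P (\<lambda>Y q. q) Y q \<otimes>\<^bsub>val P Y\<^esub> mk_nat n P (\<lambda>Y q. inv\<^bsub>val P Y\<^esub> s Y q) Y q)"
  have w: "w \<in> rmod_hom n R P P" unfolding w_def by (rule rmod_hom_add[OF p p rmod_hom_id[OF p] rmod_hom_inv[OF p p s]])
  have wq: "w Y q = q \<otimes>\<^bsub>val P Y\<^esub> inv\<^bsub>val P Y\<^esub> \<sigma> Y (v Y q)" if "Y \<in> gsets n" "q \<in> carrier (val P Y)" for Y q
    using that by (simp add: w_def s_def)
  have wk: "w Y q \<in> u Y ` carrier (val P' Y)" if Y: "Y \<in> gsets n" and q: "q \<in> carrier (val P Y)" for Y q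
  proof -
    interpret C: comm_group "val P Y" by (rule mackey_group[OF PM Y])
    interpret C'': comm_group "val P'' Y" by (rule mackey_group[OF P''M Y])
    interpret V: group_hom "val P Y" "val P'' Y" "v Y" using nathom_hom[OF vn Y] by unfold_locales
    have "v Y (w Y q) = \<one>\<^bsub>val P'' Y\<^esub>" using q vc[OF Y q] sc[OF Y vc[OF Y q]] v\<sigma>[OF Y vc[OF Y q]] by (simp add: wq[OF Y q])
    moreover have "w Y q \<in> carrier (val P Y)" by (rule nathom_closed[OF rmod_hom_nathom[OF w] Y q])
    ultimately show ?thesis unfolding se(2)[OF Y] kernel_def by simp
  qed
  obtain \<rho> where \<rho>: "\<rho> \<in> rmod_hom n R P P'" and u\<rho>: "\<And>Y q. Y \<in> gsets n \<Longrightarrow> q \<in> carrier (val P Y) \<Longrightarrow> u Y (\<rho> Y q) = w Y q"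
    using rmod_hom_factor[OF p p' p w u se(1) wk] by blast
  have rc: "\<rho> Y q \<in> carrier (val P' Y)" if "Y \<in> gsets n" "q \<in> carrier (val P Y)" for Y q by (rule nathom_closed[OF rmod_hom_nathom[OF \<rho>] that])
  have uc: "u Y q \<in> carrier (val P Y)" if "Y \<in> gsets n" "q \<in> carrier (val P' Y)" for Y q by (rule nathom_closed[OF un that])
  have fc: "f Y q \<in> carrier (val P Y)" if "Y \<in> gsets n" "q \<in> carrier (val P Y)" for Y q using nathom_closed[OF fn that] by simp
  have split: "q = u Y (\<rho> Y q) \<otimes>\<^bsub>val P Y\<^esub> \<sigma> Y (v Y q)" if Y: "Y \<in> gsets n" and q: "q \<in> carrier (val P Y)" for Y q
  proof -
    interpret C: comm_group "val P Y" by (rule mackey_group[OF PM Y])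
    show ?thesis using q sc[OF Y vc[OF Y q]] by (simp add: u\<rho>[OF Y q] wq[OF Y q] C.m_assoc)
  qed
  have \<rho>u: "\<rho> Y (u Y x) = x" if Y: "Y \<in> gsets n" and x: "x \<in> carrier (val P' Y)" for Y x
  proof -
    interpret C: comm_group "val P Y" by (rule mackey_group[OF PM Y])
    interpret S: group_hom "val P'' Y" "val P Y" "\<sigma> Y" using nathom_hom[OF \<sigma>n Y] mackey_is_group[OF P''M Y] by (simp add: group_hom_def group_hom_axioms_def)
    have "u Y x \<in> kernel (val P Y) (val P'' Y) (v Y)" using se(2)[OF Y] x by blast
    then have "v Y (u Y x) = \<one>\<^bsub>val P'' Y\<^esub>" by (simp add: kernel_def)
    then have "u Y (\<rho> Y (u Y x)) = u Y x" using uc[OF Y x] by (simp add: u\<rho> wq Y)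
    then show ?thesis using inj_onD[OF se(1)[OF Y]] rc[OF Y uc[OF Y x]] x by blast
  qed
  \<comment> \<open>the coordinate functionals of the outer terms, extended to \<open>P\<close>\<close>
  define t1 where "t1 = mk_nat n P (\<lambda>Y q. \<theta>1 Y (\<rho> Y q))"
  define t2 where "t2 = mk_nat n P (\<lambda>Y q. \<theta>2 Y (v Y q))"
  have t1: "t1 \<in> carrier (val (dual n R P) X1)"
    unfolding t1_def dual_carrier by (rule rmod_hom_comp[OF p p' premod_shift[OF premod_regular b1(1)] \<rho> b1(3)[unfolded dual_carrier]])
  have t2: "t2 \<in> carrier (val (dual n R P) X2)"
    unfolding t2_def dual_carrier by (rule rmod_hom_comp[OF p p'' premod_shift[OF premod_regular b2(1)] v b2(3)[unfolded dual_carrier]])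
  note up1 = uc[OF b1(1,2)]
  have "hs_trace n R g P (gone n) (hom_elt n P (twist n R g P) f) =
     diag_trace X1 (t1 X1 (f X1 (u X1 p1))) \<otimes>\<^bsub>val (HH0 n R g) (gone n)\<^esub> diag_trace X2 (t2 X2 (f X2 h))"
  proof (rule trace_sum[OF e db b1(1) t1 fc[OF b1(1) up1] b2(1) t2 fc[OF b2(1) h(1)]])
    fix Y q assume Y: "Y \<in> gsets n" and q: "q \<in> carrier (val P Y)"
    note r = rc[OF Y q] and vq = vc[OF Y q]
    have "u Y (\<rho> Y q) = contract P X1 Y (\<theta>1 Y (\<rho> Y q)) (u X1 p1)"
      using contract_rmod_hom[OF p' p u b1(1) Y dual_closed[OF b1(3) Y r] b1(2)] basis_expand[OF e' db1 Y r] by simp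
    then have 1: "f Y (u Y (\<rho> Y q)) = contract (twist n R g P) X1 Y (t1 Y q) (f X1 (u X1 p1))"
      using contract_rmod_hom[OF p gP_pre[OF e] f b1(1) Y dual_closed[OF b1(3) Y r] up1] Y q by (simp add: t1_def)
    have 2: "f Y (\<sigma> Y (v Y q)) = contract (twist n R g P) X2 Y (t2 Y q) (f X2 h)"
      using contract_rmod_hom[OF p gP_pre[OF e] f b2(1) Y dual_closed[OF b2(3) Y vq] h(1)] Y q vq by (simp add: t2_def \<sigma>_def)
    have "f Y q = f Y (u Y (\<rho> Y q) \<otimes>\<^bsub>val P Y\<^esub> \<sigma> Y (v Y q))" using split[OF Y q] by simp
    also have "\<dots> = f Y (u Y (\<rho> Y q)) \<otimes>\<^bsub>val P Y\<^esub> f Y (\<sigma> Y (v Y q))"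
      using nathom_mult[OF fn Y uc[OF Y r] sc[OF Y vq]] by simp
    finally show "f Y q = contract (twist n R g P) X1 Y (t1 Y q) (f X1 (u X1 p1)) \<otimes>\<^bsub>val P Y\<^esub> contract (twist n R g P) X2 Y (t2 Y q) (f X2 h)"
      unfolding 1 2 .
  qed
  also have "t1 X1 (f X1 (u X1 p1)) = \<theta>1 X1 (f' X1 p1)"
  proof -
    have f1: "f' X1 p1 \<in> carrier (val P' X1)" using nathom_closed[OF fn' b1(1,2)] by simp
    show ?thesis using b1(1) fc[OF b1(1) up1] by (simp add: t1_def uf[OF b1(1,2), symmetric] \<rho>u[OF b1(1) f1] uc[OF b1(1) f1])
  qed
  also have "t2 X2 (f X2 h) = \<theta>2 X2 (f'' X2 p2)"
    using b2(1) fc[OF b2(1) h(1)] by (simp add: t2_def vf[OF b2(1) h(1)] h(2))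
  finally show ?thesis
    unfolding E fst_conv snd_conv trace_dual_basis(1)[OF e' db1 f'] trace_dual_basis(1)[OF e'' db2 f''] .
qed

section \<open>The reduced Dennis trace\<close>

abbreviation "endo_trace \<equiv> \<lambda>(P, f). hs_trace n R g P (gone n) (hom_elt n P (twist n R g P) f)"

lemma endo_trace_closed: "endo_trace \<in> end_objs n R g \<rightarrow> carrier (val (HH0 n R g) (gone n))"
proof
  fix E assume "E \<in> end_objs n R g"
  then obtain P f where E: "E = (P, f)" "fg_projective n R P" "f \<in> rmod_hom n R P (twist n R g P)"
    by (auto simp: end_objs_def proj_objs_def)
  obtain X p0 \<theta>0 where db: "dual_basis P X p0 \<theta>0" using fg_projective_dual_basis(2)[OF E(2)] by blast
  note e = fg_projective_dual_basis(1)[OF E(2)]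
  show "endo_trace E \<in> carrier (val (HH0 n R g) (gone n))"
    unfolding E(1) prod.case trace_dual_basis(1)[OF e db E(3)]
    by (rule hom_in_carrier[OF diag_trace_hom[OF basis_gset[OF e db]] trace_dual_basis(2)[OF e db E(3)]])
qed

lemma K0_rels_carrier:
  assumes "\<And>a b c. (a, b, c) \<in> Tr \<Longrightarrow> a \<in> S \<and> b \<in> S \<and> c \<in> S"
  shows "K0_rels Tr \<subseteq> carrier (free_Abelian_group S)"
proof
  fix x assume "x \<in> K0_rels Tr"
  then obtain a b c where x: "x = frag_of b - frag_of a - frag_of c" "(a, b, c) \<in> Tr" unfolding K0_rels_def by blast
  have "Poly_Mapping.keys x \<subseteq> S" unfolding x(1) using assms[OF x(2)] by (intro keys_frag_diff_diff) simp_all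
  then show "x \<in> carrier (free_Abelian_group S)" by simp
qed

lemma K0_kill:
  assumes G: "comm_group G" and h: "h \<in> S \<rightarrow> carrier G"
    and Tr: "\<And>a b c. (a, b, c) \<in> Tr \<Longrightarrow> a \<in> S \<and> b \<in> S \<and> c \<in> S \<and> h b = h a \<otimes>\<^bsub>G\<^esub> h c"
    and x: "x \<in> K0_rels Tr"
  shows "ab_ext G h x = \<one>\<^bsub>G\<^esub>"
proof -
  interpret G: comm_group G by fact
  obtain a b c where x: "x = frag_of b - frag_of a - frag_of c" "(a, b, c) \<in> Tr" using x unfolding K0_rels_def by blast
  show ?thesis unfolding x(1) using Tr[OF x(2)] by (intro G.ab_ext_rel3[OF h]) simp_all
qed

lemma end_exact_objs: "(a, b, c) \<in> end_exact n R g \<Longrightarrow> a \<in> end_objs n R g \<and> b \<in> end_objs n R g \<and> c \<in> end_objs n R g"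
  unfolding end_exact_def by blast

lemma proj_exact_objs: "(a, b, c) \<in> proj_exact n R \<Longrightarrow> a \<in> proj_objs n R \<and> b \<in> proj_objs n R \<and> c \<in> proj_objs n R"
  unfolding proj_exact_def by blast

lemmas end_rels = K0_rels_carrier[OF end_exact_objs] and proj_rels = K0_rels_carrier[OF proj_exact_objs]

lemma K0_end_comm_group: "comm_group (K0_end n R g)"
  unfolding K0_end_def by (rule ab_pres_comm_group[OF end_rels])

text \<open>Additivity of the trace says that it kills the relations of \<open>K\<^sub>0\<close>.\<close>

lemma endo_trace_kills:
  assumes "x \<in> K0_rels (end_exact n R g)" shows "ab_ext (val (HH0 n R g) (gone n)) endo_trace x = \<one>\<^bsub>val (HH0 n R g) (gone n)\<^esub>"
proof (rule K0_kill[OF HH0_group[OF gone_gset] endo_trace_closed _ assms])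
  fix a b c assume abc: "(a, b, c) \<in> end_exact n R g"
  have "endo_trace b = endo_trace a \<otimes>\<^bsub>val (HH0 n R g) (gone n)\<^esub> endo_trace c"
    using trace_additive[OF abc] by (simp add: case_prod_beta)
  then show "a \<in> end_objs n R g \<and> b \<in> end_objs n R g \<and> c \<in> end_objs n R g \<and> endo_trace b = endo_trace a \<otimes>\<^bsub>val (HH0 n R g) (gone n)\<^esub> endo_trace c"
    using end_exact_objs[OF abc] by blast
qed

lemma endo_trace_lift_hom: "ab_lift (val (HH0 n R g) (gone n)) endo_trace \<in> hom (K0_end n R g) (val (HH0 n R g) (gone n))"
  unfolding K0_end_def by (rule ab_lift_hom[OF end_rels HH0_group[OF gone_gset] endo_trace_closed endo_trace_kills])

lemma endo_trace_lift_cls: "E \<in> end_objs n R g \<Longrightarrow> ab_lift (val (HH0 n R g) (gone n)) endo_trace (K0_end_cls n R g E) = endo_trace E"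
  unfolding K0_end_cls_def by (rule ab_lift_cls[OF end_rels HH0_group[OF gone_gset] endo_trace_closed endo_trace_kills])

abbreviation "zero_map P \<equiv> mk_nat n P (\<lambda>X p. \<one>\<^bsub>val P X\<^esub>)"

lemma zero_end:
  assumes P: "P \<in> proj_objs n R"
  shows "(P, zero_map P) \<in> end_objs n R g" "endo_trace (P, zero_map P) = \<one>\<^bsub>val (HH0 n R g) (gone n)\<^esub>"
proof -
  have fg: "fg_projective n R P" using P by (simp add: proj_objs_def)
  note e = fg_projective_dual_basis(1)[OF fg]
  have z: "zero_map P \<in> rmod_hom n R P (twist n R g P)"
    using rmod_hom_one[OF P_pre[OF e] gP_pre[OF e]] by simp
  then show "(P, zero_map P) \<in> end_objs n R g" using P by (simp add: end_objs_def)
  obtain X p0 \<theta>0 where db: "dual_basis P X p0 \<theta>0" using fg_projective_dual_basis(2)[OF fg] by blast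
  note b = basis_gset[OF e db] basis_elt[OF e db] and tn = basis_dual_nathom[OF e db]
  have XX: "X \<times>\<^sub>G X \<in> gsets n" using b by simp
  have "\<theta>0 X (zero_map P X p0) = \<one>\<^bsub>val R (X \<times>\<^sub>G X)\<^esub>"
    using hom_one[OF nathom_hom[OF tn b(1)] mackey_is_group[OF P_mackey[OF e] b(1)]] mackey_is_group[OF R_mackey XX] b by simp
  then show "endo_trace (P, zero_map P) = \<one>\<^bsub>val (HH0 n R g) (gone n)\<^esub>"
    unfolding prod.case trace_dual_basis(1)[OF e db z]
    using hom_one[OF diag_trace_hom[OF b(1)] mackey_is_group[OF R_mackey XX] comm_group.axioms(2)[OF HH0_group[OF gone_gset]]] by simp
qed

text \<open>Linear maps preserve zero, so \<open>P \<mapsto> (P, 0)\<close> is exact and \<^const>\<open>K0_zero\<close> respects the relations of \<open>K\<^sub>0\<close>.\<close>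

lemma zero_exact:
  assumes abc: "(a, b, c) \<in> proj_exact n R"
  shows "((a, zero_map a), (b, zero_map b), (c, zero_map c)) \<in> end_exact n R g"
proof -
  obtain u v where uv: "u \<in> rmod_hom n R a b" "v \<in> rmod_hom n R b c" "short_exact n a u b v c"
    and o: "a \<in> proj_objs n R" "b \<in> proj_objs n R" "c \<in> proj_objs n R"
    using abc unfolding proj_exact_def by blast
  have M: "mackey_functor n M" if "M \<in> proj_objs n R" for M :: "('r, 'r) rmod"
    using P_mackey[OF fg_projective_dual_basis(1)] that by (simp add: proj_objs_def)
  have eh: "w \<in> end_hom n R (M, zero_map M) (N, zero_map N)"
    if w: "w \<in> rmod_hom n R M N" and MN: "M \<in> proj_objs n R" "N \<in> proj_objs n R" for w M N
  proof -
    have "w X (zero_map M X p) = zero_map N X (w X p)" if X: "X \<in> gsets n" and p: "p \<in> carrier (val M X)" for X p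
    proof -
      note wn = rmod_hom_nathom[OF w]
      show ?thesis using hom_one[OF nathom_hom[OF wn X] mackey_is_group[OF M[OF MN(1)] X] mackey_is_group[OF M[OF MN(2)] X]] X p nathom_closed[OF wn X p] by simp
    qed
    then show ?thesis using w by (simp add: end_hom_def)
  qed
  show ?thesis
    unfolding end_exact_def using zero_end(1)[OF o(1)] zero_end(1)[OF o(2)] zero_end(1)[OF o(3)] eh[OF uv(1) o(1,2)] eh[OF uv(2) o(2,3)] uv(3)
    by auto
qed

lemma
  shows K0_zero_hom: "K0_zero n R g \<in> hom (K0_proj n R) (K0_end n R g)"
    and K0_zero_cls: "\<And>P. P \<in> proj_objs n R \<Longrightarrow> K0_zero n R g (ab_cls (proj_objs n R) (K0_rels (proj_exact n R)) P) = K0_end_cls n R g (P, zero_map P)"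
proof -
  let ?h = "\<lambda>P. K0_end_cls n R g (P, zero_map P)"
  have cl: "?h \<in> proj_objs n R \<rightarrow> carrier (K0_end n R g)"
    unfolding K0_end_cls_def K0_end_def using zero_end(1) by (intro funcsetI ab_cls_closed)
  have kill: "ab_ext (K0_end n R g) ?h x = \<one>\<^bsub>K0_end n R g\<^esub>" if x: "x \<in> K0_rels (proj_exact n R)" for x
  proof (rule K0_kill[OF K0_end_comm_group cl _ x])
    fix a b c assume abc: "(a, b, c) \<in> proj_exact n R"
    note z = zero_exact[OF abc]
    have "frag_of (b, zero_map b) - frag_of (a, zero_map a) - frag_of (c, zero_map c) \<in> K0_rels (end_exact n R g)"
      unfolding K0_rels_def using z by blast
    from ab_cls_rel3[OF end_rels this] end_exact_objs[OF z]
    have "?h b = ?h a \<otimes>\<^bsub>K0_end n R g\<^esub> ?h c" by (simp add: K0_end_cls_def K0_end_def)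
    then show "a \<in> proj_objs n R \<and> b \<in> proj_objs n R \<and> c \<in> proj_objs n R \<and> ?h b = ?h a \<otimes>\<^bsub>K0_end n R g\<^esub> ?h c"
      using proj_exact_objs[OF abc] by blast
  qed
  show "K0_zero n R g \<in> hom (K0_proj n R) (K0_end n R g)"
    unfolding K0_zero_def K0_proj_def by (rule ab_lift_hom[OF proj_rels K0_end_comm_group cl kill])
  show "K0_zero n R g (ab_cls (proj_objs n R) (K0_rels (proj_exact n R)) P) = ?h P" if "P \<in> proj_objs n R" for P
    unfolding K0_zero_def by (rule ab_lift_cls[OF proj_rels K0_end_comm_group cl kill that])
qed

lemma endo_trace_K0_zero:
  assumes c: "c \<in> carrier (K0_proj n R)"
  shows "ab_lift (val (HH0 n R g) (gone n)) endo_trace (K0_zero n R g c) = \<one>\<^bsub>val (HH0 n R g) (gone n)\<^esub>"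
proof -
  let ?G = "val (HH0 n R g) (gone n)"
  interpret G: comm_group ?G by (rule HH0_group[OF gone_gset])
  have "(\<lambda>c. ab_lift ?G endo_trace (K0_zero n R g c)) \<in> hom (K0_proj n R) ?G"
    using Group.hom_compose[OF K0_zero_hom endo_trace_lift_hom] by (simp add: comp_def)
  then have h: "(\<lambda>c. ab_lift ?G endo_trace (K0_zero n R g c)) \<in> hom (ab_pres (proj_objs n R) (K0_rels (proj_exact n R))) ?G"
    by (simp add: K0_proj_def)
  have o: "(\<lambda>c. \<one>\<^bsub>?G\<^esub>) \<in> hom (ab_pres (proj_objs n R) (K0_rels (proj_exact n R))) ?G" by (simp add: hom_def)
  show ?thesis
  proof (rule ab_pres_hom_eq[OF proj_rels G.is_group h o _ c[unfolded K0_proj_def]])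
    fix P assume P: "P \<in> proj_objs n R"
    show "ab_lift ?G endo_trace (K0_zero n R g (ab_cls (proj_objs n R) (K0_rels (proj_exact n R)) P)) = \<one>\<^bsub>?G\<^esub>"
      unfolding K0_zero_cls[OF P] endo_trace_lift_cls[OF zero_end(1)[OF P]] by (rule zero_end(2)[OF P])
  qed
qed

text \<open>Elements of a coset of the image of \<^const>\<open>K0_zero\<close> differ by classes of zero endomorphisms, on which
  the trace vanishes.\<close>

lemma dennis_trace_red_cls:
  assumes E: "E \<in> end_objs n R g"
  shows "dennis_trace_red n R g (K0_end_red_cls n R g E) = endo_trace E"
  unfolding dennis_trace_red_def K0_end_red_cls_def
proof (rule descend_eqI)
  let ?G = "val (HH0 n R g) (gone n)"
  interpret G: comm_group ?G by (rule HH0_group[OF gone_gset])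
  have Ec: "K0_end_cls n R g E \<in> carrier (K0_end n R g)"
    unfolding K0_end_cls_def K0_end_def using E by (rule ab_cls_closed)
  interpret K: comm_group "K0_proj n R" unfolding K0_proj_def by (rule ab_pres_comm_group[OF proj_rels])
  show "K0_zero n R g ` carrier (K0_proj n R) #>\<^bsub>K0_end n R g\<^esub> K0_end_cls n R g E \<noteq> {}"
    using K.one_closed unfolding r_coset_def by blast
  fix y assume "y \<in> K0_zero n R g ` carrier (K0_proj n R) #>\<^bsub>K0_end n R g\<^esub> K0_end_cls n R g E"
  then obtain c where c: "c \<in> carrier (K0_proj n R)" "y = K0_zero n R g c \<otimes>\<^bsub>K0_end n R g\<^esub> K0_end_cls n R g E"
    unfolding r_coset_def by blast
  have "ab_lift ?G endo_trace y = ab_lift ?G endo_trace (K0_zero n R g c) \<otimes>\<^bsub>?G\<^esub> ab_lift ?G endo_trace (K0_end_cls n R g E)"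
    unfolding c(2) by (rule hom_mult[OF endo_trace_lift_hom hom_in_carrier[OF K0_zero_hom c(1)] Ec])
  moreover have "endo_trace E \<in> carrier ?G" using endo_trace_closed E by blast
  ultimately show "ab_lift ?G endo_trace y = endo_trace E" unfolding endo_trace_K0_zero[OF c(1)] endo_trace_lift_cls[OF E] by simp
qed

section \<open>The endomorphisms of the regular module\<close>

text \<open>The identity of \<open>R\<close> as an element of its dual at level \<open>C\<^sub>n/C\<^sub>n\<close>.\<close>

abbreviation "unit_dual \<equiv> mk_nat n (regular R) (\<lambda>Y. tra n R Y (gone n \<times>\<^sub>G Y) (\<lambda>y. PPair (pnt n) y))"

lemma unit_dual: "unit_dual \<in> carrier (val (dual n R (regular R)) (gone n))"
  unfolding dual_carrier
proof (rule rmod_homI[OF premod_regular premod_shift[OF premod_regular gone_gset]])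
  have "nathom R (lshift R (gone n)) (\<lambda>Y. tra n R Y (gone n \<times>\<^sub>G Y) (\<lambda>y. PPair (pnt n) y))"
  proof (rule nathomI)
    fix X Y h y assume "X \<in> gsets n" "Y \<in> gsets n" "eqv n X Y h" "y \<in> carrier (val R Y)"
    then show "tra n R X (gone n \<times>\<^sub>G X) (\<lambda>y. PPair (pnt n) y) (res n R X Y h y) = res n (lshift R (gone n)) X Y h (tra n R Y (gone n \<times>\<^sub>G Y) (\<lambda>y. PPair (pnt n) y) y)"
      by (simp add: res_lshift)
        (subst base_change[where W = X and ?w1.0 = h and ?w2.0 = "\<lambda>y. PPair (pnt n) y"], simp_all add: eqv_def)
  qed (simp_all add: hom_def Pi_iff tra_mult tra_lshift tra_tra eqv_def)
  then show "nathom (regular R) (shift n R (regular R) (gone n)) (\<lambda>Y. tra n R Y (gone n \<times>\<^sub>G Y) (\<lambda>y. PPair (pnt n) y))" by simp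
  fix U V a p assume "U \<in> gsets n" "V \<in> gsets n" "a \<in> carrier (val R U)" "p \<in> carrier (val (regular R) V)"
  then show "tra n R (U \<times>\<^sub>G V) (gone n \<times>\<^sub>G (U \<times>\<^sub>G V)) (\<lambda>y. PPair (pnt n) y) (xact n R (regular R) U V a p) =
     xact n R (shift n R (regular R) (gone n)) U V a (tra n R V (gone n \<times>\<^sub>G V) (\<lambda>y. PPair (pnt n) y) p)"
    by (simp add: xact_shift[OF premod_regular] eqv_def pairing_tra_right[OF xmul_pairing] pairing_closed[OF xmul_pairing] tra_tra)
      (rule fun_cong[OF tra_cong], auto simp: gprod_def)
qed

text \<open>The product \<open>\<alpha>(a) res(x)\<close> is the twisted action of \<open>a\<close> on \<open>x\<close>, so \<open>f\<^sub>x\<close> is the image of \<open>1 \<otimes> x\<close>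
  under the tensor-Hom map. The sum over the points of \<open>C\<^sub>n/C\<^sub>n\<close> has one term.\<close>

lemma fmap_contract:
  assumes x: "x \<in> carrier (val R (gone n))" and Y: "Y \<in> gsets n" and a: "a \<in> carrier (val R Y)"
  shows "fmap n R g x Y a = contract (twist n R g (regular R)) (gone n) Y (unit_dual Y a) x"
proof -
  let ?a = "alpha n R g Y a"
  have aa: "?a \<in> carrier (val R Y)" using Y a by simp
  have y: "xmul n R Y (gone n) ?a x \<in> carrier (val R (Y \<times>\<^sub>G gone n))" by (rule pairing_closed[OF xmul_pairing Y gone_gset aa x])
  have oY: "gone n \<times>\<^sub>G Y \<in> gsets n" using Y by simp
  have ta: "tra n R Y (gone n \<times>\<^sub>G Y) (\<lambda>y. PPair (pnt n) y) a \<in> carrier (val R (gone n \<times>\<^sub>G Y))" using Y a by (simp add: eqv_def)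
  have t: "res n R Y (gone n) (gterm n Y) = res n R Y (gone n) (\<lambda>y. pnt n)" by (rule res_cong) (simp add: gterm_def)
  have "fmap n R g x Y a = res n R Y (Y \<times>\<^sub>G gone n) (\<lambda>y. PPair y (pnt n)) (xmul n R Y (gone n) ?a x)"
    using Y a aa x y by (simp add: fmap_def imul_def t pairing_res_right[OF xmul_pairing] eqv_def res_res)
  moreover have "contract (twist n R g (regular R)) (gone n) Y (unit_dual Y a) x = res n R Y (Y \<times>\<^sub>G gone n) (\<lambda>y. PPair y (pnt n)) (xmul n R Y (gone n) ?a x)"
  proof -
    have xt: "xact n R (twist n R g (regular R)) (gone n \<times>\<^sub>G Y) (gone n) (unit_dual Y a) x =
       xmul n R (gone n \<times>\<^sub>G Y) (gone n) (alpha n R g (gone n \<times>\<^sub>G Y) (tra n R Y (gone n \<times>\<^sub>G Y) (\<lambda>y. PPair (pnt n) y) a)) x"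
      using xact_twist[OF premod_regular oY gone_gset ta, of x] Y a x by simp
    also have "\<dots> = tra n R (Y \<times>\<^sub>G gone n) ((gone n \<times>\<^sub>G Y) \<times>\<^sub>G gone n) (\<lambda>w. PPair (PPair (pnt n) (pfst w)) (psnd w)) (xmul n R Y (gone n) ?a x)"
      using Y a aa x by (simp add: nathom_tra[OF alpha_nathom] pairing_tra_left[OF xmul_pairing] eqv_def)
    finally show ?thesis
      unfolding contract_def using Y y
      by simp (subst base_change[where W = Y and ?w1.0 = "\<lambda>y. PPair y (pnt n)" and ?w2.0 = "\<lambda>y. PPair (pnt n) y"],
          simp_all add: eqv_def tra_tra tra_ident)
  qed
  ultimately show ?thesis by simp
qed

lemma fmap_end: 
  assumes x: "x \<in> carrier (val R (gone n))"
  shows "(regular R, fmap n R g x) \<in> end_objs n R g"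
proof -
  have xg: "x \<in> carrier (val (twist n R g (regular R)) (gone n))" using x by simp
  have "mk_nat n (regular R) (\<lambda>Y p. contract (twist n R g (regular R)) (gone n) Y (unit_dual Y p) x) \<in> rmod_hom n R (regular R) (twist n R g (regular R))"
    by (rule contract_dual_rmod[OF premod_regular extmod_twist[OF extmod_regular] gone_gset unit_dual xg])
  also have "mk_nat n (regular R) (\<lambda>Y p. contract (twist n R g (regular R)) (gone n) Y (unit_dual Y p) x) = mk_nat n (regular R) (fmap n R g x)"
    by (rule mk_nat_eqI) (simp only: regular_simps fmap_contract[OF x])
  also have "\<dots> = fmap n R g x"
  proof -
    have "mk_nat n R (mk_nat n R (\<lambda>X a. imul n R X (alpha n R g X a) (res n R X (gone n) (gterm n X) x))) = mk_nat n R (\<lambda>X a. imul n R X (alpha n R g X a) (res n R X (gone n) (gterm n X) x))"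
      by (rule mk_nat_eqI) simp
    then show ?thesis by (simp add: fmap_def)
  qed
  finally show ?thesis using fg_projective_regular by (simp add: end_objs_def proj_objs_def)
qed

text \<open>By \<open>fmap_contract\<close> the trace is the class of \<open>1(x)\<close>, summed over the one point of \<open>C\<^sub>n/C\<^sub>n\<close>.\<close>

lemma endo_trace_fmap:
  assumes x: "x \<in> carrier (val R (gone n))"
  shows "endo_trace (regular R, fmap n R g x) = HH0_map n R g (gone n) x"
proof -
  obtain X p0 \<theta>0 where db: "dual_basis (regular R) X p0 \<theta>0" using fg_projective_dual_basis(2)[OF fg_projective_regular] by blast
  have xr: "x \<in> carrier (val (regular R) (gone n))" using x by simp
  have "endo_trace (regular R, fmap n R g x) = diag_trace (gone n) (unit_dual (gone n) x)"
    unfolding prod.case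
    by (rule trace_single[OF extmod_regular db gone_gset unit_dual xr]) (simp only: regular_simps fmap_contract[OF x])
  also have "mor R (gone n \<times>\<^sub>G gone n) (gone n) (diag_span (gone n)) (unit_dual (gone n) x) = x"
  proof -
    have "res n R (gone n) (gone n \<times>\<^sub>G gone n) (\<lambda>x. PPair x x) (tra n R (gone n) (gone n \<times>\<^sub>G gone n) (\<lambda>y. PPair (pnt n) y) x) =
       tra n R (gone n) (gone n) (\<lambda>x. x) (res n R (gone n) (gone n) (\<lambda>x. x) x)"
      using x by (intro base_change) (simp_all add: eqv_def)
    also have "\<dots> = x" using x by (simp add: tra_ident res_ident)
    finally have "mor R (gone n \<times>\<^sub>G gone n) (gone n) (diag_span (gone n)) (unit_dual (gone n) x) = tra n R (gone n) (gone n) (\<lambda>x. pnt n) x"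
      using x unfolding diag_span_def by (simp add: mor_sp eqv_def)
    also have "\<dots> = x" by (rule tra_ident[OF R_mackey gone_gset x]) simp
    finally show ?thesis .
  qed
  then have "diag_trace (gone n) (unit_dual (gone n) x) = HH0_map n R g (gone n) x" by (simp only: diag_trace_def)
  finally show ?thesis .
qed

text \<open>For an arbitrary commutative Green functor. This combines the evaluation of the trace on
  representatives with its value at \<open>f\<^sub>x\<close>.\<close>

theorem dennis_trace_fmap:
  assumes x: "x \<in> carrier (val R (gone n))"
  shows "dennis_trace_red n R g (K0_end_red_cls n R g (regular R, fmap n R g x)) = HH0_map n R g (gone n) x"
  unfolding dennis_trace_red_cls[OF fmap_end[OF x]] by (rule endo_trace_fmap[OF x])

end

lemma Cn_gen_closed: "n \<ge> 1 \<Longrightarrow> Cn_gen n \<in> carrier (Cn n)"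
proof -
  assume n: "n \<ge> 1"
  have "Cn_gen n ^ n = exp (of_nat n * (2 * of_real pi * \<i> / of_nat n))"
    unfolding Cn_gen_def by (rule exp_of_nat_mult[symmetric])
  also have "of_nat n * (2 * of_real pi * \<i> / of_nat n) = 2 * of_real pi * \<i>" using n by simp
  finally show ?thesis by (simp add: Cn_def exp_eq_polar) 
qed

theorem proposition5p40:
  fixes n :: nat and R :: "'r tambara" and H :: "complex set" and r :: 'r
  assumes "n \<ge> 1"
    and "tambara_functor n R"
    and "subgroup H (Cn n)"
    and "r \<in> carrier (val R (gorbit n H))"
  shows "dennis_trace_red n R (Cn_gen n)
           (K0_end_red_cls n R (Cn_gen n) (regular R, fmap n R (Cn_gen n) (inorm n R H r)))
         = teichmueller n R H r"
proof -
  have green: "comm_green_functor n R" using assms(2) by (simp add: tambara_functor_def)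
  interpret T: twisted_green n R "Cn_gen n"
    by unfold_locales (use assms(1) green Cn_gen_closed in auto)
  have o: "gorbit n H \<in> gsets n" by (rule T.gorbit_gset[OF assms(3)])
  have f: "gterm n (gorbit n H) \<in> gmaps n (gorbit n H) (gone n)"
    using o by (simp add: T.gmaps_eqv) (simp add: gterm_def eqv_def)
  have "inorm n R H r \<in> carrier (val R (gone n))"
  proof -
    have "\<forall>X\<in>gsets n. \<forall>Y\<in>gsets n. \<forall>f\<in>gmaps n X Y. nrm R X Y f \<in> carrier (val R X) \<rightarrow> carrier (val R Y)"
      using assms(2) by (simp add: tambara_functor_def)
    then show ?thesis using f o T.gone_gset assms(4)
      unfolding inorm_def by blast
  qed
  then show ?thesis unfolding teichmueller_def by (rule T.dennis_trace_fmap)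
qed

end
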